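(* Assume the Riemann hypothesis. Then for $T\ge 2$, \[ N_2(T) = \frac{T}{2\pi}\log\frac{T}{4\pi} - \frac{T}{2\pi} + O\left(\frac{\log T}{(\log\log T)^{1/2}}\right). \]
   Context: $\zeta(s)$ is the Riemann zeta function. $N_2(T)$ denotes the number of non-real zeros $\rho''=\beta''+i\gamma''$ of the second derivative $\zeta''(s)$ with $0<\gamma''\le T$, counted with multiplicity. *)

theory Defs
  imports "HOL-Complex_Analysis.Complex_Analysis"
begin

text \<open>
  The Riemann zeta function is the analytic continuation of the Dirichlet series to the
  plane punctured at 1. The value 0 at the pole is a convention that makes the description
  unique. Lemma \<open>zeta_exists_unique\<close> below shows that the description is proper.
\<close>

definition zeta :: "complex \<Rightarrow> complex" where
  "zeta = (THE f. f holomorphic_on -{1} \<and> f 1 = 0 \<and>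
                  (\<forall>s. Re s > 1 \<longrightarrow> (\<lambda>n. 1 / of_nat (Suc n) powr s) sums f s))"

definition riemann_hypothesis :: bool where
  "riemann_hypothesis \<longleftrightarrow> (\<forall>s. zeta s = 0 \<and> 0 < Re s \<and> Re s < 1 \<longrightarrow> Re s = 1 / 2)"

text \<open>
  The zeros lie off the real axis, hence away from the pole. For a zero of a holomorphic function
  that does not vanish identically, \<^const>\<open>zorder\<close> is its multiplicity.
\<close>

definition N2 :: "real \<Rightarrow> nat" where
  "N2 T = (\<Sum>s | (deriv ^^ 2) zeta s = 0 \<and> 0 < Im s \<and> Im s \<le> T. nat (zorder ((deriv ^^ 2) zeta) s))"

lemma holomorphic_on_suminf:
  fixes f :: "nat \<Rightarrow> complex \<Rightarrow> complex"
  assumes S: "open S" and f: "\<And>n. f n holomorphic_on S"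
    and M: "\<And>z. z \<in> S \<Longrightarrow> \<exists>d h. 0 < d \<and> summable h \<and>
              (\<forall>\<^sub>F n in sequentially. \<forall>w\<in>ball z d \<inter> S. cmod (f n w) \<le> (h n :: real))"
  shows "(\<lambda>z. \<Sum>n. f n z) holomorphic_on S" and "\<And>z. z \<in> S \<Longrightarrow> summable (\<lambda>n. f n z)"
proof -
  have der: "(f n has_field_derivative deriv (f n) z) (at z)" if "z \<in> S" for n z
    using f S that holomorphic_derivI by blast
  have "\<exists>g g'. \<forall>z\<in>S. (\<lambda>n. f n z) sums g z \<and> (\<lambda>n. deriv (f n) z) sums g' z \<and>
                    (g has_field_derivative g' z) (at z)"
    by (rule series_and_derivative_comparison_local [OF S der M])
  then obtain g g' where g: "\<forall>z\<in>S. (\<lambda>n. f n z) sums g z \<and> (\<lambda>n. deriv (f n) z) sums g' z \<and>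
                    (g has_field_derivative g' z) (at z)"
    by (elim exE)
  have "g holomorphic_on S"
    using g S by (auto simp: holomorphic_on_open)
  moreover have "(\<Sum>n. f n z) = g z" if "z \<in> S" for z
    using g that sums_unique by metis
  ultimately show "(\<lambda>z. \<Sum>n. f n z) holomorphic_on S"
    by (simp cong: holomorphic_cong)
  show "summable (\<lambda>n. f n z)" if "z \<in> S" for z
    using g that sums_summable by blast
qed

lemma gbinomial_step:
  fixes a :: complex
  shows "(a gchoose Suc k) * of_nat (Suc k) = (a gchoose k) * (a - of_nat k)"
proof -
  have "complex_of_nat (Suc k) \<noteq> 0" by (simp only: of_nat_eq_0_iff)
  then show ?thesis
    unfolding gbinomial_prod_rev prod.atLeast0_lessThan_Suc fact_Suc by (simp del: of_nat_Suc)
qed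

lemma cmod_gbinomial_le:
  fixes a :: complex
  assumes "cmod a \<le> A" "1 \<le> A"
  shows "cmod (a gchoose k) \<le> A ^ k"
proof (induction k)
  case (Suc k)
  have "cmod (a - of_nat k) \<le> A + real k"
    using assms norm_triangle_ineq4 [of a "of_nat k"] by simp
  also have "\<dots> \<le> A * real (Suc k)"
    using assms mult_right_mono [of 1 A "real k"] by (simp add: algebra_simps)
  finally have 1: "cmod (a - of_nat k) \<le> A * real (Suc k)" .
  have "cmod (a gchoose Suc k) * real (Suc k) = cmod ((a gchoose Suc k) * of_nat (Suc k))"
    by (simp only: norm_mult norm_of_nat)
  also have "\<dots> = cmod (a gchoose k) * cmod (a - of_nat k)"
    by (simp only: gbinomial_step norm_mult)
  also have "\<dots> \<le> A ^ k * (A * real (Suc k))"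
    using Suc 1 assms by (intro mult_mono) auto
  finally have "cmod (a gchoose Suc k) * real (Suc k) \<le> A ^ Suc k * real (Suc k)"
    by (simp add: algebra_simps)
  then show ?case
    by (metis mult_le_cancel_right_pos of_nat_0_less_iff zero_less_Suc)
qed auto

lemma binomial_tail_le:
  fixes a :: complex
  assumes "cmod a \<le> A" "1 \<le> A" "0 < x" "2 * A * x \<le> 1"
  shows "cmod ((\<Sum>j<J. (a gchoose j) * of_real x ^ j) - (1 + of_real x) powr a) \<le> 2 * (A * x) ^ J"
proof -
  define f where "f = (\<lambda>j. (a gchoose j) * complex_of_real x ^ j)"
  have Ax: "0 \<le> A * x" "A * x \<le> 1/2" using assms by auto
  have "x \<le> A * x" using assms by (simp add: mult_le_cancel_right1)
  then have x1: "x < 1" using Ax by linarith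
  have s: "f sums (1 + of_real x) powr a"
    unfolding f_def using gen_binomial_complex[of "of_real x" a] x1 assms by simp
  have t: "(\<lambda>j. f (j + J)) sums ((1 + of_real x) powr a - (\<Sum>j<J. f j))"
    using s by (rule sums_split_initial_segment)
  have b: "cmod (f (j + J)) \<le> (A * x) ^ J * (1/2) ^ j" for j
  proof -
    have "cmod (f (j + J)) \<le> A ^ (j + J) * x ^ (j + J)"
      unfolding f_def norm_mult norm_power
      using cmod_gbinomial_le[OF assms(1,2)] assms by (intro mult_mono) auto
    also have "\<dots> = (A * x) ^ J * (A * x) ^ j"
      by (simp add: power_mult_distrib power_add algebra_simps)
    also have "\<dots> \<le> (A * x) ^ J * (1/2) ^ j"
      using Ax by (intro mult_left_mono power_mono) auto
    finally show ?thesis .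
  qed
  have g: "(\<lambda>j. (A * x) ^ J * (1/2) ^ j) sums ((A * x) ^ J * 2)"
    using geometric_sums[of "1/2::real"] by (intro sums_mult) simp
  have "cmod ((1 + of_real x) powr a - (\<Sum>j<J. f j)) \<le> (A * x) ^ J * 2"
    using norm_sums_le[OF t g b] .
  then show ?thesis unfolding f_def by (simp add: norm_minus_commute mult.commute)
qed

lemma norm_Suc_powr: "cmod (of_nat (Suc n) powr s) = real (Suc n) powr Re s"
  using norm_powr_real_powr[of "of_nat (Suc n)" s] by simp

lemma summable_Suc_powr: "c < -1 \<Longrightarrow> summable (\<lambda>n. real (Suc n) powr c)"
  using summable_real_powr_iff[of c] summable_Suc_iff[of "\<lambda>n. real n powr c"] by simp

lemma dirichlet_series_zeta:
  defines "D \<equiv> (\<lambda>s::complex. \<Sum>n. of_nat (Suc n) powr (-s))"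
  shows "D holomorphic_on {s. Re s > 1}"
    and "\<And>s. Re s > 1 \<Longrightarrow> (\<lambda>n. of_nat (Suc n) powr (-s)) sums D s"
proof -
  define f where "f = (\<lambda>n s. complex_of_nat (Suc n) powr (-s))"
  have o: "open {s. Re s > 1}" by (rule open_halfspace_Re_gt)
  have h: "f n holomorphic_on {s. Re s > 1}" for n
    unfolding f_def by (intro holomorphic_intros)
  have M: "\<exists>d h. 0 < d \<and> summable h \<and>
     (\<forall>\<^sub>F n in sequentially. \<forall>w\<in>ball z d \<inter> {s. Re s > 1}. cmod (f n w) \<le> h n)"
    if "z \<in> {s. Re s > 1}" for z
  proof -
    define d where "d = (Re z - 1) / 2"
    have d: "d > 0" using that by (simp add: d_def)
    have "cmod (f n w) \<le> real (Suc n) powr (-1-d)" if "w \<in> ball z d" for w n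
    proof -
      have "\<bar>Re (z - w)\<bar> < d" using that abs_Re_le_cmod[of "z - w"] by (auto simp: dist_norm)
      then have "Re w \<ge> 1 + d" unfolding d_def minus_complex.sel by argo
      then show ?thesis unfolding f_def norm_Suc_powr by (intro powr_mono) auto
    qed
    moreover have "summable (\<lambda>n. real (Suc n) powr (-1-d))"
      using d by (intro summable_Suc_powr) auto
    ultimately show ?thesis using d by (intro exI[of _ d] exI[of _ "\<lambda>n. real (Suc n) powr (-1-d)"]) auto
  qed
  show "D holomorphic_on {s. Re s > 1}"
    using holomorphic_on_suminf(1)[OF o h M] unfolding D_def f_def by simp
  show "(\<lambda>n. of_nat (Suc n) powr (-s)) sums D s" if "Re s > 1" for s
    using holomorphic_on_suminf(2)[OF o h M, of s] that unfolding D_def f_def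
    by (simp add: summable_sums)
qed

lemma zeta_remainder_series:
  fixes J :: nat
  defines "R \<equiv> (\<lambda>n (s::complex). (\<Sum>j<Suc J. ((1 - s) gchoose j) * of_nat (Suc n) powr (1 - s - of_nat j))
                    - of_nat (Suc (Suc n)) powr (1 - s))"
  defines "S \<equiv> {s::complex. Re s > 1 - real J}"
  shows "(\<lambda>s. \<Sum>n. R n s) holomorphic_on S"
proof -
  have o: "open S" unfolding S_def by (rule open_halfspace_Re_gt)
  have h: "R n holomorphic_on S" for n
    unfolding R_def gbinomial_prod_rev by (intro holomorphic_intros) auto
  have M: "\<exists>d h. 0 < d \<and> summable h \<and>
     (\<forall>\<^sub>F n in sequentially. \<forall>w\<in>ball z d \<inter> S. cmod (R n w) \<le> h n)"
    if "z \<in> S" for z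
  proof -
    define d where "d = (Re z - (1 - real J)) / 2"
    have d: "d > 0" using that by (simp add: d_def S_def)
    define A where "A = cmod (1 - z) + d + 1"
    have A1: "A \<ge> 1" using d by (simp add: A_def)
    define h where "h = (\<lambda>n. 2 * A ^ Suc J * real (Suc n) powr (-1-d))"
    have "cmod (R n w) \<le> h n" if w: "w \<in> ball z d" and n: "real n \<ge> 2 * A" for w n
    proof -
      have zw: "cmod (z - w) < d" using w by (simp add: dist_norm)
      then have "\<bar>Re (z - w)\<bar> < d" using abs_Re_le_cmod[of "z - w"] by linarith
      then have rew: "Re w \<ge> 1 - real J + d" unfolding d_def minus_complex.sel by argo
      have wA: "cmod (1 - w) \<le> A"
        using norm_triangle_ineq[of "1 - z" "z - w"] zw by (simp add: A_def)
      define N where "N = real (Suc n)"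
      have N: "N > 0" by (simp add: N_def)
      define x where "x = 1 / N"
      have x: "0 < x" "2 * A * x \<le> 1" using n by (auto simp: x_def N_def field_simps)
      have NN: "complex_of_nat (Suc n) = of_real N" by (simp add: N_def)
      have "real (Suc (Suc n)) = N * (1 + x)" by (simp add: N_def x_def field_simps)
      then have NN': "complex_of_nat (Suc (Suc n)) = of_real N * (1 + of_real x)"
        by (metis of_real_1 of_real_add of_real_mult of_real_of_nat_eq)
      have p1: "complex_of_real N powr (1 - w - of_nat j) = of_real N powr (1 - w) * of_real x ^ j" for j
      proof -
        have "complex_of_real N powr (1 - w - of_nat j) = of_real N powr (1 - w) / of_real N ^ j"
          using N by (simp only: powr_diff powr_complexpow of_real_eq_0_iff)
        then show ?thesis by (simp add: x_def power_one_over)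
      qed
      have p2: "complex_of_nat (Suc (Suc n)) powr (1 - w) = of_real N powr (1 - w) * (1 + of_real x) powr (1 - w)"
        unfolding NN' using N x by (intro powr_times_real) auto
      have "R n w = of_real N powr (1 - w) * ((\<Sum>j<Suc J. ((1 - w) gchoose j) * of_real x ^ j) - (1 + of_real x) powr (1 - w))"
        unfolding R_def p2 NN p1 by (simp only: right_diff_distrib sum_distrib_left mult_ac)
      then have "cmod (R n w) = N powr (1 - Re w) *
           cmod ((\<Sum>j<Suc J. ((1 - w) gchoose j) * of_real x ^ j) - (1 + of_real x) powr (1 - w))"
        using norm_Suc_powr[of n "1 - w"] by (simp only: norm_mult NN N_def) simp
      also have "\<dots> \<le> N powr (1 - Re w) * (2 * (A * x) ^ Suc J)"
        by (intro mult_left_mono binomial_tail_le[OF wA A1 x]) auto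
      also have "\<dots> = 2 * A ^ Suc J * N powr (1 - Re w - real (Suc J))"
      proof -
        have "N powr (1 - Re w - real (Suc J)) = N powr (1 - Re w) / N ^ Suc J"
          by (subst powr_diff) (simp only: powr_realpow[OF N])
        moreover have "(A * x) ^ Suc J = A ^ Suc J / N ^ Suc J"
          by (simp only: x_def times_divide_eq_right mult_1_right power_divide)
        ultimately show ?thesis by (simp only: times_divide_eq_right mult_ac)
      qed
      also have "\<dots> \<le> 2 * A ^ Suc J * N powr (-1-d)"
        using A1 rew by (intro mult_left_mono powr_mono) (auto simp: N_def)
      finally show ?thesis by (simp add: h_def N_def)
    qed
    moreover have "\<forall>\<^sub>F n in sequentially. real n \<ge> 2 * A" by real_asymp
    ultimately have "\<forall>\<^sub>F n in sequentially. \<forall>w\<in>ball z d \<inter> S. cmod (R n w) \<le> h n"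
      by (auto elim!: eventually_mono)
    moreover have "summable h" unfolding h_def
      using d by (intro summable_mult summable_Suc_powr) auto
    ultimately show ?thesis using d by blast
  qed
  show ?thesis using holomorphic_on_suminf(1)[OF o h M] by simp
qed

lemma zeta_continuation_halfplane:
  defines "D \<equiv> (\<lambda>s::complex. \<Sum>n. of_nat (Suc n) powr (-s))"
  shows "\<exists>F. F holomorphic_on {s. Re s > 1 - real k} \<and> (\<forall>s. Re s > 1 \<longrightarrow> F s = (s - 1) * D s)"
proof (induction k)
  case 0
  show ?case
    using dirichlet_series_zeta(1)
    by (intro exI[of _ "\<lambda>s. (s - 1) * D s"]) (auto simp: D_def intro!: holomorphic_intros)
next
  case (Suc k)
  then obtain F where F: "F holomorphic_on {s. Re s > 1 - real k}"
    "\<And>s. Re s > 1 \<Longrightarrow> F s = (s - 1) * D s" by blast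
  define R where "R = (\<lambda>n (s::complex). (\<Sum>j<Suc (Suc k). ((1 - s) gchoose j) * of_nat (Suc n) powr (1 - s - of_nat j))
                    - of_nat (Suc (Suc n)) powr (1 - s))"
  define G where "G = (\<lambda>s. 1 - (\<Sum>i<k. ((1 - s) gchoose Suc i) / of_nat (i + 2) * F (s + of_nat (Suc i))) - (\<Sum>n. R n s))"
  have "F \<circ> (\<lambda>s. s + of_nat (Suc i)) holomorphic_on {s. Re s > 1 - real (Suc k)}" for i
    by (rule holomorphic_on_compose_gen[OF _ F(1)]) (auto intro!: holomorphic_intros)
  then have Fi: "(\<lambda>s. F (s + of_nat (Suc i))) holomorphic_on {s. Re s > 1 - real (Suc k)}" for i
    by (simp add: o_def)
  have Rh: "(\<lambda>s. \<Sum>n. R n s) holomorphic_on {s. Re s > 1 - real (Suc k)}"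
    unfolding R_def by (rule zeta_remainder_series)
  have gh: "(\<lambda>s. ((1 - s) gchoose Suc i) / of_nat (i + 2)) holomorphic_on A" for i and A :: "complex set"
    unfolding gbinomial_prod_rev by (intro holomorphic_intros) (auto simp del: of_nat_Suc of_nat_add)
  have "G holomorphic_on {s. Re s > 1 - real (Suc k)}"
    unfolding G_def by (intro holomorphic_on_diff holomorphic_on_sum holomorphic_on_mult Fi Rh gh holomorphic_on_const)
  moreover have "G s = (s - 1) * D s" if s: "Re s > 1" for s
  proof -
    have Ds: "(\<lambda>n. of_nat (Suc n) powr (- (s + of_nat j))) sums D (s + of_nat j)" for j
      using dirichlet_series_zeta(2)[of "s + of_nat j"] s by (simp add: D_def)
    have lim: "(\<lambda>n. complex_of_nat (Suc n) powr (1 - s)) \<longlonglongrightarrow> 0"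
    proof (rule tendsto_norm_zero_cancel)
      have "(\<lambda>n. real (Suc n) powr (1 - Re s)) \<longlonglongrightarrow> 0" using s by real_asymp
      then show "(\<lambda>n. cmod (complex_of_nat (Suc n) powr (1 - s))) \<longlonglongrightarrow> 0"
        by (simp only: norm_Suc_powr) simp
    qed
    have tel: "(\<lambda>n. complex_of_nat (Suc n) powr (1 - s) - of_nat (Suc (Suc n)) powr (1 - s)) sums 1"
      using telescope_sums'[OF lim] by simp
    have Req: "R n s = (of_nat (Suc n) powr (1 - s) - of_nat (Suc (Suc n)) powr (1 - s)) +
        (\<Sum>j<Suc k. ((1 - s) gchoose Suc j) * of_nat (Suc n) powr (- (s + of_nat j)))" for n
      unfolding R_def by (subst sum.lessThan_Suc_shift) (simp add: algebra_simps)
    have "(\<lambda>n. R n s) sums (1 + (\<Sum>j<Suc k. ((1 - s) gchoose Suc j) * D (s + of_nat j)))"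
      unfolding Req by (intro sums_add tel sums_sum sums_mult Ds)
    then have Rs: "(\<Sum>n. R n s) = 1 + (\<Sum>j<Suc k. ((1 - s) gchoose Suc j) * D (s + of_nat j))"
      by (simp add: sums_iff)
    have F': "((1 - s) gchoose Suc i) / of_nat (i + 2) * F (s + of_nat (Suc i))
           = - ((1 - s) gchoose Suc (Suc i)) * D (s + of_nat (Suc i))" for i
    proof -
      have "Re (s + of_nat (Suc i)) > 1" using s by simp
      then have "F (s + of_nat (Suc i)) = (s + of_nat i) * D (s + of_nat (Suc i))"
        using F(2) by simp
      moreover have "((1 - s) gchoose Suc (Suc i)) = - ((1 - s) gchoose Suc i) * (s + of_nat i) / of_nat (i + 2)"
      proof -
        have "((1 - s) gchoose Suc (Suc i)) * of_nat (i + 2) = ((1 - s) gchoose Suc i) * (1 - s - of_nat (Suc i))"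
          using gbinomial_step[of "1 - s" "Suc i"] by simp
        also have "\<dots> = - ((1 - s) gchoose Suc i) * (s + of_nat i)"
          by (simp add: algebra_simps)
        finally show ?thesis
          by (metis eq_divide_eq of_nat_eq_0_iff add_is_0 zero_neq_numeral)
      qed
      ultimately show ?thesis by simp
    qed
    have "G s = 1 - (\<Sum>i<k. - ((1 - s) gchoose Suc (Suc i)) * D (s + of_nat (Suc i))) - (\<Sum>n. R n s)"
      unfolding G_def F' ..
    also have "\<dots> = 1 + (\<Sum>i<k. ((1 - s) gchoose Suc (Suc i)) * D (s + of_nat (Suc i))) - (\<Sum>n. R n s)"
      by (simp add: sum_negf)
    also have "\<dots> = (s - 1) * D s"
      unfolding Rs by (subst sum.lessThan_Suc_shift) (simp add: algebra_simps)
    finally show ?thesis .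
  qed
  ultimately show ?case by blast
qed

lemma zeta_continuation:
  "\<exists>H. H holomorphic_on UNIV \<and>
       (\<forall>s. Re s > 1 \<longrightarrow> H s = (s - 1) * (\<Sum>n. of_nat (Suc n) powr (-s)))"
proof -
  define D where "D = (\<lambda>s::complex. \<Sum>n. of_nat (Suc n) powr (-s))"
  obtain F where F: "\<And>k. F k holomorphic_on {s. Re s > 1 - real k}"
     "\<And>k s. Re s > 1 \<Longrightarrow> F k s = (s - 1) * D s"
    using zeta_continuation_halfplane unfolding D_def by metis
  have FF: "F k s = F l s" if "k \<le> l" "Re s > 1 - real k" for k l s
  proof (rule analytic_continuation_open[where s = "{s. Re s > 1}" and s' = "{s. Re s > 1 - real k}" and f = "F k" and g = "F l" and z = s])
    show "F l holomorphic_on {s. Re s > 1 - real k}"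
      using F(1)[of l] by (rule holomorphic_on_subset) (use that in auto)
    show "{s. 1 < Re s} \<noteq> {}" by (auto intro!: exI[of _ 2])
  qed (use F that in \<open>auto intro: open_halfspace_Re_gt\<close>)
  define K where "K = (\<lambda>s. nat \<lceil>2 - Re s\<rceil>)"
  have K: "Re s > 1 - real (K s)" for s unfolding K_def by linarith
  define H where "H = (\<lambda>s. F (K s) s)"
  have HF: "H s = F k s" if "Re s > 1 - real k" for s k
    unfolding H_def by (metis FF K linear that)
  have "H holomorphic_on {s. Re s > 1 - real k}" for k
    using F(1)[of k] by (rule holomorphic_transform) (simp add: HF)
  then have "H field_differentiable at s" for s
    using K[of s] by (intro holomorphic_on_imp_differentiable_at[OF _ open_halfspace_Re_gt]) auto
  then have "H holomorphic_on UNIV"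
    by (simp add: holomorphic_on_def field_differentiable_at_within)
  moreover have "H s = (s - 1) * D s" if "Re s > 1" for s
    unfolding H_def using F(2) that by simp
  ultimately show ?thesis unfolding D_def by blast
qed

lemma zeta_exists_unique:
  "\<exists>!f. f holomorphic_on -{1} \<and> f 1 = 0 \<and>
        (\<forall>s. Re s > 1 \<longrightarrow> (\<lambda>n. 1 / of_nat (Suc n) powr s) sums f s)"
proof (rule ex_ex1I)
  obtain H where H: "H holomorphic_on UNIV"
    "\<And>s. Re s > 1 \<Longrightarrow> H s = (s - 1) * (\<Sum>n. of_nat (Suc n) powr (-s))"
    using zeta_continuation by blast
  define f where "f = (\<lambda>s. if s = 1 then 0 else H s / (s - 1))"
  have "(\<lambda>s. H s / (s - 1)) holomorphic_on -{1}"
    using holomorphic_on_subset[OF H(1)] by (intro holomorphic_intros) auto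
  then have "f holomorphic_on -{1}"
    by (rule holomorphic_transform) (auto simp: f_def)
  moreover have "(\<lambda>n. 1 / of_nat (Suc n) powr s) sums f s" if "Re s > 1" for s
  proof -
    have "s \<noteq> 1" using that by auto
    then have "f s = (\<Sum>n. of_nat (Suc n) powr (-s))" using H(2)[OF that] by (simp add: f_def)
    then show ?thesis
      using dirichlet_series_zeta(2)[OF that] by (simp add: powr_minus_divide del: of_nat_Suc)
  qed
  ultimately show "\<exists>f. f holomorphic_on -{1} \<and> f 1 = 0 \<and>
        (\<forall>s. Re s > 1 \<longrightarrow> (\<lambda>n. 1 / of_nat (Suc n) powr s) sums f s)"
    by (intro exI[of _ f]) (auto simp: f_def)
next
  fix f g :: "complex \<Rightarrow> complex"
  assume f: "f holomorphic_on -{1} \<and> f 1 = 0 \<and> (\<forall>s. Re s > 1 \<longrightarrow> (\<lambda>n. 1 / of_nat (Suc n) powr s) sums f s)"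
    and g: "g holomorphic_on -{1} \<and> g 1 = 0 \<and> (\<forall>s. Re s > 1 \<longrightarrow> (\<lambda>n. 1 / of_nat (Suc n) powr s) sums g s)"
  have eq: "f s = g s" if "Re s > 1" for s
    using f g that sums_unique2 by blast
  have "f s = g s" if "s \<noteq> 1" for s
  proof (rule analytic_continuation_open[where s = "{s. Re s > 1}" and s' = "-{1}" and f = f and g = g and z = s])
    show "{s. 1 < Re s} \<noteq> {}" by (auto intro!: exI[of _ 2])
    show "connected (-{1::complex})" by (rule connected_punctured_universe) simp
  qed (use f g eq that in \<open>auto intro: open_halfspace_Re_gt\<close>)
  then show "f = g" using f g by (metis ext)
qed

lemma zeta_holomorphic: "zeta holomorphic_on -{1}"
  and zeta_1: "zeta 1 = 0"
  and zeta_sums: "\<And>s. Re s > 1 \<Longrightarrow> (\<lambda>n. 1 / of_nat (Suc n) powr s) sums zeta s"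
  using theI'[OF zeta_exists_unique, folded zeta_def] by blast+

end

theory Submission
  imports Defs
begin

text \<open>
  Write F for the second derivative of zeta. All its zeros with positive imaginary part lie in a
  strip - b < Re s < A, so the argument principle turns the count into the change of arg F around
  the rectangle [- b, A] x [t0, T]. On the right edge F s is close to (ln 2)^2 2^(- s), which
  contributes - T ln 2. To the left of the critical line the functional equation
  zeta s = chi s * zeta (1 - s) gives F = chi s * zeta (1 - s) * (q^2 + q'), where q = zeta' / zeta
  equals - ln (Im s) up to smaller terms and hence Re (q^2 + q') > 0; on the left edge only chi
  matters, and it contributes T ln (T / (2 pi)) - T.

  The error term comes from the top edge. Put d = (ln (ln T)) powr (- 1/2). Under the Riemann
  hypothesis log zeta is holomorphic for Re s > 1/2, and Borel-Caratheodory together with the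
  maximum principle on an annulus makes it O(d^4 ln T) for Re s >= 1/2 + d. Dividing out the zeros
  of F in a disc bounds the change of arg F along a segment by the growth of F in the disc. With
  centre A + i T this covers Re s >= 1/2 + 8 d and yields a point near 1/2 + 10 d + i T at which F
  is not small. Around that point a disc of radius 60 d covers 1/2 - 3 d <= Re s <= 1/2 + 8 d, where
  the maximum principle with a Gaussian factor carries the bound |F| <= exp (O(d ln T)) across the
  critical line. Further to the left the factorization of F through chi applies. Each part
  contributes O(d ln T), and neither the zeros of zeta nor those of zeta' have to be counted.
\<close>

section \<open>Bounded functions on a disc\<close>

text \<open>With x = ln (ln T), the maximum principle on an annulus with an exponent m of order x
  gains a factor exp (- c d m) at distance d from the critical line; for d = x powr (- 1/2) this is
  exp (- c sqrt x), smaller than every power of d. The power d^4 is room for later losses: a Cauchy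
  estimate on a disc of radius d costs one power of d per derivative, and removing zeros in a disc
  with relative margin of order d costs another one, plus a factor ln (1 / d) for lower bounds.
  Across the critical line there is no such gain. F is only known to be exp (O(d ln T)) there, so a
  loss of 1 / d from the margin is not affordable, and the margin must be proportional to the
  radius. A disc of radius O(d) achieves this, but its centre has to be a point where F is not
  small, and none near the line is known in advance. It is found inside the large disc: there the
  Moebius factors are too few for their product to be small throughout a disc of radius 2 d. Zeros
  very close to the top edge do no harm, since along a horizontal segment each Moebius factor turns
  by at most 4 pi whatever its distance.\<close>

lemma Borel_Caratheodory:
  assumes hol: "k holomorphic_on ball c r" and k0: "k c = 0" and B: "B > 0"
    and Re: "\<And>z. z \<in> ball c r \<Longrightarrow> Re (k z) < B" and z: "z \<in> ball c r"
  shows "cmod (k z) \<le> 2 * B * cmod (z - c) / (r - cmod (z - c))"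
proof -
  have r: "r > 0" using z zero_le_dist[of c z] by (simp del: zero_le_dist)
  \<comment> \<open>The map u -> u / (2 B - u) sends the half-plane Re u < B into the unit disc and
    fixes 0, so the Schwarz lemma applies to \<phi>; solving for k gives the bound.\<close>
  define \<phi> where "\<phi> = (\<lambda>w. k (c + of_real r * w) / (2 * of_real B - k (c + of_real r * w)))"
  have in_ball: "c + of_real r * w \<in> ball c r" if "w \<in> ball 0 1" for w
    using that r by (simp add: dist_norm norm_mult)
  have hk: "(\<lambda>w. k (c + of_real r * w)) holomorphic_on ball 0 1"
    by (rule holomorphic_on_compose_gen[of "\<lambda>w. c + of_real r * w" "ball 0 1" k "ball c r", unfolded o_def])
       (use hol in_ball in \<open>auto intro!: holomorphic_intros\<close>)
  have lt: "cmod (k u) < cmod (2 * of_real B - k u)" if "u \<in> ball c r" for u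
  proof -
    have "(2 * B - Re (k u))\<^sup>2 + (Im (k u))\<^sup>2 > (Re (k u))\<^sup>2 + (Im (k u))\<^sup>2"
      using Re[OF that] B by (simp add: power2_eq_square algebra_simps)
    then show ?thesis by (simp add: cmod_def)
  qed
  have "\<phi> holomorphic_on ball 0 1"
    unfolding \<phi>_def using lt in_ball hk by (intro holomorphic_intros) (auto, force)
  moreover have "\<phi> 0 = 0" by (simp add: \<phi>_def k0)
  moreover have "cmod (\<phi> w) < 1" if "cmod w < 1" for w
    using lt[OF in_ball, of w] that unfolding \<phi>_def norm_divide
    by (metis divide_less_eq_1_pos dual_order.strict_trans2 mem_ball_0 norm_ge_zero)
  ultimately have S: "cmod (\<phi> w) \<le> cmod w" if "cmod w < 1" for w
    using Schwarz_Lemma(1) that by blast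
  define w where "w = (z - c) / of_real r"
  define t where "t = cmod w"
  have t: "t = cmod (z - c) / r" "t < 1"
    using z r by (auto simp: t_def w_def norm_divide dist_norm norm_minus_commute)
  have cw: "c + of_real r * w = z" using r by (simp add: w_def)
  have "2 * of_real B - k z \<noteq> 0" using lt[OF z] by force
  then have "k z = \<phi> w * (2 * of_real B - k z)" by (simp add: \<phi>_def cw)
  then have "cmod (k z) = cmod (\<phi> w) * cmod (2 * of_real B - k z)"
    by (metis norm_mult)
  also have "\<dots> \<le> t * (2 * B + cmod (k z))"
  proof (rule mult_mono)
    show "cmod (\<phi> w) \<le> t" using S[of w] t(2) by (simp add: t_def)
    show "cmod (2 * of_real B - k z) \<le> 2 * B + cmod (k z)"
      using norm_triangle_ineq4[of "2 * of_real B" "k z"] B by (simp add: norm_mult)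
  qed (simp_all add: t_def)
  finally have "cmod (k z) * (1 - t) \<le> 2 * B * t" by (simp add: algebra_simps)
  then have "cmod (k z) \<le> 2 * B * t / (1 - t)"
    using t(2) by (simp only: pos_le_divide_eq diff_gt_0_iff_gt)
  also have "\<dots> = 2 * B * cmod (z - c) / (r - cmod (z - c))"
    using r unfolding t(1) by (simp add: diff_divide_distrib[symmetric] divide_simps)
  finally show ?thesis .
qed

text \<open>Dividing by a Blaschke factor does not increase the supremum: after a disc automorphism
  that moves \<rho> to 0, the Schwarz lemma bounds f by M times the factor. This allows zeros to be
  removed one at a time without shrinking the disc.\<close>

lemma bounded_zero_Moebius_factor:
  assumes hol: "f holomorphic_on ball 0 1" and M: "\<And>z. cmod z < 1 \<Longrightarrow> cmod (f z) \<le> M"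
    and \<rho>: "cmod \<rho> < 1" "f \<rho> = 0"
  obtains g where "g holomorphic_on ball 0 1" "\<And>z. cmod z < 1 \<Longrightarrow> cmod (g z) \<le> M"
    "\<And>z. cmod z < 1 \<Longrightarrow> f z = Moebius_function 0 \<rho> z * g z"
proof -
  let ?b = "Moebius_function 0 \<rho>" and ?b' = "Moebius_function 0 (-\<rho>)"
  have M0: "M \<ge> 0" using M[of 0] norm_ge_zero[of "f 0"] by (simp del: norm_ge_zero)
  have b_lt: "cmod (?b z) < 1" if "cmod z < 1" for z
    using Moebius_function_norm_lt_1[OF \<rho>(1) that] .
  have b'_lt: "cmod (?b' z) < 1" if "cmod z < 1" for z
    using Moebius_function_norm_lt_1[of "-\<rho>" z] that \<rho> by simp
  have le: "cmod (f z) \<le> M * cmod (?b z)" if z: "cmod z < 1" for z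
  proof (rule field_le_epsilon)
    \<comment> \<open>The Schwarz lemma needs a strict bound and a nonzero divisor, hence M + e in
      place of M.\<close>
    fix e :: real assume e: "e > 0"
    define h where "h = (\<lambda>w. f (?b' w) / of_real (M + e))"
    have "h holomorphic_on ball 0 1"
      unfolding h_def using M0 e b'_lt
      by (intro holomorphic_intros holomorphic_on_compose_gen[of ?b' "ball 0 1" f "ball 0 1", unfolded o_def]
            hol Moebius_function_holomorphic) (use \<rho> in \<open>auto simp flip: of_real_add\<close>)
    moreover have "h 0 = 0" using \<rho> by (simp add: h_def Moebius_function_of_zero)
    moreover have "cmod (h w) < 1" if "cmod w < 1" for w
    proof -
      have "cmod (f (?b' w)) \<le> M" using M b'_lt that by blast
      then show ?thesis using e M0 by (simp add: h_def norm_divide flip: of_real_add)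
    qed
    ultimately have "cmod (h (?b z)) \<le> cmod (?b z)"
      using Schwarz_Lemma(1) b_lt z by blast
    moreover have "?b' (?b z) = z"
      using Moebius_function_compose[of "-\<rho>" \<rho> z] \<rho> z by simp
    ultimately have "cmod (f z) \<le> (M + e) * cmod (?b z)"
      using e M0 by (simp add: h_def norm_divide field_simps flip: of_real_add)
    also have "\<dots> \<le> M * cmod (?b z) + e"
      using b_lt[OF z] e by (simp add: algebra_simps mult_left_le)
    finally show "cmod (f z) \<le> M * cmod (?b z) + e" .
  qed
  obtain q where q: "q holomorphic_on ball 0 1" "\<And>z. z \<in> ball 0 1 \<Longrightarrow> f z = (z - \<rho>) * q z"
  proof -
    have "\<exists>q. q holomorphic_on ball 0 1 \<and> (\<forall>z\<in>ball 0 1. f z = f \<rho> + (z - \<rho>) * q z)"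
    proof -
      define q where "q = (\<lambda>z. if z = \<rho> then deriv f \<rho> else (f z - f \<rho>) / (z - \<rho>))"
      have "q holomorphic_on ball 0 1"
        unfolding q_def using pole_theorem_open_0[of f "ball 0 1" \<rho>] 
        by (intro pole_lemma[OF hol]) (use \<rho> in auto)
      then show ?thesis by (intro exI[of _ q]) (auto simp: q_def)
    qed
    then show ?thesis using that \<rho> by auto
  qed
  define g where "g = (\<lambda>z. (1 - cnj \<rho> * z) * q z)"
  have nz: "1 - cnj \<rho> * z \<noteq> 0" if "cmod z < 1" for z
  proof
    assume "1 - cnj \<rho> * z = 0"
    then have "cmod \<rho> * cmod z = 1" by (metis complex_mod_cnj eq_iff_diff_eq_0 norm_mult norm_one)
    moreover have "cmod \<rho> * cmod z \<le> cmod z"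
      using \<rho> by (intro mult_left_le_one_le) auto
    ultimately show False using that by simp
  qed
  have fac: "f z = ?b z * g z" if "cmod z < 1" for z
    using q(2)[of z] nz[OF that] that by (simp add: g_def Moebius_function_simple)
  have hg: "g holomorphic_on ball 0 1" unfolding g_def by (intro holomorphic_intros q)
  have g_le: "cmod (g z) \<le> M" if z: "cmod z < 1" "z \<noteq> \<rho>" for z
  proof -
    have "?b z \<noteq> 0" using z nz[of z] by (simp add: Moebius_function_simple)
    moreover have "cmod (?b z) * cmod (g z) \<le> M * cmod (?b z)"
      using le[OF z(1)] fac[OF z(1)] by (simp add: norm_mult)
    ultimately show ?thesis by (simp add: mult.commute)
  qed
  \<comment> \<open>The Moebius factor vanishes at \<rho>, so the quotient bound reaches this point
    only by continuity.\<close>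
  have "cmod (g \<rho>) \<le> M"
  proof (rule tendsto_upperbound)
    have "isCont g \<rho>"
      using holomorphic_on_imp_continuous_on[OF hg] \<rho> by (simp add: continuous_on_eq_continuous_at)
    then show "((\<lambda>z. cmod (g z)) \<longlongrightarrow> cmod (g \<rho>)) (at \<rho>)"
      by (simp add: isCont_def tendsto_norm)
    have "\<forall>\<^sub>F z in at \<rho>. z \<in> ball 0 1" using \<rho> by (intro eventually_at_in_open') auto
    then show "\<forall>\<^sub>F z in at \<rho>. cmod (g z) \<le> M"
      using eventually_neq_at_within[of \<rho> \<rho> UNIV] 
      by eventually_elim (use g_le in auto)
  qed simp
  with g_le have "cmod (g z) \<le> M" if "cmod z < 1" for z using that by (cases "z = \<rho>") auto
  with hg fac show ?thesis using that by blast
qed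


text \<open>Jensen's inequality in multiplicative form. Each factor with cmod \<rho> <= 1 -
  \<epsilon> is at most exp (- \<epsilon>) at 0, while the product of all factors and a cofactor of
  size at most exp B equals 1 there. Hence the lists of removable zeros have length at most B /
  \<epsilon>, a longest one exists, and its cofactor cannot vanish in the smaller disc.\<close>

lemma disc_factorization:
  assumes hol: "f holomorphic_on ball 0 1" and le: "\<And>z. cmod z < 1 \<Longrightarrow> cmod (f z) \<le> exp B"
    and f0: "f 0 = 1" and \<epsilon>: "0 < \<epsilon>" "\<epsilon> < 1"
  obtains g zs where "g holomorphic_on ball 0 1" "\<And>z. cmod z < 1 \<Longrightarrow> cmod (g z) \<le> exp B"
    "\<And>z. cmod z \<le> 1 - \<epsilon> \<Longrightarrow> g z \<noteq> 0" "cmod (g 0) \<ge> 1" "\<And>\<rho>. \<rho> \<in> set zs \<Longrightarrow> cmod \<rho> \<le> 1 - \<epsilon>"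
    "\<And>z. cmod z < 1 \<Longrightarrow> f z = g z * (\<Prod>\<rho>\<leftarrow>zs. Moebius_function 0 \<rho> z)" "real (length zs) * \<epsilon> \<le> B"
proof -
  define P where "P = (\<lambda>(zs :: complex list) g. g holomorphic_on ball 0 1 \<and> (\<forall>z. cmod z < 1 \<longrightarrow> cmod (g z) \<le> exp B) \<and>
     (\<forall>\<rho>\<in>set zs. cmod \<rho> \<le> 1 - \<epsilon>) \<and> (\<forall>z. cmod z < 1 \<longrightarrow> f z = g z * (\<Prod>\<rho>\<leftarrow>zs. Moebius_function 0 \<rho> z)))"
  have len: "real (length zs) * \<epsilon> \<le> B \<and> cmod (g 0) \<ge> 1" if "P zs g" for zs g
  proof -
    have prod: "cmod (\<Prod>\<rho>\<leftarrow>zs. Moebius_function 0 \<rho> 0) \<le> exp (- real (length zs) * \<epsilon>)"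
      if "\<forall>\<rho>\<in>set zs. cmod \<rho> \<le> 1 - \<epsilon>" for zs
      using that
    proof (induction zs)
      case (Cons \<rho> zs)
      have "cmod \<rho> \<le> exp (-\<epsilon>)" using Cons.prems exp_ge_add_one_self[of "-\<epsilon>"] by simp
      then have "cmod (\<Prod>\<rho>\<leftarrow>\<rho> # zs. Moebius_function 0 \<rho> 0) \<le> exp (-\<epsilon>) * exp (- real (length zs) * \<epsilon>)"
        using Cons by (auto simp: norm_mult Moebius_function_of_zero intro!: mult_mono)
      then show ?case by (simp add: algebra_simps flip: exp_add)
    qed simp
    have 1: "1 = cmod (g 0) * cmod (\<Prod>\<rho>\<leftarrow>zs. Moebius_function 0 \<rho> 0)"
      using that f0 by (auto simp: P_def norm_mult[symmetric])
    also have "\<dots> \<le> exp B * exp (- real (length zs) * \<epsilon>)"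
      using that prod[of zs] by (intro mult_mono) (auto simp: P_def)
    finally have a: "real (length zs) * \<epsilon> \<le> B"
      by (simp flip: exp_add)
    have "cmod (\<Prod>\<rho>\<leftarrow>zs. Moebius_function 0 \<rho> 0) \<le> 1"
      using prod[of zs] that \<epsilon> by (auto simp: P_def intro: order_trans)
    then have "cmod (g 0) \<ge> 1"
      using mult_left_mono[of "cmod (\<Prod>\<rho>\<leftarrow>zs. Moebius_function 0 \<rho> 0)" 1 "cmod (g 0)"] 1 by simp
    with a show ?thesis by blast
  qed
  define Q where "Q = (\<lambda>n. \<exists>zs g. length zs = n \<and> P zs g)"
  have "Q 0" unfolding Q_def P_def using hol le by (intro exI[of _ "[]"] exI[of _ f]) auto
  have bd: "n \<le> nat \<lfloor>B / \<epsilon>\<rfloor>" if "Q n" for n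
    using that len \<epsilon> unfolding Q_def by (force simp: le_nat_floor le_divide_eq)
  define n where "n = (GREATEST n. Q n)"
  have "Q n" unfolding n_def using GreatestI_nat[of Q 0] \<open>Q 0\<close> bd by blast
  then obtain zs g where zg: "length zs = n" "P zs g" by (auto simp: Q_def)
  have "g z \<noteq> 0" if z: "cmod z \<le> 1 - \<epsilon>" for z
  proof
    assume "g z = 0"
    then obtain h where h: "h holomorphic_on ball 0 1" "\<And>w. cmod w < 1 \<Longrightarrow> cmod (h w) \<le> exp B"
      "\<And>w. cmod w < 1 \<Longrightarrow> g w = Moebius_function 0 z w * h w"
      using bounded_zero_Moebius_factor[of g "exp B" z] zg z \<epsilon> unfolding P_def by auto
    have "P (z # zs) h" using zg z h by (auto simp: P_def)
    then have "Q (Suc n)" using zg by (auto simp: Q_def intro!: exI[of _ "z # zs"])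
    then have "Suc n \<le> n" unfolding n_def by (rule Greatest_le_nat[OF _ bd])
    then show False by simp
  qed
  with zg len[of zs g] show ?thesis using that[of g zs] by (auto simp: P_def)
qed

text \<open>The maximum principle for the polynomial in w obtained by substituting p + h / w and clearing
  denominators.\<close>

lemma prod_dist_ge:
  fixes zs :: "complex list"
  assumes "h > 0"
  shows "\<exists>z\<in>cball p h. (\<Prod>\<rho>\<leftarrow>zs. cmod (z - \<rho>)) \<ge> h ^ length zs"
proof -
  define Q where "Q = (\<lambda>w. \<Prod>\<rho>\<leftarrow>zs. (p - \<rho>) * w + of_real h)"
  have hQ: "Q holomorphic_on A" for A
    unfolding Q_def by (induction zs) (auto intro!: holomorphic_intros)
  have cQ: "continuous_on A (\<lambda>w. cmod (Q w))" for A
    using holomorphic_on_imp_continuous_on[OF hQ] by (intro continuous_on_norm)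
  obtain w where w: "cmod w = 1" "\<And>v. cmod v = 1 \<Longrightarrow> cmod (Q v) \<le> cmod (Q w)"
  proof -
    have "\<exists>w\<in>sphere 0 1. \<forall>v\<in>sphere 0 (1::real). cmod (Q v) \<le> cmod (Q w)"
      by (rule continuous_attains_sup) (auto simp: cQ)
    then show ?thesis using that by auto
  qed
  have "cmod (Q 0) \<le> cmod (Q w)"
    by (rule maximum_modulus_frontier[where S = "cball 0 1"])
       (use w hQ in \<open>auto intro: holomorphic_on_imp_continuous_on\<close>)
  moreover have "Q 0 = of_real h ^ length zs"
    unfolding Q_def by (induction zs) auto
  ultimately have "h ^ length zs \<le> cmod (Q w)"
    using assms by (simp add: norm_power)
  moreover have "cmod (Q w) = (\<Prod>\<rho>\<leftarrow>zs. cmod (p + of_real h / w - \<rho>))"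
  proof -
    have "cmod ((p - \<rho>) * w + of_real h) = cmod (p + of_real h / w - \<rho>)" for \<rho>
    proof -
      have "(p - \<rho>) * w + of_real h = w * (p + of_real h / w - \<rho>)" using w by (auto simp: field_simps)
      then show ?thesis using w by (simp add: norm_mult)
    qed
    then show ?thesis unfolding Q_def by (induction zs) (auto simp: norm_mult)
  qed
  ultimately show ?thesis using w assms
    by (intro bexI[of _ "p + of_real h / w"]) (auto simp: dist_norm norm_divide)
qed

section \<open>Calculus of the change of argument along a segment\<close>

text \<open>L is a primitive of f' / f along the segment, so K bounds the change of arg f.\<close>

definition arg_change_le :: "(complex \<Rightarrow> complex) \<Rightarrow> complex \<Rightarrow> complex \<Rightarrow> real \<Rightarrow> bool" where
  "arg_change_le f a b K \<longleftrightarrow>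
     (\<exists>L. (\<forall>z\<in>closed_segment a b.
            (L has_field_derivative deriv f z / f z) (at z within closed_segment a b)) \<and>
          \<bar>Im (L b - L a)\<bar> \<le> K)"

lemma arg_change_le_mono: "arg_change_le f a b K \<Longrightarrow> K \<le> K' \<Longrightarrow> arg_change_le f a b K'"
  unfolding arg_change_le_def by force

lemma arg_change_le_integral:
  assumes "arg_change_le f a b K"
  obtains I where "((\<lambda>z. deriv f z / f z) has_contour_integral I) (linepath a b)" "\<bar>Im I\<bar> \<le> K"
proof -
  obtain L where L: "\<And>z. z\<in>closed_segment a b \<Longrightarrow>
      (L has_field_derivative deriv f z / f z) (at z within closed_segment a b)"
    "\<bar>Im (L b - L a)\<bar> \<le> K"
    using assms by (auto simp: arg_change_le_def)
  have "((\<lambda>z. deriv f z / f z) has_contour_integral (L (pathfinish (linepath a b)) - L (pathstart (linepath a b)))) (linepath a b)"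
    by (rule contour_integral_primitive[OF L(1)]) auto
  then show ?thesis using that L by simp
qed

text \<open>The principal logarithm serves as primitive as soon as one constant u rotates the values
  of f off the negative real axis; its imaginary part lies in (- pi, pi], and u drops out of f' /
  f.\<close>

lemma arg_change_le_Ln:
  assumes S: "open S" "f holomorphic_on S" "closed_segment a b \<subseteq> S"
    and u: "\<And>z. z \<in> closed_segment a b \<Longrightarrow> u * f z \<notin> \<real>\<^sub>\<le>\<^sub>0"
  shows "arg_change_le f a b (2 * pi)"
proof -
  have "((\<lambda>z. Ln (u * f z)) has_field_derivative deriv f z / f z) (at z within closed_segment a b)"
    if z: "z \<in> closed_segment a b" for z
  proof -
    have "(f has_field_derivative deriv f z) (at z)"
      using S z holomorphic_derivI by blast
    then have d: "(f has_field_derivative deriv f z) (at z within closed_segment a b)"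
      by (rule has_field_derivative_at_within)
    have "u * f z \<noteq> 0" using u[OF z] by force
    then show ?thesis using u[OF z]
      by (auto intro!: derivative_eq_intros d simp: field_simps)
  qed
  moreover have "\<bar>Im (Ln (u * f b) - Ln (u * f a))\<bar> \<le> 2 * pi"
  proof -
    have "u * f a \<noteq> 0" "u * f b \<noteq> 0" using u[of a] u[of b] by force+
    then show ?thesis
      using Im_Ln_le_pi[of "u * f a"] mpi_less_Im_Ln[of "u * f a"] Im_Ln_le_pi[of "u * f b"] mpi_less_Im_Ln[of "u * f b"]
      by simp
  qed
  ultimately show ?thesis unfolding arg_change_le_def by (intro exI[of _ "\<lambda>z. Ln (u * f z)"]) blast
qed

lemma arg_change_le_exp:
  assumes S: "open S" "k holomorphic_on S" "closed_segment a b \<subseteq> S"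
    and f: "\<And>z. z \<in> S \<Longrightarrow> f z = exp (k z)"
  shows "arg_change_le f a b \<bar>Im (k b - k a)\<bar>"
proof -
  have "(k has_field_derivative deriv f z / f z) (at z within closed_segment a b)"
    if z: "z \<in> closed_segment a b" for z
  proof -
    have zS: "z \<in> S" using S z by blast
    have k: "(k has_field_derivative deriv k z) (at z)"
      using S zS holomorphic_derivI by blast
    then have "((\<lambda>z. exp (k z)) has_field_derivative exp (k z) * deriv k z) (at z)"
      by (auto intro!: derivative_eq_intros)
    then have "(f has_field_derivative exp (k z) * deriv k z) (at z)"
      by (rule has_field_derivative_transform_within_open[OF _ S(1) zS]) (simp add: f)
    then have "deriv f z / f z = deriv k z" using f[OF zS] DERIV_imp_deriv by fastforce
    then show ?thesis using k by (simp add: has_field_derivative_at_within)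
  qed
  then show ?thesis unfolding arg_change_le_def by (intro exI[of _ k]) auto
qed

lemma arg_change_le_mult:
  assumes "arg_change_le f a b K" "arg_change_le g a b K'"
    and S: "open S" "f holomorphic_on S" "g holomorphic_on S" "closed_segment a b \<subseteq> S"
    and nz: "\<And>z. z \<in> closed_segment a b \<Longrightarrow> f z \<noteq> 0 \<and> g z \<noteq> 0"
  shows "arg_change_le (\<lambda>z. f z * g z) a b (K + K')"
proof -
  obtain L L' where L: "\<And>z. z\<in>closed_segment a b \<Longrightarrow>
      (L has_field_derivative deriv f z / f z) (at z within closed_segment a b)"
    "\<bar>Im (L b - L a)\<bar> \<le> K" "\<And>z. z\<in>closed_segment a b \<Longrightarrow>
      (L' has_field_derivative deriv g z / g z) (at z within closed_segment a b)"
    "\<bar>Im (L' b - L' a)\<bar> \<le> K'"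
    using assms(1,2) by (auto simp: arg_change_le_def)
  have "((\<lambda>z. L z + L' z) has_field_derivative deriv (\<lambda>z. f z * g z) z / (f z * g z)) (at z within closed_segment a b)"
    if z: "z \<in> closed_segment a b" for z
  proof -
    have "f field_differentiable at z" "g field_differentiable at z"
      using S z holomorphic_on_imp_differentiable_at by blast+
    then have "deriv (\<lambda>z. f z * g z) z / (f z * g z) = deriv f z / f z + deriv g z / g z"
      using nz[OF z] by (simp add: deriv_mult field_simps)
    then show ?thesis using L z by (auto intro!: derivative_intros)
  qed
  moreover have "\<bar>Im ((L b + L' b) - (L a + L' a))\<bar> \<le> K + K'" using L(2,4) by simp
  ultimately show ?thesis unfolding arg_change_le_def by (intro exI[of _ "\<lambda>z. L z + L' z"]) auto
qed

lemma arg_change_le_cong: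
  assumes S: "open S" "closed_segment a b \<subseteq> S" and eq: "\<And>z. z \<in> S \<Longrightarrow> f z = g z"
    and "arg_change_le f a b K"
  shows "arg_change_le g a b K"
proof -
  have "deriv f z / f z = deriv g z / g z" if "z \<in> closed_segment a b" for z
  proof -
    have "\<forall>\<^sub>F w in nhds z. f w = g w"
      using S that eq by (intro eventually_nhds_in_open[THEN eventually_mono, of S]) auto
    then have "deriv f z = deriv g z" by (rule deriv_cong_ev) simp
    then show ?thesis using that S eq by auto
  qed
  then show ?thesis using assms(4) unfolding arg_change_le_def by (metis (no_types, lifting))
qed

text \<open>The factorizations live on the unit disc with value 1 at the centre; this undoes that
  normalization.\<close>

lemma arg_change_le_affine:
  assumes "arg_change_le (\<lambda>w. f (c + of_real R * w) / d) ((a - c) / of_real R) ((b - c) / of_real R) K"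
    and S: "open S" "f holomorphic_on S" "closed_segment a b \<subseteq> S" and R: "R > 0" and d: "d \<noteq> 0"
  shows "arg_change_le f a b K"
proof -
  define \<phi> where "\<phi> = (\<lambda>z. (z - c) / of_real R)"
  obtain L where L: "\<And>z. z\<in>closed_segment (\<phi> a) (\<phi> b) \<Longrightarrow>
      (L has_field_derivative deriv (\<lambda>w. f (c + of_real R * w) / d) z / (f (c + of_real R * z) / d)) (at z within closed_segment (\<phi> a) (\<phi> b))"
    "\<bar>Im (L (\<phi> b) - L (\<phi> a))\<bar> \<le> K"
    using assms(1) by (auto simp: arg_change_le_def \<phi>_def)
  have seg: "\<phi> ` closed_segment a b = closed_segment (\<phi> a) (\<phi> b)"
  proof -
    have "\<phi> ((1 - u) *\<^sub>R a + u *\<^sub>R b) = (1 - u) *\<^sub>R \<phi> a + u *\<^sub>R \<phi> b" for u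
      using R by (simp add: \<phi>_def field_simps scaleR_conv_of_real)
    then show ?thesis by (auto simp: closed_segment_image_interval image_image)
  qed
  have "((\<lambda>z. L (\<phi> z)) has_field_derivative deriv f z / f z) (at z within closed_segment a b)"
    if z: "z \<in> closed_segment a b" for z
  proof -
    have f: "(f has_field_derivative deriv f z) (at z)"
      using S z holomorphic_derivI by blast
    have cz: "c + of_real R * \<phi> z = z" using R by (simp add: \<phi>_def)
    have "((\<lambda>w. f (c + of_real R * w) / d) has_field_derivative deriv f z * of_real R / d) (at (\<phi> z))"
    proof (rule DERIV_cdivide, rule DERIV_chain2[of f])
      show "(f has_field_derivative deriv f z) (at (c + of_real R * \<phi> z))" using f cz by simp
    qed (auto intro!: derivative_eq_intros)
    then have "deriv (\<lambda>w. f (c + of_real R * w) / d) (\<phi> z) = deriv f z * of_real R / d"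
      by (rule DERIV_imp_deriv)
    then have 1: "(L has_field_derivative deriv f z * of_real R / f z) (at (\<phi> z) within \<phi> ` closed_segment a b)"
      using L(1)[of "\<phi> z"] z d seg by (auto simp: cz)
    have 2: "(\<phi> has_field_derivative 1 / of_real R) (at z within closed_segment a b)"
      unfolding \<phi>_def using R by (auto intro!: derivative_eq_intros)
    show ?thesis using DERIV_image_chain[OF 1 2] R by (simp add: o_def)
  qed
  then show ?thesis using L(2) unfolding arg_change_le_def by (intro exI[of _ "\<lambda>z. L (\<phi> z)"]) auto
qed


lemma arg_change_le_diff_const:
  assumes "Im a = Im b" "\<rho> \<notin> closed_segment a b"
  shows "arg_change_le (\<lambda>z. z - \<rho>) a b (2 * pi)"
proof -
  have seg: "closed_segment a b = {z. Im z = Im a \<and> min (Re a) (Re b) \<le> Re z \<and> Re z \<le> max (Re a) (Re b)}"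
    using closed_segment_same_Im[OF assms(1)] by (auto simp: closed_segment_eq_real_ivl)
  \<comment> \<open>On a horizontal segment z - \<rho> has constant imaginary part, so it avoids the
    slit unless \<rho> lies at the same height to the right of the segment; only then is the sign
    reversed.\<close>
  define u :: complex where "u = (if Im \<rho> = Im a \<and> Re \<rho> > max (Re a) (Re b) then -1 else 1)"
  have "u * (z - \<rho>) \<notin> \<real>\<^sub>\<le>\<^sub>0" if "z \<in> closed_segment a b" for z
    using that assms(2) unfolding seg u_def complex_nonpos_Reals_iff by (auto split: if_splits)
  then show ?thesis
    by (intro arg_change_le_Ln[of UNIV]) (auto intro!: holomorphic_intros)
qed

text \<open>The numerator is handled by the horizontal direction, the denominator by Re (1 - cnj
  \<rho> * z) > 0; each contributes 2 pi, however close \<rho> is to the segment.\<close>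

lemma arg_change_le_Moebius:
  assumes "Im a = Im b" "cmod \<rho> < 1" "closed_segment a b \<subseteq> ball 0 1" "\<rho> \<notin> closed_segment a b"
  shows "arg_change_le (Moebius_function 0 \<rho>) a b (4 * pi)"
proof -
  have Re: "Re (1 - cnj \<rho> * z) > 0" if "z \<in> ball 0 1" for z
  proof -
    have "cmod (cnj \<rho> * z) \<le> cmod \<rho>" using that by (simp add: norm_mult mult_left_le)
    then show ?thesis using complex_Re_le_cmod[of "cnj \<rho> * z"] assms by simp
  qed
  then have nz: "1 - cnj \<rho> * z \<noteq> 0" if "z \<in> ball 0 1" for z
    using that by (metis less_irrefl zero_complex.sel(1))
  have "arg_change_le (\<lambda>z. inverse (1 - cnj \<rho> * z)) a b (2 * pi)"
  proof (rule arg_change_le_Ln[of "ball 0 1" _ _ _ 1])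
    fix z assume "z \<in> closed_segment a b"
    then have "Re (1 - cnj \<rho> * z) > 0" using Re assms by blast
    then show "1 * inverse (1 - cnj \<rho> * z) \<notin> \<real>\<^sub>\<le>\<^sub>0"
      by (metis complex_nonpos_Reals_iff mult_1 nonpos_Reals_inverse_iff not_le)
  qed (use nz assms in \<open>auto intro!: holomorphic_intros\<close>)
  then have "arg_change_le (\<lambda>z. (z - \<rho>) * inverse (1 - cnj \<rho> * z)) a b (2 * pi + 2 * pi)"
    by (intro arg_change_le_mult[of _ _ _ _ _ _ "ball 0 1"] arg_change_le_diff_const)
       (use nz assms in \<open>auto intro!: holomorphic_intros\<close>)
  then show ?thesis
    by (simp add: Moebius_function_simple[abs_def] divide_inverse)
qed

lemma arg_change_le_prod_Moebius:
  assumes "Im a = Im b" "closed_segment a b \<subseteq> ball 0 1"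
    and "\<And>\<rho>. \<rho> \<in> set zs \<Longrightarrow> cmod \<rho> < 1" "\<And>\<rho>. \<rho> \<in> set zs \<Longrightarrow> \<rho> \<notin> closed_segment a b"
  shows "arg_change_le (\<lambda>z. \<Prod>\<rho>\<leftarrow>zs. Moebius_function 0 \<rho> z) a b (real (length zs) * (4 * pi))"
  using assms(3,4)
proof (induction zs)
  case Nil
  show ?case unfolding arg_change_le_def by (intro exI[of _ "\<lambda>_. 0"]) auto
next
  case (Cons \<rho> zs)
  have nz: "Moebius_function 0 \<sigma> z \<noteq> 0" if "\<sigma> \<in> set (\<rho> # zs)" "z \<in> closed_segment a b" for \<sigma> z
  proof -
    have "cmod z < 1" using that assms by auto
    moreover have "cmod \<sigma> < 1" "z \<noteq> \<sigma>" using Cons.prems that by auto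
    moreover have "cnj \<sigma> * z \<noteq> 1"
    proof
      assume "cnj \<sigma> * z = 1"
      then have "cmod \<sigma> * cmod z = 1" by (metis complex_mod_cnj norm_mult norm_one)
      moreover have "cmod \<sigma> * cmod z \<le> cmod z"
        using \<open>cmod \<sigma> < 1\<close> by (intro mult_left_le_one_le) auto
      ultimately show False using \<open>cmod z < 1\<close> by simp
    qed
    ultimately show ?thesis by (simp add: Moebius_function_simple)
  qed
  have hol: "(\<lambda>z. \<Prod>\<rho>\<leftarrow>zs. Moebius_function 0 \<rho> z) holomorphic_on ball 0 1"
    using Cons.prems(1) by (induction zs) (auto intro!: holomorphic_intros Moebius_function_holomorphic)
  have "arg_change_le (\<lambda>z. Moebius_function 0 \<rho> z * (\<Prod>\<rho>\<leftarrow>zs. Moebius_function 0 \<rho> z)) a b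
          (4 * pi + real (length zs) * (4 * pi))"
    using Cons assms nz
    by (intro arg_change_le_mult[of _ _ _ _ _ _ "ball 0 1"] arg_change_le_Moebius hol Moebius_function_holomorphic)
       (auto simp: prod_list_zero_iff)
  then show ?case by (simp add: algebra_simps)
qed

section \<open>Logarithm, argument and lower bound after division by the zeros\<close>

text \<open>The cofactor of a longest Blaschke product has no zeros for cmod z <= 1 - \<epsilon>,
  hence a logarithm k with Re k <= B and Re (k 0) >= 0. Borel-Caratheodory on the disc of radius 1 -
  \<epsilon>, evaluated up to radius 1 - 2 * \<epsilon>, then bounds k - k 0.\<close>

lemma disc_log_decomposition:
  assumes hol: "f holomorphic_on ball 0 1" and le: "\<And>z. cmod z < 1 \<Longrightarrow> cmod (f z) \<le> exp B"
    and f0: "f 0 = 1" and \<epsilon>: "0 < \<epsilon>" "\<epsilon> < 1 / 2" and B: "B > 0"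
  obtains k zs where "k holomorphic_on ball 0 (1 - \<epsilon>)"
    "\<And>z. cmod z \<le> 1 - 2 * \<epsilon> \<Longrightarrow> cmod (k z - k 0) \<le> 4 * B / \<epsilon>" "Re (k 0) \<ge> 0"
    "\<And>z. cmod z < 1 - \<epsilon> \<Longrightarrow> f z = exp (k z) * (\<Prod>\<rho>\<leftarrow>zs. Moebius_function 0 \<rho> z)"
    "\<And>\<rho>. \<rho> \<in> set zs \<Longrightarrow> cmod \<rho> \<le> 1 - \<epsilon>" "real (length zs) * \<epsilon> \<le> B"
proof -
  have "\<epsilon> < 1" using \<epsilon> by simp
  obtain g zs where g: "g holomorphic_on ball 0 1" "\<And>z. cmod z < 1 \<Longrightarrow> cmod (g z) \<le> exp B"
    "\<And>z. cmod z \<le> 1 - \<epsilon> \<Longrightarrow> g z \<noteq> 0" "cmod (g 0) \<ge> 1" "\<And>\<rho>. \<rho> \<in> set zs \<Longrightarrow> cmod \<rho> \<le> 1 - \<epsilon>"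
    "\<And>z. cmod z < 1 \<Longrightarrow> f z = g z * (\<Prod>\<rho>\<leftarrow>zs. Moebius_function 0 \<rho> z)" "real (length zs) * \<epsilon> \<le> B"
  proof (rule disc_factorization[where f = f and B = B, OF hol le f0 \<epsilon>(1) \<open>\<epsilon> < 1\<close>], goal_cases)
    case (2 g zs)
    show ?case by (rule 2(1)) (fact 2)+
  qed
  have "ball 0 (1 - \<epsilon>) \<subseteq> ball (0::complex) 1" using \<epsilon> by (intro subset_ball) auto
  then have g1: "g holomorphic_on ball 0 (1 - \<epsilon>)" using g(1) holomorphic_on_subset by blast
  obtain k where k: "k holomorphic_on ball 0 (1 - \<epsilon>)" "\<And>z. z \<in> ball 0 (1 - \<epsilon>) \<Longrightarrow> exp (k z) = g z"
    by (rule holomorphic_logarithm_exists[OF convex_ball open_ball g1, of 0])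
       (use g(3) \<epsilon> in auto)
  have Re_k: "exp (Re (k z)) = cmod (g z)" if "cmod z < 1 - \<epsilon>" for z
    using k(2)[of z] that by (metis mem_ball_0 norm_exp_eq_Re)
  have k0: "Re (k 0) \<ge> 0"
    using Re_k[of 0] g(4) \<epsilon> by (metis diff_gt_0_iff_gt \<open>\<epsilon> < 1\<close> norm_zero one_le_exp_iff)
  have bound: "cmod (k z - k 0) \<le> 4 * B / \<epsilon>" if z: "cmod z \<le> 1 - 2 * \<epsilon>" for z
  proof -
    have "cmod (k z - k 0) \<le> 2 * (2 * B) * cmod (z - 0) / ((1 - \<epsilon>) - cmod (z - 0))"
    proof (rule Borel_Caratheodory[where k = "\<lambda>z. k z - k 0"])
      fix w assume w: "w \<in> ball (0::complex) (1 - \<epsilon>)"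
      have "exp (Re (k w)) \<le> exp B" using Re_k[of w] g(2)[of w] w \<epsilon> by auto
      \<comment> \<open>The real part is at most B; the factor 2 supplies the strict
        inequality.\<close>
      then show "Re (k w - k 0) < 2 * B" using k0 B by simp
    qed (use k B z \<epsilon> in \<open>auto intro!: holomorphic_intros\<close>)
    also have "\<dots> \<le> 2 * (2 * B) * 1 / \<epsilon>"
      using B z \<epsilon> by (intro frac_le mult_left_mono) auto
    finally show ?thesis by simp
  qed
  show ?thesis
    by (rule that[OF k(1) bound k0 _ g(5) g(7)]) (use g(6) k(2) \<epsilon> in auto)
qed

text \<open>Both parts of the decomposition are controlled by B / \<epsilon>: the logarithm varies
  by at most 8 * B / \<epsilon>, and at most B / \<epsilon> Moebius factors turn by 4 * pi
  each.\<close>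

lemma disc_arg_change:
  assumes hol: "f holomorphic_on ball c R" and le: "\<And>z. z \<in> ball c R \<Longrightarrow> cmod (f z) \<le> exp B * cmod (f c)"
    and R: "R > 0" and fc: "f c \<noteq> 0" and \<epsilon>: "0 < \<epsilon>" "\<epsilon> < 1 / 2" and B: "B > 0"
    and ab: "a \<in> cball c ((1 - 2 * \<epsilon>) * R)" "b \<in> cball c ((1 - 2 * \<epsilon>) * R)" "Im a = Im b"
    and nz: "\<And>z. z \<in> closed_segment a b \<Longrightarrow> f z \<noteq> 0"
  shows "arg_change_le f a b (40 * B / \<epsilon>)"
proof -
  define F where "F = (\<lambda>w. f (c + of_real R * w) / f c)"
  define \<alpha> \<beta> where "\<alpha> = (a - c) / of_real R" and "\<beta> = (b - c) / of_real R"
  have in_ball: "c + of_real R * w \<in> ball c R" if "w \<in> ball 0 1" for w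
    using that R by (simp add: dist_norm norm_mult)
  have holF: "F holomorphic_on ball 0 1"
    unfolding F_def
    by (intro holomorphic_intros holomorphic_on_compose_gen[of "\<lambda>w. c + of_real R * w" "ball 0 1" f "ball c R", unfolded o_def])
       (use hol in_ball fc in \<open>auto intro!: holomorphic_intros\<close>)
  have leF: "cmod (F w) \<le> exp B" if "cmod w < 1" for w
    using le[OF in_ball, of w] that fc by (simp add: F_def norm_divide divide_le_eq)
  have F0: "F 0 = 1" using fc by (simp add: F_def)
  obtain k zs where k: "k holomorphic_on ball 0 (1 - \<epsilon>)"
    "\<And>z. cmod z \<le> 1 - 2 * \<epsilon> \<Longrightarrow> cmod (k z - k 0) \<le> 4 * B / \<epsilon>" "Re (k 0) \<ge> 0"
    "\<And>z. cmod z < 1 - \<epsilon> \<Longrightarrow> F z = exp (k z) * (\<Prod>\<rho>\<leftarrow>zs. Moebius_function 0 \<rho> z)"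
    "\<And>\<rho>. \<rho> \<in> set zs \<Longrightarrow> cmod \<rho> \<le> 1 - \<epsilon>" "real (length zs) * \<epsilon> \<le> B"
  proof (rule disc_log_decomposition[where f = F, OF holF leF F0 \<epsilon> B], goal_cases)
    case (2 k zs)
    show ?case by (rule 2(1)) (fact 2)+
  qed
  have seg0: "closed_segment a b \<subseteq> cball c ((1 - 2 * \<epsilon>) * R)"
    using ab by (intro closed_segment_subset) auto
  have \<alpha>\<beta>: "cmod \<alpha> \<le> 1 - 2 * \<epsilon>" "cmod \<beta> \<le> 1 - 2 * \<epsilon>"
    using ab R by (auto simp: \<alpha>_def \<beta>_def norm_divide dist_norm norm_minus_commute divide_le_eq)
  have seg1: "closed_segment \<alpha> \<beta> \<subseteq> cball 0 (1 - 2 * \<epsilon>)"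
    using \<alpha>\<beta> by (intro closed_segment_subset) auto
  have seg: "closed_segment \<alpha> \<beta> \<subseteq> ball 0 (1 - \<epsilon>)" "closed_segment \<alpha> \<beta> \<subseteq> ball 0 1"
    using seg1 \<epsilon> by (force dest!: subsetD)+
  have Im: "Im \<alpha> = Im \<beta>" using ab R by (simp add: \<alpha>_def \<beta>_def)
  have Fnz: "F w \<noteq> 0" if w: "w \<in> closed_segment \<alpha> \<beta>" for w
  proof -
    have "c + of_real R * w \<in> closed_segment a b"
    proof -
      obtain u where u: "0 \<le> u" "u \<le> 1" "w = (1 - u) *\<^sub>R \<alpha> + u *\<^sub>R \<beta>"
        using w by (auto simp: closed_segment_def)
      have "c + of_real R * w = (1 - u) *\<^sub>R a + u *\<^sub>R b"
        using R unfolding u(3) \<alpha>_def \<beta>_def by (simp add: field_simps scaleR_conv_of_real)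
      then show ?thesis using u by (auto simp: closed_segment_def)
    qed
    then show ?thesis using nz fc by (simp add: F_def)
  qed
  have rho: "\<rho> \<notin> closed_segment \<alpha> \<beta>" if "\<rho> \<in> set zs" for \<rho>
  proof
    assume "\<rho> \<in> closed_segment \<alpha> \<beta>"
    moreover have "(\<Prod>\<sigma>\<leftarrow>zs. Moebius_function 0 \<sigma> \<rho>) = 0"
      using that by (auto simp: prod_list_zero_iff Moebius_function_eq_zero intro!: image_eqI[of _ _ \<rho>])
    ultimately show False using Fnz[of \<rho>] k(4)[of \<rho>] seg by auto
  qed
  have rho1: "cmod \<rho> < 1" if "\<rho> \<in> set zs" for \<rho> using k(5)[OF that] \<epsilon> by simp
  have holM: "(\<lambda>z. \<Prod>\<rho>\<leftarrow>zs. Moebius_function 0 \<rho> z) holomorphic_on ball 0 1"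
    using rho1 by (induction zs) (auto intro!: holomorphic_intros Moebius_function_holomorphic)
  have sub: "ball 0 (1 - \<epsilon>) \<subseteq> ball (0::complex) 1" using \<epsilon> by (intro subset_ball) auto
  have 1: "arg_change_le (\<lambda>z. exp (k z)) \<alpha> \<beta> (8 * B / \<epsilon>)"
  proof (rule arg_change_le_mono[OF arg_change_le_exp[of "ball 0 (1 - \<epsilon>)" k]])
    have "\<bar>Im (k \<beta> - k \<alpha>)\<bar> \<le> cmod (k \<beta> - k 0) + cmod (k \<alpha> - k 0)"
      using abs_Im_le_cmod[of "(k \<beta> - k 0) - (k \<alpha> - k 0)"] norm_triangle_ineq4[of "k \<beta> - k 0" "k \<alpha> - k 0"]
      by simp
    then show "\<bar>Im (k \<beta> - k \<alpha>)\<bar> \<le> 8 * B / \<epsilon>" using k(2)[of \<alpha>] k(2)[of \<beta>] \<alpha>\<beta> by simp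
  qed (use k(1) seg in auto)
  have 2: "arg_change_le (\<lambda>z. exp (k z) * (\<Prod>\<rho>\<leftarrow>zs. Moebius_function 0 \<rho> z)) \<alpha> \<beta>
       (8 * B / \<epsilon> + real (length zs) * (4 * pi))"
  proof (rule arg_change_le_mult[OF 1 arg_change_le_prod_Moebius])
    show "exp (k z) \<noteq> 0 \<and> (\<Prod>\<rho>\<leftarrow>zs. Moebius_function 0 \<rho> z) \<noteq> 0" if "z \<in> closed_segment \<alpha> \<beta>" for z
      using Fnz[OF that] k(4)[of z] seg that by auto
    show "(\<lambda>z. exp (k z)) holomorphic_on ball 0 (1 - \<epsilon>)" using k(1) by (intro holomorphic_intros)
    show "(\<lambda>z. \<Prod>\<rho>\<leftarrow>zs. Moebius_function 0 \<rho> z) holomorphic_on ball 0 (1 - \<epsilon>)"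
      using holM sub holomorphic_on_subset by blast
  qed (use Im seg rho rho1 in auto)
  have "arg_change_le F \<alpha> \<beta> (8 * B / \<epsilon> + real (length zs) * (4 * pi))"
    by (rule arg_change_le_cong[OF open_ball seg(1) _ 2]) (use k(4) in auto)
  moreover have "8 * B / \<epsilon> + real (length zs) * (4 * pi) \<le> 40 * B / \<epsilon>"
  proof -
    have "real (length zs) \<le> B / \<epsilon>" using k(6) \<epsilon> by (simp add: le_divide_eq)
    then have "real (length zs) * (4 * pi) \<le> B / \<epsilon> * 16"
      using pi_less_4 B \<epsilon> by (intro mult_mono) auto
    then show ?thesis using B \<epsilon> by (simp add: field_simps)
  qed
  ultimately have "arg_change_le F \<alpha> \<beta> (40 * B / \<epsilon>)" by (rule arg_change_le_mono)
  then show ?thesis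
    unfolding F_def \<alpha>_def \<beta>_def
  proof (rule arg_change_le_affine[OF _ open_ball hol _ R fc])
    show "closed_segment a b \<subseteq> ball c R"
    proof -
      have "cball c ((1 - 2 * \<epsilon>) * R) \<subseteq> ball c R" using \<epsilon> R by (simp add: cball_subset_ball_iff)
      then show ?thesis using seg0 by blast
    qed
  qed
qed

text \<open>At most B / \<epsilon> zeros are divided out, and by \<open>prod_dist_ge\<close> some
  point of the disc of radius h loses only a factor h / (2 * R) per zero. Such a point can serve as
  the centre of another disc.\<close>

lemma disc_lower_bound_point:
  assumes hol: "f holomorphic_on ball c R" and le: "\<And>z. z \<in> ball c R \<Longrightarrow> cmod (f z) \<le> exp B * cmod (f c)"
    and R: "R > 0" and fc: "f c \<noteq> 0" and \<epsilon>: "0 < \<epsilon>" "\<epsilon> < 1 / 2" and B: "B > 0"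
    and h: "h > 0" "h \<le> R" "cball p h \<subseteq> cball c ((1 - 2 * \<epsilon>) * R)"
  shows "\<exists>z\<in>cball p h. cmod (f z) \<ge> cmod (f c) * exp (- (B / \<epsilon> * (4 + ln (2 * R / h))))"
proof -
  define F where "F = (\<lambda>w. f (c + of_real R * w) / f c)"
  have in_ball: "c + of_real R * w \<in> ball c R" if "w \<in> ball 0 1" for w
    using that R by (simp add: dist_norm norm_mult)
  have holF: "F holomorphic_on ball 0 1"
    unfolding F_def
    by (intro holomorphic_intros holomorphic_on_compose_gen[of "\<lambda>w. c + of_real R * w" "ball 0 1" f "ball c R", unfolded o_def])
       (use hol in_ball fc in \<open>auto intro!: holomorphic_intros\<close>)
  have leF: "cmod (F w) \<le> exp B" if "cmod w < 1" for w
    using le[OF in_ball, of w] that fc by (simp add: F_def norm_divide divide_le_eq)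
  have F0: "F 0 = 1" using fc by (simp add: F_def)
  obtain k zs where k: "k holomorphic_on ball 0 (1 - \<epsilon>)"
    "\<And>z. cmod z \<le> 1 - 2 * \<epsilon> \<Longrightarrow> cmod (k z - k 0) \<le> 4 * B / \<epsilon>" "Re (k 0) \<ge> 0"
    "\<And>z. cmod z < 1 - \<epsilon> \<Longrightarrow> F z = exp (k z) * (\<Prod>\<rho>\<leftarrow>zs. Moebius_function 0 \<rho> z)"
    "\<And>\<rho>. \<rho> \<in> set zs \<Longrightarrow> cmod \<rho> \<le> 1 - \<epsilon>" "real (length zs) * \<epsilon> \<le> B"
  proof (rule disc_log_decomposition[where f = F, OF holF leF F0 \<epsilon> B], goal_cases)
    case (2 k zs)
    show ?case by (rule 2(1)) (fact 2)+
  qed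
  define h' where "h' = h / R"
  have h': "h' > 0" "h' \<le> 1" using h R by (auto simp: h'_def)
  obtain w where w: "w \<in> cball ((p - c) / of_real R) h'" "(\<Prod>\<rho>\<leftarrow>zs. cmod (w - \<rho>)) \<ge> h' ^ length zs"
    using prod_dist_ge[OF h'(1)] by blast
  define z where "z = c + of_real R * w"
  have zp: "z \<in> cball p h"
  proof -
    have "p - z = of_real R * ((p - c) / of_real R - w)" using R by (simp add: z_def field_simps)
    then have "dist p z = R * dist ((p - c) / of_real R) w"
      using R by (simp add: dist_norm norm_mult)
    then show ?thesis using w(1) R by (simp add: h'_def le_divide_eq mult.commute)
  qed
  then have "z \<in> cball c ((1 - 2 * \<epsilon>) * R)" using h by blast
  then have w1: "cmod w \<le> 1 - 2 * \<epsilon>" using R by (simp add: z_def dist_norm norm_mult)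
  \<comment> \<open>The denominators 1 - cnj \<rho> * w are at most 2 in modulus, so the distances
    to the zeros are what counts.\<close>
  have prod: "cmod (\<Prod>\<rho>\<leftarrow>zs. Moebius_function 0 \<rho> w) \<ge> (\<Prod>\<rho>\<leftarrow>zs. cmod (w - \<rho>) / 2)"
    using k(5)
  proof (induction zs)
    case (Cons \<rho> zs)
    have "cmod \<rho> < 1" using Cons.prems[of \<rho>] \<epsilon> by auto
    have "cmod (cnj \<rho> * w) \<le> cmod w"
      using \<open>cmod \<rho> < 1\<close> by (simp add: norm_mult mult_left_le_one_le)
    then have "cmod (1 - cnj \<rho> * w) \<le> 2"
      using norm_triangle_ineq4[of 1 "cnj \<rho> * w"] w1 \<epsilon> by simp
    moreover have "1 - cnj \<rho> * w \<noteq> 0"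
      using \<open>cmod (cnj \<rho> * w) \<le> cmod w\<close> w1 \<epsilon> by force
    ultimately have "cmod (w - \<rho>) / 2 \<le> cmod (Moebius_function 0 \<rho> w)"
      unfolding Moebius_function_simple norm_divide by (intro divide_left_mono) auto
    moreover have "0 \<le> (\<Prod>\<rho>\<leftarrow>zs. cmod (w - \<rho>) / 2)" by (induction zs) auto
    ultimately show ?case using Cons unfolding list.map prod_list.Cons norm_mult
      by (intro mult_mono) auto
  qed simp
  have prod2: "(\<Prod>\<rho>\<leftarrow>zs. cmod (w - \<rho>) / 2) = (\<Prod>\<rho>\<leftarrow>zs. cmod (w - \<rho>)) / 2 ^ length zs"
    by (induction zs) auto
  have n: "real (length zs) \<le> B / \<epsilon>" using k(6) \<epsilon> by (simp add: le_divide_eq)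
  have Rh: "2 * R / h \<ge> 1" using h by simp
  have "exp (- (B / \<epsilon> * ln (2 * R / h))) \<le> exp (- (real (length zs) * ln (2 * R / h)))"
    using mult_right_mono[OF n ln_ge_zero[OF Rh]] by simp
  also have "\<dots> = (h' / 2) ^ length zs"
  proof -
    have "exp (- (real (length zs) * ln (2 * R / h))) = exp (- ln (2 * R / h)) ^ length zs"
      by (simp flip: exp_of_nat_mult)
    also have "exp (- ln (2 * R / h)) = h' / 2" using Rh h R by (simp add: exp_minus h'_def)
    finally show ?thesis .
  qed
  also have "\<dots> \<le> (\<Prod>\<rho>\<leftarrow>zs. cmod (w - \<rho>)) / 2 ^ length zs"
    using w(2) by (simp add: power_divide divide_right_mono)
  finally have P: "exp (- (B / \<epsilon> * ln (2 * R / h))) \<le> cmod (\<Prod>\<rho>\<leftarrow>zs. Moebius_function 0 \<rho> w)"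
    using prod prod2 by linarith
  have "- (4 * B / \<epsilon>) \<le> Re (k w)"
    using k(2)[OF w1] k(3) abs_Re_le_cmod[of "k w - k 0"] by simp
  then have "exp (- (4 * B / \<epsilon>)) * exp (- (B / \<epsilon> * ln (2 * R / h))) \<le>
      exp (Re (k w)) * cmod (\<Prod>\<rho>\<leftarrow>zs. Moebius_function 0 \<rho> w)"
    using P by (intro mult_mono) auto
  also have "\<dots> = cmod (F w)" using k(4)[of w] w1 \<epsilon> by (simp add: norm_mult)
  also have "\<dots> = cmod (f z) / cmod (f c)" by (simp add: F_def z_def norm_divide)
  finally have "exp (- (4 * B / \<epsilon>)) * exp (- (B / \<epsilon> * ln (2 * R / h))) * cmod (f c) \<le> cmod (f z)"
    using fc by (simp add: le_divide_eq)
  moreover have "exp (- (4 * B / \<epsilon>)) * exp (- (B / \<epsilon> * ln (2 * R / h))) = exp (- (B / \<epsilon> * (4 + ln (2 * R / h))))"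
    by (simp add: algebra_simps flip: exp_add)
  ultimately show ?thesis using zp by (auto simp: mult.commute)
qed

text \<open>A form of the three circles theorem with a free integer exponent: the maximum principle
  for k z / (z - c) ^ m between the radii r1 and r3. A sum of two terms replaces the interpolated
  product; m is chosen in \<open>zeta_log_bound\<close>.\<close>

lemma annulus_bound:
  assumes hol: "k holomorphic_on ball c R" and r: "0 < r1" "r1 \<le> r2" "r2 \<le> r3" "r3 < R"
    and M1: "\<And>z. z \<in> cball c r1 \<Longrightarrow> cmod (k z) \<le> M1" and M3: "\<And>z. z \<in> cball c r3 \<Longrightarrow> cmod (k z) \<le> M3"
    and z: "z \<in> cball c r2"
  shows "cmod (k z) \<le> M1 * (r2 / r1) ^ m + M3 * (r2 / r3) ^ m"
proof -
  have M0: "M1 \<ge> 0" "M3 \<ge> 0"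
    using M1[of c] M3[of c] r norm_ge_zero[of "k c"] by (auto simp del: norm_ge_zero)
  show ?thesis
  proof (cases "z \<in> cball c r1")
    case True
    have "M1 * 1 \<le> M1 * (r2 / r1) ^ m"
      using M0 r by (intro mult_left_mono one_le_power) auto
    moreover have "0 \<le> M3 * (r2 / r3) ^ m" using M0 r by simp
    ultimately show ?thesis using M1[OF True] by linarith
  next
    case False
    define S where "S = cball c r3 - ball c r1"
    define h where "h = (\<lambda>w. k w / (w - c) ^ m)"
    define E where "E = M1 / r1 ^ m + M3 / r3 ^ m"
    have S: "closed S" "bounded S" "c \<notin> S" "S \<subseteq> ball c R"
      using r by (auto simp: S_def closed_Diff intro: bounded_subset)
    have hh: "h holomorphic_on S"
      unfolding h_def using S by (intro holomorphic_intros holomorphic_on_subset[OF hol]) auto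
    have "cmod (h z) \<le> E"
    proof (rule maximum_modulus_frontier[of h S])
      show "h holomorphic_on interior S" using hh interior_subset holomorphic_on_subset by blast
      show "continuous_on (closure S) h" using hh S by (simp add: holomorphic_on_imp_continuous_on)
      show "z \<in> S" using False z r by (auto simp: S_def)
      fix w assume "w \<in> frontier S"
      then have "w \<in> sphere c r3 \<union> sphere c r1"
        using frontier_Int_subset[of "cball c r3" "- ball c r1"] r
        by (auto simp: S_def Diff_eq frontier_complement)
      then show "cmod (h w) \<le> E"
      proof
        assume w: "w \<in> sphere c r3"
        then have "cmod (w - c) = r3" by (simp add: dist_norm norm_minus_commute)
        moreover have "cmod (k w) \<le> M3" using w M3 by auto
        ultimately have "cmod (h w) \<le> M3 / r3 ^ m"
          using r by (simp add: h_def norm_divide norm_power divide_right_mono)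
        moreover have "0 \<le> M1 / r1 ^ m" using M0 r by simp
        ultimately show ?thesis by (simp add: E_def)
      next
        assume w: "w \<in> sphere c r1"
        then have "cmod (w - c) = r1" by (simp add: dist_norm norm_minus_commute)
        moreover have "cmod (k w) \<le> M1" using w M1 by auto
        ultimately have "cmod (h w) \<le> M1 / r1 ^ m"
          using r by (simp add: h_def norm_divide norm_power divide_right_mono)
        moreover have "0 \<le> M3 / r3 ^ m" using M0 r by simp
        ultimately show ?thesis by (simp add: E_def)
      qed
    qed (use S in auto)
    moreover have "cmod (z - c) > 0" using False r by auto
    ultimately have "cmod (k z) \<le> E * cmod (z - c) ^ m"
      by (auto simp: h_def norm_divide norm_power divide_le_eq zero_less_power split: if_splits)
    also have "\<dots> \<le> E * r2 ^ m"
      using z M0 r by (intro mult_left_mono power_mono) (auto simp: E_def dist_norm norm_minus_commute)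
    finally show ?thesis by (simp add: E_def power_divide algebra_simps add_divide_distrib)
  qed
qed

section \<open>Elementary bounds for zeta\<close>

text \<open>By uniqueness of the continuation: cnj (zeta (cnj s)) has the defining properties of
  zeta.\<close>

lemma zeta_cnj: "zeta (cnj s) = cnj (zeta s)"
proof -
  define f where "f = (\<lambda>s. cnj (zeta (cnj s)))"
  have diff: "f field_differentiable at z" if "z \<noteq> 1" for z
  proof -
    have "cnj z \<noteq> 1" using that by (metis complex_cnj_cnj complex_cnj_one)
    then have "zeta field_differentiable at (cnj z)"
      using zeta_holomorphic holomorphic_on_imp_differentiable_at[of zeta "-{1}" "cnj z"] by auto
    then obtain D where "(zeta has_field_derivative D) (at (cnj z))"
      by (auto simp: field_differentiable_def)
    then have "((\<lambda>y. (zeta y - zeta (cnj z)) / (y - cnj z)) \<longlongrightarrow> D) (at (cnj z))"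
      by (simp add: has_field_derivative_iff)
    moreover have "filterlim cnj (at (cnj z)) (at z)"
      by (auto simp: filterlim_at eventually_at_filter intro!: tendsto_intros)
    ultimately have "((\<lambda>y. (zeta (cnj y) - zeta (cnj z)) / (cnj y - cnj z)) \<longlongrightarrow> D) (at z)"
      by (rule filterlim_compose)
    then have "((\<lambda>y. cnj ((zeta (cnj y) - zeta (cnj z)) / (cnj y - cnj z))) \<longlongrightarrow> cnj D) (at z)"
      by (rule tendsto_cnj)
    then have "(f has_field_derivative cnj D) (at z)"
      by (simp add: has_field_derivative_iff f_def)
    then show ?thesis by (auto simp: field_differentiable_def)
  qed
  have "f holomorphic_on -{1}"
    unfolding holomorphic_on_def using diff by (auto intro: field_differentiable_at_within)
  moreover have "f 1 = 0" by (simp add: f_def zeta_1)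
  moreover have "(\<lambda>n. 1 / of_nat (Suc n) powr s) sums f s" if "Re s > 1" for s
  proof -
    have "(\<lambda>n. cnj (1 / of_nat (Suc n) powr cnj s)) sums f s"
      unfolding f_def using zeta_sums[of "cnj s"] that by (subst sums_cnj) auto
    moreover have "cnj (1 / of_nat (Suc n) powr cnj s) = 1 / of_nat (Suc n) powr s" for n
      by (simp add: cnj_powr del: of_nat_Suc)
    ultimately show ?thesis by simp
  qed
  ultimately have "f = zeta"
    using zeta_exists_unique zeta_holomorphic zeta_1 zeta_sums by blast
  then show ?thesis unfolding f_def by (metis complex_cnj_cnj)
qed

lemma zeta_differentiable: "s \<noteq> 1 \<Longrightarrow> zeta field_differentiable at s"
  using zeta_holomorphic holomorphic_on_imp_differentiable_at[of zeta "-{1}" s] by auto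

section \<open>Summation by the trapezoidal rule\<close>

text \<open>The error of the trapezoidal rule for the integral of \<open>x powr (- s)\<close> from n
  + 1 to n + 2. Summing these errors represents zeta as far as Re s > -1.\<close>

definition trapezoid_error :: "nat \<Rightarrow> complex \<Rightarrow> complex" where
  "trapezoid_error n s =
     (of_nat (Suc n) powr (-s) + of_nat (Suc (Suc n)) powr (-s)) / 2
     - (of_nat (Suc (Suc n)) powr (1 - s) - of_nat (Suc n) powr (1 - s)) / (1 - s)"

text \<open>The error is the integral of (x - N) * (N + 1 - x) / 2 against the second derivative of
  x powr (- s). \<Psi> is the primitive of this integrand found by partial integration, and the mean
  value inequality on a segment of length 1 bounds its increment.\<close>

lemma norm_trapezoid_error:
  assumes "s \<noteq> 1" "Re s \<ge> -2"
  shows "cmod (trapezoid_error n s) \<le> cmod s * cmod (s + 1) * real (Suc n) powr (- Re s - 2)"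
proof -
  define N where "N = real (Suc n)"
  have N: "N > 0" by (simp add: N_def)
  define NN where "NN = complex_of_real N"
  define \<Psi> where "\<Psi> = (\<lambda>x. (x - NN) * (NN + 1 - x) / 2 * (- s * x powr (- s - 1))
     - (NN + 1 / 2 - x) * x powr (- s) - x powr (1 - s) / (1 - s))"
  define \<Psi>' where "\<Psi>' = (\<lambda>x. (x - NN) * (NN + 1 - x) / 2 * (s * (s + 1)) * x powr (- s - 2))"
  define S where "S = complex_of_real ` {N..N + 1}"
  have der: "(\<Psi> has_field_derivative \<Psi>' x) (at x within S)" if x: "x \<in> S" for x
  proof -
    have xx: "Re x > 0" "x \<noteq> 0" using x N by (auto simp: S_def)
    then have nr: "x \<notin> \<real>\<^sub>\<le>\<^sub>0" by (simp add: complex_nonpos_Reals_iff)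
    have "x powr (- s - 1) = x * x powr (- s - 2)" "x powr (- s) = x ^ 2 * x powr (- s - 2)"
    proof -
      have e: "- s - 1 = (- s - 2) + 1" by simp
      show "x powr (- s - 1) = x * x powr (- s - 2)"
        unfolding e powr_add using xx by (simp add: mult.commute)
      have "x powr (- s - 2 + 2) = x powr (- s - 2) * x powr 2" by (rule powr_add)
      moreover have "x powr 2 = x ^ 2" using powr_complexpow[of x 2] xx by simp
      ultimately show "x powr (- s) = x ^ 2 * x powr (- s - 2)" by (simp add: mult.commute)
    qed

    have d: "((\<lambda>x. x powr a) has_field_derivative a * x powr (a - 1)) (at x within S)" for a
      using has_field_derivative_powr[OF nr, of a] has_field_derivative_at_within by blast
    have 1: "((\<lambda>x. (x - NN) * (NN + 1 - x) / 2) has_field_derivative (NN + 1 - x + (x - NN) * (-1)) / 2) (at x within S)"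
      by (auto intro!: derivative_eq_intros)
    have 2: "((\<lambda>x. NN + 1 / 2 - x) has_field_derivative -1) (at x within S)"
      by (auto intro!: derivative_eq_intros)
    note DERIV_diff[OF DERIV_diff[OF DERIV_mult[OF 1 DERIV_cmult[OF d[of "- s - 1"], of "-s"]] DERIV_mult[OF 2 d[of "- s"]]]
        DERIV_cdivide[OF d[of "1 - s"], of "1 - s"]]
    moreover have "((NN + 1 - x + (x - NN) * (-1)) / 2 * (- s * x powr (- s - 1)) +
        (- s * ((- s - 1) * x powr (- s - 1 - 1))) * ((x - NN) * (NN + 1 - x) / 2)) -
        ((-1) * x powr (- s) + (- s * x powr (- s - 1)) * (NN + 1 / 2 - x))
        - (1 - s) * x powr (1 - s - 1) / (1 - s) = \<Psi>' x"
    proof -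
      have "- s - 1 - 1 = - s - 2" "1 - s - 1 = - s" by simp_all
      moreover have "1 - s \<noteq> 0" using assms by simp
      ultimately show ?thesis unfolding \<Psi>'_def by (simp add: field_simps)
    qed
    ultimately show ?thesis unfolding \<Psi>_def by (simp only:)
  qed
  have bound: "cmod (\<Psi>' x) \<le> cmod s * cmod (s + 1) * N powr (- Re s - 2)" if xS: "x \<in> S" for x
  proof -
    obtain y where y: "x = of_real y" "N \<le> y" "y \<le> N + 1" using xS by (auto simp: S_def)
    have 1: "cmod ((x - NN) * (NN + 1 - x) / 2) \<le> 1"
    proof -
      have "(x - NN) * (NN + 1 - x) / 2 = of_real ((y - N) * (N + 1 - y) / 2)" by (simp add: y NN_def)
      then have "cmod ((x - NN) * (NN + 1 - x) / 2) = (y - N) * (N + 1 - y) / 2"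
        using y by (metis abs_of_nonneg add.commute diff_ge_0_iff_ge divide_nonneg_nonneg mult_nonneg_nonneg norm_of_real zero_le_numeral)
      also have "\<dots> \<le> 1 * 1 / 2" using y by (intro divide_right_mono mult_mono) auto
      finally show ?thesis by simp
    qed
    have "cmod (x powr (- s - 2)) = y powr (- Re s - 2)"
      using y N by (subst norm_powr_real_powr) auto
    also have "\<dots> \<le> N powr (- Re s - 2)" using y N assms by (intro powr_mono2') auto
    finally have 2: "cmod (x powr (- s - 2)) \<le> N powr (- Re s - 2)" .
    have "cmod (\<Psi>' x) = cmod ((x - NN) * (NN + 1 - x) / 2) * (cmod s * cmod (s + 1)) * cmod (x powr (- s - 2))"
      by (simp add: \<Psi>'_def norm_mult)
    also have "\<dots> \<le> 1 * (cmod s * cmod (s + 1)) * N powr (- Re s - 2)"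
      using 1 2 by (intro mult_mono mult_nonneg_nonneg) auto
    finally show ?thesis by simp
  qed
  have "cmod (\<Psi> (NN + 1) - \<Psi> NN) \<le> (cmod s * cmod (s + 1) * N powr (- Re s - 2)) * cmod ((NN + 1) - NN)"
  proof (rule field_differentiable_bound[OF _ der bound])
    show "convex S" unfolding S_def by (intro convex_linear_image) (auto intro: bounded_linear.linear bounded_linear_of_real)
    show "NN + 1 \<in> S" unfolding S_def NN_def by (intro image_eqI[of _ _ "N + 1"]) auto
    show "NN \<in> S" unfolding S_def NN_def by (intro image_eqI[of _ _ "N"]) auto
  qed
  moreover have "\<Psi> (NN + 1) - \<Psi> NN = trapezoid_error n s"
  proof -
    have "NN = of_nat (Suc n)" "NN + 1 = of_nat (Suc (Suc n))" by (simp_all add: NN_def N_def)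
    then show ?thesis
      unfolding trapezoid_error_def by (simp only: \<Psi>_def flip: \<open>NN = of_nat (Suc n)\<close> \<open>NN + 1 = of_nat (Suc (Suc n))\<close>)
        (simp add: algebra_simps diff_divide_distrib add_divide_distrib)
  qed
  ultimately show ?thesis by (simp add: N_def)
qed

lemma trapezoid_error_series:
  defines "S \<equiv> {s. Re s > -1} - {1}"
  shows "(\<lambda>s. \<Sum>n. trapezoid_error n s) holomorphic_on S"
    and "s \<in> S \<Longrightarrow> summable (\<lambda>n. trapezoid_error n s)"
proof -
  have S: "open S" unfolding S_def by (intro open_delete open_halfspace_Re_gt)
  have h: "trapezoid_error n holomorphic_on S" for n
    unfolding trapezoid_error_def S_def by (intro holomorphic_intros) auto
  have M: "\<exists>d h. 0 < d \<and> summable h \<and>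
              (\<forall>\<^sub>F n in sequentially. \<forall>w\<in>ball z d \<inter> S. cmod (trapezoid_error n w) \<le> h n)"
    if "z \<in> S" for z
  proof -
    define d where "d = (Re z + 1) / 2"
    have d: "d > 0" using that by (simp add: d_def S_def)
    define C where "C = (cmod z + d) * (cmod z + d + 1)"
    have "cmod (trapezoid_error n w) \<le> C * real (Suc n) powr (-1 - d)" if w: "w \<in> ball z d \<inter> S" for n w
    proof -
      have "cmod (w - z) < d" using w by (simp add: dist_norm norm_minus_commute)
      then have a: "cmod w \<le> cmod z + d" "cmod (w + 1) \<le> cmod z + d + 1" "Re z - Re w < d"
        using norm_triangle_ineq2[of w z] norm_triangle_ineq[of w 1] abs_Re_le_cmod[of "w - z"] by auto
      have e: "- Re w - 2 \<le> -1 - d" using a d by (simp add: d_def field_simps)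
      have e': "0 \<le> cmod z + d" using d norm_ge_zero[of z] by linarith
      have "cmod (trapezoid_error n w) \<le> cmod w * cmod (w + 1) * real (Suc n) powr (- Re w - 2)"
        using w by (intro norm_trapezoid_error) (auto simp: S_def)
      also have "\<dots> \<le> C * real (Suc n) powr (-1 - d)"
        unfolding C_def using a e e' by (intro mult_mono powr_mono mult_nonneg_nonneg) auto
      finally show ?thesis .
    qed
    moreover have "summable (\<lambda>n. C * real (Suc n) powr (-1 - d))"
      using d by (intro summable_mult summable_Suc_powr) auto
    ultimately show ?thesis using d
      by (intro exI[of _ d] exI[of _ "\<lambda>n. C * real (Suc n) powr (-1 - d)"]) auto
  qed
  show "(\<lambda>s. \<Sum>n. trapezoid_error n s) holomorphic_on S"
    by (rule holomorphic_on_suminf(1)[OF S h M])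
  show "s \<in> S \<Longrightarrow> summable (\<lambda>n. trapezoid_error n s)"
    by (rule holomorphic_on_suminf(2)[OF S h M])
qed

text \<open>For Re s > 1 the two halves of the rule sum to zeta s and zeta s - 1 and the integrals
  telescope; the identity theorem extends the formula to the domain of convergence.\<close>

lemma zeta_trapezoid:
  assumes "Re s > -1" "s \<noteq> 1"
  shows "(\<lambda>n. trapezoid_error n s) sums (zeta s - 1 / 2 - 1 / (s - 1))"
proof -
  let ?S = "{s. Re s > -1} - {1::complex}"
  have "zeta s - 1 / 2 - 1 / (s - 1) = (\<Sum>n. trapezoid_error n s)"
  proof (rule analytic_continuation_open[where s = "{s. Re s > 1}" and s' = ?S and
        f = "\<lambda>s. zeta s - 1 / 2 - 1 / (s - 1)" and g = "\<lambda>s. \<Sum>n. trapezoid_error n s"])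
    show "{s. 1 < Re s} \<noteq> {}" by (auto intro!: exI[of _ 2])
    show "open ?S" by (intro open_delete open_halfspace_Re_gt)
    show "connected ?S"
      by (intro connected_open_delete) (auto intro: convex_connected convex_halfspace_Re_gt open_halfspace_Re_gt)
    show "(\<lambda>s. zeta s - 1 / 2 - 1 / (s - 1)) holomorphic_on ?S"
      by (intro holomorphic_intros holomorphic_on_subset[OF zeta_holomorphic]) auto
    show "(\<lambda>s. \<Sum>n. trapezoid_error n s) holomorphic_on ?S" by (rule trapezoid_error_series)
  next
    fix z assume "z \<in> {s. 1 < Re s}"
    then have z: "Re z > 1" by simp
    define f where "f = (\<lambda>n. complex_of_nat (Suc n) powr (-z))"
    define g where "g = (\<lambda>n. complex_of_nat (Suc n) powr (1 - z))"
    have f: "f sums zeta z"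
      using zeta_sums[OF z] by (simp add: f_def powr_minus_divide del: of_nat_Suc)
    have f': "(\<lambda>n. f (Suc n)) sums (zeta z - 1)"
      using sums_Suc_imp[of "\<lambda>n. f (Suc n)"] sums_split_initial_segment[OF f, of 1] by (simp add: f_def)
    have g: "g \<longlonglongrightarrow> 0"
    proof (rule tendsto_norm_zero_cancel)
      have "(\<lambda>n. real (Suc n) powr (1 - Re z)) \<longlonglongrightarrow> 0" using z by real_asymp
      then show "(\<lambda>n. cmod (g n)) \<longlonglongrightarrow> 0"
        unfolding g_def by (simp only: norm_Suc_powr) simp
    qed
    have "(\<lambda>n. (f n + f (Suc n)) / 2 - (g (Suc n) - g n) / (1 - z)) sums
        ((zeta z + (zeta z - 1)) / 2 - (0 - g 0) / (1 - z))"
      by (rule sums_diff[OF sums_divide[OF sums_add[OF f f']] sums_divide[OF telescope_sums[OF g]]])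
    moreover have "(zeta z + (zeta z - 1)) / 2 - (0 - g 0) / (1 - z) = zeta z - 1 / 2 - 1 / (z - 1)"
      using z by (auto simp: g_def divide_simps) (simp add: algebra_simps)
    ultimately show "zeta z - 1 / 2 - 1 / (z - 1) = (\<Sum>n. trapezoid_error n z)"
      by (simp add: sums_iff trapezoid_error_def f_def g_def)
  qed (use assms in \<open>auto intro: open_halfspace_Re_gt\<close>)
  then show ?thesis using trapezoid_error_series(2)[of s] assms by (simp add: summable_sums)
qed

text \<open>The factor cmod s * cmod (s + 1) of the error bound grows like the square of the height,
  and Re s >= -1/2 keeps the exponent of n at most -3/2.\<close>

lemma zeta_polynomial_bound:
  "\<exists>C>0. \<forall>s. -1/2 \<le> Re s \<and> Re s \<le> X \<and> \<bar>Im s\<bar> \<ge> 1 \<longrightarrow> cmod (zeta s) \<le> C * \<bar>Im s\<bar> ^ 2"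
proof -
  define K where "K = (\<Sum>n. real (Suc n) powr (-3/2))"
  have sK: "summable (\<lambda>n. real (Suc n) powr (-3/2))" by (rule summable_Suc_powr) simp
  have K: "K \<ge> 0" unfolding K_def by (intro suminf_nonneg sK) auto
  define Y where "Y = \<bar>X\<bar> + 3"
  have "cmod (zeta s) \<le> (Y * Y * K + 2) * \<bar>Im s\<bar> ^ 2"
    if s: "-1/2 \<le> Re s" "Re s \<le> X" "\<bar>Im s\<bar> \<ge> 1" for s
  proof -
    have s1: "s \<noteq> 1" using s by auto
    have i2: "1 \<le> \<bar>Im s\<bar> ^ 2" using one_le_power[OF s(3), of 2] .
    have rs: "\<bar>Re s\<bar> \<le> \<bar>X\<bar> + 1 / 2" "\<bar>Re (s + 1)\<bar> \<le> \<bar>X\<bar> + 3 / 2" using s by auto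
    have X: "\<bar>X\<bar> + 1 \<le> (\<bar>X\<bar> + 1) * \<bar>Im s\<bar>" using s mult_left_mono[of 1 "\<bar>Im s\<bar>" "\<bar>X\<bar> + 1"] by auto
    have Y1: "cmod s \<le> Y * \<bar>Im s\<bar>" "cmod (s + 1) \<le> Y * \<bar>Im s\<bar>"
      using cmod_le[of s] cmod_le[of "s + 1"] rs s(3) X by (simp_all add: Y_def algebra_simps)
    have e: "- Re s - 2 \<le> -3/2" using s(1) by (simp add: field_simps)
    have "cmod (zeta s - 1 / 2 - 1 / (s - 1)) \<le> (Y * \<bar>Im s\<bar>) * (Y * \<bar>Im s\<bar>) * K"
    proof (rule norm_sums_le)
      show "(\<lambda>n. trapezoid_error n s) sums (zeta s - 1 / 2 - 1 / (s - 1))"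
        using s s1 by (intro zeta_trapezoid) auto
      show "(\<lambda>n. (Y * \<bar>Im s\<bar>) * (Y * \<bar>Im s\<bar>) * real (Suc n) powr (-3/2)) sums ((Y * \<bar>Im s\<bar>) * (Y * \<bar>Im s\<bar>) * K)"
        unfolding K_def by (intro sums_mult summable_sums sK)
      fix n
      have "cmod (trapezoid_error n s) \<le> cmod s * cmod (s + 1) * real (Suc n) powr (- Re s - 2)"
        using s s1 by (intro norm_trapezoid_error) auto
      also have "\<dots> \<le> (Y * \<bar>Im s\<bar>) * (Y * \<bar>Im s\<bar>) * real (Suc n) powr (-3/2)"
        using Y1 e by (intro mult_mono powr_mono mult_nonneg_nonneg) (auto simp: Y_def)
      finally show "cmod (trapezoid_error n s) \<le> (Y * \<bar>Im s\<bar>) * (Y * \<bar>Im s\<bar>) * real (Suc n) powr (-3/2)" .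
    qed
    moreover have "cmod (1 / (s - 1)) \<le> 1"
      using s abs_Im_le_cmod[of "s - 1"] s1 by (simp add: norm_divide divide_le_eq)
    moreover have "cmod (zeta s) \<le> cmod (zeta s - 1 / 2 - 1 / (s - 1)) + cmod (1 / 2 + 1 / (s - 1))"
      using norm_triangle_ineq[of "zeta s - 1 / 2 - 1 / (s - 1)" "1 / 2 + 1 / (s - 1)"] by simp
    moreover have "cmod (1 / 2 + 1 / (s - 1)) \<le> 1/2 + cmod (1 / (s - 1))"
      using norm_triangle_ineq[of "1/2" "1 / (s - 1)"] by simp
    ultimately have "cmod (zeta s) \<le> Y * Y * K * \<bar>Im s\<bar> ^ 2 + 2"
      by (simp add: power2_eq_square algebra_simps)
    also have "\<dots> \<le> (Y * Y * K + 2) * \<bar>Im s\<bar> ^ 2" using i2 by (simp add: algebra_simps)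
    finally show ?thesis .
  qed
  moreover have "Y * Y * K + 2 > 0" using K by (simp add: Y_def add_nonneg_pos)
  ultimately show ?thesis by blast
qed

text \<open>Comparison with the sum of 1 / n^2, since pi^2 / 6 - 1 < 3/4. As 3/4 is less than 1,
  zeta has no zeros here and stays in the right half-plane.\<close>

lemma zeta_minus_one_le:
  assumes "Re s \<ge> 2"
  shows "cmod (zeta s - 1) \<le> 3 / 4"
proof -
  have "(\<lambda>n. 1 / real (n + 1) ^ 2) sums (pi ^ 2 / 6)" using inverse_squares_sums by simp
  then have sq: "(\<lambda>n. 1 / real (n + 2) ^ 2) sums (pi ^ 2 / 6 - 1)"
    using sums_split_initial_segment[of "\<lambda>n. 1 / real (n + 1) ^ 2" _ 1] by (simp add: add_ac)
  have "(\<lambda>n. 1 / of_nat (Suc n) powr s) sums zeta s" using assms by (intro zeta_sums) auto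
  then have "(\<lambda>n. 1 / of_nat (Suc (Suc n)) powr s) sums (zeta s - 1)"
    using sums_split_initial_segment[of "\<lambda>n. 1 / of_nat (Suc n) powr s" _ 1] by simp
  then have "cmod (zeta s - 1) \<le> pi ^ 2 / 6 - 1"
  proof (rule norm_sums_le[OF _ sq])
    fix n
    have "cmod (1 / of_nat (Suc (Suc n)) powr s) = real (Suc (Suc n)) powr (- Re s)"
      by (simp only: norm_divide norm_Suc_powr norm_one powr_minus_divide)
    also have "\<dots> \<le> real (Suc (Suc n)) powr (- 2)" using assms by (intro powr_mono) auto
    also have "\<dots> = 1 / real (n + 2) ^ 2"
      by (simp add: powr_minus_divide)
    finally show "cmod (1 / of_nat (Suc (Suc n)) powr s) \<le> 1 / real (n + 2) ^ 2" .
  qed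
  moreover have "pi ^ 2 \<le> (3.2::real) ^ 2" using pi_approx by (intro power_mono) auto
  ultimately show ?thesis by (simp add: power2_eq_square)
qed

text \<open>For n >= 3 the term n powr (- Re s) is at most 3 powr (2 - Re s) / n^2; the 9 is
  3^2.\<close>

lemma zeta_dirichlet_tail:
  assumes "Re s \<ge> 2"
  shows "cmod (zeta s - 1 - 2 powr (-s)) \<le> 9 * 3 powr (- Re s)"
proof -
  have "(\<lambda>n. 1 / real (n + 1) ^ 2) sums (pi ^ 2 / 6)" using inverse_squares_sums by simp
  then have sq: "(\<lambda>n. 1 / real (n + 3) ^ 2) sums (pi ^ 2 / 6 - (1 + 1 / 4))"
    using sums_split_initial_segment[of "\<lambda>n. 1 / real (n + 1) ^ 2" _ 2] by (simp add: numeral_2_eq_2 add_ac)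
  have "(\<lambda>n. 1 / of_nat (Suc n) powr s) sums zeta s" using assms by (intro zeta_sums) auto
  then have "(\<lambda>n. 1 / of_nat (Suc (Suc (Suc n))) powr s) sums (zeta s - (1 + 1 / 2 powr s))"
    using sums_split_initial_segment[of "\<lambda>n. 1 / of_nat (Suc n) powr s" _ 2] by (simp add: numeral_2_eq_2)
  moreover have "zeta s - (1 + 1 / 2 powr s) = zeta s - 1 - 2 powr (-s)"
    by (simp add: powr_minus_divide)
  ultimately have s: "(\<lambda>n. 1 / of_nat (Suc (Suc (Suc n))) powr s) sums (zeta s - 1 - 2 powr (-s))" by simp
  have "cmod (zeta s - 1 - 2 powr (-s)) \<le> 3 powr (2 - Re s) * (pi ^ 2 / 6 - (1 + 1 / 4))"
  proof (rule norm_sums_le[OF s sums_mult[OF sq]])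
    fix n
    have "cmod (1 / of_nat (Suc (Suc (Suc n))) powr s) = real (n + 3) powr (- Re s)"
      by (simp only: norm_divide norm_Suc_powr norm_one powr_minus_divide) (simp add: numeral_3_eq_3)
    also have "\<dots> = real (n + 3) powr (2 - Re s) * real (n + 3) powr (- 2)"
      by (simp flip: powr_add)
    also have "\<dots> \<le> 3 powr (2 - Re s) * real (n + 3) powr (- 2)"
      using assms by (intro mult_right_mono powr_mono2') auto
    also have "real (n + 3) powr (- 2) = 1 / real (n + 3) ^ 2"
      by (simp add: powr_minus_divide)
    finally show "cmod (1 / of_nat (Suc (Suc (Suc n))) powr s) \<le> 3 powr (2 - Re s) * (1 / real (n + 3) ^ 2)" .
  qed
  also have "\<dots> \<le> 3 powr (2 - Re s) * 1"
  proof -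
    have "pi ^ 2 \<le> (3.2::real) ^ 2" using pi_approx by (intro power_mono) auto
    then show ?thesis by (intro mult_left_mono) (auto simp: power2_eq_square)
  qed
  also have "\<dots> = 9 * 3 powr (- Re s)" by (simp add: powr_diff powr_minus_divide)
  finally show ?thesis .
qed


section \<open>Non-vanishing of zeta for Re s >= 1\<close>

text \<open>One Euler factor of the 3-4-1 inequality, with x the modulus of p powr (- s) and w its
  direction. In the power series of the logarithms each term carries 3 + 4 cos + cos of the double
  angle, which is 2 (1 + cos)^2 >= 0.\<close>

lemma log_inequality_3_4_1:
  assumes x: "0 \<le> x" "x < 1" and w: "cmod w = 1"
  shows "(1 - x) ^ 3 * cmod (1 - of_real x * w) ^ 4 * cmod (1 - of_real x * w ^ 2) \<le> 1"
proof -
  have ln: "(\<lambda>n. Re (- ((- (- of_real x * v)) ^ n) / of_nat n)) sums ln (cmod (1 - of_real x * v))"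
    and nz: "1 - of_real x * v \<noteq> 0" if "cmod v = 1" for v
  proof -
    have c: "cmod (- of_real x * v) < 1" using x that by (simp add: norm_mult)
    show nz: "1 - of_real x * v \<noteq> 0" using c by force
    show "(\<lambda>n. Re (- ((- (- of_real x * v)) ^ n) / of_nat n)) sums ln (cmod (1 - of_real x * v))"
      using sums_Re[OF Ln_series'[OF c]] nz by simp
  qed
  have S: "(\<lambda>n. 3 * Re (- ((- (- of_real x * 1)) ^ n) / of_nat n) + 4 * Re (- ((- (- of_real x * w)) ^ n) / of_nat n)
      + Re (- ((- (- of_real x * w ^ 2)) ^ n) / of_nat n))
    sums (3 * ln (cmod (1 - of_real x * 1)) + 4 * ln (cmod (1 - of_real x * w)) + ln (cmod (1 - of_real x * w ^ 2)))"
    using w by (intro sums_add sums_mult ln) (auto simp: norm_power)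
  have L: "3 * Re (- ((- (- of_real x * 1)) ^ n) / of_nat n) + 4 * Re (- ((- (- of_real x * w)) ^ n) / of_nat n)
      + Re (- ((- (- of_real x * w ^ 2)) ^ n) / of_nat n) \<le> 0" for n
  proof -
    have "cmod (w ^ n) = 1" using w by (simp add: norm_power)
    then have "(Re (w ^ n))\<^sup>2 + (Im (w ^ n))\<^sup>2 = 1" by (simp add: cmod_def)
    then have "3 + 4 * Re (w ^ n) + Re ((w ^ n) ^ 2) = 2 * (1 + Re (w ^ n))\<^sup>2"
      by (simp add: power2_eq_square algebra_simps)
    then have "0 \<le> x ^ n / real n * (3 + 4 * Re (w ^ n) + Re ((w ^ n) ^ 2))" using x by simp
    also have "\<dots> = - (3 * Re (- ((- (- of_real x * 1)) ^ n) / of_nat n) + 4 * Re (- ((- (- of_real x * w)) ^ n) / of_nat n)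
      + Re (- ((- (- of_real x * w ^ 2)) ^ n) / of_nat n))"
      by (simp add: power_mult_distrib power_mult[symmetric] mult.commute algebra_simps add_divide_distrib
        flip: of_real_power)
    finally show ?thesis by simp
  qed
  have "3 * ln (cmod (1 - of_real x * 1)) + 4 * ln (cmod (1 - of_real x * w)) + ln (cmod (1 - of_real x * w ^ 2)) \<le> 0"
    by (rule sums_le[OF _ S sums_zero]) (rule L)
  moreover have "cmod (1 - of_real x * 1) = 1 - x"
  proof -
    have "cmod (of_real (1 - x)) = 1 - x" using x by (simp only: norm_of_real)
    then show ?thesis by simp
  qed
  ultimately have "ln ((1 - x) ^ 3 * cmod (1 - of_real x * w) ^ 4 * cmod (1 - of_real x * w ^ 2)) \<le> 0"
    using x nz[of w] nz[of "w ^ 2"] w by (simp add: ln_mult ln_realpow norm_power)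
  moreover have "0 < (1 - x) ^ 3 * cmod (1 - of_real x * w) ^ 4 * cmod (1 - of_real x * w ^ 2)"
    using x nz[of w] nz[of "w ^ 2"] w by (simp add: norm_power)
  ultimately show ?thesis by (simp add: ln_le_zero_iff)
qed

text \<open>Sieving: the sum over \<open>A P\<close>, the integers without a prime factor up to P,
  loses exactly the multiples of the next prime p, which multiplies it by 1 - p powr (- s). What
  remains is 1 plus terms with n > P. In this form the product formula involves only finite products
  and no division by zeta.\<close>

lemma zeta_euler_product:
  assumes s: "Re s > 1"
  shows "(\<lambda>P. zeta s * (\<Prod>p | prime p \<and> p \<le> P. 1 - of_nat p powr (-s))) \<longlonglongrightarrow> 1"
proof -
  define f where "f = (\<lambda>n::nat. complex_of_nat n powr (-s))"
  define A where "A = (\<lambda>P. {n::nat. 0 < n \<and> (\<forall>q. prime q \<and> q \<le> P \<longrightarrow> \<not> q dvd n)})"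
  have nf: "cmod (f n) = real n powr (- Re s)" for n
    unfolding f_def using norm_powr_real_powr[of "of_nat n" "-s"] by simp
  have summ: "summable (\<lambda>n. cmod (f n))"
    unfolding nf using s by (simp add: summable_real_powr_iff)
  have "(\<lambda>n. f (Suc n)) sums zeta s"
    using zeta_sums[OF s] by (simp add: f_def powr_minus_divide del: of_nat_Suc)
  then have "f sums zeta s"
    by (subst (asm) sums_Suc_iff) (simp add: f_def)
  then have hs: "(f has_sum zeta s) UNIV" using norm_summable_imp_has_sum[OF summ] by blast
  have abs: "(\<lambda>n. cmod (f n)) summable_on B" for B
    using norm_summable_imp_summable_on[of "\<lambda>n. cmod (f n)"] summ summable_on_subset_banach[of _ UNIV B] by auto
  have sm: "f summable_on B" for B using abs_summable_summable[OF abs] .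
  have step: "infsum f {n \<in> A P. \<not> p dvd n} = (1 - of_nat p powr (-s)) * infsum f (A P)"
    if p: "prime p" "p > P" for p P
  proof -
    have img: "{n \<in> A P. p dvd n} = (*) p ` A P"
    proof (intro equalityI subsetI)
      fix n assume n: "n \<in> {n \<in> A P. p dvd n}"
      then obtain m where m: "n = p * m" by (auto elim: dvdE)
      then have "m \<in> A P" using n by (auto simp: A_def)
      then show "n \<in> (*) p ` A P" using m by auto
    next
      fix n assume "n \<in> (*) p ` A P"
      then obtain m where m: "m \<in> A P" "n = p * m" by auto
      have "\<not> q dvd p * m" if q: "prime q" "q \<le> P" for q
      proof
        assume "q dvd p * m"
        then have "q dvd p \<or> q dvd m" using q by (simp add: prime_dvd_mult_iff)
        moreover have "\<not> q dvd p" using q p primes_dvd_imp_eq[of q p] by auto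
        ultimately show False using m q by (auto simp: A_def)
      qed
      then show "n \<in> {n \<in> A P. p dvd n}" using m p by (auto simp: A_def prime_gt_0_nat)
    qed
    have "infsum f {n \<in> A P. p dvd n} = infsum (f \<circ> (*) p) (A P)"
      unfolding img by (rule infsum_reindex) (use p in \<open>auto simp: inj_on_def prime_gt_0_nat\<close>)
    also have "f \<circ> (*) p = (\<lambda>n. of_nat p powr (-s) * f n)"
      by (auto simp: f_def fun_eq_iff powr_times_real[of "of_nat p" "of_nat _"] simp flip: of_nat_mult)
         (simp add: powr_times_real)
    also have "infsum (\<lambda>n. of_nat p powr (-s) * f n) (A P) = of_nat p powr (-s) * infsum f (A P)"
      by (rule infsum_cmult_right')
    finally have "infsum f {n \<in> A P. p dvd n} = of_nat p powr (-s) * infsum f (A P)" .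
    moreover have "infsum f (A P) = infsum f {n \<in> A P. p dvd n} + infsum f {n \<in> A P. \<not> p dvd n}"
    proof -
      have "A P = {n \<in> A P. p dvd n} \<union> {n \<in> A P. \<not> p dvd n}" by auto
      then show ?thesis using infsum_Un_disjoint[OF sm sm, of "{n \<in> A P. p dvd n}" "{n \<in> A P. \<not> p dvd n}"] by auto
    qed
    ultimately show ?thesis by (simp add: algebra_simps)
  qed
  have prod: "infsum f (A P) = zeta s * (\<Prod>p | prime p \<and> p \<le> P. 1 - of_nat p powr (-s))" for P
  proof (induction P)
    case 0
    have "infsum f (A 0) = infsum f UNIV"
      by (rule infsum_cong_neutral) (auto simp: A_def f_def)
    moreover have "{p::nat. prime p \<and> p \<le> 0} = {}" by auto
    ultimately show ?case using hs by (simp add: infsumI)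
  next
    case (Suc P)
    show ?case
    proof (cases "prime (Suc P)")
      case True
      have "A (Suc P) = {n \<in> A P. \<not> Suc P dvd n}" using True by (auto simp: A_def le_Suc_eq)
      moreover have "{p. prime p \<and> p \<le> Suc P} = insert (Suc P) {p. prime p \<and> p \<le> P}"
        using True by (auto simp: le_Suc_eq)
      ultimately show ?thesis using step[OF True, of P] Suc by (simp del: of_nat_Suc)
    next
      case False
      have "A (Suc P) = A P" using False by (auto simp: A_def le_Suc_eq)
      moreover have "{p. prime p \<and> p \<le> Suc P} = {p. prime p \<and> p \<le> P}"
        using False by (auto simp: le_Suc_eq)
      ultimately show ?thesis using Suc by simp
    qed
  qed
  have "(\<lambda>P. infsum f (A P)) \<longlonglongrightarrow> 1"
  proof (rule LIM_zero_cancel, rule Lim_null_comparison)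
    define T where "T = suminf (\<lambda>n. cmod (f n))"
    have hT: "((\<lambda>n. cmod (f n)) has_sum T) UNIV"
      unfolding T_def using summ by (intro norm_summable_imp_has_sum summable_sums) auto
    show "\<forall>\<^sub>F P in sequentially. cmod (infsum f (A P) - 1) \<le> T - (\<Sum>n<Suc P. cmod (f n))"
    proof (rule always_eventually, rule allI)
      fix P
      have 1: "1 \<in> A P" by (auto simp: A_def)
      have "infsum f (A P) = f 1 + infsum f (A P - {1})"
        using infsum_Un_disjoint[OF sm sm, of "{1}" "A P - {1}"] 1 by (simp add: insert_absorb)
      then have "infsum f (A P) - 1 = infsum f (A P - {1})" by (simp add: f_def)
      also have "cmod \<dots> \<le> infsum (\<lambda>n. cmod (f n)) (A P - {1})"
        by (rule norm_infsum_bound[OF abs])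
      also have "\<dots> \<le> infsum (\<lambda>n. cmod (f n)) {Suc P..}"
      proof (rule infsum_mono2)
        show "A P - {1} \<subseteq> {Suc P..}"
        proof
          fix n assume n: "n \<in> A P - {1}"
          then obtain q where q: "prime q" "q dvd n" using prime_factor_nat[of n] by auto
          then have "q > P" using n by (auto simp: A_def not_le)
          moreover have "q \<le> n" using q n by (auto simp: A_def intro: dvd_imp_le)
          ultimately show "n \<in> {Suc P..}" by simp
        qed
      qed (use abs in auto)
      also have "\<dots> = T - (\<Sum>n<Suc P. cmod (f n))"
      proof -
        have "infsum (\<lambda>n. cmod (f n)) UNIV = infsum (\<lambda>n. cmod (f n)) {..<Suc P} + infsum (\<lambda>n. cmod (f n)) {Suc P..}"
        proof -
          have "UNIV = {..<Suc P} \<union> {Suc P..}" by auto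
          then have "infsum (\<lambda>n. cmod (f n)) UNIV = infsum (\<lambda>n. cmod (f n)) ({..<Suc P} \<union> {Suc P..})"
            by (rule arg_cong)
          also have "\<dots> = infsum (\<lambda>n. cmod (f n)) {..<Suc P} + infsum (\<lambda>n. cmod (f n)) {Suc P..}"
            by (rule infsum_Un_disjoint[OF abs abs]) auto
          finally show ?thesis .
        qed
        then show ?thesis using hT by (simp add: infsumI)
      qed
      finally show "cmod (infsum f (A P) - 1) \<le> T - (\<Sum>n<Suc P. cmod (f n))" .
    qed
    have "(\<lambda>P. \<Sum>n<Suc P. cmod (f n)) \<longlonglongrightarrow> T"
      using summable_sums[OF summ] LIMSEQ_Suc unfolding T_def sums_def by blast
    then show "(\<lambda>P. T - (\<Sum>n<Suc P. cmod (f n))) \<longlonglongrightarrow> 0"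
      using tendsto_diff[OF tendsto_const, of _ T sequentially T] by simp
  qed
  then show ?thesis by (simp only: prod)
qed

text \<open>The finite Euler products stand for 1 / zeta, so the factorwise inequality has the
  opposite sense; \<open>zeta_euler_product\<close> passes to the limit.\<close>

lemma zeta_3_4_1:
  assumes \<sigma>: "\<sigma> > 1"
  shows "cmod (zeta (of_real \<sigma>)) ^ 3 * cmod (zeta (Complex \<sigma> t)) ^ 4 * cmod (zeta (Complex \<sigma> (2 * t))) \<ge> 1"
proof -
  define Q where "Q = (\<lambda>P s. \<Prod>p | prime p \<and> p \<le> P. 1 - complex_of_nat p powr (-s))"
  define E where "E = (\<lambda>P. cmod (zeta (of_real \<sigma>) * Q P (of_real \<sigma>)) ^ 3 * cmod (zeta (Complex \<sigma> t) * Q P (Complex \<sigma> t)) ^ 4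
     * cmod (zeta (Complex \<sigma> (2 * t)) * Q P (Complex \<sigma> (2 * t))))"
  have "E \<longlonglongrightarrow> cmod 1 ^ 3 * cmod 1 ^ 4 * cmod 1"
    unfolding E_def Q_def by (intro tendsto_intros zeta_euler_product) (use \<sigma> in auto)
  then have E: "E \<longlonglongrightarrow> 1" by simp
  have le: "cmod (Q P (of_real \<sigma>)) ^ 3 * cmod (Q P (Complex \<sigma> t)) ^ 4 * cmod (Q P (Complex \<sigma> (2 * t))) \<le> 1" for P
  proof -
    define q where "q = (\<lambda>s p. cmod (1 - complex_of_nat p powr (-s)))"
    have "cmod (Q P (of_real \<sigma>)) ^ 3 * cmod (Q P (Complex \<sigma> t)) ^ 4 * cmod (Q P (Complex \<sigma> (2 * t)))
      = (\<Prod>p | prime p \<and> p \<le> P. q (of_real \<sigma>) p ^ 3 * q (Complex \<sigma> t) p ^ 4 * q (Complex \<sigma> (2 * t)) p)"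
      by (simp only: Q_def q_def prod.distrib prod_power_distrib prod_norm[symmetric])
    also have "\<dots> \<le> 1"
    proof (rule prod_le_1)
      fix p assume "p \<in> {p. prime p \<and> p \<le> P}"
      then have p: "p \<ge> 2" using prime_ge_2_nat by auto
      define x where "x = real p powr (-\<sigma>)"
      define w where "w = complex_of_nat p powr (- (\<i> * of_real t))"
      have x: "0 \<le> x" "x < 1"
        using powr_less_mono[of "-\<sigma>" 0 "real p"] p \<sigma> by (auto simp: x_def)
      have w: "cmod w = 1" unfolding w_def using p by (subst norm_powr_real_powr) auto
      have xc: "complex_of_nat p powr (- of_real \<sigma>) = of_real x"
        using powr_of_real[of "real p" "-\<sigma>"] by (simp add: x_def)
      have e1: "complex_of_nat p powr (- Complex \<sigma> t) = of_real x * w"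
        unfolding xc[symmetric] w_def powr_add[symmetric] by (simp add: Complex_eq)
      have e2: "complex_of_nat p powr (- Complex \<sigma> (2 * t)) = of_real x * w ^ 2"
        unfolding xc[symmetric] w_def power2_eq_square powr_add[symmetric] by (simp add: Complex_eq algebra_simps)
      have e0: "q (of_real \<sigma>) p = 1 - x"
      proof -
        have "q (of_real \<sigma>) p = cmod (of_real (1 - x))" unfolding q_def xc by simp
        also have "\<dots> = 1 - x" using x by (simp only: norm_of_real)
        finally show ?thesis .
      qed
      show "0 \<le> q (of_real \<sigma>) p ^ 3 * q (Complex \<sigma> t) p ^ 4 * q (Complex \<sigma> (2 * t)) p \<and>
         q (of_real \<sigma>) p ^ 3 * q (Complex \<sigma> t) p ^ 4 * q (Complex \<sigma> (2 * t)) p \<le> 1"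
        unfolding e0 unfolding q_def e1 e2 using log_inequality_3_4_1[OF x w] x by simp
    qed
    finally show ?thesis .
  qed
  show ?thesis
  proof (rule LIMSEQ_le_const2[OF E])
    have "E P \<le> cmod (zeta (of_real \<sigma>)) ^ 3 * cmod (zeta (Complex \<sigma> t)) ^ 4 * cmod (zeta (Complex \<sigma> (2 * t)))" for P
    proof -
      have "E P = (cmod (zeta (of_real \<sigma>)) ^ 3 * cmod (zeta (Complex \<sigma> t)) ^ 4 * cmod (zeta (Complex \<sigma> (2 * t)))) *
         (cmod (Q P (of_real \<sigma>)) ^ 3 * cmod (Q P (Complex \<sigma> t)) ^ 4 * cmod (Q P (Complex \<sigma> (2 * t))))"
        by (simp add: E_def norm_mult power_mult_distrib mult_ac)
      also have "\<dots> \<le> (cmod (zeta (of_real \<sigma>)) ^ 3 * cmod (zeta (Complex \<sigma> t)) ^ 4 * cmod (zeta (Complex \<sigma> (2 * t)))) * 1"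
        by (intro mult_left_mono le) auto
      finally show ?thesis by simp
    qed
    then show "\<exists>N. \<forall>n\<ge>N. E n \<le> cmod (zeta (of_real \<sigma>)) ^ 3 * cmod (zeta (Complex \<sigma> t)) ^ 4 * cmod (zeta (Complex \<sigma> (2 * t)))"
      by blast
  qed
qed

text \<open>For Re s > 1 the 3-4-1 inequality excludes zeros at once. On the line Re s = 1 a zero
  would contribute a fourth power of \<sigma> - 1 against the inverse cube from the pole at 1, and
  the product would tend to 0 instead of staying above 1.\<close>

lemma zeta_nonzero_Re_ge_1:
  assumes "Re s \<ge> 1" "Im s \<noteq> 0"
  shows "zeta s \<noteq> 0"
proof
  assume z: "zeta s = 0"
  define t where "t = Im s"
  show False
  proof (cases "Re s > 1")
    case True
    then show False using zeta_3_4_1[of "Re s" t] z by (simp add: t_def)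
  next
    case False
    then have s: "s = Complex 1 t" using assms by (simp add: t_def complex_eq_iff)
    have t: "t \<noteq> 0" using assms by (simp add: t_def)
    obtain H where H: "H holomorphic_on UNIV"
       "\<And>s. Re s > 1 \<Longrightarrow> H s = (s - 1) * (\<Sum>n. of_nat (Suc n) powr (-s))"
      using zeta_continuation by blast
    have Hz: "H s = (s - 1) * zeta s" if "Re s > 1" for s
      using H(2)[OF that] dirichlet_series_zeta(2)[OF that] zeta_sums[OF that]
      by (simp add: sums_iff powr_minus_divide del: of_nat_Suc)
    have cH: "((\<lambda>\<sigma>. H (of_real \<sigma>)) \<longlongrightarrow> H (of_real 1)) (at_right (1::real))"
    proof -
      have "continuous_on UNIV (\<lambda>\<sigma>. H (complex_of_real \<sigma>))"
        by (rule continuous_on_compose2[OF holomorphic_on_imp_continuous_on[OF H(1)]]) (auto intro!: continuous_intros)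
      then show ?thesis using continuous_on_def by (metis (no_types) UNIV_I at_within_open_subset continuous_at_imp_continuous_at_within continuous_on_eq_continuous_within continuous_within open_UNIV top_greatest)
    qed
    have lin: "((\<lambda>\<sigma>. Complex \<sigma> a) \<longlongrightarrow> Complex 1 a) (at_right (1::real))" for a
      by (intro tendsto_intros)
    have c2: "((\<lambda>\<sigma>. zeta (Complex \<sigma> (2 * t))) \<longlongrightarrow> zeta (Complex 1 (2 * t))) (at_right (1::real))"
    proof -
      have "isCont zeta (Complex 1 (2 * t))"
        using zeta_differentiable[of "Complex 1 (2 * t)"] t
        by (intro field_differentiable_imp_continuous_at) (auto simp: complex_eq_iff)
      then show ?thesis using isCont_tendsto_compose lin by blast
    qed
    obtain D where D: "(zeta has_field_derivative D) (at s)"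
      using zeta_differentiable[of s] t s by (auto simp: field_differentiable_def complex_eq_iff)
    have c1: "((\<lambda>\<sigma>. zeta (Complex \<sigma> t) / (of_real \<sigma> - 1)) \<longlongrightarrow> D) (at_right (1::real))"
    proof -
      have "((\<lambda>y. (zeta y - zeta s) / (y - s)) \<longlongrightarrow> D) (at s)" using D by (simp add: has_field_derivative_iff)
      moreover have "filterlim (\<lambda>\<sigma>. Complex \<sigma> t) (at s) (at_right (1::real))"
        unfolding filterlim_at using lin[of t] s by (auto simp: eventually_at_filter)
      ultimately have "((\<lambda>\<sigma>. (zeta (Complex \<sigma> t) - zeta s) / (Complex \<sigma> t - s)) \<longlongrightarrow> D) (at_right 1)"
        by (rule filterlim_compose)
      moreover have "Complex \<sigma> t - s = of_real \<sigma> - 1" for \<sigma> by (simp add: s complex_eq_iff)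
      ultimately show ?thesis using z by simp
    qed
    \<comment> \<open>H absorbs the pole and the difference quotient the zero; one factor \<sigma> -
      1 is left over and drives G to 0.\<close>
    define G where "G = (\<lambda>\<sigma>. cmod (H (of_real \<sigma>)) ^ 3 * cmod (zeta (Complex \<sigma> t) / (of_real \<sigma> - 1)) ^ 4
        * cmod (zeta (Complex \<sigma> (2 * t))) * (\<sigma> - 1))"
    have "(G \<longlongrightarrow> cmod (H (of_real 1)) ^ 3 * cmod D ^ 4 * cmod (zeta (Complex 1 (2 * t))) * (1 - 1)) (at_right 1)"
      unfolding G_def by (intro tendsto_intros cH c1 c2)
    then have "(G \<longlongrightarrow> 0) (at_right 1)" by simp
    then have "\<forall>\<^sub>F \<sigma> in at_right 1. G \<sigma> < 1" by (rule order_tendstoD) simp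
    moreover have "\<forall>\<^sub>F \<sigma> in at_right (1::real). \<sigma> > 1" by (simp add: eventually_at_right_less)
    ultimately have "\<forall>\<^sub>F \<sigma> in at_right (1::real). False"
    proof eventually_elim
      case (elim \<sigma>)
      have "G \<sigma> = cmod (zeta (of_real \<sigma>)) ^ 3 * cmod (zeta (Complex \<sigma> t)) ^ 4 * cmod (zeta (Complex \<sigma> (2 * t)))"
      proof -
        have "cmod (of_real \<sigma> - 1) = \<sigma> - 1"
        proof -
          have "cmod (of_real (\<sigma> - 1)) = \<sigma> - 1" using elim by (simp only: norm_of_real)
          then show ?thesis by simp
        qed
        then have "G \<sigma> = ((\<sigma> - 1) * cmod (zeta (of_real \<sigma>))) ^ 3 * (cmod (zeta (Complex \<sigma> t)) / (\<sigma> - 1)) ^ 4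
            * cmod (zeta (Complex \<sigma> (2 * t))) * (\<sigma> - 1)"
          unfolding G_def using Hz[of "of_real \<sigma>"] elim by (simp add: norm_mult norm_divide)
        also have "\<dots> = cmod (zeta (of_real \<sigma>)) ^ 3 * cmod (zeta (Complex \<sigma> t)) ^ 4 * cmod (zeta (Complex \<sigma> (2 * t)))
            * ((\<sigma> - 1) ^ 4 / (\<sigma> - 1) ^ 4)"
          by (simp add: power_divide power_mult_distrib power3_eq_cube power4_eq_xxxx)
        finally show ?thesis using elim by simp
      qed
      then show False using zeta_3_4_1[of \<sigma> t] elim by simp
    qed
    then show False by simp
  qed
qed

section \<open>The functional equation\<close>

text \<open>
  For - 1 < s < 0 the trapezoid series expresses zeta s through the integral of
  kappa v * v powr (- s - 2). Writing this power of v as a Gamma integral and exchanging the integrals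
  (all integrands are nonnegative) leads to x powr (s - 1) * (coth (x / 2) / 2 - 1 / x), and
  integrating the partial fractions of coth term by term gives the series of zeta (1 - s).
\<close>

lemma nn_integral_powr_exp:
  assumes a: "a > 0" and v: "v > (0::real)"
  shows "(\<integral>\<^sup>+x. ennreal (x powr (a - 1) * exp (- v * x)) * indicator {0<..} x \<partial>lborel) = ennreal (Gamma a * v powr (- a))"
proof -
  let ?I = "\<integral>\<^sup>+x. ennreal (x powr (a - 1) * exp (- v * x)) * indicator {0<..} x \<partial>lborel"
  have "ennreal (Gamma a) = (\<integral>\<^sup>+t. ennreal (indicator {0..} t * t powr (a - 1) / exp t) \<partial>lborel)"
    by (rule Gamma_conv_nn_integral_real[OF a])
  also have "\<dots> = ennreal \<bar>v\<bar> * (\<integral>\<^sup>+x. ennreal (indicator {0..} (0 + v * x) * (0 + v * x) powr (a - 1) / exp (0 + v * x)) \<partial>lborel)"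
    by (rule nn_integral_real_affine) (use v in auto)
  also have "(\<integral>\<^sup>+x. ennreal (indicator {0..} (0 + v * x) * (0 + v * x) powr (a - 1) / exp (0 + v * x)) \<partial>lborel)
     = (\<integral>\<^sup>+x. ennreal (v powr (a - 1)) * (ennreal (x powr (a - 1) * exp (- v * x)) * indicator {0<..} x) \<partial>lborel)"
    by (intro nn_integral_cong)
       (use v in \<open>auto simp: indicator_def powr_mult zero_le_mult_iff exp_minus field_simps simp flip: ennreal_mult'\<close>)
  also have "\<dots> = ennreal (v powr (a - 1)) * ?I"
    by (rule nn_integral_cmult) auto
  also have "ennreal \<bar>v\<bar> * (ennreal (v powr (a - 1)) * ?I) = ennreal (v powr a) * ?I"
    using v by (simp add: powr_diff mult.assoc[symmetric] flip: ennreal_mult')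
  finally have "ennreal (v powr (- a)) * ennreal (Gamma a) = ennreal (v powr (- a)) * (ennreal (v powr a) * ?I)"
    by simp
  also have "\<dots> = ?I"
    using v by (simp add: mult.assoc[symmetric] flip: ennreal_mult' powr_add)
  finally show ?thesis
    using a by (simp add: mult.commute flip: ennreal_mult')
qed

text \<open>The logarithmic derivative of the reflection formula for Gamma yields Digamma (1 - z) -
  Digamma z, and the limit formula for Digamma turns both terms into partial sums. Pairing n with -
  n shifts one sum by an index; the surplus term tends to 0 by \<open>lim2\<close>.\<close>

lemma cot_partial_fractions:
  fixes z :: complex
  assumes z: "z \<notin> \<int>"
  shows "(\<lambda>n. inverse (z + of_nat (Suc n)) + inverse (z - of_nat (Suc n))) sums (of_real pi * cot (of_real pi * z) - 1 / z)"
proof -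
  have z0: "z \<noteq> 0" "1 - z \<noteq> 0" using z by auto
  have nz: "z \<notin> \<int>\<^sub>\<le>\<^sub>0" "1 - z \<notin> \<int>\<^sub>\<le>\<^sub>0"
  proof -
    show "z \<notin> \<int>\<^sub>\<le>\<^sub>0" using z nonpos_Ints_subset_Ints by blast
    show "1 - z \<notin> \<int>\<^sub>\<le>\<^sub>0"
    proof
      assume "1 - z \<in> \<int>\<^sub>\<le>\<^sub>0"
      then have "1 - (1 - z) \<in> \<int>" using nonpos_Ints_subset_Ints Ints_1 Ints_diff by blast
      then show False using z by simp
    qed
  qed
  have sin: "sin (of_real pi * z) \<noteq> 0"
    using z by (subst sin_eq_0) (auto simp: mult.commute)
  have refl: "Digamma (1 - z) - Digamma z = of_real pi * cot (of_real pi * z)"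
  proof -
    have d1: "((\<lambda>z. Gamma z * Gamma (1 - z)) has_field_derivative
        Gamma z * Digamma z * Gamma (1 - z) - Gamma z * (Gamma (1 - z) * Digamma (1 - z))) (at z)"
      using nz by (auto intro!: derivative_eq_intros)
    have d2: "((\<lambda>z. of_real pi / sin (of_real pi * z)) has_field_derivative
        - (of_real pi * (cos (of_real pi * z) * of_real pi) / (sin (of_real pi * z)) ^ 2)) (at z)"
      using sin by (auto intro!: derivative_eq_intros simp: power2_eq_square)
    have "Gamma z * Digamma z * Gamma (1 - z) - Gamma z * (Gamma (1 - z) * Digamma (1 - z))
      = - (of_real pi * (cos (of_real pi * z) * of_real pi) / (sin (of_real pi * z)) ^ 2)"
      by (rule DERIV_unique[OF d1]) (unfold Gamma_reflection_complex, rule d2)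
    then have E: "Gamma z * Gamma (1 - z) * (Digamma (1 - z) - Digamma z) =
       of_real pi * (cos (of_real pi * z) * of_real pi) / (sin (of_real pi * z)) ^ 2"
      by (simp add: algebra_simps)
    have "Digamma (1 - z) - Digamma z = sin (of_real pi * z) / of_real pi *
        (of_real pi / sin (of_real pi * z) * (Digamma (1 - z) - Digamma z))"
      using sin by simp
    also have "\<dots> = of_real pi * cot (of_real pi * z)"
      unfolding E[unfolded Gamma_reflection_complex] using sin
      by (simp add: cot_def power2_eq_square)
    finally show ?thesis .
  qed
  have "(\<lambda>m. (\<Sum>n<m. inverse (z + of_nat n)) - (\<Sum>n<m. inverse (1 - z + of_nat n))) \<longlonglongrightarrow> Digamma (1 - z) - Digamma z"
    using tendsto_diff[OF Digamma_LIMSEQ[OF z0(2)] Digamma_LIMSEQ[OF z0(1)]] by simp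
  then have lim1: "(\<lambda>m. (\<Sum>n<Suc m. inverse (z + of_nat n)) - (\<Sum>n<Suc m. inverse (1 - z + of_nat n)))
      \<longlonglongrightarrow> of_real pi * cot (of_real pi * z)"
    unfolding refl by (rule LIMSEQ_Suc)
  have lim2: "(\<lambda>m. inverse (1 - z + of_nat m)) \<longlonglongrightarrow> 0"
    by (intro filterlim_compose[OF tendsto_inverse_0] tendsto_add_filterlim_at_infinity[OF tendsto_const] tendsto_of_nat)
  have eq: "(\<Sum>n<Suc m. inverse (z + of_nat n)) - (\<Sum>n<Suc m. inverse (1 - z + of_nat n)) + inverse (1 - z + of_nat m) - 1 / z
     = (\<Sum>n<m. inverse (z + of_nat (Suc n)) + inverse (z - of_nat (Suc n)))" for m
  proof -
    have "inverse (1 - z + of_nat n) = - inverse (z - of_nat (Suc n))" for n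
      by (simp add: algebra_simps flip: inverse_minus_eq)
    then have "(\<Sum>n<m. inverse (1 - z + of_nat n)) = - (\<Sum>n<m. inverse (z - of_nat (Suc n)))"
      by (simp add: sum_negf)
    moreover have "(\<Sum>n<Suc m. inverse (z + of_nat n)) = 1 / z + (\<Sum>n<m. inverse (z + of_nat (Suc n)))"
      by (subst sum.lessThan_Suc_shift) (simp add: divide_inverse)
    ultimately show ?thesis by (simp add: sum.distrib)
  qed
  show ?thesis
    unfolding sums_def eq[symmetric]
    using tendsto_diff[OF tendsto_add[OF lim1 lim2] tendsto_const[of "1 / z"]] by simp
qed

lemma coth_partial_fractions:
  fixes x :: real
  assumes x: "x > 0"
  shows "(\<lambda>n. 2 * x / (x ^ 2 + (2 * pi * real (Suc n)) ^ 2)) sums ((1 + exp (- x)) / (1 - exp (- x)) / 2 - 1 / x)"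
proof -
  \<comment> \<open>At this point, and after multiplication by i / (2 pi), the cotangent becomes
    coth (x / 2), written through exp (- x), and the paired terms become real.\<close>
  define z where "z = \<i> * of_real (x / (2 * pi))"
  have "z \<notin> \<int>"
  proof
    assume "z \<in> \<int>"
    then have "Im z = 0" by (auto elim: Ints_cases)
    then show False using x by (simp add: z_def)
  qed
  then have s: "(\<lambda>n. inverse (z + of_nat (Suc n)) + inverse (z - of_nat (Suc n))) sums (of_real pi * cot (of_real pi * z) - 1 / z)"
    by (rule cot_partial_fractions)
  have c1: "\<i> / (2 * of_real pi) * (inverse (z + of_nat (Suc n)) + inverse (z - of_nat (Suc n))) =
     of_real (2 * x / (x ^ 2 + (2 * pi * real (Suc n)) ^ 2))" for n
  proof -
    define N where "N = real (Suc n)"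
    have N: "N > 0" "of_nat (Suc n) = complex_of_real N" by (simp_all add: N_def)
    have nz: "z + of_real N \<noteq> 0" "z - of_real N \<noteq> 0"
      using N x by (auto simp: z_def complex_eq_iff)
    have "inverse (z + of_real N) + inverse (z - of_real N) = 2 * z / (z ^ 2 - of_real N ^ 2)"
      using nz by (simp add: field_simps power2_eq_square)
    also have "z ^ 2 = - of_real ((x / (2 * pi)) ^ 2)" by (simp add: z_def power_mult_distrib power_divide)
    also have "- of_real ((x / (2 * pi)) ^ 2) - of_real N ^ 2 = - complex_of_real ((x ^ 2 + (2 * pi * N) ^ 2) / (2 * pi) ^ 2)"
      by (simp add: field_simps power_divide power_mult_distrib)
    finally have "\<i> / (2 * of_real pi) * (inverse (z + of_real N) + inverse (z - of_real N)) =
       of_real ((x / (2 * pi)) / pi / ((x ^ 2 + (2 * pi * N) ^ 2) / (2 * pi) ^ 2))"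
      by (simp add: z_def field_simps)
    also have "(x / (2 * pi)) / pi / ((x ^ 2 + (2 * pi * N) ^ 2) / (2 * pi) ^ 2) = 2 * x / (x ^ 2 + (2 * pi * N) ^ 2)"
      by (simp add: power2_eq_square)
    finally show ?thesis unfolding N(2) N_def .
  qed
  have c2: "\<i> / (2 * of_real pi) * (of_real pi * cot (of_real pi * z) - 1 / z) =
     of_real ((1 + exp (- x)) / (1 - exp (- x)) / 2 - 1 / x)"
  proof -
    define E where "E = exp (- x)"
    have E: "0 < E" "E < 1" using x by (simp_all add: E_def)
    have pz: "of_real pi * z = \<i> * of_real (x / 2)" by (simp add: z_def)
    define h where "h = complex_of_real (exp (x / 2))"
    have h: "h \<noteq> 0" by (simp add: h_def)
    have hE: "1 / h ^ 2 = of_real E"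
    proof -
      have "exp (x / 2) ^ 2 = exp x" by (simp add: power2_eq_square flip: exp_add)
      then have "1 / exp (x / 2) ^ 2 = E" by (simp only: E_def exp_minus divide_inverse mult_1_left)
      then show ?thesis unfolding h_def by (metis of_real_1 of_real_divide of_real_power)
    qed
    have ii: "\<i> * (\<i> * of_real (x / 2)) = - complex_of_real (x / 2)" by (simp flip: mult.assoc)
    have e1: "exp (\<i> * (\<i> * of_real (x / 2))) = 1 / h"
      unfolding ii h_def exp_minus exp_of_real by (simp only: divide_inverse mult_1_left)
    have e2: "exp (- (\<i> * (\<i> * of_real (x / 2)))) = h"
      unfolding ii h_def minus_minus exp_of_real ..
    have hne: "1 - h ^ 2 \<noteq> 0" "h ^ 2 - 1 \<noteq> 0"
    proof -
      have "of_real E \<noteq> (1::complex)" using E by (metis less_irrefl of_real_eq_1_iff)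
      then show "1 - h ^ 2 \<noteq> 0" "h ^ 2 - 1 \<noteq> 0" using hE h by auto
    qed
    have "cot (\<i> * of_real (x / 2)) = \<i> * (1 / h + h) / (1 / h - h)"
    proof -
      have "(a / 2) / (b / (2 * \<i>)) = \<i> * a / b" for a b :: complex
        by (cases "b = 0") (auto simp: field_simps)
      then show ?thesis unfolding cot_def cos_exp_eq sin_exp_eq e1 e2 .
    qed
    also have "\<dots> = - \<i> * ((1 + 1 / h ^ 2) / (1 - 1 / h ^ 2))"
      using h hne by (simp add: field_simps power2_eq_square)
    also have "\<dots> = - \<i> * of_real ((1 + E) / (1 - E))" by (simp add: hE)
    finally have cot: "cot (of_real pi * z) = - \<i> * of_real ((1 + E) / (1 - E))" by (simp add: pz)
    have "\<i> / (2 * of_real pi) * (of_real pi * cot (of_real pi * z)) = of_real ((1 + E) / (1 - E) / 2)"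
    proof -
      have "\<i> / (2 * of_real pi) * (of_real pi * (- \<i> * of_real R)) = of_real (R / 2)" for R by simp
      then show ?thesis unfolding cot .
    qed
    moreover have "\<i> / (2 * of_real pi) * (1 / z) = of_real (1 / x)"
      using x by (simp add: z_def)
    ultimately show ?thesis unfolding E_def[symmetric] by (simp only: right_diff_distrib of_real_diff)
  qed
  have "(\<lambda>n. complex_of_real (2 * x / (x ^ 2 + (2 * pi * real (Suc n)) ^ 2))) sums
     of_real ((1 + exp (- x)) / (1 - exp (- x)) / 2 - 1 / x)"
    unfolding c1[symmetric] c2[symmetric] by (intro sums_mult s)
  then show ?thesis by (simp only: sums_of_real_iff)
qed

text \<open>The substitution t = x^2 / (1 + x^2) turns the case a = 1 into a Beta integral whose
  parameters (1 + s) / 2 and (1 - s) / 2 add up to 1, so the reflection formula evaluates it.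
  Scaling gives general a.\<close>

lemma nn_integral_powr_over_quadratic:
  fixes s a :: real
  assumes s: "-1 < s" "s < 0" and a: "a > 0"
  shows "(\<integral>\<^sup>+x. ennreal (2 * x powr s / (x ^ 2 + a ^ 2)) * indicator {0<..} x \<partial>lborel)
     = ennreal (a powr (s - 1) * (pi / cos (pi * s / 2)))"
proof -
  define \<alpha> \<beta> where "\<alpha> = (1 + s) / 2" and "\<beta> = (1 - s) / 2"
  have \<alpha>\<beta>: "\<alpha> > 0" "\<beta> > 0" "\<alpha> + \<beta> = 1" using s by (auto simp: \<alpha>_def \<beta>_def field_simps)
  define f where "f = (\<lambda>t::real. t powr (\<alpha> - 1) * (1 - t) powr (\<beta> - 1))"
  define g where "g = (\<lambda>x::real. x ^ 2 / (1 + x ^ 2))"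
  define g' where "g' = (\<lambda>x::real. 2 * x / (1 + x ^ 2) ^ 2)"
  have pos: "1 + x ^ 2 > 0" for x :: real by (simp add: add_pos_nonneg)
  have B: "(f has_integral Beta \<alpha> \<beta>) {0..1}"
    unfolding f_def by (rule has_integral_Beta_real) (use \<alpha>\<beta> in auto)
  have Beta: "Beta \<alpha> \<beta> = pi / cos (pi * s / 2)"
  proof -
    have "complex_of_real (Beta \<alpha> \<beta>) = Gamma (of_real \<alpha>) * Gamma (1 - of_real \<alpha>)"
    proof -
      have "Beta \<alpha> \<beta> = Gamma \<alpha> * Gamma \<beta>" using \<alpha>\<beta> by (simp add: Beta_def)
      moreover have "\<beta> = 1 - \<alpha>" using \<alpha>\<beta> by simp
      ultimately show ?thesis by (simp add: Gamma_complex_of_real[symmetric])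
    qed
    also have "\<dots> = of_real (pi / sin (pi * \<alpha>))"
      by (simp add: Gamma_reflection_complex flip: sin_of_real)
    also have "sin (pi * \<alpha>) = cos (pi * s / 2)"
      by (simp add: \<alpha>_def sin_cos_eq field_simps)
    finally show ?thesis by (simp only: of_real_eq_iff)
  qed
  have img: "g ` {0<..} = {0<..<1}"
  proof (intro equalityI subsetI)
    fix t assume "t \<in> {0<..<(1::real)}"
    then have t: "0 < t" "t < 1" by auto
    have "g (sqrt (t / (1 - t))) = t" using t by (simp add: g_def field_simps)
    then show "t \<in> g ` {0<..}" using t by (intro image_eqI[of _ _ "sqrt (t / (1 - t))"]) auto
  qed (use pos in \<open>auto simp: g_def\<close>)
  have inj: "inj_on g {0<..}"
  proof (rule inj_onI)
    fix x y :: real assume xy: "x \<in> {0<..}" "y \<in> {0<..}" "g x = g y"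
    have "x ^ 2 * (1 + y ^ 2) = y ^ 2 * (1 + x ^ 2)"
      using xy(3) pos[of x] pos[of y] unfolding g_def by (simp add: frac_eq_eq)
    then have "x ^ 2 = y ^ 2" by (simp add: algebra_simps)
    then show "x = y" using xy by (simp add: power2_eq_iff_nonneg)
  qed
  have B': "(f has_integral Beta \<alpha> \<beta>) {0<..<1}"
    using has_integral_open_interval[of f _ 0 1] B by (simp add: box_real)
  have ai: "f absolutely_integrable_on {0<..<1}"
    by (rule nonnegative_absolutely_integrable_1) (use B' in \<open>auto simp: f_def has_integral_integrable\<close>)
  have "(\<lambda>x. \<bar>g' x\<bar> * f (g x)) absolutely_integrable_on {0<..} \<and> integral {0<..} (\<lambda>x. \<bar>g' x\<bar> * f (g x)) = Beta \<alpha> \<beta>"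
  proof (subst has_absolute_integral_change_of_variables_1'[OF _ _ inj])
    show "(g has_field_derivative g' x) (at x within {0<..})" for x
    proof -
      have "(g has_field_derivative ((2 * x) * (1 + x ^ 2) - x ^ 2 * (2 * x)) / ((1 + x ^ 2) * (1 + x ^ 2))) (at x within {0<..})"
        unfolding g_def using pos[of x] by (intro DERIV_divide) (auto intro!: derivative_eq_intros)
      moreover have "(2 * x) * (1 + x ^ 2) - x ^ 2 * (2 * x) = 2 * x" by (simp add: algebra_simps)
      ultimately show ?thesis by (simp only: g'_def power2_eq_square[of "1 + _"])
    qed
    show "f absolutely_integrable_on g ` {0<..} \<and> integral (g ` {0<..}) f = Beta \<alpha> \<beta>"
      unfolding img using ai B' by (auto simp: integral_unique)
  qed auto
  then have hi: "((\<lambda>x. \<bar>g' x\<bar> * f (g x)) has_integral Beta \<alpha> \<beta>) {0<..}"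
    by (auto simp: has_integral_iff absolutely_integrable_on_def)
  have eq: "\<bar>g' x\<bar> * f (g x) = 2 * x powr s / (x ^ 2 + 1)" if x: "x > 0" for x
  proof -
    define q where "q = 1 + x ^ 2"
    have q: "q > 0" using pos by (simp add: q_def)
    have "1 - g x = 1 / q" using q by (simp add: g_def q_def field_simps)
    then have "f (g x) = (x ^ 2 / q) powr (\<alpha> - 1) * (1 / q) powr (\<beta> - 1)" by (simp add: f_def g_def q_def)
    also have "\<dots> = (x ^ 2) powr (\<alpha> - 1) * (q powr (1 - \<alpha>) * q powr (1 - \<beta>))"
      using powr_minus_divide[of q "\<alpha> - 1"] powr_minus_divide[of q "\<beta> - 1"] q x by (simp add: powr_divide)
    also have "q powr (1 - \<alpha>) * q powr (1 - \<beta>) = q"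
    proof -
      have "(1 - \<alpha>) + (1 - \<beta>) = 1" using \<alpha>\<beta> by simp
      then show ?thesis using q by (simp only: powr_add[symmetric]) simp
    qed
    also have "(x ^ 2) powr (\<alpha> - 1) = x powr (s - 1)"
    proof -
      have "(x ^ 2) powr (\<alpha> - 1) = (x powr 2) powr (\<alpha> - 1)" using x by simp
      also have "\<dots> = x powr (2 * (\<alpha> - 1))" by (simp only: powr_powr)
      also have "2 * (\<alpha> - 1) = s - 1" by (simp add: \<alpha>_def field_simps)
      finally show ?thesis .
    qed
    finally have "f (g x) = x powr (s - 1) * q" .
    moreover have "\<bar>g' x\<bar> = 2 * x / q ^ 2" using x by (simp add: g'_def q_def)
    moreover have "x powr s = x powr (s - 1) * x" using x by (simp add: powr_diff)
    ultimately show ?thesis using q by (simp add: q_def power2_eq_square add.commute)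
  qed
  have "((\<lambda>x. 2 * x powr s / (x ^ 2 + 1)) has_integral Beta \<alpha> \<beta>) {0<..}"
    using hi by (rule has_integral_cong[THEN iffD1, rotated]) (use eq in auto)
  from nn_integral_has_integral_lebesgue[OF _ this]
  have I: "(\<integral>\<^sup>+x. ennreal (indicator {0<..} x * (2 * x powr s / (x ^ 2 + 1))) \<partial>lborel) = ennreal (Beta \<alpha> \<beta>)"
    by simp
  have "(\<integral>\<^sup>+x. ennreal (2 * x powr s / (x ^ 2 + a ^ 2)) * indicator {0<..} x \<partial>lborel) =
     ennreal \<bar>a\<bar> * (\<integral>\<^sup>+x. ennreal (2 * (0 + a * x) powr s / ((0 + a * x) ^ 2 + a ^ 2)) * indicator {0<..} (0 + a * x) \<partial>lborel)"
    by (rule nn_integral_real_affine) (use a in auto)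
  also have "(\<integral>\<^sup>+x. ennreal (2 * (0 + a * x) powr s / ((0 + a * x) ^ 2 + a ^ 2)) * indicator {0<..} (0 + a * x) \<partial>lborel)
     = (\<integral>\<^sup>+x. ennreal (a powr (s - 2)) * ennreal (indicator {0<..} x * (2 * x powr s / (x ^ 2 + 1))) \<partial>lborel)"
  proof (intro nn_integral_cong)
    fix x :: real
    show "ennreal (2 * (0 + a * x) powr s / ((0 + a * x) ^ 2 + a ^ 2)) * indicator {0<..} (0 + a * x) =
       ennreal (a powr (s - 2)) * ennreal (indicator {0<..} x * (2 * x powr s / (x ^ 2 + 1)))"
    proof (cases "x > 0")
      case True
      have "2 * (a * x) powr s / ((a * x) ^ 2 + a ^ 2) = a powr s / a ^ 2 * (2 * x powr s / (x ^ 2 + 1))"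
      proof -
        have "(a * x) ^ 2 + a ^ 2 = a ^ 2 * (x ^ 2 + 1)" by (simp add: algebra_simps power_mult_distrib)
        then show ?thesis using True a by (simp add: powr_mult)
      qed
      also have "a powr s / a ^ 2 = a powr (s - 2)" using a by (simp add: powr_diff)
      finally show ?thesis using True a by (simp flip: ennreal_mult')
    qed (use a in \<open>auto simp: zero_less_mult_iff\<close>)
  qed
  also have "\<dots> = ennreal (a powr (s - 2)) * ennreal (Beta \<alpha> \<beta>)"
    unfolding I[symmetric] by (rule nn_integral_cmult) auto
  also have "ennreal \<bar>a\<bar> * (ennreal (a powr (s - 2)) * ennreal (Beta \<alpha> \<beta>)) = ennreal (a powr (s - 1) * Beta \<alpha> \<beta>)"
  proof -
    have "a * a powr (s - 2) = a powr (s - 1)" using a by (simp add: powr_diff power2_eq_square)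
    then show ?thesis using a by (simp add: mult.assoc[symmetric] flip: ennreal_mult')
  qed
  finally show ?thesis by (simp only: Beta)
qed


context
  fixes s :: real
  assumes s: "-1 < s" "s < 0"
begin

text \<open>The Peano kernel of the trapezoidal rule on the interval from n to n + 1.\<close>

definition kappa :: "nat \<Rightarrow> real \<Rightarrow> real" where
  "kappa n v = (v - real n) * (real n + 1 - v) / 2"

lemma kappa_nonneg: "v \<in> {real n..real n + 1} \<Longrightarrow> kappa n v \<ge> 0"
  by (auto simp: kappa_def)

text \<open>Shifted by one against \<open>trapezoid_error\<close>, so that the interval from 0 to 1
  is included. For s in (- 1, 0) its term is 1 / 2 + 1 / (s - 1), exactly the elementary part in
  \<open>zeta_trapezoid\<close>, and the series sums to zeta s itself.\<close>

definition trapezoid_real :: "nat \<Rightarrow> real" where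
  "trapezoid_real n = (real n powr (- s) + (real n + 1) powr (- s)) / 2
     - ((real n + 1) powr (1 - s) - real n powr (1 - s)) / (1 - s)"

lemma has_integral_kappa_powr:
  "((\<lambda>v. kappa n v * v powr (- s - 2)) has_integral (trapezoid_real n / (s * (s + 1)))) {real n..real n + 1}"
proof -
  define \<Psi> where "\<Psi> = (\<lambda>v. (v - real n) * (real n + 1 - v) / 2 * (- s * v powr (- s - 1))
     - (real n + 1 / 2 - v) * v powr (- s) - v powr (1 - s) / (1 - s))"
  \<comment> \<open>For n = 0 the factor v powr (- s - 1) is unbounded at 0, but v times it is v
    powr (- s), which is continuous because s < 0.\<close>
  have cont1: "continuous_on {real n..real n + 1} (\<lambda>v. (v - real n) * (real n + 1 - v) / 2 * (- s * v powr (- s - 1)))"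
  proof (cases "n = 0")
    case True
    have "(v - real n) * (real n + 1 - v) / 2 * (- s * v powr (- s - 1)) = (real n + 1 - v) / 2 * (- s * v powr (- s))"
      if "v \<in> {real n..real n + 1}" for v
    proof (cases "v = 0")
      case False
      then have "v powr (- s) = v * v powr (- s - 1)" using that by (simp add: powr_diff)
      then show ?thesis using True by simp
    qed (use True in auto)
    moreover have "continuous_on {real n..real n + 1} (\<lambda>v. (real n + 1 - v) / 2 * (- s * v powr (- s)))"
      using s by (intro continuous_intros continuous_on_powr') auto
    ultimately show ?thesis by (subst continuous_on_cong[OF refl]) auto
  next
    case False
    then show ?thesis by (intro continuous_intros) auto
  qed
  have cont: "continuous_on {real n..real n + 1} \<Psi>"
    unfolding \<Psi>_def
    by (intro continuous_on_diff[OF continuous_on_diff[OF cont1]] continuous_intros continuous_on_powr')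
       (use s in auto)
  have der: "(\<Psi> has_vector_derivative s * (s + 1) * (kappa n v * v powr (- s - 2))) (at v)"
    if v: "v \<in> {real n<..<real n + 1}" for v
  proof -
    have v0: "v > 0" using v by (auto intro: le_less_trans[of 0 "real n"])
    have p: "v powr (- s - 1) = v * v powr (- s - 2)" "v powr (- s) = v ^ 2 * v powr (- s - 2)"
      using v0 by (simp_all add: powr_diff power2_eq_square)
    have d: "((\<lambda>v. v powr a) has_field_derivative a * v powr (a - 1)) (at v)" for a
      using has_real_derivative_powr[OF v0, of a] .
    have 1: "((\<lambda>v. (v - real n) * (real n + 1 - v) / 2) has_field_derivative (real n + 1 - v + (v - real n) * (-1)) / 2) (at v)"
      by (auto intro!: derivative_eq_intros)
    have 2: "((\<lambda>v. real n + 1 / 2 - v) has_field_derivative -1) (at v)"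
      by (auto intro!: derivative_eq_intros)
    note DERIV_diff[OF DERIV_diff[OF DERIV_mult[OF 1 DERIV_cmult[OF d[of "- s - 1"], of "-s"]] DERIV_mult[OF 2 d[of "- s"]]]
        DERIV_cdivide[OF d[of "1 - s"], of "1 - s"]]
    moreover have "((real n + 1 - v + (v - real n) * (-1)) / 2 * (- s * v powr (- s - 1)) +
        (- s * ((- s - 1) * v powr (- s - 1 - 1))) * ((v - real n) * (real n + 1 - v) / 2)) -
        ((-1) * v powr (- s) + (- s * v powr (- s - 1)) * (real n + 1 / 2 - v))
        - (1 - s) * v powr (1 - s - 1) / (1 - s) = s * (s + 1) * (kappa n v * v powr (- s - 2))"
    proof -
      have "- s - 1 - 1 = - s - 2" "1 - s - 1 = - s" by simp_all
      moreover have "1 - s \<noteq> 0" using s by simp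
      ultimately show ?thesis unfolding kappa_def by (simp add: p power2_eq_square field_simps)
    qed
    ultimately show ?thesis
      unfolding \<Psi>_def has_real_derivative_iff_has_vector_derivative[symmetric] by (simp only:)
  qed
  have "((\<lambda>v. s * (s + 1) * (kappa n v * v powr (- s - 2))) has_integral (\<Psi> (real n + 1) - \<Psi> (real n))) {real n..real n + 1}"
    by (rule fundamental_theorem_of_calculus_interior[OF _ cont der]) auto
  moreover have "\<Psi> (real n + 1) - \<Psi> (real n) = trapezoid_real n"
    unfolding \<Psi>_def trapezoid_real_def by (simp add: diff_divide_distrib algebra_simps)
  ultimately have "((\<lambda>v. s * (s + 1) * (kappa n v * v powr (- s - 2)) / (s * (s + 1))) has_integral
      (trapezoid_real n / (s * (s + 1)))) {real n..real n + 1}"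
    by (simp only: has_integral_divide)
  then show ?thesis using s by simp
qed

lemma trapezoid_real_sign: "trapezoid_real n / (s * (s + 1)) \<ge> 0"
  by (rule has_integral_nonneg[OF has_integral_kappa_powr]) (use kappa_nonneg in auto)

lemma nn_integral_kappa_powr:
  "(\<integral>\<^sup>+v. ennreal (kappa n v * v powr (- s - 2)) * indicator {real n..real n + 1} v \<partial>lborel)
     = ennreal (trapezoid_real n / (s * (s + 1)))"
proof -
  from nn_integral_has_integral_lebesgue[OF _ has_integral_kappa_powr]
  have "(\<integral>\<^sup>+v. ennreal (indicator {real n..real n + 1} v * (kappa n v * v powr (- s - 2))) \<partial>lborel)
     = ennreal (trapezoid_real n / (s * (s + 1)))"
    using kappa_nonneg by simp
  moreover have "ennreal (indicator {real n..real n + 1} v * (kappa n v * v powr (- s - 2))) =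
     ennreal (kappa n v * v powr (- s - 2)) * indicator {real n..real n + 1} v" for v
    by (auto simp: indicator_def)
  ultimately show ?thesis by simp
qed

lemma trapezoid_real_sums: "(\<lambda>n. of_real (trapezoid_real n)) sums zeta (of_real s)"
proof -
  have "trapezoid_error n (of_real s) = of_real (trapezoid_real (Suc n))" for n
  proof -
    have p: "complex_of_nat (Suc m) powr (of_real a) = of_real (real (Suc m) powr a)" for m a
      by (metis of_nat_0_le_iff of_real_of_nat_eq powr_of_real)
    have "1 - complex_of_real s = of_real (1 - s)" "- complex_of_real s = of_real (- s)" by simp_all
    then show ?thesis
      unfolding trapezoid_error_def trapezoid_real_def by (simp only: p) (simp add: add_ac)
  qed
  then have "(\<lambda>n. of_real (trapezoid_real (Suc n))) sums (zeta (of_real s) - 1 / 2 - 1 / (of_real s - 1))"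
    using zeta_trapezoid[of "of_real s"] s by auto
  then have "(\<lambda>n. of_real (trapezoid_real n)) sums (zeta (of_real s) - 1 / 2 - 1 / (of_real s - 1) + of_real (trapezoid_real 0))"
    by (rule sums_Suc)
  moreover have "of_real (trapezoid_real 0) = 1 / 2 + 1 / (of_real s - 1 :: complex)"
  proof -
    have "1 / (s - 1) = - (1 / (1 - s))" using s by (simp add: field_simps)
    then have "trapezoid_real 0 = 1 / 2 + 1 / (s - 1)"
      using s by (simp add: trapezoid_real_def)
    then show ?thesis by simp
  qed
  ultimately show ?thesis by simp
qed

lemma nn_integral_kappa_exp:
  assumes x: "x > 0"
  shows "(\<integral>\<^sup>+v. ennreal (kappa n v * exp (- v * x)) * indicator {real n..real n + 1} v \<partial>lborel)
     = ennreal (exp (- real n * x) * (((1 + exp (- x)) / 2 - (1 - exp (- x)) / x) / x ^ 2))"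
proof -
  define F where "F = (\<lambda>v. - exp (- v * x) * (kappa n v / x + (real n + 1 / 2 - v) / x ^ 2 - 1 / x ^ 3))"
  have "(\<integral>\<^sup>+v. ennreal (kappa n v * exp (- v * x)) * indicator {real n..real n + 1} v \<partial>lborel) = F (real n + 1) - F (real n)"
  proof (rule nn_integral_FTC_Icc)
    show "(\<lambda>v. kappa n v * exp (- v * x)) \<in> borel_measurable borel" by (simp add: kappa_def[abs_def])
    show "(F has_real_derivative kappa n v * exp (- v * x)) (at v)" for v
      unfolding F_def kappa_def using x
      by (auto intro!: derivative_eq_intros simp: field_simps power2_eq_square power3_eq_cube)
  qed (use kappa_nonneg in auto)
  also have "F (real n + 1) - F (real n) = exp (- real n * x) * (((1 + exp (- x)) / 2 - (1 - exp (- x)) / x) / x ^ 2)"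
  proof -
    have e: "exp (- (real n + 1) * x) = exp (- real n * x) * exp (- x)"
      by (simp add: algebra_simps flip: exp_add)
    have "exp (- real n * x) * (((1 + exp (- x)) / 2 - (1 - exp (- x)) / x) / x ^ 2) =
      - (exp (- real n * x) * exp (- x)) * (0 + (- 1 / 2) / x ^ 2 - 1 / x ^ 3) +
       exp (- real n * x) * (0 + (1 / 2) / x ^ 2 - 1 / x ^ 3)"
      using x by (simp add: field_simps power2_eq_square power3_eq_cube)
    then show ?thesis unfolding F_def e kappa_def by simp
  qed
  finally show ?thesis .
qed

lemma zeta_Gamma_nn_integral:
  "(\<Sum>n. ennreal (Gamma (s + 2)) * ennreal (trapezoid_real n / (s * (s + 1)))) =
   (\<integral>\<^sup>+x. ennreal (x powr (s - 1) * ((1 + exp (- x)) / (1 - exp (- x)) / 2 - 1 / x)) * indicator {0<..} x \<partial>lborel)"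
proof -
  define c where "c = (\<lambda>x. ((1 + exp (- x)) / 2 - (1 - exp (- x)) / x) / x ^ 2 :: real)"
  \<comment> \<open>Nonnegativity comes from the partial fractions of coth, whose terms are all
    positive.\<close>
  have c0: "c x \<ge> 0" if x: "x > 0" for x
  proof -
    have "(1 + exp (- x)) / (1 - exp (- x)) / 2 - 1 / x \<ge> 0"
      using x by (intro sums_le[OF _ sums_zero coth_partial_fractions]) auto
    then have "0 \<le> (1 - exp (- x)) * ((1 + exp (- x)) / (1 - exp (- x)) / 2 - 1 / x)"
      using x by (intro mult_nonneg_nonneg) auto
    also have "\<dots> = (1 + exp (- x)) / 2 - (1 - exp (- x)) / x"
    proof -
      have "D * (a / D / 2 - 1 / x) = a / 2 - D / x" if "D \<noteq> 0" for D a :: real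
        using that by (simp add: right_diff_distrib)
      then show ?thesis using x by (metis diff_gt_0_iff_gt exp_less_one_iff less_irrefl neg_less_0_iff_less)
    qed
    finally show ?thesis by (simp add: c_def)
  qed
  have step: "ennreal (Gamma (s + 2)) * ennreal (trapezoid_real n / (s * (s + 1))) =
     (\<integral>\<^sup>+x. ennreal (x powr (s + 1) * (exp (- real n * x) * c x)) * indicator {0<..} x \<partial>lborel)" for n
  proof -
    define I where "I = {real n..real n + 1}"
    have "ennreal (Gamma (s + 2)) * ennreal (trapezoid_real n / (s * (s + 1))) =
       (\<integral>\<^sup>+v. ennreal (Gamma (s + 2)) * (ennreal (kappa n v * v powr (- s - 2)) * indicator I v) \<partial>lborel)"
      unfolding I_def nn_integral_kappa_powr[symmetric]
      by (rule nn_integral_cmult[symmetric]) (simp add: kappa_def[abs_def])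
    also have "\<dots> = (\<integral>\<^sup>+v. (\<integral>\<^sup>+x. ennreal (kappa n v) * indicator I v *
         (ennreal (x powr (s + 1) * exp (- v * x)) * indicator {0<..} x) \<partial>lborel) \<partial>lborel)"
    proof (rule nn_integral_cong)
      fix v :: real
      have "(\<integral>\<^sup>+x. ennreal (kappa n v) * indicator I v *
         (ennreal (x powr (s + 1) * exp (- v * x)) * indicator {0<..} x) \<partial>lborel) =
         ennreal (kappa n v) * indicator I v * (\<integral>\<^sup>+x. (ennreal (x powr (s + 1) * exp (- v * x)) * indicator {0<..} x) \<partial>lborel)"
        by (rule nn_integral_cmult) simp
      also have "\<dots> = ennreal (Gamma (s + 2)) * (ennreal (kappa n v * v powr (- s - 2)) * indicator I v)"
      proof (cases "v \<in> I \<and> v \<noteq> 0")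
        case True
        then have "v > 0" "kappa n v \<ge> 0" using kappa_nonneg[of v n] by (auto simp: I_def)
        moreover have e: "s + 2 - 1 = s + 1" "- (s + 2) = - s - 2" by simp_all
        moreover have "Gamma (s + 2) > 0" using s by (intro Gamma_real_pos) auto
        moreover have "(\<integral>\<^sup>+x. (ennreal (x powr (s + 1) * exp (- v * x)) * indicator {0<..} x) \<partial>lborel)
           = ennreal (Gamma (s + 2) * v powr (- s - 2))"
          using nn_integral_powr_exp[of "s + 2" v, unfolded e] s \<open>v > 0\<close> by simp
        ultimately show ?thesis using True
          by (simp only: mult_ac ennreal_mult'[symmetric] less_imp_le indicator_eq_1_iff mult_1_right mult_1_left)
      next
        case False
        then have "v \<in> I \<Longrightarrow> kappa n v = 0" by (auto simp: I_def kappa_def)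
        then show ?thesis by (cases "v \<in> I") auto
      qed
      finally show "ennreal (Gamma (s + 2)) * (ennreal (kappa n v * v powr (- s - 2)) * indicator I v) =
         (\<integral>\<^sup>+x. ennreal (kappa n v) * indicator I v *
         (ennreal (x powr (s + 1) * exp (- v * x)) * indicator {0<..} x) \<partial>lborel)" by simp
    qed
    also have "\<dots> = (\<integral>\<^sup>+x. (\<integral>\<^sup>+v. ennreal (kappa n v) * indicator I v *
         (ennreal (x powr (s + 1) * exp (- v * x)) * indicator {0<..} x) \<partial>lborel) \<partial>lborel)"
      by (rule lborel_pair.Fubini') (simp add: kappa_def[abs_def] I_def case_prod_unfold)
    also have "\<dots> = (\<integral>\<^sup>+x. ennreal (x powr (s + 1) * (exp (- real n * x) * c x)) * indicator {0<..} x \<partial>lborel)"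
    proof (rule nn_integral_cong)
      fix x :: real
      show "(\<integral>\<^sup>+v. ennreal (kappa n v) * indicator I v *
         (ennreal (x powr (s + 1) * exp (- v * x)) * indicator {0<..} x) \<partial>lborel) =
         ennreal (x powr (s + 1) * (exp (- real n * x) * c x)) * indicator {0<..} x"
      proof (cases "x > 0")
        case True
        have "(\<integral>\<^sup>+v. ennreal (kappa n v) * indicator I v *
           (ennreal (x powr (s + 1) * exp (- v * x)) * indicator {0<..} x) \<partial>lborel) =
          (\<integral>\<^sup>+v. ennreal (x powr (s + 1)) * (ennreal (kappa n v * exp (- v * x)) * indicator I v) \<partial>lborel)"
        proof (rule nn_integral_cong)
          fix v :: real
          show "ennreal (kappa n v) * indicator I v * (ennreal (x powr (s + 1) * exp (- v * x)) * indicator {0<..} x) =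
             ennreal (x powr (s + 1)) * (ennreal (kappa n v * exp (- v * x)) * indicator I v)"
            using True kappa_nonneg[of v n] by (cases "v \<in> I") (auto simp: I_def mult_ac simp flip: ennreal_mult')
        qed
        also have "\<dots> = ennreal (x powr (s + 1)) * (\<integral>\<^sup>+v. (ennreal (kappa n v * exp (- v * x)) * indicator I v) \<partial>lborel)"
          by (rule nn_integral_cmult) (simp add: kappa_def[abs_def] I_def)
        also have "\<dots> = ennreal (x powr (s + 1) * (exp (- real n * x) * c x))"
          unfolding I_def nn_integral_kappa_exp[OF True] c_def by (simp flip: ennreal_mult')
        finally show ?thesis using True by simp
      qed auto
    qed
    finally show ?thesis .
  qed
  have "(\<Sum>n. ennreal (Gamma (s + 2)) * ennreal (trapezoid_real n / (s * (s + 1)))) =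
    (\<integral>\<^sup>+x. (\<Sum>n. ennreal (x powr (s + 1) * (exp (- real n * x) * c x)) * indicator {0<..} x) \<partial>lborel)"
    unfolding step by (rule nn_integral_suminf[symmetric]) (simp add: c_def)
  also have "\<dots> = (\<integral>\<^sup>+x. ennreal (x powr (s - 1) * ((1 + exp (- x)) / (1 - exp (- x)) / 2 - 1 / x)) * indicator {0<..} x \<partial>lborel)"
  proof (rule nn_integral_cong)
    fix x :: real
    show "(\<Sum>n. ennreal (x powr (s + 1) * (exp (- real n * x) * c x)) * indicator {0<..} x) =
       ennreal (x powr (s - 1) * ((1 + exp (- x)) / (1 - exp (- x)) / 2 - 1 / x)) * indicator {0<..} x"
    proof (cases "x > 0")
      case True
      have "(\<lambda>n. exp (- x) ^ n) sums (1 / (1 - exp (- x)))"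
        using True by (intro geometric_sums) auto
      moreover have "exp (- x) ^ n = exp (- real n * x)" for n
        by (simp flip: exp_of_nat_mult)
      ultimately have "(\<lambda>n. exp (- real n * x)) sums (1 / (1 - exp (- x)))" by simp
      then have "(\<lambda>n. x powr (s + 1) * (exp (- real n * x) * c x)) sums (x powr (s + 1) * (1 / (1 - exp (- x)) * c x))"
        by (intro sums_mult sums_mult2)
      moreover have "x powr (s + 1) * (1 / (1 - exp (- x)) * c x) =
         x powr (s - 1) * ((1 + exp (- x)) / (1 - exp (- x)) / 2 - 1 / x)"
      proof -
        define e where "e = 1 - exp (- x)"
        have e: "e \<noteq> 0" using True by (simp add: e_def)
        have 1: "x powr (s + 1) = x powr (s - 1) * x ^ 2" using True by (simp add: powr_add powr_diff power2_eq_square)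
        have 2: "x ^ 2 * (1 / e * (((2 - e) / 2 - e / x) / x ^ 2)) = (2 - e) / e / 2 - 1 / x"
          using e True by (simp add: field_simps power2_eq_square)
        have 3: "1 + exp (- x) = 2 - e" by (simp add: e_def)
        show ?thesis unfolding c_def e_def[symmetric] 1 3 by (simp only: mult.assoc 2)
      qed
      ultimately have "(\<lambda>n. x powr (s + 1) * (exp (- real n * x) * c x)) sums
         (x powr (s - 1) * ((1 + exp (- x)) / (1 - exp (- x)) / 2 - 1 / x))" by simp
      then have "(\<Sum>n. ennreal (x powr (s + 1) * (exp (- real n * x) * c x))) =
         ennreal (x powr (s - 1) * ((1 + exp (- x)) / (1 - exp (- x)) / 2 - 1 / x))"
        by (intro suminf_ennreal_eq) (use c0[OF True] in auto)
      then show ?thesis using True by simp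
    qed auto
  qed
  finally show ?thesis .
qed

lemma functional_equation_real_aux:
  "(\<integral>\<^sup>+x. ennreal (x powr (s - 1) * ((1 + exp (- x)) / (1 - exp (- x)) / 2 - 1 / x)) * indicator {0<..} x \<partial>lborel)
    = (\<Sum>n. ennreal ((2 * pi * real (Suc n)) powr (s - 1) * (pi / cos (pi * s / 2))))"
proof -
  have "(\<integral>\<^sup>+x. ennreal (x powr (s - 1) * ((1 + exp (- x)) / (1 - exp (- x)) / 2 - 1 / x)) * indicator {0<..} x \<partial>lborel)
    = (\<integral>\<^sup>+x. (\<Sum>n. ennreal (2 * x powr s / (x ^ 2 + (2 * pi * real (Suc n)) ^ 2)) * indicator {0<..} x) \<partial>lborel)"
  proof (rule nn_integral_cong)
    fix x :: real
    show "ennreal (x powr (s - 1) * ((1 + exp (- x)) / (1 - exp (- x)) / 2 - 1 / x)) * indicator {0<..} x =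
      (\<Sum>n. ennreal (2 * x powr s / (x ^ 2 + (2 * pi * real (Suc n)) ^ 2)) * indicator {0<..} x)"
    proof (cases "x > 0")
      case True
      have "(\<lambda>n. x powr (s - 1) * (2 * x / (x ^ 2 + (2 * pi * real (Suc n)) ^ 2))) sums
          (x powr (s - 1) * ((1 + exp (- x)) / (1 - exp (- x)) / 2 - 1 / x))"
        by (intro sums_mult coth_partial_fractions True)
      moreover have "x powr (s - 1) * (2 * x / (x ^ 2 + (2 * pi * real (Suc n)) ^ 2)) =
         2 * x powr s / (x ^ 2 + (2 * pi * real (Suc n)) ^ 2)" for n
      proof -
        have "x powr s = x powr (s - 1) * x" using True by (simp add: powr_diff)
        then show ?thesis by simp
      qed
      ultimately have "(\<lambda>n. 2 * x powr s / (x ^ 2 + (2 * pi * real (Suc n)) ^ 2)) sums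
          (x powr (s - 1) * ((1 + exp (- x)) / (1 - exp (- x)) / 2 - 1 / x))" by (simp only:)
      then have "(\<Sum>n. ennreal (2 * x powr s / (x ^ 2 + (2 * pi * real (Suc n)) ^ 2))) =
         ennreal (x powr (s - 1) * ((1 + exp (- x)) / (1 - exp (- x)) / 2 - 1 / x))"
        by (intro suminf_ennreal_eq) auto
      then show ?thesis using True by simp
    qed auto
  qed
  also have "\<dots> = (\<Sum>n. \<integral>\<^sup>+x. ennreal (2 * x powr s / (x ^ 2 + (2 * pi * real (Suc n)) ^ 2)) * indicator {0<..} x \<partial>lborel)"
    by (rule nn_integral_suminf) simp
  also have "\<dots> = (\<Sum>n. ennreal ((2 * pi * real (Suc n)) powr (s - 1) * (pi / cos (pi * s / 2))))"
  proof -
    have "2 * pi * real (Suc n) > 0" for n by simp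
    then show ?thesis by (simp only: nn_integral_powr_over_quadratic[OF s])
  qed
  finally show ?thesis .
qed

text \<open>Two series of nonnegative terms agree as extended reals; since both sums are
  nonnegative, they agree as reals. The relation Gamma (s + 2) = s * (s + 1) * Gamma s then removes
  the negative factor s * (s + 1).\<close>

lemma functional_equation_real:
  "zeta (of_real s) * of_real (Gamma s) =
   of_real ((2 * pi) powr (s - 1) * (pi / cos (pi * s / 2))) * zeta (of_real (1 - s))"
proof -
  have ss: "s * (s + 1) < 0" using s by (simp add: mult_less_0_iff)
  have cos: "cos (pi * s / 2) > 0"
  proof (rule cos_gt_zero_pi)
    show "- (pi / 2) < pi * s / 2" using mult_strict_left_mono[OF s(1) pi_gt_zero] by simp
    show "pi * s / 2 < pi / 2" using mult_strict_left_mono[OF s(2) pi_gt_zero] pi_gt_zero by linarith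
  qed
  have G2: "Gamma (s + 2) = s * (s + 1) * Gamma s"
  proof -
    have "s \<notin> \<int>\<^sub>\<le>\<^sub>0" "s + 1 \<notin> \<int>\<^sub>\<le>\<^sub>0" using s by (auto elim!: nonpos_Ints_cases)
    then have "Gamma (s + 1 + 1) = (s + 1) * (s * Gamma s)"
      using Gamma_plus1[of "s + 1"] Gamma_plus1[of s] by metis
    moreover have "s + 1 + 1 = s + 2" by simp
    ultimately show ?thesis by (simp only: mult_ac)
  qed
  have G2pos: "Gamma (s + 2) > 0" using s by (intro Gamma_real_pos) auto
  define Z where "Z = Re (zeta (of_real s))"
  define Z' where "Z' = Re (zeta (of_real (1 - s)))"
  have real: "zeta (of_real x) = of_real (Re (zeta (of_real x)))" for x
    using zeta_cnj[of "of_real x"] by (simp add: complex_eq_iff)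
  have tr: "trapezoid_real sums Z"
    using sums_Re[OF trapezoid_real_sums] by (simp add: Z_def)
  note tr0 = trapezoid_real_sign
  have nn: "0 \<le> Gamma (s + 2) * (trapezoid_real n / (s * (s + 1)))" for n
    using tr0[of n] G2pos by (intro mult_nonneg_nonneg) auto
  have L: "(\<lambda>n. Gamma (s + 2) * (trapezoid_real n / (s * (s + 1)))) sums (Gamma (s + 2) * (Z / (s * (s + 1))))"
    by (intro sums_mult sums_divide tr)
  have "Re (1 - complex_of_real s) > 1" using s by simp
  from zeta_sums[OF this] have "(\<lambda>n. Re (1 / of_nat (Suc n) powr (1 - of_real s))) sums Z'"
    unfolding Z'_def by (intro sums_Re) simp
  moreover have "Re (1 / of_nat (Suc n) powr (1 - of_real s)) = real (Suc n) powr (s - 1)" for n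
  proof -
    have "complex_of_nat (Suc n) powr (of_real (1 - s)) = of_real (real (Suc n) powr (1 - s))"
      by (metis of_nat_0_le_iff of_real_of_nat_eq powr_of_real)
    moreover have "of_real (1 - s) = 1 - complex_of_real s" by simp
    ultimately have "1 / of_nat (Suc n) powr (1 - complex_of_real s) = of_real (1 / real (Suc n) powr (1 - s))"
      by simp
    then show ?thesis using powr_minus_divide[of "real (Suc n)" "1 - s"] by simp
  qed
  ultimately have "(\<lambda>n. real (Suc n) powr (s - 1)) sums Z'" by simp
  then have R: "(\<lambda>n. (2 * pi) powr (s - 1) * (real (Suc n) powr (s - 1) * (pi / cos (pi * s / 2)))) sums
     ((2 * pi) powr (s - 1) * (Z' * (pi / cos (pi * s / 2))))"
    by (intro sums_mult sums_mult2)
  have "ennreal (Gamma (s + 2) * (Z / (s * (s + 1)))) = (\<Sum>n. ennreal (Gamma (s + 2) * (trapezoid_real n / (s * (s + 1)))))"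
    by (intro suminf_ennreal_eq[symmetric] L nn)
  also have "\<dots> = (\<Sum>n. ennreal (Gamma (s + 2)) * ennreal (trapezoid_real n / (s * (s + 1))))"
    by (simp only: ennreal_mult'[OF less_imp_le[OF G2pos]])
  also have "\<dots> = (\<Sum>n. ennreal ((2 * pi * real (Suc n)) powr (s - 1) * (pi / cos (pi * s / 2))))"
    unfolding zeta_Gamma_nn_integral functional_equation_real_aux ..
  also have "\<dots> = (\<Sum>n. ennreal ((2 * pi) powr (s - 1) * (real (Suc n) powr (s - 1) * (pi / cos (pi * s / 2)))))"
    by (simp add: powr_mult mult.assoc del: of_nat_Suc)
  also have "\<dots> = ennreal ((2 * pi) powr (s - 1) * (Z' * (pi / cos (pi * s / 2))))"
    using cos by (intro suminf_ennreal_eq R) auto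
  finally have "Gamma (s + 2) * (Z / (s * (s + 1))) = (2 * pi) powr (s - 1) * (Z' * (pi / cos (pi * s / 2)))"
  proof (rule ennreal_inj[THEN iffD1, rotated 2])
    show "0 \<le> Gamma (s + 2) * (Z / (s * (s + 1)))"
      by (rule sums_le[OF _ sums_zero L]) (rule nn)
    show "0 \<le> (2 * pi) powr (s - 1) * (Z' * (pi / cos (pi * s / 2)))"
      using cos by (intro sums_le[OF _ sums_zero R]) auto
  qed
  moreover have "Gamma (s + 2) * (Z / (s * (s + 1))) = Z * Gamma s"
  proof -
    have "p * G * (Z / p) = Z * G" if "p \<noteq> 0" for p G :: real using that by simp
    then show ?thesis unfolding G2 using ss by (metis less_irrefl)
  qed
  ultimately have "Z * Gamma s = (2 * pi) powr (s - 1) * (pi / cos (pi * s / 2)) * Z'"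
    by (simp only: mult_ac)
  then have "complex_of_real (Z * Gamma s) = of_real ((2 * pi) powr (s - 1) * (pi / cos (pi * s / 2)) * Z')"
    by (rule arg_cong)
  then show ?thesis
    using real[of s, folded Z_def] real[of "1 - s", folded Z'_def] by (simp only: of_real_mult)
qed

end

section \<open>The functional equation in the complex plane\<close>

definition chi :: "complex \<Rightarrow> complex" where
  "chi s = 2 * of_real (2 * pi) powr (s - 1) * sin (of_real pi * s / 2) * Gamma (1 - s)"

definition chi_logderiv :: "complex \<Rightarrow> complex" where
  "chi_logderiv s = of_real (ln (2 * pi)) + of_real (pi / 2) * cot (of_real pi * s / 2) - Digamma (1 - s)"

text \<open>The cut removes the pole of zeta at 1, that of zeta (1 - s) at 0 and the poles of Gamma
  (1 - s), and it leaves a connected set.\<close>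

abbreviation slit_plane :: "complex set" where
  "slit_plane \<equiv> - (complex_of_real ` {0..})"

lemma slit_plane_iff: "s \<in> slit_plane \<longleftrightarrow> Im s \<noteq> 0 \<or> Re s < 0"
proof -
  have "s \<in> complex_of_real ` {0..} \<longleftrightarrow> Im s = 0 \<and> Re s \<ge> 0"
    by (auto simp: complex_eq_iff image_iff intro!: exI[of _ "Re s"] bexI[of _ "Re s"])
  then show ?thesis by auto
qed

lemma open_slit_plane: "open slit_plane"
proof -
  have "slit_plane = {s. Im s \<noteq> 0 \<or> Re s < 0}" using slit_plane_iff by blast
  moreover have "open {s. Im s \<noteq> 0 \<or> Re s < 0}"
    by (intro open_Collect_disj open_Collect_neq open_Collect_less continuous_intros)
  ultimately show ?thesis by simp
qed

lemma one_minus_slit_plane: "s \<in> slit_plane \<Longrightarrow> 1 - s \<notin> \<int>\<^sub>\<le>\<^sub>0" "s \<in> slit_plane \<Longrightarrow> 1 - s \<notin> \<real>\<^sub>\<le>\<^sub>0"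
proof -
  assume "s \<in> slit_plane"
  then have "Im s \<noteq> 0 \<or> Re s < 0" using slit_plane_iff by blast
  then show "1 - s \<notin> \<real>\<^sub>\<le>\<^sub>0" by (auto simp: complex_nonpos_Reals_iff)
  then show "1 - s \<notin> \<int>\<^sub>\<le>\<^sub>0" using nonpos_Ints_subset_nonpos_Reals by blast
qed

text \<open>By the identity theorem the real interval (- 1, 0) suffices.\<close>

lemma zeta_functional_equation:
  assumes "s \<in> slit_plane"
  shows "zeta s = chi s * zeta (1 - s)"
proof -
  define h where "h = (\<lambda>s. zeta s - chi s * zeta (1 - s))"
  define U where "U = complex_of_real ` {-1<..<0}"
  have ne: "1 \<notin> slit_plane" "0 \<notin> slit_plane" by (auto simp: slit_plane_iff)
  have "zeta holomorphic_on slit_plane"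
    by (rule holomorphic_on_subset[OF zeta_holomorphic]) (use ne in auto)
  moreover have "(\<lambda>s. zeta (1 - s)) holomorphic_on slit_plane"
    by (rule holomorphic_on_compose_gen[of "\<lambda>s. 1 - s" _ zeta "-{1}", unfolded o_def])
       (use zeta_holomorphic ne in \<open>auto intro!: holomorphic_intros\<close>)
  moreover have "chi holomorphic_on slit_plane"
    unfolding chi_def using one_minus_slit_plane by (intro holomorphic_intros) auto
  ultimately have "h holomorphic_on slit_plane"
    unfolding h_def by (intro holomorphic_intros)
  moreover have "connected slit_plane"
    by (intro starlike_imp_connected starlike_slotted_complex_plane_right)
  moreover have "U \<subseteq> slit_plane" by (auto simp: U_def slit_plane_iff)
  moreover have "complex_of_real (-1/2) \<in> slit_plane" unfolding slit_plane_iff by simp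
  moreover have "complex_of_real (-1/2) islimpt U"
  proof -
    have "(-1/2 :: real) islimpt {-1<..<0}" by (simp add: islimpt_greaterThanLessThan1 open_imp_islimpt)
    moreover have "complex_of_real a islimpt complex_of_real ` S" if "a islimpt S" for a S
      using that by (intro islimpt_isCont_image) (auto simp: eventually_at_filter)
    ultimately show ?thesis unfolding U_def by blast
  qed
  moreover have "h z = 0" if zU: "z \<in> U" for z
  proof -
    obtain x where x: "z = of_real x" "-1 < x" "x < 0" using zU by (auto simp: U_def)
    define S C where "S = sin (pi * x / 2)" and "C = cos (pi * x / 2)"
    have xi: "x \<notin> \<int>" using x by (auto elim!: Ints_cases)
    have sc: "sin (pi * x) = 2 * S * C"
      unfolding S_def C_def using sin_double[of "pi * x / 2"] by simp
    have "sin (pi * x) \<noteq> 0" using xi by (simp add: sin_zero_iff_int2 mult.commute) (metis Ints_of_int)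
    then have SC: "S \<noteq> 0" "C \<noteq> 0" using sc by auto
    have refl: "Gamma x * Gamma (1 - x) = pi / (2 * S * C)"
    proof -
      have "complex_of_real (Gamma x * Gamma (1 - x)) = of_real (pi / sin (pi * x))"
        using Gamma_reflection_complex[of "of_real x"]
        by (simp add: Gamma_complex_of_real[symmetric] flip: sin_of_real)
      then show ?thesis unfolding sc by (simp only: of_real_eq_iff)
    qed
    have G: "Gamma x \<noteq> 0" using xi by (simp add: Gamma_eq_zero_iff) (use nonpos_Ints_subset_Ints in blast)
    have "zeta (of_real x) * of_real (Gamma x) =
       of_real ((2 * pi) powr (x - 1) * (pi / C)) * zeta (of_real (1 - x))"
      using functional_equation_real[OF x(2,3)] by (simp add: C_def)
    also have "pi / C = 2 * S * (Gamma x * Gamma (1 - x))" using SC by (simp add: refl)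
    finally have "of_real (Gamma x) * zeta (of_real x) =
       of_real (Gamma x) * (of_real ((2 * pi) powr (x - 1) * (2 * S * Gamma (1 - x))) * zeta (of_real (1 - x)))"
      by (simp only: of_real_mult mult_ac)
    then have "zeta (of_real x) = of_real ((2 * pi) powr (x - 1) * (2 * S * Gamma (1 - x))) * zeta (of_real (1 - x))"
      using G by (simp only: mult_cancel_left of_real_eq_0_iff) simp
    also have "of_real ((2 * pi) powr (x - 1) * (2 * S * Gamma (1 - x))) = chi (of_real x)"
    proof -
      have "complex_of_real (2 * pi) powr (of_real x - 1) = of_real ((2 * pi) powr (x - 1))"
        using powr_of_real[of "2 * pi" "x - 1"] by simp
      moreover have "sin (of_real pi * of_real x / 2) = complex_of_real S"
        unfolding S_def by (simp flip: sin_of_real)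
      moreover have "Gamma (1 - of_real x) = complex_of_real (Gamma (1 - x))"
        by (simp flip: Gamma_complex_of_real)
      ultimately show ?thesis unfolding chi_def by simp
    qed
    finally show "h z = 0" by (simp add: h_def x)
  qed
  ultimately have "h s = 0"
    using analytic_continuation[OF _ open_slit_plane, of h U "complex_of_real (-1/2)" s] assms by blast
  then show ?thesis by (simp add: h_def)
qed

lemma chi_has_derivative:
  assumes "s \<in> slit_plane" "sin (of_real pi * s / 2) \<noteq> 0"
  shows "(chi has_field_derivative chi s * chi_logderiv s) (at s)"
proof -
  note g = one_minus_slit_plane(1)[OF assms(1)]
  have 1: "((\<lambda>s. of_real (2 * pi) powr (s - 1)) has_field_derivative
     of_real (2 * pi) powr (s - 1) * of_real (ln (2 * pi))) (at s)"
  proof -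
    define c where "c = complex_of_real (2 * pi)"
    have "c \<noteq> 0" "Ln c = of_real (ln (2 * pi))" by (simp_all add: c_def Ln_of_real del: of_real_mult)
    moreover have "((\<lambda>s. c powr (s - 1)) has_field_derivative c powr (s - 1) * Ln c) (at s)"
    proof -
      have "((\<lambda>s. s - 1) has_field_derivative 1) (at s)" by (auto intro!: derivative_eq_intros)
      from DERIV_chain2[OF has_field_derivative_powr_right[OF \<open>c \<noteq> 0\<close>] this]
      show ?thesis by (simp add: mult.commute)
    qed
    ultimately show ?thesis by (simp only: c_def)
  qed
  have 2: "((\<lambda>s. sin (of_real pi * s / 2)) has_field_derivative
      cos (of_real pi * s / 2) * (of_real pi / 2)) (at s)"
    by (auto intro!: derivative_eq_intros)
  have 3: "((\<lambda>s. Gamma (1 - s)) has_field_derivative - (Gamma (1 - s) * Digamma (1 - s))) (at s)"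
    using g by (auto intro!: derivative_eq_intros)
  have "(chi has_field_derivative
     (2 * (of_real (2 * pi) powr (s - 1) * of_real (ln (2 * pi))) * sin (of_real pi * s / 2)
        + cos (of_real pi * s / 2) * (of_real pi / 2) * (2 * of_real (2 * pi) powr (s - 1))) * Gamma (1 - s)
     + (- (Gamma (1 - s) * Digamma (1 - s))) * (2 * of_real (2 * pi) powr (s - 1) * sin (of_real pi * s / 2))) (at s)"
    unfolding chi_def by (rule DERIV_mult[OF DERIV_mult[OF DERIV_cmult[OF 1] 2] 3])
  then show ?thesis
    by (rule DERIV_cong) (use assms(2) in \<open>simp add: chi_def chi_logderiv_def cot_def field_simps\<close>)
qed

lemma chi_nonzero:
  assumes "s \<in> slit_plane" "sin (of_real pi * s / 2) \<noteq> 0"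
  shows "chi s \<noteq> 0"
  using assms one_minus_slit_plane(1)[OF assms(1)] by (auto simp: chi_def Gamma_eq_zero_iff)

lemma sin_pi_half_nonzero: "Im s \<noteq> 0 \<Longrightarrow> sin (of_real pi * s / 2) \<noteq> 0"
proof
  assume "Im s \<noteq> 0" "sin (of_real pi * s / 2) = 0"
  then obtain n :: int where "of_real pi * s / 2 = of_real (of_int n * pi)" by (auto simp: sin_eq_0)
  then have "Im (of_real pi * s / 2) = 0" by (metis Im_complex_of_real)
  then show False using \<open>Im s \<noteq> 0\<close> by simp
qed

section \<open>Asymptotics of the logarithmic derivative of chi\<close>

text \<open>The remainder has derivative z^2 / (1 + z), which is at most 2 * cmod z ^ 2 for cmod z
  <= 1/2.\<close>

lemma Ln_one_plus_cubic:
  fixes w :: complex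
  assumes "cmod w \<le> 1 / 2"
  shows "cmod (Ln (1 + w) - w + w ^ 2 / 2) \<le> 2 * cmod w ^ 3"
proof -
  define f where "f = (\<lambda>w::complex. Ln (1 + w) - w + w ^ 2 / 2)"
  have "cmod (f w - f 0) \<le> 2 * cmod w ^ 2 * cmod (w - 0)"
  proof (rule field_differentiable_bound[where S = "cball 0 (cmod w)"])
    fix z :: complex assume z: "z \<in> cball 0 (cmod w)"
    then have z1: "cmod z \<le> cmod w" by simp
    have re: "Re (1 + z) \<ge> 1 / 2" using abs_Re_le_cmod[of z] z1 assms by simp
    then have nz: "1 + z \<noteq> 0" "1 + z \<notin> \<real>\<^sub>\<le>\<^sub>0" by (auto simp: complex_nonpos_Reals_iff complex_eq_iff)
    show "(f has_field_derivative z ^ 2 / (1 + z)) (at z within cball 0 (cmod w))"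
    proof -
      have "(f has_field_derivative 1 / (1 + z) - 1 + z) (at z within cball 0 (cmod w))"
        unfolding f_def using nz by (auto intro!: derivative_eq_intros simp: inverse_eq_divide)
      moreover have "1 / (1 + z) - 1 + z = z ^ 2 / (1 + z)"
        using nz by (simp add: divide_simps) (simp add: power2_eq_square algebra_simps)
      ultimately show ?thesis by simp
    qed
    have "cmod (1 + z) \<ge> 1 / 2" using re complex_Re_le_cmod[of "1 + z"] by linarith
    then have "cmod (z ^ 2 / (1 + z)) \<le> cmod z ^ 2 / (1 / 2)"
      unfolding norm_divide norm_power by (intro divide_left_mono) (use nz in auto)
    also have "\<dots> \<le> 2 * cmod w ^ 2" using z1 power_mono[OF z1, of 2] by simp
    finally show "cmod (z ^ 2 / (1 + z)) \<le> 2 * cmod w ^ 2" .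
  qed auto
  then show ?thesis by (simp add: f_def power2_eq_square power3_eq_cube)
qed

text \<open>The error E z satisfies E z - E (z + 1) = O(1 / |z|^3) and tends to 0 along z + n.\<close>

lemma Digamma_asymptotic:
  fixes z :: complex
  assumes "Re z \<ge> 0" "cmod z \<ge> 2"
  shows "cmod (Digamma z - Ln z + 1 / (2 * z)) \<le> 18 / cmod z ^ 2"
proof -
  define r where "r = cmod z"
  have r: "r \<ge> 2" using assms by (simp add: r_def)
  have z0: "z \<noteq> 0" using assms by auto
  define E where "E = (\<lambda>z::complex. Digamma z - Ln z + 1 / (2 * z))"
  define zn where "zn = (\<lambda>n. z + of_nat n)"
  have zn_Re: "Re (zn n) = Re z + real n" "Im (zn n) = Im z" for n by (simp_all add: zn_def)
  have nsq: "cmod (zn n) ^ 2 \<ge> r ^ 2 + real n ^ 2" for n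
  proof -
    have "cmod (zn n) ^ 2 = (Re z + real n) ^ 2 + Im z ^ 2" by (simp add: cmod_power2 zn_Re)
    also have "\<dots> \<ge> Re z ^ 2 + real n ^ 2 + Im z ^ 2"
      using assms by (simp add: power2_eq_square algebra_simps)
    finally show ?thesis by (simp add: r_def cmod_power2)
  qed
  have rn: "r + real n \<le> sqrt 2 * cmod (zn n)" for n
  proof -
    have "(r + real n) ^ 2 \<le> 2 * (r ^ 2 + real n ^ 2)"
      using sum_squares_bound[of r "real n"] by (simp add: power2_eq_square algebra_simps)
    also have "\<dots> \<le> 2 * cmod (zn n) ^ 2" using nsq[of n] by simp
    also have "\<dots> = (sqrt 2 * cmod (zn n)) ^ 2" by (simp add: power_mult_distrib)
    finally show ?thesis by (rule power2_le_imp_le) auto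
  qed
  have zn2: "cmod (zn n) \<ge> 2" for n
  proof -
    have "2 ^ 2 \<le> r ^ 2 + real n ^ 2" using r power_mono[of 2 r 2] by (simp add: add_increasing2)
    also have "\<dots> \<le> cmod (zn n) ^ 2" by (rule nsq)
    finally show ?thesis by (rule power2_le_imp_le) auto
  qed
  \<comment> \<open>The cubic bound is weakened to a telescoping difference that carries a factor 1
    / r, so that the sum over n is still of order 1 / r^2.\<close>
  have step: "cmod (E (zn n) - E (zn (Suc n))) \<le> (9 / r) * (1 / (r + real n - 1) - 1 / (r + real (Suc n) - 1))" for n
  proof -
    define u where "u = zn n"
    define w where "w = 1 / u"
    have u: "u \<noteq> 0" "Re u \<ge> 0" "cmod u \<ge> 2" using zn2[of n] assms by (auto simp: u_def zn_Re)
    have w: "cmod w \<le> 1 / 2" "cmod w = 1 / cmod u" using u by (auto simp: w_def norm_divide)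
    have w1: "cmod (1 + w) \<ge> 1 / 2" using norm_triangle_ineq2[of 1 "-w"] w(1) by simp
    then have w1': "1 + w \<noteq> 0" by (metis norm_zero not_le zero_less_divide_1_iff zero_less_numeral)
    have u1: "u + 1 \<noteq> 0" using u by (auto simp: complex_eq_iff)
    have Ln: "Ln (u + 1) = Ln u + Ln (1 + w)"
    proof -
      have "u + 1 = u * (1 + w)" using u by (simp add: w_def field_simps)
      moreover have "Ln (u * (1 + w)) = Ln u + Ln (1 + w)"
      proof (rule Ln_times_simple)
        show "u \<noteq> 0" "1 + w \<noteq> 0" using u w1' by auto
        have "\<bar>Im (Ln u)\<bar> \<le> pi / 2" using u Re_Ln_pos_le[of u] by simp
        moreover have "Re (1 + w) > 0" using abs_Re_le_cmod[of w] w by simp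
        then have "\<bar>Im (Ln (1 + w))\<bar> < pi / 2" using w1' Re_Ln_pos_lt[of "1 + w"] by simp
        ultimately show "-pi < Im (Ln u) + Im (Ln (1 + w))" "Im (Ln u) + Im (Ln (1 + w)) \<le> pi"
          by linarith+
      qed
      ultimately show ?thesis by simp
    qed
    have "E u - E (u + 1) = (Ln (1 + w) - w + w ^ 2 / 2) - w ^ 3 / (2 * (1 + w))"
    proof -
      have "E u - E (u + 1) = - 1 / u + Ln (1 + w) + 1 / (2 * u) - 1 / (2 * (u + 1))"
        using u by (simp add: E_def Ln Digamma_plus1)
      moreover have "- 1 / u + 1 / (2 * u) - 1 / (2 * (u + 1)) = - w + w ^ 2 / 2 - w ^ 3 / (2 * (1 + w))"
      proof -
        have 1: "1 / (2 * (u + 1)) = w / (2 * (1 + w))" using u u1 w1' by (simp add: w_def field_simps)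
        have "w ^ 3 - w = w * (w - 1) * (1 + w)" by (simp add: power3_eq_cube algebra_simps)
        moreover have "a * d / (2 * d) = a / 2" if "d \<noteq> 0" for a d :: complex using that by simp
        ultimately have "(w ^ 3 - w) / (2 * (1 + w)) = w * (w - 1) / 2" using w1' by metis
        moreover define q where "q = w / (2 * (1 + w))"
        ultimately have pq: "w ^ 3 / (2 * (1 + w)) = q + w * (w - 1) / 2"
          by (simp only: diff_divide_distrib diff_eq_eq add.commute)
        have 2: "- w + w ^ 2 / 2 - w ^ 3 / (2 * (1 + w)) = - w / 2 - w / (2 * (1 + w))"
          unfolding q_def[symmetric] pq by (simp add: power2_eq_square field_simps)
        have 3: "- 1 / u + 1 / (2 * u) = - w / 2" using u by (simp add: w_def)
        show ?thesis by (simp only: 1 2 3)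
      qed
      ultimately show ?thesis by simp
    qed
    then have "cmod (E u - E (u + 1)) \<le> cmod (Ln (1 + w) - w + w ^ 2 / 2) + cmod (w ^ 3 / (2 * (1 + w)))"
      by (metis norm_triangle_ineq4)
    also have "\<dots> \<le> 2 * cmod w ^ 3 + cmod w ^ 3"
    proof (rule add_mono)
      show "cmod (Ln (1 + w) - w + w ^ 2 / 2) \<le> 2 * cmod w ^ 3" by (rule Ln_one_plus_cubic[OF w(1)])
      have "cmod (w ^ 3 / (2 * (1 + w))) = cmod w ^ 3 / (2 * cmod (1 + w))"
        by (simp only: norm_divide norm_mult norm_power norm_numeral)
      also have "\<dots> \<le> cmod w ^ 3 / 1"
        using w1 by (intro divide_left_mono) auto
      finally show "cmod (w ^ 3 / (2 * (1 + w))) \<le> cmod w ^ 3" by simp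
    qed
    also have "\<dots> = 3 / cmod u ^ 3" by (simp add: w(2) power_divide)
    also have "\<dots> \<le> 9 / (r + real n) ^ 3"
    proof -
      have "(r + real n) ^ 3 \<le> 3 * cmod u ^ 3"
      proof -
        have "(r + real n) \<le> sqrt 2 * cmod u"
          using rn[of n] by (simp add: u_def)
        then have "(r + real n) ^ 3 \<le> (sqrt 2 * cmod u) ^ 3" using r by (intro power_mono) auto
        also have "\<dots> = (2 * sqrt 2) * cmod u ^ 3" by (simp add: power_mult_distrib power3_eq_cube)
        also have "\<dots> \<le> 3 * cmod u ^ 3"
        proof (rule mult_right_mono)
          have "sqrt 2 \<le> 3 / 2" by (rule real_le_lsqrt) (auto simp: power2_eq_square)
          then show "2 * sqrt 2 \<le> 3" by simp
        qed auto
        finally show ?thesis .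
      qed
      moreover have "cmod u ^ 3 > 0" "(r + real n) ^ 3 > 0" using u r by auto
      ultimately show ?thesis by (simp add: field_simps)
    qed
    also have "\<dots> \<le> (9 / r) * (1 / (r + real n - 1) - 1 / (r + real (Suc n) - 1))"
    proof -
      define x where "x = r + real n"
      have x: "x \<ge> r" "x \<ge> 2" using r by (auto simp: x_def)
      have "r * (x * (x - 1)) \<le> x * (x * x)"
        using x r by (intro mult_mono) auto
      then have "9 / (x * (x * x)) \<le> 9 / (r * (x * (x - 1)))"
        using x r by (intro divide_left_mono) auto
      also have "\<dots> = (9 / r) * (1 / (x - 1) - 1 / x)"
        using x r by (simp add: field_simps)
      finally show ?thesis by (simp add: x_def power3_eq_cube algebra_simps)
    qed
    finally show ?thesis by (simp add: u_def zn_def add_ac)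
  qed
  have lim: "(\<lambda>n. E (zn n)) \<longlonglongrightarrow> 0"
  proof -
    define G where "G = (\<lambda>n. - (of_real (ln (real n)) - (\<Sum>k<n. inverse (z + of_nat k)) - Digamma z)
        - Ln (1 + z / of_nat n) + 1 / (2 * zn n))"
    have EG: "E (zn n) = G n" if n: "n > 0" for n
    proof -
      have "Digamma (zn n) = Digamma z + (\<Sum>k<n. inverse (z + of_nat k))"
      proof (induction n)
        case (Suc n)
        have "zn n \<noteq> 0" using zn2[of n] by auto
        then have "Digamma (zn n + 1) = Digamma (zn n) + 1 / zn n" by (rule Digamma_plus1)
        then show ?case using Suc by (simp add: zn_def divide_inverse add_ac)
      qed (simp add: zn_def)
      moreover have "Ln (zn n) = of_real (ln (real n)) + Ln (1 + z / of_nat n)"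
      proof -
        have "zn n = of_real (real n) * (1 + z / of_nat n)" using n by (simp add: zn_def field_simps)
        moreover have "Re (1 + z / of_nat n) \<ge> 1" using assms by simp
        then have "1 + z / of_nat n \<noteq> 0" by (metis not_one_le_zero zero_complex.sel(1))
        ultimately show ?thesis using n Ln_times_of_real[of "real n" "1 + z / of_nat n"] by simp
      qed
      ultimately show ?thesis by (simp add: E_def G_def)
    qed
    have "G \<longlonglongrightarrow> - (Digamma z - Digamma z) - Ln (1 + 0) + 0"
      unfolding G_def
    proof (rule tendsto_add[OF tendsto_diff[OF tendsto_minus[OF tendsto_diff[OF Digamma_LIMSEQ[OF z0] tendsto_const]]]])
      have "(\<lambda>n. 1 + z / of_nat n) \<longlonglongrightarrow> 1 + 0" by (intro tendsto_add tendsto_const lim_const_over_n)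
      then show "(\<lambda>n. Ln (1 + z / of_nat n)) \<longlonglongrightarrow> Ln (1 + 0)" by (rule tendsto_Ln) auto
      have "filterlim (\<lambda>n. z + of_nat n) at_infinity sequentially"
        by (intro tendsto_add_filterlim_at_infinity[OF tendsto_const] tendsto_of_nat)
      then have "(\<lambda>n. inverse (zn n)) \<longlonglongrightarrow> 0" unfolding zn_def by (rule filterlim_compose[OF tendsto_inverse_0])
      then have "(\<lambda>n. inverse (zn n) / 2) \<longlonglongrightarrow> 0 / 2" by (rule tendsto_divide) (rule tendsto_const, simp)
      moreover have "inverse (zn n) / 2 = 1 / (2 * zn n)" for n by (simp add: inverse_eq_divide)
      ultimately show "(\<lambda>n. 1 / (2 * zn n)) \<longlonglongrightarrow> 0" by (simp only: div_0)
    qed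
    then have lG: "G \<longlonglongrightarrow> 0" by simp
    have ev: "\<forall>\<^sub>F n in sequentially. G n = E (zn n)"
      using eventually_gt_at_top[of 0] by eventually_elim (rule EG[symmetric])
    show ?thesis by (rule Lim_transform_eventually[OF lG ev])
  qed
  have s1: "(\<lambda>n. E (zn n) - E (zn (Suc n))) sums (E (zn 0) - 0)" by (rule telescope_sums'[OF lim])
  have "(\<lambda>n. 1 / (r + real n - 1)) \<longlonglongrightarrow> 0" by real_asymp
  from telescope_sums'[OF this] have s2: "(\<lambda>n. (9 / r) * (1 / (r + real n - 1) - 1 / (r + real (Suc n) - 1))) sums ((9 / r) * (1 / (r + real 0 - 1) - 0))"
    by (intro sums_mult)
  have "cmod (E (zn 0) - 0) \<le> (9 / r) * (1 / (r + real 0 - 1) - 0)"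
    by (rule norm_sums_le[OF s1 s2 step])
  also have "\<dots> \<le> 18 / r ^ 2" using r by (simp add: field_simps power2_eq_square)
  finally show ?thesis by (simp add: E_def zn_def r_def)
qed

text \<open>With w = exp (2 i u) one has cot u + i = - 2 i w / (1 - w), and w is small high above
  the real axis.\<close>

lemma cot_upper_half_plane:
  assumes "Im u \<ge> pi / 2"
  shows "cmod (cot u + \<i>) \<le> 4 * exp (- 2 * Im u)"
proof -
  define w where "w = exp (2 * \<i> * u)"
  have nw: "cmod w = exp (- 2 * Im u)" by (simp add: w_def norm_exp_eq_Re)
  also have "\<dots> \<le> exp (- 1)" using assms pi_gt3 by simp
  also have "\<dots> \<le> 1 / 2"
    using exp_ge_add_one_self[of 1] by (simp add: exp_minus field_simps)
  finally have w: "cmod w \<le> 1 / 2" .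
  have w1: "cmod (1 - w) \<ge> 1 / 2" "1 - w \<noteq> 0"
    using norm_triangle_ineq2[of 1 w] w by auto
  have e: "exp (\<i> * u) \<noteq> 0" by simp
  have ww: "w = exp (\<i> * u) * exp (\<i> * u)" by (simp add: w_def mult.assoc flip: exp_add)
  have "cot u = \<i> * (exp (\<i> * u) + exp (- (\<i> * u))) / (exp (\<i> * u) - exp (- (\<i> * u)))"
  proof -
    have "(a / 2) / (b / (2 * \<i>)) = \<i> * a / b" for a b :: complex
      by (cases "b = 0") (auto simp: field_simps)
    then show ?thesis unfolding cot_def cos_exp_eq sin_exp_eq .
  qed
  also have "\<dots> = \<i> * (exp (\<i> * u) * (exp (\<i> * u) + exp (- (\<i> * u)))) / (exp (\<i> * u) * (exp (\<i> * u) - exp (- (\<i> * u))))"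
    using e by (simp add: mult.left_commute)
  also have "\<dots> = \<i> * (w + 1) / (w - 1)"
    by (simp add: distrib_left right_diff_distrib ww flip: exp_add)
  finally have "cot u + \<i> = - (2 * \<i> * w / (1 - w))"
    using w1 by (simp add: field_simps)
  then have "cmod (cot u + \<i>) = 2 * cmod w / cmod (1 - w)" by (simp add: norm_divide norm_mult)
  also have "\<dots> \<le> 2 * cmod w / (1 / 2)" using w1 by (intro divide_left_mono) auto
  finally show ?thesis by (simp add: nw)
qed

text \<open>In the upper half-plane cot (pi s / 2) is exponentially close to - i, and Re s <= 1 puts
  1 - s where the expansion of Digamma holds. The error is integrable in the height, which
  \<open>chi_vertical\<close> exploits.\<close>

lemma chi_logderiv_asymptotic:
  assumes "Re s \<le> 1" "Im s \<ge> 2"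
  shows "cmod (chi_logderiv s - (of_real (ln (2 * pi)) - \<i> * of_real (pi / 2) - Ln (1 - s) + 1 / (2 * (1 - s)))) \<le> 30 / (Im s) ^ 2"
proof -
  define t where "t = Im s"
  have t: "t \<ge> 2" using assms by (simp add: t_def)
  have c: "cmod (1 - s) \<ge> t" using abs_Im_le_cmod[of "1 - s"] t by (simp add: t_def)
  have "cmod (Digamma (1 - s) - Ln (1 - s) + 1 / (2 * (1 - s))) \<le> 18 / cmod (1 - s) ^ 2"
    using assms c t by (intro Digamma_asymptotic) auto
  also have "\<dots> \<le> 18 / t ^ 2"
  proof -
    have "cmod (1 - s) > 0" using c t by linarith
    then show ?thesis using c t by (intro divide_left_mono power_mono mult_pos_pos zero_less_power) auto
  qed
  finally have 1: "cmod (Digamma (1 - s) - Ln (1 - s) + 1 / (2 * (1 - s))) \<le> 18 / t ^ 2" .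
  have "cmod (cot (of_real pi * s / 2) + \<i>) \<le> 4 * exp (- 2 * Im (of_real pi * s / 2))"
    using t by (intro cot_upper_half_plane) (auto simp: t_def field_simps)
  also have "- 2 * Im (of_real pi * s / 2) = - (pi * t)" by (simp add: t_def)
  also have "exp (- (pi * t)) \<le> 1 / t ^ 2"
  proof -
    have "t ^ 2 \<le> (pi * t) ^ 2 / 2"
    proof -
      have "3 * t \<le> pi * t" using pi_gt3 t by (intro mult_right_mono) auto
      then have "(3 * t) ^ 2 \<le> (pi * t) ^ 2" using t by (intro power_mono) auto
      then show ?thesis by (simp add: power2_eq_square) (use t in \<open>simp add: algebra_simps\<close>)
    qed
    also have "\<dots> \<le> exp (pi * t)"
    proof -
      have "0 \<le> pi * t" using t by simp
      then show ?thesis using exp_lower_Taylor_quadratic[of "pi * t"] by linarith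
    qed
    finally show ?thesis using t by (simp add: exp_minus field_simps)
  qed
  finally have 2: "cmod (cot (of_real pi * s / 2) + \<i>) \<le> 4 / t ^ 2" by simp
  have "chi_logderiv s - (of_real (ln (2 * pi)) - \<i> * of_real (pi / 2) - Ln (1 - s) + 1 / (2 * (1 - s)))
     = of_real (pi / 2) * (cot (of_real pi * s / 2) + \<i>) - (Digamma (1 - s) - Ln (1 - s) + 1 / (2 * (1 - s)))"
    by (simp add: chi_logderiv_def algebra_simps)
  also have "cmod \<dots> \<le> cmod (of_real (pi / 2) * (cot (of_real pi * s / 2) + \<i>)) + cmod (Digamma (1 - s) - Ln (1 - s) + 1 / (2 * (1 - s)))"
    by (rule norm_triangle_ineq4)
  also have "\<dots> \<le> (pi / 2) * (4 / t ^ 2) + 18 / t ^ 2"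
  proof (rule add_mono[OF _ 1])
    have "cmod (of_real (pi / 2) * (cot (of_real pi * s / 2) + \<i>)) = pi / 2 * cmod (cot (of_real pi * s / 2) + \<i>)"
      by (simp only: norm_mult norm_of_real) simp
    then show "cmod (of_real (pi / 2) * (cot (of_real pi * s / 2) + \<i>)) \<le> pi / 2 * (4 / t ^ 2)"
      using mult_left_mono[OF 2, of "pi / 2"] by simp
  qed
  also have "\<dots> \<le> 2 * (4 / t ^ 2) + 18 / t ^ 2"
    using pi_less_4 by (intro add_mono mult_right_mono) auto
  also have "\<dots> \<le> 30 / t ^ 2" by (simp add: divide_right_mono)
  finally show ?thesis by (simp add: t_def)
qed

section \<open>The second derivative to the left of the critical strip\<close>

definition zeta_ld :: "complex \<Rightarrow> complex" where
  "zeta_ld s = deriv zeta s / zeta s"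

text \<open>The Cauchy inequality with a bound on the open ball only: it is applied with smaller
  radii that approach r.\<close>

lemma cmod_deriv_le:
  assumes "f holomorphic_on ball z r" "\<And>w. w \<in> ball z r \<Longrightarrow> cmod (f w) \<le> B" "r > 0"
  shows "cmod ((deriv ^^ n) f z) \<le> fact n * B / r ^ n"
proof (rule field_le_mult_one_interval)
  fix x :: real assume x: "0 < x" "x < 1"
  \<comment> \<open>The root of order n + 1 makes (r' / r) ^ n at least x, and it makes sense for n
    = 0 too.\<close>
  define r' where "r' = r * root (Suc n) x"
  have rt: "0 < root (Suc n) x" "root (Suc n) x < 1"
    using x by auto
  have r': "0 < r'" "r' < r" using assms rt by (auto simp: r'_def)
  have sub: "cball z r' \<subseteq> ball z r" using r' by auto
  have "cmod ((deriv ^^ n) f z) \<le> fact n * B / r' ^ n"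
  proof (rule Cauchy_inequality)
    show "f holomorphic_on ball z r'" using assms(1) by (rule holomorphic_on_subset) (use r' in auto)
    show "continuous_on (cball z r') f"
      using holomorphic_on_imp_continuous_on[OF assms(1)] sub continuous_on_subset by blast
    show "cmod (f w) \<le> B" if "cmod (z - w) = r'" for w
      using assms(2)[of w] r' that by (simp add: dist_norm)
  qed (use r' in auto)
  have "B \<ge> 0" using assms(2)[of z] assms(3) norm_ge_zero[of "f z"] by (auto simp del: norm_ge_zero)
  have "x \<le> root (Suc n) x ^ n"
  proof -
    have "x = root (Suc n) x ^ Suc n" using x by (simp only: real_root_pow_pos2 zero_less_Suc less_imp_le)
    also have "\<dots> \<le> root (Suc n) x ^ n" using rt by (intro power_decreasing) auto
    finally show ?thesis .
  qed
  have "x * cmod ((deriv ^^ n) f z) \<le> root (Suc n) x ^ n * (fact n * B / r' ^ n)"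
    using \<open>cmod ((deriv ^^ n) f z) \<le> fact n * B / r' ^ n\<close> \<open>x \<le> root (Suc n) x ^ n\<close> rt x
    by (intro mult_mono) auto
  also have "\<dots> = fact n * B / r ^ n"
    using rt assms(3) by (simp add: r'_def power_mult_distrib)
  finally show "x * cmod ((deriv ^^ n) f z) \<le> fact n * B / r ^ n" .
qed

lemma zeta_nonzero_Re_ge_2: "Re s \<ge> 2 \<Longrightarrow> zeta s \<noteq> 0"
  using zeta_minus_one_le[of s] by force

lemma holomorphic_zeta: "1 \<notin> S \<Longrightarrow> zeta holomorphic_on S"
  by (rule holomorphic_on_subset[OF zeta_holomorphic]) auto

lemma holomorphic_deriv_zeta: "1 \<notin> S \<Longrightarrow> deriv zeta holomorphic_on S"
  by (rule holomorphic_on_subset[OF holomorphic_deriv[OF zeta_holomorphic]]) auto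

lemma holomorphic_zeta_ld: "1 \<notin> S \<Longrightarrow> (\<And>s. s \<in> S \<Longrightarrow> zeta s \<noteq> 0) \<Longrightarrow> zeta_ld holomorphic_on S"
  unfolding zeta_ld_def by (intro holomorphic_intros holomorphic_zeta holomorphic_deriv_zeta) auto

lemma ball_Re_Im: "w \<in> ball z r \<Longrightarrow> Re z - r < Re w" "w \<in> ball z r \<Longrightarrow> Re w < Re z + r"
  "w \<in> ball z r \<Longrightarrow> Im z - r < Im w" "w \<in> ball z r \<Longrightarrow> Im w < Im z + r"
  using abs_Re_le_cmod[of "z - w"] abs_Im_le_cmod[of "z - w"] by (auto simp: dist_norm)

lemma zeta_ld_le: "Re s \<ge> 3 \<Longrightarrow> cmod (zeta_ld s) \<le> 7"
proof -
  assume s: "Re s \<ge> 3"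
  have b: "Re w \<ge> 2" if "w \<in> ball s 1" for w using ball_Re_Im(1)[OF that] s by simp
  have "cmod ((deriv ^^ 1) zeta s) \<le> fact 1 * (7 / 4) / 1 ^ 1"
  proof (rule cmod_deriv_le)
    show "zeta holomorphic_on ball s 1" using b[of 1] by (intro holomorphic_zeta) auto
    show "cmod (zeta w) \<le> 7 / 4" if "w \<in> ball s 1" for w
      using zeta_minus_one_le[OF b[OF that]] norm_triangle_ineq[of "zeta w - 1" 1] by simp
  qed auto
  moreover have "cmod (zeta s) \<ge> 1 / 4"
    using zeta_minus_one_le[of s] s norm_triangle_ineq2[of 1 "1 - zeta s"] by (simp add: norm_minus_commute)
  ultimately show ?thesis
    unfolding zeta_ld_def norm_divide by (subst divide_le_eq) (auto intro: order_trans)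
qed

lemma zeta_ld_functional_equation:
  assumes s: "s \<in> slit_plane" "sin (of_real pi * s / 2) \<noteq> 0" "zeta (1 - s) \<noteq> 0"
  shows "zeta s \<noteq> 0" "zeta_ld s = chi_logderiv s - zeta_ld (1 - s)"
proof -
  show "zeta s \<noteq> 0"
    using zeta_functional_equation[OF s(1)] chi_nonzero[OF s(1,2)] s(3) by simp
  have s0: "1 - s \<noteq> 1" using s(1) by (auto simp: slit_plane_iff)
  have z: "((\<lambda>s. zeta (1 - s)) has_field_derivative - deriv zeta (1 - s)) (at s)"
  proof -
    have "(zeta has_field_derivative deriv zeta (1 - s)) (at (1 - s))"
      using zeta_differentiable[OF s0] by (simp add: DERIV_deriv_iff_field_differentiable)
    moreover have "((\<lambda>s. 1 - s) has_field_derivative -1) (at s)" by (auto intro!: derivative_eq_intros)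
    ultimately show ?thesis using DERIV_chain2[of zeta] by fastforce
  qed
  have "((\<lambda>s. chi s * zeta (1 - s)) has_field_derivative
     chi s * chi_logderiv s * zeta (1 - s) + - deriv zeta (1 - s) * chi s) (at s)"
    by (rule DERIV_mult[OF chi_has_derivative[OF s(1,2)] z])
  then have "(zeta has_field_derivative
     chi s * chi_logderiv s * zeta (1 - s) + - deriv zeta (1 - s) * chi s) (at s)"
    by (rule has_field_derivative_transform_within_open[OF _ open_slit_plane s(1)])
       (simp only: zeta_functional_equation)
  then have "deriv zeta s = chi s * chi_logderiv s * zeta (1 - s) + - deriv zeta (1 - s) * chi s"
    by (rule DERIV_imp_deriv)
  then show "zeta_ld s = chi_logderiv s - zeta_ld (1 - s)"
    unfolding zeta_ld_def zeta_functional_equation[OF s(1)]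
    using chi_nonzero[OF s(1,2)] s(3) by (simp add: field_simps)
qed

lemma deriv2_zeta_eq:
  assumes s: "s \<noteq> 1" "zeta s \<noteq> 0"
  shows "(deriv ^^ 2) zeta s = zeta s * (zeta_ld s ^ 2 + deriv zeta_ld s)"
proof -
  have d: "zeta field_differentiable at s" by (rule zeta_differentiable[OF s(1)])
  have d2: "deriv zeta field_differentiable at s"
    using holomorphic_deriv[OF zeta_holomorphic] holomorphic_on_imp_differentiable_at[of "deriv zeta" "-{1}" s] s by auto
  have "deriv zeta_ld s = (deriv (deriv zeta) s * zeta s - deriv zeta s * deriv zeta s) / zeta s ^ 2"
    unfolding zeta_ld_def[abs_def] by (rule deriv_divide[OF d2 d s(2)])
  then show ?thesis
    using s by (simp add: zeta_ld_def numeral_2_eq_2 field_simps)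
qed

text \<open>The relation between the logarithmic derivatives holds on an open set around s and may
  be differentiated; the inner derivative - 1 cancels the minus sign.\<close>

lemma deriv_zeta_ld_functional_equation:
  assumes s: "s \<in> slit_plane" "sin (of_real pi * s / 2) \<noteq> 0" "zeta (1 - s) \<noteq> 0"
  shows "deriv zeta_ld s = deriv chi_logderiv s + deriv zeta_ld (1 - s)"
    "chi_logderiv field_differentiable at s"
proof -
  note g = one_minus_slit_plane(1)[OF s(1)]
  have s0: "1 - s \<noteq> 1" using s(1) by (auto simp: slit_plane_iff)
  define U where "U = {s \<in> slit_plane. sin (of_real pi * s / 2) \<noteq> 0 \<and> zeta (1 - s) \<noteq> 0}"
  have "open U"
  proof -
    have "continuous_on slit_plane (\<lambda>s. zeta (1 - s))"
      by (rule continuous_on_compose2[OF holomorphic_on_imp_continuous_on[OF zeta_holomorphic]])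
         (auto intro!: continuous_intros simp: slit_plane_iff)
    then have "continuous_on slit_plane (\<lambda>s. sin (of_real pi * s / 2) * zeta (1 - s))"
      by (intro continuous_intros) auto
    from continuous_open_preimage[OF this open_slit_plane, of "-{0}"]
    have "open (slit_plane \<inter> (\<lambda>s. sin (of_real pi * s / 2) * zeta (1 - s)) -` (-{0}))"
      using open_delete[OF open_UNIV, of "0::complex"] by (simp add: Compl_eq_Diff_UNIV)
    also have "slit_plane \<inter> (\<lambda>s. sin (of_real pi * s / 2) * zeta (1 - s)) -` (-{0}) = U"
      by (auto simp: U_def)
    finally show ?thesis .
  qed
  show cd: "chi_logderiv field_differentiable at s"
    unfolding chi_logderiv_def[abs_def] cot_def field_differentiable_def
    using g s(2) by (auto intro!: exI derivative_eq_intros)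
  have zd: "zeta_ld field_differentiable at (1 - s)"
  proof -
    have "zeta field_differentiable at (1 - s)" "deriv zeta field_differentiable at (1 - s)"
      using zeta_differentiable[OF s0] holomorphic_deriv[OF zeta_holomorphic]
        holomorphic_on_imp_differentiable_at[of "deriv zeta" "-{1}" "1 - s"] s0 by auto
    then show ?thesis unfolding zeta_ld_def[abs_def] using s(3) by (intro field_differentiable_divide)
  qed
  have "(zeta_ld has_field_derivative deriv zeta_ld (1 - s)) (at (1 - s))"
    using zd by (simp add: DERIV_deriv_iff_field_differentiable)
  moreover have "((\<lambda>s. 1 - s) has_field_derivative -1) (at s)" by (auto intro!: derivative_eq_intros)
  ultimately have z: "((\<lambda>s. zeta_ld (1 - s)) has_field_derivative - deriv zeta_ld (1 - s)) (at s)"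
    using DERIV_chain2[of zeta_ld] by fastforce
  have "((\<lambda>s. chi_logderiv s - zeta_ld (1 - s)) has_field_derivative deriv chi_logderiv s - - deriv zeta_ld (1 - s)) (at s)"
    using cd by (intro DERIV_diff z) (simp add: DERIV_deriv_iff_field_differentiable)
  then have "(zeta_ld has_field_derivative deriv chi_logderiv s - - deriv zeta_ld (1 - s)) (at s)"
    by (rule has_field_derivative_transform_within_open[OF _ \<open>open U\<close>])
       (use s zeta_ld_functional_equation(2) in \<open>auto simp: U_def\<close>)
  then show "deriv zeta_ld s = deriv chi_logderiv s + deriv zeta_ld (1 - s)"
    by (simp add: DERIV_imp_deriv)
qed

text \<open>With w = exp (2 i u) and d = cmod (w - 1) ^ 2, the modulus of Im (cot u) equals (1 -
  cmod w ^ 2) / d, whereas cmod (cot u) ^ 2 is at most 4 / d. Comparing the two eliminates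
  d.\<close>

lemma Im_cot_lower_bound:
  assumes "Im u > 0"
  shows "\<bar>Im (cot u)\<bar> \<ge> (1 - exp (- 4 * Im u)) * cmod (cot u) ^ 2 / 4"
proof -
  define w where "w = exp (2 * \<i> * u)"
  have nw: "cmod w = exp (- 2 * Im u)" by (simp add: w_def norm_exp_eq_Re)
  have w: "cmod w < 1" using assms by (simp add: nw)
  have w1: "1 - w \<noteq> 0" using w by auto
  have e: "exp (\<i> * u) \<noteq> 0" by simp
  have ww: "w = exp (\<i> * u) * exp (\<i> * u)" by (simp add: w_def mult.assoc flip: exp_add)
  have "cot u = \<i> * (exp (\<i> * u) + exp (- (\<i> * u))) / (exp (\<i> * u) - exp (- (\<i> * u)))"
  proof -
    have "(a / 2) / (b / (2 * \<i>)) = \<i> * a / b" for a b :: complex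
      by (cases "b = 0") (auto simp: field_simps)
    then show ?thesis unfolding cot_def cos_exp_eq sin_exp_eq .
  qed
  also have "\<dots> = \<i> * (exp (\<i> * u) * (exp (\<i> * u) + exp (- (\<i> * u)))) / (exp (\<i> * u) * (exp (\<i> * u) - exp (- (\<i> * u))))"
    using e by (simp add: mult.left_commute)
  also have "\<dots> = \<i> * (w + 1) / (w - 1)"
    by (simp add: distrib_left right_diff_distrib ww flip: exp_add)
  finally have cot: "cot u = \<i> * (w + 1) / (w - 1)" .
  have w1': "w - 1 \<noteq> 0" using w1 by auto
  define d where "d = cmod (w - 1) ^ 2"
  have d: "d > 0" using w1' by (simp add: d_def)
  have "cot u = \<i> * (w + 1) * cnj (w - 1) / of_real d"
    unfolding cot d_def by (subst complex_div_cnj) simp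
  then have "Im (cot u) = Re ((w + 1) * cnj (w - 1)) / d" by simp
  also have "Re ((w + 1) * cnj (w - 1)) = cmod w ^ 2 - 1"
    unfolding cmod_power2 by (simp add: power2_eq_square algebra_simps)
  finally have Im: "Im (cot u) = (cmod w ^ 2 - 1) / d" .
  have "\<bar>Im (cot u)\<bar> = (1 - cmod w ^ 2) / d"
    using d w power_le_one[of "cmod w" 2] unfolding Im by (simp add: abs_divide abs_minus_commute)
  moreover have "cmod (cot u) ^ 2 \<le> 4 / d"
  proof -
    have "cmod (w + 1) \<le> 2" using norm_triangle_ineq[of w 1] w by simp
    then have "cmod (w + 1) ^ 2 \<le> 2 ^ 2" by (intro power_mono) auto
    then show ?thesis unfolding cot using d by (simp add: norm_divide norm_mult power_divide d_def divide_right_mono)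
  qed
  moreover have "cmod w ^ 2 = exp (- 4 * Im u)" by (simp add: nw power2_eq_square flip: exp_add)
  moreover have "exp (- 4 * Im u) \<le> 1" using assms by simp
  ultimately have "(1 - exp (- 4 * Im u)) * cmod (cot u) ^ 2 \<le> (1 - exp (- 4 * Im u)) * (4 / d)"
    by (intro mult_left_mono) auto
  then show ?thesis using \<open>\<bar>Im (cot u)\<bar> = (1 - cmod w ^ 2) / d\<close> \<open>cmod w ^ 2 = exp (- 4 * Im u)\<close> by simp
qed

section \<open>A zero-free quadrant far to the left\<close>

text \<open>Minus zeta' / zeta at s without its cotangent term, as a function of z = 1 - s. Unlike
  the cotangent it is regular far to the left, where it is close to Ln z.\<close>

definition Phi :: "complex \<Rightarrow> complex" where
  "Phi z = Digamma z - of_real (ln (2 * pi)) + zeta_ld z"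

lemma holomorphic_Phi: "S \<subseteq> {z. Re z \<ge> 2} \<Longrightarrow> Phi holomorphic_on S"
proof -
  assume S: "S \<subseteq> {z. Re z \<ge> 2}"
  have "z \<notin> \<int>\<^sub>\<le>\<^sub>0" if "z \<in> S" for z
  proof -
    have "Re z \<ge> 2" using S that by blast
    then show ?thesis by (auto elim!: nonpos_Ints_cases)
  qed
  then have "Digamma holomorphic_on S" by (intro holomorphic_on_Polygamma) auto
  moreover have "zeta_ld holomorphic_on S"
    by (rule holomorphic_zeta_ld) (use S zeta_nonzero_Re_ge_2 in auto)
  ultimately show ?thesis unfolding Phi_def[abs_def]
    by (intro holomorphic_on_add holomorphic_on_diff holomorphic_on_const)
qed

lemma Phi_minus_Ln_le:
  assumes "Re z \<ge> 3"
  shows "cmod (Phi z - Ln z) \<le> 20"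
proof -
  have z: "cmod z \<ge> 3" using assms complex_Re_le_cmod[of z] by linarith
  have "cmod (Digamma z - Ln z + 1 / (2 * z)) \<le> 18 / cmod z ^ 2"
    using assms z by (intro Digamma_asymptotic) auto
  also have "\<dots> \<le> 18 / 3 ^ 2" using z by (intro divide_left_mono power_mono) auto
  finally have 1: "cmod (Digamma z - Ln z + 1 / (2 * z)) \<le> 2" by simp
  have "cmod (1 / (2 * z)) \<le> 1" using z by (simp add: norm_divide norm_mult divide_le_eq)
  moreover have "cmod (of_real (ln (2 * pi)) :: complex) \<le> 7"
  proof -
    have "ln (2 * pi) \<le> 2 * pi - 1" using ln_le_minus_one[of "2 * pi"] by simp
    moreover have "ln (2 * pi) \<ge> 0" using pi_gt3 by (intro ln_ge_zero) auto
    ultimately show ?thesis using pi_less_4 by simp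
  qed
  moreover have "cmod (zeta_ld z) \<le> 7" by (rule zeta_ld_le[OF assms])
  moreover have "Phi z - Ln z = (Digamma z - Ln z + 1 / (2 * z)) - 1 / (2 * z) - of_real (ln (2 * pi)) + zeta_ld z"
    by (simp add: Phi_def)
  moreover have "cmod (a - b - c + d) \<le> cmod a + cmod b + cmod c + cmod d" for a b c d :: complex
    using norm_triangle_ineq4[of a b] norm_triangle_ineq4[of "a - b" c] norm_triangle_ineq[of "a - b - c" d] by linarith
  ultimately have "cmod (Phi z - Ln z) \<le> cmod (Digamma z - Ln z + 1 / (2 * z)) + cmod (1 / (2 * z)) + cmod (of_real (ln (2 * pi)) :: complex) + cmod (zeta_ld z)"
    by (simp only:)
  with \<open>cmod (1 / (2 * z)) \<le> 1\<close> \<open>cmod (of_real (ln (2 * pi)) :: complex) \<le> 7\<close> \<open>cmod (zeta_ld z) \<le> 7\<close>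
  show ?thesis using 1 by linarith
qed

text \<open>Phi - Ln is at most 20 on the unit disc around z, so the Cauchy inequality bounds its
  derivatives by 20 and 40; the derivatives of Ln at z add at most 1.\<close>

lemma Phi_bounds:
  assumes "Re z \<ge> 4"
  shows "cmod (Phi z) \<ge> ln (cmod z) - 20" "cmod (deriv Phi z) \<le> 21" "cmod ((deriv ^^ 2) Phi z) \<le> 41"
proof -
  have z0: "z \<noteq> 0" using assms by auto
  have zb: "Re w \<ge> 3" if "w \<in> ball z 1" for w using ball_Re_Im(1)[OF that] assms by simp
  have znr: "w \<notin> \<real>\<^sub>\<le>\<^sub>0" if "w \<in> ball z 1" for w using zb[OF that] by (auto simp: complex_nonpos_Reals_iff)
  show "cmod (Phi z) \<ge> ln (cmod z) - 20"
  proof -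
    have "cmod (Ln z) \<ge> ln (cmod z)" using complex_Re_le_cmod[of "Ln z"] z0 by simp
    then show ?thesis using Phi_minus_Ln_le[of z] assms norm_triangle_ineq2[of "Ln z" "Ln z - Phi z"]
      by (simp add: norm_minus_commute)
  qed
  define D where "D = (\<lambda>z. Phi z - Ln z)"
  have hP: "Phi holomorphic_on ball z 1" by (rule holomorphic_Phi) (use zb in force)
  have hL: "Ln holomorphic_on ball z 1" using znr by (intro holomorphic_intros) auto
  have hD: "D holomorphic_on ball z 1" unfolding D_def by (intro holomorphic_intros hP hL)
  have Db: "cmod (D w) \<le> 20" if "w \<in> ball z 1" for w
    unfolding D_def by (rule Phi_minus_Ln_le[OF zb[OF that]])
  have b: "cmod ((deriv ^^ n) D z) \<le> fact n * 20 / 1 ^ n" for n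
    by (rule cmod_deriv_le[OF hD Db]) auto
  have Pn: "(deriv ^^ n) Phi z = (deriv ^^ n) D z + (deriv ^^ n) Ln z" for n
  proof -
    have "(deriv ^^ n) (\<lambda>w. D w + Ln w) z = (deriv ^^ n) D z + (deriv ^^ n) Ln z"
      by (rule higher_deriv_add[OF hD hL]) auto
    then show ?thesis by (simp add: D_def)
  qed
  have cz: "cmod z \<ge> 4" using assms complex_Re_le_cmod[of z] by linarith
  have L1: "deriv Ln w = inverse w" if "w \<in> ball z 1" for w
    using znr[OF that] by (intro DERIV_imp_deriv has_field_derivative_Ln)
  have L2: "deriv (deriv Ln) z = - inverse (z ^ 2)"
  proof -
    have "deriv (deriv Ln) z = deriv inverse z"
      using L1 by (intro deriv_cong_ev eventually_mono[OF eventually_nhds_in_open[of "ball z 1" z]]) auto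
    then show ?thesis using z0 by (simp add: DERIV_imp_deriv[OF DERIV_inverse] power2_eq_square inverse_eq_divide)
  qed
  have "cmod (inverse z) \<le> 1" using cz by (simp add: norm_inverse inverse_le_1_iff)
  then show "cmod (deriv Phi z) \<le> 21"
    using Pn[of 1] b[of 1] L1[of z] norm_triangle_ineq[of "deriv D z" "inverse z"] by simp
  have "cmod (- inverse (z ^ 2)) \<le> 1"
    using cz one_le_power[of "cmod z" 2] by (simp add: norm_inverse norm_power inverse_le_1_iff)
  then show "cmod ((deriv ^^ 2) Phi z) \<le> 41"
    using Pn[of 2] b[of 2] L2 norm_triangle_ineq[of "(deriv ^^ 2) D z" "- inverse (z ^ 2)"]
    by (simp add: numeral_2_eq_2)
qed

text \<open>Makes the function W in \<open>zeta_deriv2_nonzero_left\<close> real on the real axis.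
  The derivative is a limit of real difference quotients.\<close>

lemma Phi_real:
  assumes "x > 2"
  shows "Phi (of_real x) \<in> \<real>" "deriv Phi (of_real x) \<in> \<real>"
proof -
  have real: "Phi (of_real x) \<in> \<real>" if x: "x > 1" for x
  proof -
    have Zr: "zeta (of_real y) \<in> \<real>" for y
      using zeta_cnj[of "of_real y"] by (simp add: complex_is_Real_iff complex_eq_iff)
    have "deriv zeta (of_real x) \<in> \<real>"
    proof -
      have "of_real x \<noteq> (1::complex)" using x by (metis less_irrefl of_real_eq_1_iff)
      then have "(zeta has_field_derivative deriv zeta (of_real x)) (at (of_real x))"
        using zeta_differentiable by (simp add: DERIV_deriv_iff_field_differentiable)
      then have "((\<lambda>y. (zeta y - zeta (of_real x)) / (y - of_real x)) \<longlongrightarrow> deriv zeta (of_real x)) (at (of_real x))"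
        by (simp add: has_field_derivative_iff)
      moreover have "filterlim complex_of_real (at (of_real x)) (at x)"
        by (auto simp: filterlim_at eventually_at_filter intro!: tendsto_intros)
      ultimately have "((\<lambda>y. (zeta (of_real y) - zeta (of_real x)) / (of_real y - of_real x)) \<longlongrightarrow> deriv zeta (of_real x)) (at x)"
        by (rule filterlim_compose)
      then show ?thesis
        by (rule Lim_in_closed_set[OF closed_complex_Reals, rotated 2]) (auto intro!: always_eventually Reals_divide Reals_diff Zr)
    qed
    then have "zeta_ld (of_real x) \<in> \<real>" unfolding zeta_ld_def using Zr by (intro Reals_divide)
    moreover have "Digamma (complex_of_real x) \<in> \<real>" using x by (intro Polygamma_Real) auto
    ultimately show ?thesis unfolding Phi_def by (intro Reals_add Reals_diff) auto
  qed
  show "Phi (of_real x) \<in> \<real>" using real assms by simp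
  show "deriv Phi (of_real x) \<in> \<real>"
  proof -
    have "open {z. Re z > 2}" by (rule open_halfspace_Re_gt)
    then have "(Phi has_field_derivative deriv Phi (of_real x)) (at (of_real x))"
      using assms by (intro holomorphic_derivI[of Phi "{z. Re z > 2}"] holomorphic_Phi) auto
    then have "((\<lambda>y. (Phi y - Phi (of_real x)) / (y - of_real x)) \<longlongrightarrow> deriv Phi (of_real x)) (at (of_real x))"
      by (simp add: has_field_derivative_iff)
    moreover have "filterlim complex_of_real (at (of_real x)) (at x)"
      by (auto simp: filterlim_at eventually_at_filter intro!: tendsto_intros)
    ultimately have l: "((\<lambda>y. (Phi (of_real y) - Phi (of_real x)) / (of_real y - of_real x)) \<longlongrightarrow> deriv Phi (of_real x)) (at x)"
      by (rule filterlim_compose)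
    have ev: "\<forall>\<^sub>F y in at x. (Phi (of_real y) - Phi (of_real x)) / (of_real y - of_real x) \<in> \<real>"
      using eventually_at_in_open'[of "{1<..}" x] assms
      by (auto elim!: eventually_mono intro!: Reals_divide Reals_diff real)
    show ?thesis by (rule Lim_in_closed_set[OF closed_complex_Reals ev _ l]) simp
  qed
qed

text \<open>With c = (pi / 2) cot (pi s / 2) and P = Phi (1 - s) the functional equation reads q = c - P for
  q = zeta' / zeta, so that q^2 + q' = - 2 c P + P^2 - pi^2 / 4 - P'. At a zero c equals W (1 - s), where
  W is real on the real axis and has bounded derivative; hence Im c = O(Im s), whereas |c| is large
  and Im cot u grows like |cot u|^2.\<close>

lemma zeta_deriv2_nonzero_left:
  "\<exists>b. \<forall>s. Re s \<le> - b \<and> Im s > 0 \<longrightarrow> (deriv ^^ 2) zeta s \<noteq> 0"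
proof -
  \<comment> \<open>Any large value would do: C makes cmod (W z) >= 900 and hence cmod (cot u) >=
    450, against the final bounds 5 and sqrt 800. The value of b then ensures ln (cmod z) >= C +
    20.\<close>
  define C where "C = (2000 :: real)"
  define b where "b = exp (C + 20) + 4"
  have "(deriv ^^ 2) zeta s \<noteq> 0" if s: "Re s \<le> - b" "Im s > 0" for s
  proof
    assume zero: "(deriv ^^ 2) zeta s = 0"
    define H where "H = {z. Re z \<ge> b}"
    define W where "W = (\<lambda>z. Phi z / 2 - (of_real (pi ^ 2 / 4) - deriv Phi z) / (2 * Phi z))"
    have H4: "Re z \<ge> 4" "cmod (Phi z) \<ge> C" if z: "z \<in> H" for z
    proof -
      have "Re z \<ge> b" using z by (simp add: H_def)
      then show z4: "Re z \<ge> 4" using exp_ge_zero[of "C + 20"] unfolding b_def by linarith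
      have "exp (C + 20) \<le> cmod z" using \<open>Re z \<ge> b\<close> complex_Re_le_cmod[of z] unfolding b_def by linarith
      then have "C + 20 \<le> ln (cmod z)" by (metis exp_gt_zero less_le_trans ln_ge_iff)
      then show "cmod (Phi z) \<ge> C" using Phi_bounds(1)[OF z4] by linarith
    qed
    have P0: "Phi z \<noteq> 0" if "z \<in> H" for z using H4(2)[OF that] by (auto simp: C_def)
    have pisq: "pi ^ 2 / 4 \<le> 4" using power_mono[of pi 4 2] pi_less_4 by simp
    have small: "cmod ((of_real (pi ^ 2 / 4) - deriv Phi z) / (2 * Phi z)) \<le> 25" if z: "z \<in> H" for z
    proof -
      have "cmod (of_real (pi ^ 2 / 4) - deriv Phi z) \<le> cmod (complex_of_real (pi ^ 2 / 4)) + cmod (deriv Phi z)"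
        by (rule norm_triangle_ineq4)
      also have "cmod (complex_of_real (pi ^ 2 / 4)) = pi ^ 2 / 4" by (simp only: norm_of_real) simp
      finally have "cmod (of_real (pi ^ 2 / 4) - deriv Phi z) \<le> 25"
        using pisq Phi_bounds(2)[OF H4(1)[OF z]] by linarith
      moreover have "cmod (2 * Phi z) \<ge> 1" using H4(2)[OF z] by (simp add: norm_mult C_def)
      ultimately show ?thesis unfolding norm_divide
        by (subst divide_le_eq) (auto intro: order_trans simp: mult_le_cancel_left1)
    qed
    have W_ge: "cmod (W z) \<ge> 900" if z: "z \<in> H" for z
      using norm_triangle_ineq2[of "Phi z / 2" "(of_real (pi ^ 2 / 4) - deriv Phi z) / (2 * Phi z)"]
        small[OF z] H4(2)[OF z] unfolding W_def C_def by simp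
    have dP: "(Phi has_field_derivative deriv Phi z) (at z)" "(deriv Phi has_field_derivative (deriv ^^ 2) Phi z) (at z)"
      if z: "z \<in> H" for z
    proof -
      have h: "Phi holomorphic_on {z. Re z > 2}" by (rule holomorphic_Phi) auto
      have o: "open {z::complex. Re z > 2}" by (rule open_halfspace_Re_gt)
      have zz: "z \<in> {z. Re z > 2}" using H4(1)[OF z] by simp
      show "(Phi has_field_derivative deriv Phi z) (at z)" by (rule holomorphic_derivI[OF h o zz])
      show "(deriv Phi has_field_derivative (deriv ^^ 2) Phi z) (at z)"
        using holomorphic_derivI[OF holomorphic_deriv[OF h o] o zz] by (simp add: numeral_2_eq_2)
    qed
    define W' where "W' = (\<lambda>z. deriv Phi z / 2 + (deriv ^^ 2) Phi z / (2 * Phi z)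
        + (of_real (pi ^ 2 / 4) - deriv Phi z) * deriv Phi z / (2 * Phi z ^ 2))"
    have dW: "(W has_field_derivative W' z) (at z within H)" if z: "z \<in> H" for z
    proof -
      have "(W has_field_derivative (deriv Phi z / 2 - ((0 - (deriv ^^ 2) Phi z) * (2 * Phi z)
        - (of_real (pi ^ 2 / 4) - deriv Phi z) * (2 * deriv Phi z)) / ((2 * Phi z) * (2 * Phi z)))) (at z)"
        unfolding W_def using P0[OF z] dP[OF z]
        by (intro DERIV_diff DERIV_cdivide DERIV_divide DERIV_cmult DERIV_const) auto
      moreover have "(deriv Phi z / 2 - ((0 - (deriv ^^ 2) Phi z) * (2 * Phi z)
        - (of_real (pi ^ 2 / 4) - deriv Phi z) * (2 * deriv Phi z)) / ((2 * Phi z) * (2 * Phi z))) = W' z"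
      proof -
        have "d / 2 - ((0 - d2) * (2 * p) - (a - d) * (2 * d)) / ((2 * p) * (2 * p)) =
           d / 2 + d2 / (2 * p) + (a - d) * d / (2 * p ^ 2)" if "p \<noteq> 0" for d d2 p a :: complex
          using that by (simp add: field_simps power2_eq_square)
        then show ?thesis using P0[OF z] by (simp add: W'_def)
      qed
      ultimately show ?thesis using has_field_derivative_at_within by metis
    qed
    have W'_le: "cmod (W' z) \<le> 100" if z: "z \<in> H" for z
    proof -
      have 1: "cmod (deriv Phi z / 2) \<le> 11" using Phi_bounds(2)[OF H4(1)[OF z]] by (simp add: norm_divide)
      have 2: "cmod ((deriv ^^ 2) Phi z / (2 * Phi z)) \<le> 41"
      proof -
        have "cmod (2 * Phi z) \<ge> 1" using H4(2)[OF z] by (simp add: norm_mult C_def)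
        then show ?thesis unfolding norm_divide using Phi_bounds(3)[OF H4(1)[OF z]]
          by (subst divide_le_eq) (auto intro: order_trans simp: mult_le_cancel_left1)
      qed
      have 3: "cmod ((of_real (pi ^ 2 / 4) - deriv Phi z) * deriv Phi z / (2 * Phi z ^ 2)) \<le> 1"
      proof -
        have "(of_real (pi ^ 2 / 4) - deriv Phi z) * deriv Phi z / (2 * Phi z ^ 2) =
          (of_real (pi ^ 2 / 4) - deriv Phi z) / (2 * Phi z) * (deriv Phi z / Phi z)"
          by (simp add: power2_eq_square)
        moreover have "cmod (deriv Phi z / Phi z) \<le> 1 / 25"
        proof -
          have "cmod (deriv Phi z) * 25 \<le> cmod (Phi z)"
            using Phi_bounds(2)[OF H4(1)[OF z]] H4(2)[OF z] by (simp add: C_def)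
          then show ?thesis using P0[OF z] by (simp add: norm_divide field_simps)
        qed
        ultimately have "cmod ((of_real (pi ^ 2 / 4) - deriv Phi z) * deriv Phi z / (2 * Phi z ^ 2)) \<le> 25 * (1 / 25)"
          using small[OF z] by (simp only: norm_mult) (intro mult_mono; simp)
        then show ?thesis by simp
      qed
      have "cmod (W' z) \<le> cmod (deriv Phi z / 2) + cmod ((deriv ^^ 2) Phi z / (2 * Phi z))
        + cmod ((of_real (pi ^ 2 / 4) - deriv Phi z) * deriv Phi z / (2 * Phi z ^ 2))"
        unfolding W'_def by (intro norm_triangle_le add_mono norm_triangle_ineq order_refl)
      then show ?thesis using 1 2 3 by linarith
    qed
    define z where "z = 1 - s"
    define x where "x = complex_of_real (Re z)"
    define y where "y = Im s"
    have y: "y > 0" using s by (simp add: y_def)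
    have zH: "z \<in> H" "x \<in> H" using s by (auto simp: H_def z_def x_def)
    have "Re z > 2" using H4(1)[OF zH(1)] by simp
    then have "W x \<in> \<real>"
      unfolding W_def x_def using Phi_real[of "Re z"]
      by (intro Reals_diff Reals_divide Reals_mult) auto
    then have "Im (W x) = 0" by (simp add: complex_is_Real_iff)
    have "cmod (W z - W x) \<le> 100 * cmod (z - x)"
    proof (rule field_differentiable_bound[OF _ dW W'_le])
      show "convex H" unfolding H_def by (rule convex_halfspace_Re_ge)
    qed (use zH in auto)
    moreover have "cmod (z - x) = y"
    proof -
      have "z - x = - (\<i> * of_real y)" by (simp add: z_def x_def y_def complex_eq_iff)
      then show ?thesis using y by (simp add: norm_mult)
    qed
    ultimately have ImW: "\<bar>Im (W z)\<bar> \<le> 100 * y"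
      using abs_Im_le_cmod[of "W z - W x"] \<open>Im (W x) = 0\<close> by simp
    define u where "u = of_real pi * s / 2"
    have Imu: "Im u = pi * y / 2" by (simp add: u_def y_def)
    have sp: "s \<in> slit_plane" unfolding slit_plane_iff using s by simp
    have sn: "sin (of_real pi * s / 2) \<noteq> 0" using s by (intro sin_pi_half_nonzero) auto
    have zz: "zeta (1 - s) \<noteq> 0" using H4(1)[OF zH(1)] by (intro zeta_nonzero_Re_ge_2) (simp add: z_def)
    have s1: "s \<noteq> 1" using sp by (auto simp: slit_plane_iff)
    have V0: "zeta_ld s ^ 2 + deriv zeta_ld s = 0"
      using zero deriv2_zeta_eq[OF s1] zeta_ld_functional_equation(1)[OF sp sn zz] by simp
    define c where "c = of_real (pi / 2) * cot u"
    have q: "zeta_ld s = c - Phi z"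
      unfolding zeta_ld_functional_equation(2)[OF sp sn zz] chi_logderiv_def Phi_def c_def u_def z_def
      by simp
    have q': "deriv zeta_ld s = - of_real (pi ^ 2 / 4) - c ^ 2 + deriv Phi z"
    proof -
      have "(chi_logderiv has_field_derivative
          of_real (pi / 2) * (- inverse (sin u ^ 2) * (of_real pi / 2)) - (- Polygamma 1 (1 - s))) (at s)"
        unfolding chi_logderiv_def[abs_def]
      proof (rule DERIV_diff)
        have "(cot has_field_derivative - inverse (sin u ^ 2)) (at u)" using sn unfolding u_def by (rule DERIV_cot)
        then have "(cot has_field_derivative - inverse (sin u ^ 2)) (at (of_real pi * s / 2))" by (simp add: u_def)
        then have "((\<lambda>s. cot (of_real pi * s / 2)) has_field_derivative - inverse (sin u ^ 2) * (of_real pi / 2)) (at s)"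
          by (rule DERIV_chain2) (auto intro!: derivative_eq_intros)
        from DERIV_add[OF DERIV_const[of "complex_of_real (ln (2 * pi))"] DERIV_cmult[OF this, of "of_real (pi / 2)"]]
        show "((\<lambda>s. of_real (ln (2 * pi)) + of_real (pi / 2) * cot (of_real pi * s / 2)) has_field_derivative
           of_real (pi / 2) * (- inverse (sin u ^ 2) * (of_real pi / 2))) (at s)" by simp
        show "((\<lambda>s. Digamma (1 - s)) has_field_derivative - Polygamma 1 (1 - s)) (at s)"
          using one_minus_slit_plane(1)[OF sp] by (auto intro!: derivative_eq_intros)
      qed
      then have d1: "deriv chi_logderiv s = of_real (pi / 2) * (- inverse (sin u ^ 2) * (of_real pi / 2)) + Polygamma 1 (1 - s)"
        by (simp add: DERIV_imp_deriv)
      have "1 / sin u ^ 2 = 1 + cot u ^ 2"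
        using sn sin_cos_squared_add[of u] unfolding cot_def u_def[symmetric]
        by (simp add: field_simps power_divide)
      then have d2: "of_real (pi / 2) * (- inverse (sin u ^ 2) * (of_real pi / 2)) = - of_real (pi ^ 2 / 4) - c ^ 2"
        unfolding c_def inverse_eq_divide by (simp add: power2_eq_square algebra_simps)
      have "deriv Phi z = Polygamma 1 z + deriv zeta_ld z"
      proof -
        have "z \<notin> \<int>\<^sub>\<le>\<^sub>0" using one_minus_slit_plane(1)[OF sp] by (simp add: z_def)
        then have "(Digamma has_field_derivative Polygamma 1 z) (at z)"
          using has_field_derivative_Polygamma[of z 0 UNIV] by simp
        moreover have "(zeta_ld has_field_derivative deriv zeta_ld z) (at z)"
        proof (rule holomorphic_derivI[of _ "{z. Re z > 2}"])
          show "zeta_ld holomorphic_on {z. Re z > 2}"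
            by (rule holomorphic_zeta_ld) (auto dest: zeta_nonzero_Re_ge_2[OF less_imp_le])
          show "z \<in> {z. Re z > 2}" using \<open>Re z > 2\<close> by simp
        qed (rule open_halfspace_Re_gt)
        ultimately have "(Phi has_field_derivative Polygamma 1 z - 0 + deriv zeta_ld z) (at z)"
          unfolding Phi_def[abs_def] by (intro DERIV_add DERIV_diff DERIV_const)
        then show ?thesis by (simp add: DERIV_imp_deriv)
      qed
      then show ?thesis
        unfolding deriv_zeta_ld_functional_equation(1)[OF sp sn zz] d1 d2 z_def by simp
    qed
    \<comment> \<open>The squares of c in q^2 and in q' cancel, which leaves an equation linear in
      c.\<close>
    have "c = W z"
    proof -
      have "(c - p) ^ 2 + (- a - c ^ 2 + d) = 0 \<Longrightarrow> c = p / 2 - (a - d) / (2 * p)" if "p \<noteq> 0" for p a d :: complex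
        using that by (simp add: field_simps power2_eq_square)
      then show ?thesis using V0 P0[OF zH(1)] unfolding q q' W_def by blast
    qed
    then have cot: "cmod (cot u) = 2 / pi * cmod (W z)" "\<bar>Im (cot u)\<bar> = 2 / pi * \<bar>Im (W z)\<bar>"
    proof -
      have "cot u = of_real (2 / pi) * W z" unfolding \<open>c = W z\<close>[symmetric] c_def by simp
      then show "cmod (cot u) = 2 / pi * cmod (W z)" "\<bar>Im (cot u)\<bar> = 2 / pi * \<bar>Im (W z)\<bar>"
        by (simp_all add: norm_mult norm_divide abs_mult)
    qed
    have W900: "cmod (W z) \<ge> 900" by (rule W_ge[OF zH(1)])
    have cot_ge: "cmod (cot u) \<ge> 450"
    proof -
      have "2 / pi \<ge> 1 / 2" using pi_less_4 by (simp add: field_simps)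
      then have "1 / 2 * 900 \<le> 2 / pi * cmod (W z)" using W900 by (intro mult_mono) auto
      then show ?thesis by (simp add: cot)
    qed
    show False
    \<comment> \<open>High up, cot u is close to - i and cannot be large. Near the real axis the
      lower bound for Im (cot u) and the upper bound \<open>ImW\<close> are both proportional to y;
      dividing by y bounds cot u.\<close>
    proof (cases "y \<ge> 1")
      case True
      have "pi / 2 \<le> Im u" using True by (simp add: Imu)
      then have "cmod (cot u + \<i>) \<le> 4 * exp (- 2 * Im u)" by (rule cot_upper_half_plane)
      also have "\<dots> \<le> 4 * 1" using True by (intro mult_left_mono) (auto simp: Imu)
      finally have "cmod (cot u) \<le> 5" using norm_triangle_ineq2[of "cot u" "-\<i>"] by simp
      then show False using cot_ge by simp
    next
      case False
      have "exp (- 4 * Im u) \<le> 1 - y / 2"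
      proof -
        have "exp (- (2 * pi * y)) \<le> 1 / (1 + 2 * pi * y)"
          using exp_ge_add_one_self[of "2 * pi * y"] y by (simp add: exp_minus inverse_eq_divide frac_le add_pos_pos)
        also have "\<dots> \<le> 1 / (1 + 6 * y)"
          using pi_gt3 y by (intro divide_left_mono mult_pos_pos) (auto intro!: mult_right_mono add_pos_pos)
        also have "\<dots> \<le> 1 - y / 2"
        proof -
          have "1 \<le> (1 - y / 2) * (1 + 6 * y)" using y False mult_right_mono[of y 1 y] by (simp add: algebra_simps)
          then show ?thesis using y by (simp add: divide_le_eq)
        qed
        finally show ?thesis by (simp add: Imu mult_ac)
      qed
      then have "y / 2 * cmod (cot u) ^ 2 / 4 \<le> (1 - exp (- 4 * Im u)) * cmod (cot u) ^ 2 / 4"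
        by (intro divide_right_mono mult_right_mono) auto
      also have "\<dots> \<le> \<bar>Im (cot u)\<bar>" by (rule Im_cot_lower_bound) (use y in \<open>simp add: Imu\<close>)
      also have "\<dots> \<le> 1 * (100 * y)"
        unfolding cot using ImW pi_gt3 by (intro mult_mono) (auto simp: divide_le_eq)
      finally have "cmod (cot u) ^ 2 \<le> 800" using y by simp
      moreover have "450 ^ 2 \<le> cmod (cot u) ^ 2" using cot_ge by (intro power_mono) auto
      ultimately show False by simp
    qed
  qed
  then show ?thesis by blast
qed

section \<open>The factor of the functional equation\<close>

text \<open>A convex set inside the slit plane, so chi has a holomorphic logarithm on it; the height
  2 is that of \<open>chi_logderiv_asymptotic\<close>.\<close>

abbreviation chi_region :: "complex set" where
  "chi_region \<equiv> {s. Re s < 1 \<and> Im s > 2}"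

lemma chi_region: "open chi_region" "convex chi_region" "chi_region \<subseteq> slit_plane"
  "s \<in> chi_region \<Longrightarrow> sin (of_real pi * s / 2) \<noteq> 0"
proof -
  have "chi_region = {s. Re s < 1} \<inter> {s. Im s > 2}" by auto
  then show "open chi_region" "convex chi_region"
    using open_halfspace_Re_lt open_halfspace_Im_gt convex_halfspace_Re_lt convex_halfspace_Im_gt
    by (simp_all add: open_Int convex_Int)
  show "chi_region \<subseteq> slit_plane"
  proof
    fix s assume "s \<in> chi_region"
    then have "Im s \<noteq> 0 \<or> Re s < 0" by auto
    then show "s \<in> slit_plane" using slit_plane_iff by blast
  qed
  show "s \<in> chi_region \<Longrightarrow> sin (of_real pi * s / 2) \<noteq> 0"
    by (rule sin_pi_half_nonzero) auto
qed

lemma chi_log_exists: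
  obtains L where "L holomorphic_on chi_region" "\<And>s. s \<in> chi_region \<Longrightarrow> chi s = exp (L s)"
    "\<And>s. s \<in> chi_region \<Longrightarrow> (L has_field_derivative chi_logderiv s) (at s)"
proof -
  have der: "(chi has_field_derivative chi s * chi_logderiv s) (at s)" and nz: "chi s \<noteq> 0"
    if "s \<in> chi_region" for s
    using chi_has_derivative[of s] chi_nonzero[of s] chi_region(3,4) that by blast+
  have hol: "chi holomorphic_on chi_region"
    using der chi_region(1) by (auto simp: holomorphic_on_open)
  obtain L where L: "L holomorphic_on chi_region" "\<And>s. s \<in> chi_region \<Longrightarrow> exp (L s) = chi s"
    by (rule holomorphic_logarithm_exists[OF chi_region(2,1) hol nz, of "3 * \<i>"]) auto
  have "(L has_field_derivative chi_logderiv s) (at s)" if s: "s \<in> chi_region" for s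
  proof -
    have d: "(L has_field_derivative deriv L s) (at s)" using L(1) chi_region(1) s by (rule holomorphic_derivI)
    then have "((\<lambda>s. exp (L s)) has_field_derivative exp (L s) * deriv L s) (at s)"
      by (rule DERIV_chain2[OF DERIV_exp])
    then have "(chi has_field_derivative exp (L s) * deriv L s) (at s)"
      by (rule has_field_derivative_transform_within_open[OF _ chi_region(1) s]) (rule L(2))
    then have "exp (L s) * deriv L s = chi s * chi_logderiv s" using der[OF s] DERIV_unique by blast
    then have "deriv L s = chi_logderiv s" using L(2)[OF s] nz[OF s] by simp
    then show ?thesis using d by simp
  qed
  then show ?thesis using that[of L] L by simp
qed

text \<open>In a strip of fixed width Ln (1 - s) is ln (Im s) + O(1). The derivative is estimated by
  the Cauchy inequality on a disc of radius 1/2, for which Re s <= 1/2 and Im s >= 3 leave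
  room.\<close>

lemma chi_logderiv_bounds:
  assumes b: "b \<ge> 0"
  shows "\<exists>C>0. \<forall>s. - b \<le> Re s \<and> Re s \<le> 1/2 \<and> Im s \<ge> 3 \<longrightarrow>
    cmod (chi_logderiv s + of_real (ln (Im s))) \<le> C \<and> cmod (deriv chi_logderiv s) \<le> C"
proof -
  define C where "C = 100 + (b + 2) ^ 2"
  have bd: "cmod (chi_logderiv s + Ln (1 - s)) \<le> 45" if s: "Re s \<le> 1" "Im s \<ge> 2" for s
  proof -
    have "cmod (chi_logderiv s - (of_real (ln (2 * pi)) - \<i> * of_real (pi / 2) - Ln (1 - s) + 1 / (2 * (1 - s)))) \<le> 30 / (Im s) ^ 2"
      using s by (rule chi_logderiv_asymptotic)
    also have "\<dots> \<le> 30 / 2 ^ 2" using s by (intro divide_left_mono power_mono) auto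
    finally have 1: "cmod (chi_logderiv s - (of_real (ln (2 * pi)) - \<i> * of_real (pi / 2) - Ln (1 - s) + 1 / (2 * (1 - s)))) \<le> 8" by simp
    have 2: "cmod (of_real (ln (2 * pi)) :: complex) \<le> 7"
    proof -
      have "ln (2 * pi) \<le> 2 * pi - 1" using ln_le_minus_one[of "2 * pi"] by simp
      moreover have "ln (2 * pi) \<ge> 0" using pi_gt3 by (intro ln_ge_zero) auto
      ultimately show ?thesis using pi_less_4 by simp
    qed
    have 3: "cmod (\<i> * of_real (pi / 2)) \<le> 2" using pi_less_4 by (simp add: norm_mult norm_divide)
    have "cmod (1 - s) \<ge> 2" using abs_Im_le_cmod[of "1 - s"] s by simp
    then have 4: "cmod (1 / (2 * (1 - s))) \<le> 1"
      by (simp only: norm_divide norm_mult norm_one norm_numeral) (simp add: divide_le_eq)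
    have "cmod (x + a - i + h) \<le> cmod x + cmod a + cmod i + cmod h" for x a i h :: complex
      using norm_triangle_ineq[of x a] norm_triangle_ineq4[of "x + a" i] norm_triangle_ineq[of "x + a - i" h] by linarith
    from this[of "chi_logderiv s - (of_real (ln (2 * pi)) - \<i> * of_real (pi / 2) - Ln (1 - s) + 1 / (2 * (1 - s)))"
       "of_real (ln (2 * pi))" "\<i> * of_real (pi / 2)" "1 / (2 * (1 - s))"]
    have "cmod (chi_logderiv s + Ln (1 - s)) \<le> 8 + 7 + 2 + 1"
      using 1 2 3 4 by simp
    then show ?thesis by simp
  qed
  have "cmod (chi_logderiv s + of_real (ln (Im s))) \<le> C \<and> cmod (deriv chi_logderiv s) \<le> C"
    if s: "- b \<le> Re s" "Re s \<le> 1/2" "Im s \<ge> 3" for s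
  proof
    define t where "t = Im s"
    have t: "t \<ge> 3" using s by (simp add: t_def)
    have c0: "1 - s \<noteq> 0" using s by auto
    have "cmod (Ln (1 - s) - of_real (ln t)) \<le> (b + 2) ^ 2 + 4"
    proof -
      have "Ln (1 - s) - of_real (ln t) = of_real (ln (cmod (1 - s)) - ln t) + \<i> * of_real (Im (Ln (1 - s)))"
        using c0 by (simp add: complex_eq_iff)
      also have "cmod \<dots> \<le> \<bar>ln (cmod (1 - s)) - ln t\<bar> + \<bar>Im (Ln (1 - s))\<bar>"
        by (rule norm_triangle_le) (simp add: norm_mult del: of_real_diff Im_Ln_eq)
      also have "\<bar>Im (Ln (1 - s))\<bar> \<le> 4"
        using mpi_less_Im_Ln[OF c0] Im_Ln_le_pi[OF c0] pi_less_4 by linarith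
      also have "\<bar>ln (cmod (1 - s)) - ln t\<bar> \<le> (b + 2) ^ 2"
      proof -
        have ge: "cmod (1 - s) \<ge> t" using abs_Im_le_cmod[of "1 - s"] t by (simp add: t_def)
        have "cmod (1 - s) \<le> \<bar>Re (1 - s)\<bar> + \<bar>Im (1 - s)\<bar>" by (rule cmod_le)
        also have "\<dots> \<le> (b + 1) + t" using s by (simp add: t_def)
        also have "\<dots> \<le> t * (1 + (b + 1))" using t b mult_right_mono[of 1 t "b + 1"] by (simp add: algebra_simps)
        finally have "cmod (1 - s) / t \<le> 1 + (b + 1)" using t by (simp add: divide_le_eq mult.commute)
        then have "ln (cmod (1 - s) / t) \<le> b + 1"
          using ln_add_one_self_le_self2[of "b + 1"] b ge t
          by (smt (verit, best) divide_pos_pos ln_mono)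
        moreover have "ln (cmod (1 - s) / t) = ln (cmod (1 - s)) - ln t" using c0 t by (simp add: ln_div)
        moreover have "ln t \<le> ln (cmod (1 - s))" using ge t by (intro ln_mono) auto
        moreover have "b + 1 \<le> (b + 2) ^ 2" using b by (simp add: power2_eq_square algebra_simps)
        ultimately show ?thesis by simp
      qed
      finally show ?thesis by simp
    qed
    moreover have "cmod (chi_logderiv s + Ln (1 - s)) \<le> 45" using s by (intro bd) auto
    ultimately show "cmod (chi_logderiv s + of_real (ln (Im s))) \<le> C"
      using norm_triangle_ineq4[of "chi_logderiv s + Ln (1 - s)" "Ln (1 - s) - of_real (ln t)"]
      by (simp add: C_def t_def)
    define g where "g = (\<lambda>s. chi_logderiv s + Ln (1 - s))"
    have inb: "w \<in> chi_region" "Re w \<le> 1" "Im w \<ge> 2" if "w \<in> ball s (1/2)" for w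
      using ball_Re_Im[OF that] s by auto
    have "chi_logderiv field_differentiable at w" if "w \<in> chi_region" for w
    proof -
      have "w \<in> slit_plane" using chi_region(3) that by blast
      then show ?thesis
        unfolding chi_logderiv_def[abs_def] cot_def field_differentiable_def
        using one_minus_slit_plane(1)[of w] chi_region(4)[OF that] by (auto intro!: exI derivative_eq_intros)
    qed
    then have hl: "chi_logderiv holomorphic_on ball s (1/2)"
      using inb(1) by (auto simp: holomorphic_on_def intro: field_differentiable_at_within)
    have nr: "1 - w \<notin> \<real>\<^sub>\<le>\<^sub>0" if "w \<in> ball s (1/2)" for w
      using inb(3)[OF that] by (auto simp: complex_nonpos_Reals_iff)
    have "g holomorphic_on ball s (1/2)"
      unfolding g_def using nr by (intro holomorphic_intros hl) auto
    then have "cmod ((deriv ^^ 1) g s) \<le> fact 1 * 45 / (1/2) ^ 1"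
      by (rule cmod_deriv_le) (use inb(2,3) bd in \<open>auto simp: g_def\<close>)
    then have "cmod (deriv g s) \<le> 90" by simp
    moreover have "deriv g s = deriv chi_logderiv s - 1 / (1 - s)"
    proof -
      have "(chi_logderiv has_field_derivative deriv chi_logderiv s) (at s)"
        by (rule holomorphic_derivI[OF hl]) auto
      moreover have "((\<lambda>s. Ln (1 - s)) has_field_derivative - 1 / (1 - s)) (at s)"
        using nr[of s] by (auto intro!: derivative_eq_intros simp: inverse_eq_divide)
      ultimately have "(g has_field_derivative deriv chi_logderiv s + - 1 / (1 - s)) (at s)"
        unfolding g_def by (rule DERIV_add)
      then show ?thesis by (simp add: DERIV_imp_deriv)
    qed
    moreover have "cmod (1 / (1 - s)) \<le> 1"
    proof -
      have "cmod (1 - s) \<ge> 3" using abs_Im_le_cmod[of "1 - s"] s by simp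
      then show ?thesis by (simp only: norm_divide norm_one) (simp add: divide_le_eq)
    qed
    ultimately have "cmod (deriv chi_logderiv s - 1 / (1 - s)) \<le> 90" "cmod (1 / (1 - s)) \<le> 1" by simp_all
    then show "cmod (deriv chi_logderiv s) \<le> C"
      using norm_triangle_ineq2[of "deriv chi_logderiv s" "1 / (1 - s)"] zero_le_power2[of "b + 2"] unfolding C_def
      by linarith
  qed
  moreover have "C > 0" by (simp add: C_def add_pos_nonneg)
  ultimately show ?thesis by blast
qed

text \<open>Adding ln (Im u) * s to the logarithm of chi gives a function with bounded derivative on
  the segment. Its imaginary part controls the argument, its real part the growth of chi to the
  left.\<close>

lemma chi_horizontal:
  assumes b: "b \<ge> 0"
  shows "\<exists>C>0. \<forall>u v. - b \<le> Re u \<and> Re u \<le> Re v \<and> Re v \<le> 1/2 \<and> Im u \<ge> 3 \<and> Im v = Im u \<longrightarrow>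
     arg_change_le chi u v C \<and> cmod (chi u) \<le> cmod (chi v) * exp ((Re v - Re u) * (ln (Im u) + C))"
proof -
  obtain C where C: "C > 0" "\<And>s. - b \<le> Re s \<Longrightarrow> Re s \<le> 1/2 \<Longrightarrow> Im s \<ge> 3 \<Longrightarrow> cmod (chi_logderiv s + of_real (ln (Im s))) \<le> C"
    using chi_logderiv_bounds[OF b] by blast
  obtain L where L: "L holomorphic_on chi_region" "\<And>s. s \<in> chi_region \<Longrightarrow> chi s = exp (L s)"
    "\<And>s. s \<in> chi_region \<Longrightarrow> (L has_field_derivative chi_logderiv s) (at s)"
  proof (rule chi_log_exists, goal_cases)
    case (1 L)
    show ?case by (rule 1(1)) (fact 1)+
  qed
  have "arg_change_le chi u v (C * (b + 1)) \<and> cmod (chi u) \<le> cmod (chi v) * exp ((Re v - Re u) * (ln (Im u) + C * (b + 1)))"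
    if uv: "- b \<le> Re u" "Re u \<le> Re v" "Re v \<le> 1/2" "Im u \<ge> 3" "Im v = Im u" for u v
  proof -
    define l where "l = ln (Im u)"
    have seg: "- b \<le> Re s \<and> Re s \<le> 1/2 \<and> Im s = Im u" if "s \<in> closed_segment u v" for s
      using that closed_segment_same_Im[of u v] uv by (auto simp: closed_segment_eq_real_ivl)
    have sub: "closed_segment u v \<subseteq> chi_region"
    proof
      fix s assume "s \<in> closed_segment u v"
      then show "s \<in> chi_region" using seg[of s] uv by simp
    qed
    have "cmod ((L v + of_real l * v) - (L u + of_real l * u)) \<le> C * cmod (v - u)"
    proof (rule field_differentiable_bound[OF convex_closed_segment[of u v]])
      fix s assume s: "s \<in> closed_segment u v"
      then have "s \<in> chi_region" using sub by blast
      then have "((\<lambda>s. L s + of_real l * s) has_field_derivative chi_logderiv s + of_real l * 1) (at s)"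
        by (intro DERIV_add L(3) DERIV_cmult DERIV_ident)
      then show "((\<lambda>s. L s + of_real l * s) has_field_derivative chi_logderiv s + of_real l) (at s within closed_segment u v)"
        by (simp add: has_field_derivative_at_within)
      show "cmod (chi_logderiv s + of_real l) \<le> C" using C(2)[of s] seg[OF s] uv by (simp add: l_def)
    qed auto
    moreover have vu: "v - u = of_real (Re v - Re u)" using uv by (simp add: complex_eq_iff)
    have nvu: "cmod (v - u) = Re v - Re u" unfolding vu norm_of_real using uv by simp
    define d where "d = L v - L u + of_real (l * (Re v - Re u))"
    moreover have "(L v + of_real l * v) - (L u + of_real l * u) = d"
    proof -
      have "(L v + of_real l * v) - (L u + of_real l * u) = L v - L u + of_real l * (v - u)" by (simp add: algebra_simps)
      then show ?thesis unfolding vu d_def by simp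
    qed
    ultimately have d: "cmod d \<le> C * (Re v - Re u)" by (simp only: nvu)
    have le: "C * (Re v - Re u) \<le> C * (b + 1)" using uv C by (intro mult_left_mono) auto
    have 1: "arg_change_le chi u v (C * (b + 1))"
    proof (rule arg_change_le_mono[OF arg_change_le_exp[OF chi_region(1) L(1) sub L(2)]])
      have "Im (L v - L u) = Im d" by (simp add: d_def)
      then show "\<bar>Im (L v - L u)\<bar> \<le> C * (b + 1)" using d le abs_Im_le_cmod[of d] by linarith
    qed
    have "Re (L u) - Re (L v) = l * (Re v - Re u) - Re d" by (simp add: d_def)
    also have "\<dots> \<le> l * (Re v - Re u) + C * (Re v - Re u)" using d abs_Re_le_cmod[of d] by linarith
    also have "\<dots> \<le> (Re v - Re u) * (l + C * (b + 1))"
      using uv C b mult_left_mono[of 1 "b + 1" C] mult_right_mono[of C "C * (b + 1)" "Re v - Re u"] by (simp add: algebra_simps)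
    finally have "Re (L u) \<le> Re (L v) + (Re v - Re u) * (l + C * (b + 1))" by simp
    then have "exp (Re (L u)) \<le> exp (Re (L v)) * exp ((Re v - Re u) * (l + C * (b + 1)))" by (simp flip: exp_add)
    moreover have "u \<in> chi_region" "v \<in> chi_region" using sub by auto
    ultimately have "cmod (chi u) \<le> cmod (chi v) * exp ((Re v - Re u) * (l + C * (b + 1)))"
      by (simp add: L(2))
    with 1 show ?thesis by (simp add: l_def)
  qed
  moreover have "C * (b + 1) > 0" using C b by simp
  ultimately show ?thesis by blast
qed

text \<open>Here 1 - s = cnj s, so the identity chi s * chi (1 - s) = 1 becomes chi s * cnj (chi s)
  = 1.\<close>

lemma cmod_chi_critical_line:
  assumes "Re s = 1/2" "Im s \<noteq> 0"
  shows "cmod (chi s) = 1"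
proof -
  have "1 - s = cnj s" using assms by (simp add: complex_eq_iff)
  have "s \<in> slit_plane" "1 - s \<in> slit_plane" unfolding slit_plane_iff using assms by simp_all
  have G: "Gamma s * Gamma (1 - s) = of_real pi / sin (of_real pi * s)" by (rule Gamma_reflection_complex)
  have sc: "sin (of_real pi * s) = 2 * sin (of_real pi * s / 2) * cos (of_real pi * s / 2)"
    using sin_double[of "of_real pi * s / 2"] by simp
  have snz: "sin (of_real pi * s) \<noteq> 0"
    using sin_pi_half_nonzero[of "2 * s"] assms by simp
  have "chi s * chi (1 - s) = 1"
  proof -
    have c: "sin (of_real pi * (1 - s) / 2) = cos (of_real pi * s / 2)"
    proof -
      have "of_real pi * (1 - s) / 2 = of_real pi / 2 - of_real pi * s / 2" by (simp add: algebra_simps diff_divide_distrib)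
      then show ?thesis by (simp only: cos_sin_eq)
    qed
    have p: "(of_real (2 * pi) :: complex) powr (s - 1) * of_real (2 * pi) powr (1 - s - 1) = 1 / of_real (2 * pi)"
    proof -
      have "(of_real (2 * pi) :: complex) powr (s - 1) * of_real (2 * pi) powr (1 - s - 1) = of_real (2 * pi) powr (- 1)"
        by (simp only: powr_add[symmetric]) (simp add: algebra_simps)
      then show ?thesis by (simp add: powr_minus_divide)
    qed
    have "chi s * chi (1 - s) = 4 * (of_real (2 * pi) powr (s - 1) * of_real (2 * pi) powr (1 - s - 1)) *
       (sin (of_real pi * s / 2) * cos (of_real pi * s / 2)) * (Gamma s * Gamma (1 - s))"
      unfolding chi_def c by simp
    also have "\<dots> = 1"
      unfolding p G using snz unfolding sc by (simp add: field_simps)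
    finally show ?thesis .
  qed
  moreover have "chi (cnj s) = cnj (chi s)"
  proof -
    have "cnj (complex_of_real (2 * pi) powr (s - 1)) = of_real (2 * pi) powr (cnj s - 1)"
      by (subst cnj_powr) auto
    moreover have "cnj (sin (of_real pi * s / 2)) = sin (of_real pi * cnj s / 2)" by (simp add: cnj_sin)
    ultimately show ?thesis unfolding chi_def by (simp add: cnj_Gamma)
  qed
  ultimately have "chi s * cnj (chi s) = 1" using \<open>1 - s = cnj s\<close> by simp
  then have "of_real (cmod (chi s) ^ 2) = (1 :: complex)" by (simp only: complex_norm_square)
  then have "cmod (chi s) ^ 2 = 1" by (simp only: of_real_eq_1_iff)
  then show ?thesis by (simp add: power2_eq_1_iff) (metis norm_ge_zero not_one_le_zero neg_0_le_iff_le order_trans)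
qed

text \<open>A primitive of the main term of the logarithmic derivative of chi.\<close>

definition chi_main :: "complex \<Rightarrow> complex" where
  "chi_main s = (of_real (ln (2 * pi)) - \<i> * of_real (pi / 2)) * s + (1 - s) * Ln (1 - s) + s - Ln (1 - s) / 2"

lemma chi_main_has_derivative:
  assumes "s \<in> chi_region"
  shows "(chi_main has_field_derivative
    (of_real (ln (2 * pi)) - \<i> * of_real (pi / 2) - Ln (1 - s) + 1 / (2 * (1 - s)))) (at s)"
proof -
  have nr: "1 - s \<notin> \<real>\<^sub>\<le>\<^sub>0" using assms by (auto simp: complex_nonpos_Reals_iff)
  then have "1 - s \<noteq> 0" by auto
  have L: "((\<lambda>s. Ln (1 - s)) has_field_derivative - 1 / (1 - s)) (at s)"
    using nr by (auto intro!: derivative_eq_intros simp: inverse_eq_divide)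
  have "(chi_main has_field_derivative ((of_real (ln (2 * pi)) - \<i> * of_real (pi / 2)) * 1
     + (- 1 * Ln (1 - s) + - 1 / (1 - s) * (1 - s)) + 1 - (- 1 / (1 - s)) / 2)) (at s)"
    unfolding chi_main_def[abs_def]
    by (intro DERIV_add DERIV_diff DERIV_cmult DERIV_ident DERIV_mult L DERIV_cdivide) (auto intro!: derivative_eq_intros)
  then show ?thesis by (rule DERIV_cong) (use \<open>1 - s \<noteq> 0\<close> in simp)
qed

text \<open>The logarithm of chi minus \<open>chi_main\<close> has derivative at most 30 / t^2 along
  the edge; adding or subtracting 30 / t makes its imaginary part monotone. The 10 is 30 /
  3.\<close>

lemma chi_vertical:
  assumes t0: "3 \<le> t0" "t0 \<le> T" and b: "b > 0"
  shows "arg_change_le (\<lambda>s. chi s * exp (- chi_main s)) (Complex (-b) t0) (Complex (-b) T) 10"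
proof -
  obtain L where L: "L holomorphic_on chi_region" "\<And>s. s \<in> chi_region \<Longrightarrow> chi s = exp (L s)"
    "\<And>s. s \<in> chi_region \<Longrightarrow> (L has_field_derivative chi_logderiv s) (at s)"
  proof (rule chi_log_exists, goal_cases)
    case (1 L)
    show ?case by (rule 1(1)) (fact 1)+
  qed
  define h where "h = (\<lambda>s. L s - chi_main s)"
  define h' where "h' = (\<lambda>s. chi_logderiv s - (of_real (ln (2 * pi)) - \<i> * of_real (pi / 2) - Ln (1 - s) + 1 / (2 * (1 - s))))"
  have dh: "(h has_field_derivative h' s) (at s)" if "s \<in> chi_region" for s
    unfolding h_def h'_def using that by (intro DERIV_diff L(3) chi_main_has_derivative)
  have hol: "h holomorphic_on chi_region" using dh chi_region(1) by (auto simp: holomorphic_on_open)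
  define \<phi> where "\<phi> = (\<lambda>t. Im (h (Complex (-b) t)))"
  have d\<phi>: "(\<phi> has_real_derivative Re (h' (Complex (-b) t))) (at t)" if t: "t \<ge> t0" for t
  proof -
    have "Complex (-b) t \<in> chi_region" using t t0 b by simp
    note dh = dh[OF this]
    have "((\<lambda>t. Complex (-b) t) has_vector_derivative \<i>) (at t)"
    proof -
      have "((\<lambda>t. of_real (-b) + \<i> * of_real t) has_vector_derivative \<i>) (at t)"
        by (auto intro!: derivative_eq_intros)
      moreover have "(\<lambda>t. Complex (-b) t) = (\<lambda>t. of_real (-b) + \<i> * of_real t)" by (auto simp: complex_eq_iff)
      ultimately show ?thesis by simp
    qed
    from field_vector_diff_chain_at[OF this dh]
    have "((\<lambda>t. h (Complex (-b) t)) has_vector_derivative \<i> * h' (Complex (-b) t)) (at t)" by (simp add: o_def)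
    from bounded_linear.has_vector_derivative[OF bounded_linear_Im this]
    show ?thesis unfolding \<phi>_def has_real_derivative_iff_has_vector_derivative by simp
  qed
  have bd: "\<bar>Re (h' (Complex (-b) t))\<bar> \<le> 30 / t ^ 2" if t: "t \<ge> t0" for t
  proof -
    have "cmod (h' (Complex (-b) t)) \<le> 30 / (Im (Complex (-b) t)) ^ 2"
      unfolding h'_def using t t0 b by (intro chi_logderiv_asymptotic) auto
    then show ?thesis using abs_Re_le_cmod[of "h' (Complex (-b) t)"] by simp
  qed
  have di: "((\<lambda>t. 30 / t) has_real_derivative - (30 / t ^ 2)) (at t)" if "t \<ge> t0" for t
    using that t0 by (auto intro!: derivative_eq_intros simp: power2_eq_square)
  have "\<phi> T + 30 / T \<le> \<phi> t0 + 30 / t0"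
  proof (rule DERIV_nonpos_imp_nonincreasing[OF t0(2)])
    fix x assume "t0 \<le> x" "x \<le> T"
    then show "\<exists>y. ((\<lambda>t. \<phi> t + 30 / t) has_real_derivative y) (at x) \<and> y \<le> 0"
      using DERIV_add[OF d\<phi>[of x] di[of x]] bd[of x] by (intro exI conjI) auto
  qed
  moreover have "\<phi> t0 - 30 / t0 \<le> \<phi> T - 30 / T"
  proof (rule DERIV_nonneg_imp_nondecreasing[OF t0(2)])
    fix x assume "t0 \<le> x" "x \<le> T"
    then show "\<exists>y. ((\<lambda>t. \<phi> t - 30 / t) has_real_derivative y) (at x) \<and> y \<ge> 0"
      using DERIV_diff[OF d\<phi>[of x] di[of x]] bd[of x] by (intro exI conjI) auto
  qed
  moreover have "30 / T \<ge> 0" "30 / t0 \<le> 10" using t0 by (auto simp: divide_le_eq)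
  ultimately have "\<bar>\<phi> T - \<phi> t0\<bar> \<le> 10" by linarith
  moreover have "closed_segment (Complex (-b) t0) (Complex (-b) T) \<subseteq> chi_region"
    using t0 b by (intro closed_segment_subset chi_region(2)) auto
  moreover have "chi s * exp (- chi_main s) = exp (h s)" if "s \<in> chi_region" for s
    using L(2)[OF that] by (simp add: h_def flip: exp_add)
  ultimately show ?thesis
    by (intro arg_change_le_mono[OF arg_change_le_exp[OF chi_region(1) hol]]) (auto simp: \<phi>_def)
qed

text \<open>With w = 1 - s, the terms that grow are T * ln (2 * pi) - T * ln (cmod w) + T, and ln
  (cmod w) exceeds ln T only by O(1 / T^2).\<close>

lemma chi_main_Im:
  assumes b: "b > 0"
  shows "\<exists>C. \<forall>T\<ge>3. \<bar>Im (chi_main (Complex (-b) T)) + (T * ln (T / (2 * pi)) - T)\<bar> \<le> C"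
proof -
  define C where "C = pi / 2 * b + (1 + b) * 4 + (1 + b) ^ 2 + 4"
  have "\<bar>Im (chi_main (Complex (-b) T)) + (T * ln (T / (2 * pi)) - T)\<bar> \<le> C" if T: "T \<ge> 3" for T
  proof -
    define w where "w = 1 - Complex (-b) T"
    define a where "a = Im (Ln w)"
    have w: "Re w = 1 + b" "Im w = - T" by (simp_all add: w_def)
    have w0: "w \<noteq> 0" using w T by auto
    have a: "\<bar>a\<bar> \<le> 4" using mpi_less_Im_Ln[OF w0] Im_Ln_le_pi[OF w0] pi_less_4 by (auto simp: a_def)
    have re: "Re (Ln w) = ln (cmod w)" using w0 by simp
    have "Im (chi_main (Complex (-b) T)) = ln (2 * pi) * T + pi / 2 * b + ((1 + b) * a - T * ln (cmod w)) + T - a / 2"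
      using re unfolding chi_main_def w_def[symmetric] by (simp add: w a_def[symmetric] del: Re_Ln Im_Ln_eq)
    moreover have "T * ln (T / (2 * pi)) = T * ln T - T * ln (2 * pi)"
      using T by (simp add: ln_div right_diff_distrib)
    ultimately have eq: "Im (chi_main (Complex (-b) T)) + (T * ln (T / (2 * pi)) - T)
       = pi / 2 * b + (1 + b) * a - (T * ln (cmod w) - T * ln T) - a / 2"
      by (simp add: algebra_simps)
    have "T * ln (cmod w) - T * ln T = T / 2 * ln (cmod w ^ 2 / T ^ 2)"
      using T w0 by (simp add: ln_div ln_realpow field_simps)
    also have "cmod w ^ 2 / T ^ 2 = 1 + ((1 + b) / T) ^ 2"
      using T by (simp add: cmod_power2 w field_simps power_divide)
    finally have e2: "T * ln (cmod w) - T * ln T = T / 2 * ln (1 + ((1 + b) / T) ^ 2)" .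
    have "0 \<le> ln (1 + ((1 + b) / T) ^ 2)" by (intro ln_ge_zero) simp
    moreover have "ln (1 + ((1 + b) / T) ^ 2) \<le> ((1 + b) / T) ^ 2"
      by (rule ln_add_one_self_le_self) simp
    ultimately have "0 \<le> T / 2 * ln (1 + ((1 + b) / T) ^ 2)" "T / 2 * ln (1 + ((1 + b) / T) ^ 2) \<le> T / 2 * ((1 + b) / T) ^ 2"
      using T by (auto intro!: mult_left_mono)
    moreover have "T / 2 * ((1 + b) / T) ^ 2 \<le> (1 + b) ^ 2"
    proof -
      have "T / 2 * ((1 + b) / T) ^ 2 = (1 + b) ^ 2 / (2 * T)" using T by (simp add: power2_eq_square)
      also have "\<dots> \<le> (1 + b) ^ 2 / 1" using T by (intro divide_left_mono) auto
      finally show ?thesis by simp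
    qed
    ultimately have r: "\<bar>T * ln (cmod w) - T * ln T\<bar> \<le> (1 + b) ^ 2" unfolding e2 by linarith
    have "\<bar>(1 + b) * a\<bar> \<le> (1 + b) * 4" using mult_left_mono[OF a, of "1 + b"] b by (simp add: abs_mult)
    moreover have "pi / 2 * b \<ge> 0" using b by simp
    ultimately show ?thesis unfolding eq C_def using r a by linarith
  qed
  then show ?thesis by blast
qed

section \<open>Bounds under the Riemann hypothesis\<close>

lemma RH_zeta_nonzero:
  assumes "riemann_hypothesis" "Re s > 1/2" "Im s \<noteq> 0"
  shows "zeta s \<noteq> 0"
proof (cases "Re s \<ge> 1")
  case True
  then show ?thesis using assms zeta_nonzero_Re_ge_1 by blast
next
  case False
  then show ?thesis using assms unfolding riemann_hypothesis_def by force
qed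

text \<open>The disc touches the critical line, and the Riemann hypothesis keeps it free of zeros.
  Up to radius A - 3 one has Re z >= 3, so k' is at most 7; up to distance \<eta> from the boundary
  Borel-Caratheodory and the polynomial growth of zeta give O(ln T / \<eta>).
  \<open>annulus_bound\<close> combines the two with m still free.\<close>

lemma zeta_local_log:
  assumes RH: "riemann_hypothesis" and A: "A \<ge> 4"
  shows "\<exists>C>0. \<forall>T\<ge>A + 1. \<forall>\<eta> m. 0 < \<eta> \<and> \<eta> < 1/2 \<longrightarrow> (\<exists>k. k holomorphic_on ball (Complex A T) (A - 1/2) \<and>
    (\<forall>z\<in>ball (Complex A T) (A - 1/2). zeta z = zeta (Complex A T) * exp (k z)) \<and>
    (\<forall>z\<in>cball (Complex A T) (A - 1/2 - 2 * \<eta>).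
        cmod (k z) \<le> C * ((A - 1/2) / (A - 3)) ^ m + C * ln T / \<eta> * (1 - \<eta> / A) ^ m))"
proof -
  obtain C1 where C1: "C1 > 0" "\<And>s. -1/2 \<le> Re s \<Longrightarrow> Re s \<le> 2 * A \<Longrightarrow> \<bar>Im s\<bar> \<ge> 1 \<Longrightarrow> cmod (zeta s) \<le> C1 * \<bar>Im s\<bar> ^ 2"
    using zeta_polynomial_bound[of "2 * A"] by blast
  define C0 where "C0 = \<bar>ln (16 * C1)\<bar> + 3"
  define C where "C = 7 * A + 2 * C0 * A"
  have C0: "C0 \<ge> 3" by (simp add: C0_def)
  have "\<exists>k. k holomorphic_on ball (Complex A T) (A - 1/2) \<and>
    (\<forall>z\<in>ball (Complex A T) (A - 1/2). zeta z = zeta (Complex A T) * exp (k z)) \<and>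
    (\<forall>z\<in>cball (Complex A T) (A - 1/2 - 2 * \<eta>).
        cmod (k z) \<le> C * ((A - 1/2) / (A - 3)) ^ m + C * ln T / \<eta> * (1 - \<eta> / A) ^ m)"
    if T: "T \<ge> A + 1" and \<eta>: "0 < \<eta>" "\<eta> < 1/2" for T \<eta> m
  proof -
    define c where "c = Complex A T"
    define R where "R = A - 1/2"
    have inb: "Re z > 1/2" "Re z \<le> 2 * A" "Im z \<ge> 1" "Im z \<le> 2 * T" if "z \<in> ball c R" for z
      using ball_Re_Im[OF that] A T by (auto simp: c_def R_def)
    have n1: "1 \<notin> ball c R" using inb(3)[of 1] by auto
    have nz: "zeta z \<noteq> 0" if "z \<in> ball c R" for z
      using RH_zeta_nonzero[OF RH, of z] inb[OF that] by auto
    have zc4: "cmod (zeta c) \<ge> 1/4"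
      using zeta_minus_one_le[of c] A norm_triangle_ineq2[of 1 "1 - zeta c"] by (simp add: c_def norm_minus_commute)
    then have zc: "zeta c \<noteq> 0" by auto
    have hol: "(\<lambda>z. zeta z / zeta c) holomorphic_on ball c R"
      using zc n1 by (intro holomorphic_intros holomorphic_zeta) auto
    have R0: "R > 0" using A by (simp add: R_def)
    have "\<exists>k. k holomorphic_on ball c R \<and> k c = 0 \<and> (\<forall>z\<in>ball c R. exp (k z) = zeta z / zeta c)"
    proof -
      obtain l where l: "l holomorphic_on ball c R" "\<And>z. z \<in> ball c R \<Longrightarrow> exp (l z) = zeta z / zeta c"
        by (rule holomorphic_logarithm_exists[OF convex_ball open_ball hol, of c]) (use nz zc R0 in auto)
      have "exp (l c) = 1" using l(2)[of c] R0 zc by simp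
      then show ?thesis using l
        by (intro exI[of _ "\<lambda>z. l z - l c"]) (auto simp: exp_diff intro!: holomorphic_intros)
    qed
    then obtain k where k: "k holomorphic_on ball c R" "k c = 0" "\<And>z. z \<in> ball c R \<Longrightarrow> exp (k z) = zeta z / zeta c"
      by blast
    have lnT: "ln T \<ge> 1"
      using T A exp_le by (subst ln_ge_iff) auto
    define B where "B = C0 * ln T"
    have B0: "B > 0" using C0 lnT by (simp add: B_def)
    have ReB: "Re (k z) < B" if z: "z \<in> ball c R" for z
    proof -
      have "exp (Re (k z)) = cmod (zeta z) / cmod (zeta c)"
        using k(3)[OF z] by (metis norm_divide norm_exp_eq_Re)
      also have "\<dots> \<le> cmod (zeta z) / (1/4)" using zc4 by (intro divide_left_mono) auto
      also have "\<dots> = 4 * cmod (zeta z)" by simp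
      also have "\<dots> \<le> 4 * (C1 * \<bar>Im z\<bar> ^ 2)" using inb[OF z] by (intro mult_left_mono C1(2)) auto
      also have "\<dots> \<le> 4 * (C1 * (2 * T) ^ 2)" using inb[OF z] C1 by (intro mult_left_mono power_mono) auto
      also have "\<dots> = exp (ln (16 * C1) + 2 * ln T)"
        using C1 T A by (simp add: exp_add exp_double power2_eq_square)
      finally have "Re (k z) \<le> ln (16 * C1) + 2 * ln T" by simp
      also have "\<dots> < \<bar>ln (16 * C1)\<bar> * ln T + 3 * ln T"
        using lnT mult_left_mono[of 1 "ln T" "\<bar>ln (16 * C1)\<bar>"] by linarith
      finally show ?thesis by (simp add: B_def C0_def algebra_simps)
    qed
    have dk: "(k has_field_derivative zeta_ld z) (at z)" if z: "z \<in> ball c R" for z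
    proof -
      have d: "(k has_field_derivative deriv k z) (at z)" by (rule holomorphic_derivI[OF k(1) open_ball z])
      then have "((\<lambda>z. exp (k z)) has_field_derivative exp (k z) * deriv k z) (at z)"
        by (rule DERIV_chain2[OF DERIV_exp])
      then have "((\<lambda>z. zeta z / zeta c) has_field_derivative exp (k z) * deriv k z) (at z)"
        by (rule has_field_derivative_transform_within_open[OF _ open_ball z]) (rule k(3))
      moreover have "z \<noteq> 1" using n1 z by auto
      then have "((\<lambda>z. zeta z / zeta c) has_field_derivative deriv zeta z / zeta c) (at z)"
        by (intro DERIV_cdivide) (simp add: zeta_differentiable field_differentiable_derivI)
      ultimately have "exp (k z) * deriv k z = deriv zeta z / zeta c" by (rule DERIV_unique)
      then have "zeta z * deriv k z = deriv zeta z" using zc k(3)[OF z] by simp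
      then show ?thesis using d nz[OF z] unfolding zeta_ld_def by (metis nonzero_mult_div_cancel_left)
    qed
    have M1: "cmod (k z) \<le> 7 * A" if z: "z \<in> cball c (A - 3)" for z
    proof -
      have "cmod (k z - k c) \<le> 7 * cmod (z - c)"
      proof (rule field_differentiable_bound[OF convex_cball[of c "A - 3"]])
        fix w assume w: "w \<in> cball c (A - 3)"
        then have "w \<in> ball c R" by (auto simp: R_def)
        then show "(k has_field_derivative zeta_ld w) (at w within cball c (A - 3))"
          using dk has_field_derivative_at_within by blast
        have "\<bar>Re c - Re w\<bar> \<le> A - 3" using w abs_Re_le_cmod[of "c - w"] by (auto simp: dist_norm)
        then have "Re w \<ge> 3" by (simp add: c_def)
        then show "cmod (zeta_ld w) \<le> 7" by (rule zeta_ld_le)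
      qed (use z A in auto)
      moreover have "cmod (z - c) \<le> A" using z by (auto simp: dist_norm norm_minus_commute)
      ultimately show ?thesis using k(2) by simp
    qed
    have M3: "cmod (k z) \<le> 2 * C0 * A * ln T / \<eta>" if z: "z \<in> cball c (R - \<eta>)" for z
    proof -
      have zb: "z \<in> ball c R" using z \<eta> by auto
      have d: "cmod (z - c) \<le> R - \<eta>" using z by (auto simp: dist_norm norm_minus_commute)
      have "cmod (k z) \<le> 2 * B * cmod (z - c) / (R - cmod (z - c))"
        by (rule Borel_Caratheodory[OF k(1,2) B0 ReB zb])
      also have "\<dots> \<le> 2 * B * A / \<eta>"
        using d \<eta> B0 A by (intro frac_le mult_left_mono) (auto simp: R_def)
      finally show ?thesis by (simp add: B_def mult_ac)
    qed
    have "cmod (k z) \<le> C * ((A - 1/2) / (A - 3)) ^ m + C * ln T / \<eta> * (1 - \<eta> / A) ^ m"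
      if z: "z \<in> cball c (R - 2 * \<eta>)" for z
    proof -
      have "cmod (k z) \<le> 7 * A * ((R - 2 * \<eta>) / (A - 3)) ^ m + 2 * C0 * A * ln T / \<eta> * ((R - 2 * \<eta>) / (R - \<eta>)) ^ m"
        using A \<eta> by (intro annulus_bound[OF k(1) _ _ _ _ M1 M3 z]) (auto simp: R_def)
      also have "\<dots> \<le> C * ((A - 1/2) / (A - 3)) ^ m + C * ln T / \<eta> * (1 - \<eta> / A) ^ m"
      proof (intro add_mono mult_mono power_mono)
        show "(R - 2 * \<eta>) / (A - 3) \<le> (A - 1/2) / (A - 3)" using A \<eta> by (intro divide_right_mono) (auto simp: R_def)
        show "2 * C0 * A * ln T / \<eta> \<le> C * ln T / \<eta>" using A \<eta> lnT
          by (intro divide_right_mono mult_right_mono) (auto simp: C_def)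
        have "(R - 2 * \<eta>) / (R - \<eta>) = 1 - \<eta> / (R - \<eta>)" using A \<eta> by (simp add: R_def field_simps)
        also have "\<dots> \<le> 1 - \<eta> / A" using A \<eta> by (intro diff_left_mono divide_left_mono) (auto simp: R_def)
        finally show "(R - 2 * \<eta>) / (R - \<eta>) \<le> 1 - \<eta> / A" .
      qed (use A \<eta> lnT C0 in \<open>auto simp: R_def C_def\<close>)
      finally show ?thesis .
    qed
    moreover have "zeta z = zeta c * exp (k z)" if "z \<in> ball c R" for z using k(3)[OF that] zc by simp
    ultimately show ?thesis using k(1) unfolding c_def[symmetric] R_def[symmetric] by blast
  qed
  moreover have "C > 0" using A C0 by (simp add: C_def add_pos_pos)
  ultimately show ?thesis by blast
qed

definition width :: "real \<Rightarrow> real" where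
  "width T = 1 / sqrt (ln (ln T))"

text \<open>For x = ln (ln T) and m close to q * x the first term is O(sqrt (ln T)), and the second
  is ln T times sqrt x * exp (- c * sqrt x), because \<eta> * m is of order sqrt x. Both are small
  against ln T / x^2 = width T ^ 4 * ln T. The centres at heights T' near T share the width of T, so
  that the bound can be used uniformly around height T.\<close>

lemma zeta_log_bound:
  assumes RH: "riemann_hypothesis" and A: "A \<ge> 4"
  shows "\<forall>\<^sub>F T in at_top. \<forall>T'. \<bar>T' - T\<bar> \<le> 2 * A \<longrightarrow> (\<exists>k. k holomorphic_on ball (Complex A T') (A - 1/2) \<and>
    (\<forall>z\<in>ball (Complex A T') (A - 1/2). zeta z = zeta (Complex A T') * exp (k z)) \<and>
    (\<forall>z\<in>cball (Complex A T') (A - 1/2 - width T). cmod (k z) \<le> width T ^ 4 * ln T))"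
proof -
  from zeta_local_log[OF RH A] obtain C where C: "C > 0" "\<forall>T\<ge>A + 1. \<forall>\<eta> m. 0 < \<eta> \<and> \<eta> < 1/2 \<longrightarrow> (\<exists>k. k holomorphic_on ball (Complex A T) (A - 1/2) \<and>
    (\<forall>z\<in>ball (Complex A T) (A - 1/2). zeta z = zeta (Complex A T) * exp (k z)) \<and>
    (\<forall>z\<in>cball (Complex A T) (A - 1/2 - 2 * \<eta>).
        cmod (k z) \<le> C * ((A - 1/2) / (A - 3)) ^ m + C * ln T / \<eta> * (1 - \<eta> / A) ^ m))"
    by (elim exE conjE)
  define Q where "Q = (A - 1/2) / (A - 3)"
  have Q: "Q > 1" using A by (simp add: Q_def)
  \<comment> \<open>Chosen so that Q ^ m <= exp (x / 2) for m <= q * x.\<close>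
  define q where "q = 1 / (2 * ln Q)"
  have q: "q > 0" using Q by (simp add: q_def)
  define d where "d = 1 / (2 * A)"
  have d: "d > 0" using A by (simp add: d_def)
  have "\<forall>\<^sub>F x in at_top. x ^ 2 * (C * exp (- (x / 2))) < 1 / 2" using C(1) by real_asymp
  moreover have "\<forall>\<^sub>F x in at_top. x ^ 2 * (4 * C * sqrt x * exp (- ((q * x - 1) * (d / sqrt x)))) < 1 / 2"
  proof -
    define e where "e = q * d"
    have e: "e > 0" using q d by (simp add: e_def)
    have "\<forall>\<^sub>F x in at_top. x ^ 2 * (4 * C * exp d * sqrt x * exp (- (e * sqrt x))) < 1 / 2"
      using e by real_asymp
    then show ?thesis using eventually_ge_at_top[of 1]
    proof eventually_elim
      case (elim x)
      have "(q * x - 1) * (d / sqrt x) = e * sqrt x - d / sqrt x"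
        using elim by (simp add: e_def field_simps)
      moreover have "d / sqrt x \<le> d" using elim d by (simp add: divide_le_eq mult_le_cancel_left1)
      ultimately have "exp (- ((q * x - 1) * (d / sqrt x))) \<le> exp (d - e * sqrt x)" by simp
      also have "\<dots> = exp d * exp (- (e * sqrt x))" by (simp flip: exp_add)
      finally have "x ^ 2 * (4 * C * sqrt x * exp (- ((q * x - 1) * (d / sqrt x)))) \<le> x ^ 2 * (4 * C * sqrt x * (exp d * exp (- (e * sqrt x))))"
        using C(1) elim by (intro mult_left_mono) auto
      then show ?case using elim by (simp add: mult_ac)
    qed
  qed
  ultimately have "\<forall>\<^sub>F x in at_top. C * exp (x / 2) + 4 * C * exp x * sqrt x * exp (- ((q * x - 1) * (d / sqrt x))) \<le> exp x / x ^ 2"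
    using eventually_gt_at_top[of 0]
  proof eventually_elim
    case (elim x)
    have "exp (x / 2) = exp x * exp (- (x / 2))" by (simp flip: exp_add)
    then have "x ^ 2 * (C * exp (x / 2) + 4 * C * exp x * sqrt x * exp (- ((q * x - 1) * (d / sqrt x)))) =
      exp x * (x ^ 2 * (C * exp (- (x / 2))) + x ^ 2 * (4 * C * sqrt x * exp (- ((q * x - 1) * (d / sqrt x)))))"
      by (simp only: distrib_left mult_ac)
    also have "\<dots> \<le> exp x * 1" using elim by (intro mult_left_mono) auto
    finally show ?case using elim by (simp add: pos_le_divide_eq mult.commute)
  qed
  moreover have "filterlim (\<lambda>T::real. ln (ln T)) at_top at_top" by real_asymp
  ultimately have "\<forall>\<^sub>F T::real in at_top. C * exp (ln (ln T) / 2) + 4 * C * exp (ln (ln T)) * sqrt (ln (ln T)) * exp (- ((q * ln (ln T) - 1) * (d / sqrt (ln (ln T))))) \<le> exp (ln (ln T)) / ln (ln T) ^ 2"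
    by (rule eventually_compose_filterlim)
  moreover have "\<forall>\<^sub>F T::real in at_top. T + 2 * A \<le> T ^ 2 \<and> T - 2 * A \<ge> A + 1 \<and> ln (ln T) > 1" 
    by (intro eventually_conj; real_asymp)
  ultimately show ?thesis
  proof eventually_elim
    case (elim T)
    define x where "x = ln (ln T)"
    have x: "x > 1" using elim by (simp add: x_def)
    have T: "T > 1" using elim A by auto
    have ex: "exp x = ln T" using T by (simp add: x_def)
    define \<eta> where "\<eta> = width T / 2"
    have \<eta>x: "\<eta> = 1 / (2 * sqrt x)" by (simp add: \<eta>_def width_def x_def)
    have \<eta>: "0 < \<eta>" "\<eta> < 1/2" using x by (auto simp: \<eta>x)
    define m where "m = nat \<lfloor>q * x\<rfloor>"
    have m: "real m \<le> q * x" "real m \<ge> q * x - 1" using q x by (auto simp: m_def)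
    have 1: "C * Q ^ m \<le> C * exp (x / 2)"
    proof -
      have "Q ^ m = exp (real m * ln Q)" using Q by (simp add: exp_of_nat_mult)
      also have "real m * ln Q \<le> (q * x) * ln Q" using m Q by (intro mult_right_mono) auto
      also have "(q * x) * ln Q = x / 2" using Q by (simp add: q_def)
      finally show ?thesis using C(1) by simp
    qed
    have 2: "C * (2 * exp x) / \<eta> * (1 - \<eta> / A) ^ m \<le> 4 * C * exp x * sqrt x * exp (- ((q * x - 1) * (d / sqrt x)))"
    proof -
      have "(1 - \<eta> / A) ^ m \<le> exp (- (\<eta> / A)) ^ m"
        using \<eta> A exp_ge_add_one_self[of "- (\<eta> / A)"] by (intro power_mono) (auto simp: divide_le_eq)
      also have "\<dots> = exp (- (real m * (\<eta> / A)))" by (simp flip: exp_of_nat_mult)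
      also have "\<dots> \<le> exp (- ((q * x - 1) * (\<eta> / A)))" using m(2) \<eta> A unfolding exp_le_cancel_iff neg_le_iff_le by (intro mult_right_mono) auto
      also have "(q * x - 1) * (\<eta> / A) = (q * x - 1) * (d / sqrt x)" by (simp add: \<eta>x d_def)
      finally have le: "(1 - \<eta> / A) ^ m \<le> exp (- ((q * x - 1) * (d / sqrt x)))" .
      have eq: "C * (2 * exp x) / \<eta> = 4 * C * exp x * sqrt x" by (simp add: \<eta>x)
      have "C * (2 * exp x) / \<eta> * (1 - \<eta> / A) ^ m \<le> C * (2 * exp x) / \<eta> * exp (- ((q * x - 1) * (d / sqrt x)))"
        using C(1) \<eta> by (intro mult_left_mono le) auto
      then show ?thesis unfolding eq .
    qed
    show ?case
    proof (intro allI impI)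
      fix T' assume T': "\<bar>T' - T\<bar> \<le> 2 * A"
      have "T' \<ge> A + 1" using T' elim by linarith
      from C(2)[rule_format, OF this conjI[OF \<eta>], of m] obtain k where k: "k holomorphic_on ball (Complex A T') (A - 1/2)"
        "\<And>z. z\<in>ball (Complex A T') (A - 1/2) \<Longrightarrow> zeta z = zeta (Complex A T') * exp (k z)"
        "\<And>z. z\<in>cball (Complex A T') (A - 1/2 - 2 * \<eta>) \<Longrightarrow>
          cmod (k z) \<le> C * ((A - 1/2) / (A - 3)) ^ m + C * ln T' / \<eta> * (1 - \<eta> / A) ^ m"
        by blast
      have "cmod (k z) \<le> width T ^ 4 * ln T" if z: "z \<in> cball (Complex A T') (A - 1/2 - width T)" for z
      proof -
        have "cmod (k z) \<le> C * Q ^ m + C * ln T' / \<eta> * (1 - \<eta> / A) ^ m"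
          unfolding Q_def by (rule k(3)) (use z in \<open>simp add: \<eta>_def\<close>)
        also have "C * ln T' / \<eta> * (1 - \<eta> / A) ^ m \<le> C * (2 * exp x) / \<eta> * (1 - \<eta> / A) ^ m"
        proof -
          have "ln T' \<le> ln (T ^ 2)" using T' elim \<open>T' \<ge> A + 1\<close> A by (intro ln_mono) auto
          also have "\<dots> = 2 * exp x" using T ex by (simp add: ln_realpow)
          finally show ?thesis using C(1) \<eta> A by (intro mult_right_mono divide_right_mono mult_left_mono) (auto simp: divide_le_eq)
        qed
        also note 2
        also note 1
        also have "C * exp (x / 2) + 4 * C * exp x * sqrt x * exp (- ((q * x - 1) * (d / sqrt x))) \<le> exp x / x ^ 2"
          using elim unfolding x_def by simp
        also have "exp x / x ^ 2 = width T ^ 4 * ln T"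
        proof -
          have "sqrt x ^ 4 = x ^ 2" using x by (simp add: power4_eq_xxxx power2_eq_square)
          then show ?thesis unfolding width_def x_def[symmetric] ex by (simp add: power_divide)
        qed
        finally show ?thesis by simp
      qed
      with k(1,2) show "\<exists>k. k holomorphic_on ball (Complex A T') (A - 1/2) \<and>
         (\<forall>z\<in>ball (Complex A T') (A - 1/2). zeta z = zeta (Complex A T') * exp (k z)) \<and>
         (\<forall>z\<in>cball (Complex A T') (A - 1/2 - width T). cmod (k z) \<le> width T ^ 4 * ln T)"
        by (intro exI[of _ k]) auto
    qed
  qed
qed

lemma width_small:
  assumes "e > 0"
  shows "\<forall>\<^sub>F T in at_top. 0 < width T \<and> width T < e"
  unfolding width_def using assms by (intro eventually_conj; real_asymp)

lemma cmod_zeta_one_minus_cnj: "cmod (zeta (1 - cnj s)) = cmod (zeta (1 - s))"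
  using zeta_cnj[of "1 - s"] by simp

lemma cmod_zeta_le_2: "Re z \<ge> 2 \<Longrightarrow> cmod (zeta z) \<le> 2"
  using zeta_minus_one_le[of z] norm_triangle_ineq2[of "zeta z" 1] by simp



lemma open_one_minus: "open S \<Longrightarrow> open ((\<lambda>z::complex. 1 - z) ` S)"
  using open_translation[OF open_negations, of S 1] by (simp add: image_image)

text \<open>For Re s < 2 the point s is reached horizontally from the disc centred at its own
  height; for Re s >= 2 the Dirichlet series suffices.\<close>

lemma zeta_upper_bound_right:
  assumes RH: "riemann_hypothesis" and A: "A \<ge> 4"
  shows "\<forall>\<^sub>F T in at_top. \<forall>s. \<bar>Im s - T\<bar> \<le> 2 * A \<and> 1/2 + width T \<le> Re s \<longrightarrow>
    cmod (zeta s) \<le> 2 * exp (width T ^ 4 * ln T)"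
  using zeta_log_bound[OF RH A] eventually_gt_at_top[of 1] width_small[of 1, simplified]
proof eventually_elim
  case (elim T)
  show ?case
  proof (intro allI impI)
    fix s assume s: "\<bar>Im s - T\<bar> \<le> 2 * A \<and> 1/2 + width T \<le> Re s"
    show "cmod (zeta s) \<le> 2 * exp (width T ^ 4 * ln T)"
    proof (cases "Re s \<ge> 2")
      case True
      have "exp (width T ^ 4 * ln T) \<ge> 1" using elim(2) by simp
      then show ?thesis using cmod_zeta_le_2[OF True] by linarith
    next
      case False
      define c where "c = Complex A (Im s)"
      obtain k where k: "\<And>z. z\<in>ball c (A - 1/2) \<Longrightarrow> zeta z = zeta c * exp (k z)"
        "\<And>z. z\<in>cball c (A - 1/2 - width T) \<Longrightarrow> cmod (k z) \<le> width T ^ 4 * ln T"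
        unfolding c_def using elim(1) s by metis
      have "c - s = of_real (A - Re s)" by (simp add: c_def complex_eq_iff)
      then have "dist c s = \<bar>A - Re s\<bar>" by (simp only: dist_norm norm_of_real)
      then have d: "dist c s = A - Re s" using False A by simp
      have ws: "s \<in> cball c (A - 1/2 - width T)" "s \<in> ball c (A - 1/2)"
        using d s elim by auto
      have "cmod (zeta s) = cmod (zeta c) * exp (Re (k s))" using k(1)[OF ws(2)] by (simp add: norm_mult)
      also have "\<dots> \<le> 2 * exp (width T ^ 4 * ln T)"
        using k(2)[OF ws(1)] abs_Re_le_cmod[of "k s"] A by (intro mult_mono cmod_zeta_le_2) (auto simp: c_def)
      finally show ?thesis .
    qed
  qed
qed

text \<open>Reflecting the logarithm of zeta through \<open>s \<mapsto> 1 - cnj s\<close> keeps the height of s.\<close>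

lemma reflected_zeta_log:
  assumes RH: "riemann_hypothesis" and A: "A \<ge> 4"
  shows "\<forall>\<^sub>F T in at_top. \<exists>k. k holomorphic_on ball (Complex (1 - A) T) (A - 1/2) \<and>
    (\<forall>z\<in>ball (Complex (1 - A) T) (A - 1/2). zeta (1 - z) = exp (k z)) \<and>
    (\<exists>a. \<forall>z\<in>cball (Complex (1 - A) T) (A - 1/2 - width T). cmod (k z - a) \<le> width T ^ 4 * ln T)"
  using zeta_log_bound[OF RH A]
proof eventually_elim
  case (elim T)
  define c where "c = Complex A T"
  define c' where "c' = Complex (1 - A) T"
  have "\<bar>T - T\<bar> \<le> 2 * A" using A by simp
  from elim[rule_format, OF this] obtain k where k': "k holomorphic_on ball c (A - 1/2)" "\<forall>z\<in>ball c (A - 1/2). zeta z = zeta c * exp (k z)"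
    "\<forall>z\<in>cball c (A - 1/2 - width T). cmod (k z) \<le> width T ^ 4 * ln T"
    unfolding c_def[symmetric] by (elim exE conjE)
  note k = k'(1) k'(2,3)[rule_format]
  \<comment> \<open>The constant absorbs the factor zeta c; only differences of the logarithm are
    used later.\<close>
  define a where "a = cnj (Ln (zeta c))"
  define h where "h = (\<lambda>z. cnj (k (1 - cnj z)) + a)"
  have zc: "zeta c \<noteq> 0" using A by (intro zeta_nonzero_Re_ge_2) (simp add: c_def)
  have d: "dist c (1 - cnj z) = dist c' z" for z
  proof -
    have "c - (1 - cnj z) = - cnj (c' - z)" by (simp add: c_def c'_def complex_eq_iff)
    then show ?thesis unfolding dist_norm by (simp only: norm_minus_cancel complex_mod_cnj)
  qed
  have "(cnj \<circ> (\<lambda>z. k (1 - z)) \<circ> cnj) holomorphic_on ball c' (A - 1/2)"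
  proof (rule holomorphic_on_compose_cnj_cnj)
    have "(k \<circ> (\<lambda>z. 1 - z)) holomorphic_on cnj ` ball c' (A - 1/2)"
      by (rule holomorphic_on_compose_gen[OF _ k(1)]) (use d in \<open>auto intro!: holomorphic_intros\<close>)
    then show "(\<lambda>z. k (1 - z)) holomorphic_on cnj ` ball c' (A - 1/2)" by (simp add: o_def)
  qed auto
  then have "h holomorphic_on ball c' (A - 1/2)"
    unfolding h_def by (intro holomorphic_intros) (simp add: o_def)
  moreover have "zeta (1 - z) = exp (h z)" if "z \<in> ball c' (A - 1/2)" for z
  proof -
    have "zeta (1 - z) = cnj (zeta (1 - cnj z))" using zeta_cnj[of "1 - cnj z"] by simp
    also have "zeta (1 - cnj z) = zeta c * exp (k (1 - cnj z))" using that d by (intro k(2)) auto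
    also have "zeta c = exp (Ln (zeta c))" using zc by simp
    finally show ?thesis by (simp add: h_def a_def exp_add exp_cnj mult.commute)
  qed
  moreover have "cmod (h z - a) \<le> width T ^ 4 * ln T" if "z \<in> cball c' (A - 1/2 - width T)" for z
    using k(3)[of "1 - cnj z"] that d by (simp add: h_def)
  ultimately show ?case unfolding c'_def by blast
qed

text \<open>Cauchy inequalities on discs of radius \<open>width T\<close>, which the margin of two
  widths keeps inside the region of \<open>reflected_zeta_log\<close>; each derivative costs one
  power of the width.\<close>

lemma reflected_zeta_bounds:
  assumes RH: "riemann_hypothesis" and A: "A \<ge> 4"
  shows "\<forall>\<^sub>F T in at_top. (\<forall>s. Im s = T \<and> 1 - A \<le> Re s \<and> Re s \<le> 1/2 - 2 * width T \<longrightarrow>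
      cmod (zeta_ld (1 - s)) \<le> width T ^ 3 * ln T \<and> cmod (deriv zeta_ld (1 - s)) \<le> 2 * width T ^ 2 * ln T) \<and>
    (\<forall>u v. Im u = T \<and> Im v = T \<and> 1 - A \<le> Re u \<and> Re u \<le> Re v \<and> Re v \<le> 1/2 - 2 * width T \<longrightarrow>
      arg_change_le (\<lambda>s. zeta (1 - s)) u v (2 * width T ^ 4 * ln T))"
  using reflected_zeta_log[OF RH A] width_small[of 1, simplified] eventually_gt_at_top[of 1]
proof eventually_elim
  case (elim T)
  define \<delta> where "\<delta> = width T"
  define l where "l = ln T"
  have \<delta>: "0 < \<delta>" "\<delta> < 1" using elim by (auto simp: \<delta>_def)
  have l: "l > 0" using elim by (simp add: l_def)
  define c where "c = Complex (1 - A) T"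
  define S where "S = ball c (A - 1/2)"
  obtain k a where k: "k holomorphic_on S" "\<And>z. z\<in>S \<Longrightarrow> zeta (1 - z) = exp (k z)"
    "\<And>z. z\<in>cball c (A - 1/2 - \<delta>) \<Longrightarrow> cmod (k z - a) \<le> \<delta> ^ 4 * l"
    unfolding c_def \<delta>_def S_def l_def using elim by metis
  have oS: "open S" by (simp add: S_def)
  have n1: "1 - z \<noteq> 1" if "z \<in> S" for z
    using k(2)[OF that] zeta_1 by auto
  have dist: "dist c s = Re s - (1 - A)" if "Im s = T" "1 - A \<le> Re s" for s
  proof -
    have "c - s = of_real (1 - A - Re s)" using that by (simp add: c_def complex_eq_iff)
    then have "dist c s = \<bar>1 - A - Re s\<bar>" by (simp only: dist_norm norm_of_real)
    then show ?thesis using that by simp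
  qed
  have dk: "(k has_field_derivative - zeta_ld (1 - z)) (at z)" if z: "z \<in> S" for z
  proof -
    have d: "(k has_field_derivative deriv k z) (at z)" by (rule holomorphic_derivI[OF k(1) oS z])
    then have "((\<lambda>z. exp (k z)) has_field_derivative exp (k z) * deriv k z) (at z)"
      by (rule DERIV_chain2[OF DERIV_exp])
    then have "((\<lambda>z. zeta (1 - z)) has_field_derivative exp (k z) * deriv k z) (at z)"
      by (rule has_field_derivative_transform_within_open[OF _ oS z]) (simp add: k(2))
    moreover have "((\<lambda>z. zeta (1 - z)) has_field_derivative deriv zeta (1 - z) * (- 1)) (at z)"
    proof (rule DERIV_chain2[where f = zeta])
      show "(zeta has_field_derivative deriv zeta (1 - z)) (at (1 - z))"
        using n1[OF z] by (simp add: zeta_differentiable field_differentiable_derivI)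
    qed (auto intro!: derivative_eq_intros)
    ultimately have "exp (k z) * deriv k z = - deriv zeta (1 - z)" using DERIV_unique by fastforce
    then have "deriv k z = - zeta_ld (1 - z)"
      unfolding zeta_ld_def k(2)[OF z] by (simp add: field_simps)
    then show ?thesis using d by simp
  qed
  have dk2: "deriv (deriv k) z = deriv zeta_ld (1 - z)" if z: "z \<in> S" for z
  proof -
    have nz: "zeta (1 - w) \<noteq> 0" if "w \<in> S" for w using k(2)[OF that] by simp
    have o: "open ((\<lambda>z. 1 - z) ` S)" using oS by (rule open_one_minus)
    have "zeta_ld holomorphic_on (\<lambda>z. 1 - z) ` S"
    proof (rule holomorphic_zeta_ld)
      show "1 \<notin> (\<lambda>z. 1 - z) ` S"
      proof
        assume "1 \<in> (\<lambda>z. 1 - z) ` S"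
        then obtain z where "z \<in> S" "1 = 1 - z" by (rule imageE)
        then show False using n1 by metis
      qed
    qed (use nz in auto)
    then have "(zeta_ld has_field_derivative deriv zeta_ld (1 - z)) (at (1 - z))"
      using o z by (intro holomorphic_derivI) auto
    then have "((\<lambda>z. - zeta_ld (1 - z)) has_field_derivative - (deriv zeta_ld (1 - z) * (- 1))) (at z)"
      by (intro DERIV_minus DERIV_chain2[where f = zeta_ld]) (auto intro!: derivative_eq_intros)
    then have "(deriv k has_field_derivative deriv zeta_ld (1 - z)) (at z)"
      by (simp, elim has_field_derivative_transform_within_open[OF _ oS z]) (simp add: DERIV_imp_deriv[OF dk])
    then show ?thesis by (rule DERIV_imp_deriv)
  qed
  have "cmod (zeta_ld (1 - s)) \<le> \<delta> ^ 3 * l \<and> cmod (deriv zeta_ld (1 - s)) \<le> 2 * \<delta> ^ 2 * l"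
    if s: "Im s = T" "1 - A \<le> Re s" "Re s \<le> 1/2 - 2 * \<delta>" for s
  proof -
    have sb: "ball s \<delta> \<subseteq> cball c (A - 1/2 - \<delta>)"
    proof
      fix z assume "z \<in> ball s \<delta>"
      then show "z \<in> cball c (A - 1/2 - \<delta>)" using dist[OF s(1,2)] dist_triangle[of c z s] s(3) by simp
    qed
    have sS: "ball s \<delta> \<subseteq> S" using sb \<delta> by (auto simp: S_def)
    then have s': "s \<in> S" using \<delta> by auto
    define g where "g = (\<lambda>z. k z - a)"
    have hg: "g holomorphic_on ball s \<delta>"
      unfolding g_def using holomorphic_on_subset[OF k(1) sS] by (intro holomorphic_intros)
    have bg: "cmod (g z) \<le> \<delta> ^ 4 * l" if "z \<in> ball s \<delta>" for z
      unfolding g_def using that sb by (intro k(3)) auto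
    have dg: "deriv g z = deriv k z" if "z \<in> S" for z
      unfolding g_def using dk[OF that] by (intro DERIV_imp_deriv) (auto intro!: derivative_eq_intros simp: DERIV_imp_deriv)
    have "(deriv ^^ 2) g s = deriv (deriv k) s"
    proof -
      have "deriv (deriv g) s = deriv (deriv k) s"
        by (rule deriv_cong_ev) (use eventually_nhds_in_open[OF oS s'] dg in \<open>auto elim!: eventually_mono\<close>)
      then show ?thesis by (simp add: numeral_2_eq_2)
    qed
    moreover have "cmod ((deriv ^^ 2) g s) \<le> fact 2 * (\<delta> ^ 4 * l) / \<delta> ^ 2" "cmod ((deriv ^^ 1) g s) \<le> fact 1 * (\<delta> ^ 4 * l) / \<delta> ^ 1"
      using cmod_deriv_le[OF hg bg \<delta>(1)] by blast+
    moreover have "fact 2 * (\<delta> ^ 4 * l) / \<delta> ^ 2 = 2 * \<delta> ^ 2 * l" "fact 1 * (\<delta> ^ 4 * l) / \<delta> ^ 1 = \<delta> ^ 3 * l"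
      using \<delta> by (simp_all add: field_simps power2_eq_square power3_eq_cube power4_eq_xxxx)
    ultimately show ?thesis using dk2[OF s'] dg[OF s'] DERIV_imp_deriv[OF dk[OF s']] by simp
  qed
  moreover have "arg_change_le (\<lambda>s. zeta (1 - s)) u v (2 * \<delta> ^ 4 * l)"
    if uv: "Im u = T" "Im v = T" "1 - A \<le> Re u" "Re u \<le> Re v" "Re v \<le> 1/2 - 2 * \<delta>" for u v
  proof -
    have in1: "u \<in> cball c (A - 1/2 - \<delta>)" "v \<in> cball c (A - 1/2 - \<delta>)"
      using dist[of u] dist[of v] uv \<delta> by auto
    then have "closed_segment u v \<subseteq> cball c (A - 1/2 - \<delta>)" by (intro closed_segment_subset convex_cball)
    also have "\<dots> \<subseteq> S" using \<delta> by (auto simp: S_def)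
    finally have sub: "closed_segment u v \<subseteq> S" .
    show ?thesis
    proof (rule arg_change_le_mono[OF arg_change_le_exp[OF oS k(1) sub k(2)]])
      have "k v - k u = (k v - a) - (k u - a)" by simp
      then have "cmod (k v - k u) \<le> \<delta> ^ 4 * l + \<delta> ^ 4 * l"
        by (metis order_trans[OF norm_triangle_ineq4 add_mono[OF k(3)[OF in1(2)] k(3)[OF in1(1)]]])
      then show "\<bar>Im (k v - k u)\<bar> \<le> 2 * \<delta> ^ 4 * l" using abs_Im_le_cmod[of "k v - k u"] by linarith
    qed
  qed
  ultimately show ?case unfolding \<delta>_def l_def by simp
qed

section \<open>Growth of zeta and its second derivative across the critical line\<close>

text \<open>On the left the functional equation reflects the bound from the right, and chi, of
  modulus 1 on the critical line, gains at most exp (O(width T * ln T)) over 80 widths. The 80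
  covers the disc of radius 60 widths in \<open>arg_change_top_middle\<close>, whose centre lies up
  to 12 widths to the right of the line, with room for a Cauchy estimate.\<close>

lemma zeta_bound_left_strip:
  assumes RH: "riemann_hypothesis"
  shows "\<forall>\<^sub>F T in at_top. \<forall>s. \<bar>Im s - T\<bar> \<le> 2 \<and> width T \<le> \<bar>Re s - 1/2\<bar> \<and> \<bar>Re s - 1/2\<bar> \<le> 80 * width T \<longrightarrow>
    cmod (zeta s) \<le> exp (200 * width T * ln T)"
proof -
  obtain C where C: "C > 0" "\<And>u v. - 1 \<le> Re u \<Longrightarrow> Re u \<le> Re v \<Longrightarrow> Re v \<le> 1/2 \<Longrightarrow> Im u \<ge> 3 \<Longrightarrow> Im v = Im u \<Longrightarrow>
     cmod (chi u) \<le> cmod (chi v) * exp ((Re v - Re u) * (ln (Im u) + C))"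
    using chi_horizontal[of 1] by auto
  have ev: "\<forall>\<^sub>F T in at_top. 1 + ln 2 \<le> width T * ln T" unfolding width_def by real_asymp
  have ev2: "\<forall>\<^sub>F T in at_top. C \<le> ln T / 80 \<and> T \<ge> 6 \<and> ln (T + 2) \<le> 2 * ln T" by (intro eventually_conj; real_asymp)
  show ?thesis
    using zeta_upper_bound_right[OF RH order_refl] ev ev2 width_small[of "1/160", simplified]
  proof eventually_elim
    case (elim T)
    define \<delta> where "\<delta> = width T"
    define l where "l = ln T"
    have \<delta>: "0 < \<delta>" "\<delta> < 1/160" using elim by (auto simp: \<delta>_def)
    have l: "l > 0" using elim by (simp add: l_def)
    have dl: "\<delta> * l \<ge> 1 + ln 2" using elim by (simp add: \<delta>_def l_def)
    have d4: "\<delta> ^ 4 * l \<le> \<delta> * l"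
    proof -
      have "\<delta> ^ 4 \<le> \<delta> ^ 1" using \<delta> by (intro power_decreasing) auto
      then show ?thesis using l by (intro mult_right_mono) auto
    qed
    have r: "cmod (zeta s) \<le> exp (2 * (\<delta> * l))" if s: "\<bar>Im s - T\<bar> \<le> 2" "1/2 + \<delta> \<le> Re s" for s
    proof -
      have "cmod (zeta s) \<le> 2 * exp (\<delta> ^ 4 * l)" using elim(1) s unfolding \<delta>_def l_def by simp
      also have "\<dots> = exp (ln 2 + \<delta> ^ 4 * l)" by (simp add: exp_add)
      also have "\<dots> \<le> exp (2 * (\<delta> * l))" using d4 dl by simp
      finally show ?thesis .
    qed
    show ?case
    proof (intro allI impI)
      fix s assume s: "\<bar>Im s - T\<bar> \<le> 2 \<and> width T \<le> \<bar>Re s - 1/2\<bar> \<and> \<bar>Re s - 1/2\<bar> \<le> 80 * width T"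
      have dl0: "\<delta> * l > 0" using \<delta> l by simp
      show "cmod (zeta s) \<le> exp (200 * width T * ln T)"
      proof (cases "Re s \<ge> 1/2")
        case True
        then have "cmod (zeta s) \<le> exp (2 * (\<delta> * l))" using s by (intro r) (auto simp: \<delta>_def)
        also have "\<dots> \<le> exp (200 * (\<delta> * l))" using dl0 by simp
        finally show ?thesis by (simp add: \<delta>_def l_def mult.assoc)
      next
        case False
        define v where "v = Complex (1/2) (Im s)"
        have Im: "Im s \<ge> 3" "Im s \<le> T + 2" using s elim by auto
        have Re: "Re s \<ge> 1/2 - 80 * \<delta>" "Re s \<le> 1/2 - \<delta>" using s False by (auto simp: \<delta>_def)
        have "cmod (zeta s) = cmod (chi s) * cmod (zeta (1 - s))"
          using zeta_functional_equation[of s] slit_plane_iff[of s] Im by (simp add: norm_mult)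
        also have "\<dots> \<le> exp (80 * \<delta> * (2 * l + l / 80)) * exp (2 * (\<delta> * l))"
        proof (intro mult_mono)
          have "cmod (zeta (1 - s)) = cmod (zeta (1 - cnj s))" by (rule cmod_zeta_one_minus_cnj[symmetric])
          also have "\<dots> \<le> exp (2 * (\<delta> * l))" using s Re by (intro r) auto
          finally show "cmod (zeta (1 - s)) \<le> exp (2 * (\<delta> * l))" .
          have "cmod (chi s) \<le> cmod (chi v) * exp ((Re v - Re s) * (ln (Im s) + C))"
            using Im Re \<delta> False by (intro C(2)) (auto simp: v_def)
          also have "cmod (chi v) = 1" using Im by (intro cmod_chi_critical_line) (auto simp: v_def)
          also have "1 * exp ((Re v - Re s) * (ln (Im s) + C)) \<le> exp (80 * \<delta> * (2 * l + l / 80))"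
          proof -
            have "ln (Im s) \<le> ln (T + 2)" using Im by (intro ln_mono) auto
            then have "ln (Im s) + C \<le> 2 * l + l / 80" using elim by (simp add: l_def)
            moreover have "Re v - Re s \<le> 80 * \<delta>" using Re by (simp add: v_def)
            moreover have "ln (Im s) + C \<ge> 0" using Im C by (intro add_nonneg_nonneg ln_ge_zero) auto
            ultimately have "(Re v - Re s) * (ln (Im s) + C) \<le> 80 * \<delta> * (2 * l + l / 80)"
              using \<delta> by (intro mult_mono) auto
            then show ?thesis by simp
          qed
          finally show "cmod (chi s) \<le> exp (80 * \<delta> * (2 * l + l / 80))" .
        qed auto
        also have "exp (80 * \<delta> * (2 * l + l / 80)) * exp (2 * (\<delta> * l)) = exp (163 * (\<delta> * l))"
          unfolding exp_add[symmetric] by (simp add: algebra_simps)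
        also have "\<dots> \<le> exp (200 * (\<delta> * l))" using dl0 by simp
        finally show ?thesis by (simp add: \<delta>_def l_def mult.assoc)
      qed
    qed
  qed
qed

text \<open>The maximum principle for \<open>zeta s * exp (K (s - s0)^2)\<close> on the rectangle of height 2 around s0:
  the Gaussian factor beats the polynomial growth of zeta on the horizontal sides.\<close>

lemma zeta_bound_near_line:
  assumes RH: "riemann_hypothesis"
  shows "\<forall>\<^sub>F T in at_top. \<forall>s. \<bar>Im s - T\<bar> \<le> 1 \<and> \<bar>Re s - 1/2\<bar> \<le> 80 * width T \<longrightarrow>
    cmod (zeta s) \<le> exp (300 * width T * ln T)"
proof -
  obtain C1 where C1: "C1 > 0" "\<And>s. -1/2 \<le> Re s \<Longrightarrow> Re s \<le> 2 \<Longrightarrow> \<bar>Im s\<bar> \<ge> 1 \<Longrightarrow> cmod (zeta s) \<le> C1 * \<bar>Im s\<bar> ^ 2"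
    using zeta_polynomial_bound[of 2] by blast
  have ev: "\<forall>\<^sub>F T in at_top. C1 * (T + 2) ^ 2 \<le> exp (3 * ln T) \<and> T \<ge> 4" using C1(1) by (intro eventually_conj; real_asymp)
  show ?thesis
    using zeta_bound_left_strip[OF RH] ev width_small[of "1/160", simplified]
  proof eventually_elim
    case (elim T)
    define \<delta> where "\<delta> = width T"
    define l where "l = ln T"
    have \<delta>: "0 < \<delta>" "\<delta> < 1/160" using elim by (auto simp: \<delta>_def)
    have l: "l > 0" using elim by (simp add: l_def)
    have dl0: "\<delta> * l > 0" using \<delta> l by simp
    have \<delta>2: "\<delta> ^ 2 \<le> \<delta> / 160" using \<delta> by (simp add: power2_eq_square)
    have out: "cmod (zeta s) \<le> exp (200 * (\<delta> * l))" if "\<bar>Im s - T\<bar> \<le> 2" "\<delta> \<le> \<bar>Re s - 1/2\<bar>" "\<bar>Re s - 1/2\<bar> \<le> 80 * \<delta>" for s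
      using elim(1) that unfolding \<delta>_def l_def by (simp add: mult.assoc)
    have "cmod (zeta s) \<le> exp (300 * (\<delta> * l))" if s: "\<bar>Im s - T\<bar> \<le> 1" "\<bar>Re s - 1/2\<bar> \<le> 80 * \<delta>" for s
    proof (cases "\<bar>Re s - 1/2\<bar> < \<delta>")
      case False
      then have "cmod (zeta s) \<le> exp (200 * (\<delta> * l))" using s by (intro out) auto
      also have "\<dots> \<le> exp (300 * (\<delta> * l))" using dl0 by simp
      finally show ?thesis .
    next
      case True
      \<comment> \<open>On the horizontal sides the exponent is close to - 4 * l and beats zeta,
        which is at most exp (3 * l) there; on the vertical sides, where \<open>out\<close> applies,
        it is at most \<delta> * l / 10.\<close>
      define G where "G = (\<lambda>z. zeta z * exp (of_real (4 * l) * (z - s) ^ 2))"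
      define a where "a = Complex (1/2 - \<delta>) (Im s - 1)"
      define b where "b = Complex (1/2 + \<delta>) (Im s + 1)"
      define S where "S = cbox a b"
      have Sm: "z \<in> S \<longleftrightarrow> 1/2 - \<delta> \<le> Re z \<and> Re z \<le> 1/2 + \<delta> \<and> Im s - 1 \<le> Im z \<and> Im z \<le> Im s + 1" for z
        by (auto simp: S_def a_def b_def in_cbox_complex_iff)
      have n1: "1 \<notin> S" using s(1) elim unfolding Sm by simp linarith
      have hG: "G holomorphic_on S" unfolding G_def using n1 by (intro holomorphic_intros holomorphic_zeta)
      have cG: "cmod (G z) = cmod (zeta z) * exp (4 * l * ((Re z - Re s) ^ 2 - (Im z - Im s) ^ 2))" for z
        by (simp add: G_def norm_mult Re_power2)
      have "cmod (G s) \<le> exp (300 * (\<delta> * l))"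
      proof (rule maximum_modulus_frontier[of G S])
        show "G holomorphic_on interior S" using hG interior_subset holomorphic_on_subset by blast
        show "continuous_on (closure S) G"
          using holomorphic_on_imp_continuous_on[OF hG] by (simp add: S_def)
        show "bounded S" by (simp add: S_def)
        show "s \<in> S" using True by (auto simp: Sm)
        fix z assume z: "z \<in> frontier S"
        then have "z \<in> S" "z \<notin> box a b" by (auto simp: S_def frontier_def)
        then have "z \<in> S" and cs: "(Re z = 1/2 - \<delta> \<or> Re z = 1/2 + \<delta>) \<or> (Im z = Im s - 1 \<or> Im z = Im s + 1)"
          by (auto simp: Sm in_box_complex_iff a_def b_def)
        then have z: "\<bar>Re z - 1/2\<bar> \<le> \<delta>" "\<bar>Im z - Im s\<bar> \<le> 1" by (auto simp: Sm)
        have "\<bar>Re z - Re s\<bar> \<le> 2 * \<delta>" using z True by linarith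
        then have x2: "(Re z - Re s) ^ 2 \<le> 4 * \<delta> ^ 2" using abs_le_square_iff[of "Re z - Re s" "2 * \<delta>"] \<delta> by (simp add: power_mult_distrib)
        show "cmod (G z) \<le> exp (300 * (\<delta> * l))"
          using cs
        proof
          assume "Re z = 1/2 - \<delta> \<or> Re z = 1/2 + \<delta>"
          then have "cmod (zeta z) \<le> exp (200 * (\<delta> * l))" using z s \<delta> by (intro out) auto
          moreover have "exp (4 * l * ((Re z - Re s) ^ 2 - (Im z - Im s) ^ 2)) \<le> exp (4 * l * (\<delta> / 40))"
          proof -
            have "(Re z - Re s) ^ 2 - (Im z - Im s) ^ 2 \<le> \<delta> / 40"
              using x2 \<delta>2 zero_le_power2[of "Im z - Im s"] by linarith
            then have "4 * l * ((Re z - Re s) ^ 2 - (Im z - Im s) ^ 2) \<le> 4 * l * (\<delta> / 40)"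
              using l by (intro mult_left_mono) auto
            then show ?thesis by (simp only: exp_le_cancel_iff)
          qed
          ultimately have "cmod (G z) \<le> exp (200 * (\<delta> * l)) * exp (4 * l * (\<delta> / 40))"
            unfolding cG by (intro mult_mono) auto
          also have "\<dots> \<le> exp (300 * (\<delta> * l))" unfolding exp_add[symmetric] using dl0 by (simp add: algebra_simps)
          finally show ?thesis .
        next
          assume "Im z = Im s - 1 \<or> Im z = Im s + 1"
          then have i1: "(Im z - Im s) ^ 2 = 1" by auto
          have "cmod (zeta z) \<le> C1 * \<bar>Im z\<bar> ^ 2" using z s \<delta> elim by (intro C1(2)) auto
          also have "\<dots> \<le> C1 * (T + 2) ^ 2" using z s elim C1(1) by (intro mult_left_mono power_mono) auto
          also have "\<dots> \<le> exp (3 * l)" using elim by (simp add: l_def)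
          finally have "cmod (zeta z) \<le> exp (3 * l)" .
          moreover have "exp (4 * l * ((Re z - Re s) ^ 2 - (Im z - Im s) ^ 2)) \<le> exp (4 * l * (\<delta> / 40 - 1))"
            unfolding i1 using x2 \<delta>2 l by (simp add: mult_left_mono)
          ultimately have "cmod (G z) \<le> exp (3 * l) * exp (4 * l * (\<delta> / 40 - 1))"
            unfolding cG by (intro mult_mono) auto
          also have "\<dots> = exp (\<delta> * l / 10 - l)" unfolding exp_add[symmetric] by (simp add: algebra_simps)
          also have "\<dots> \<le> exp (300 * (\<delta> * l))" using dl0 l by simp
          finally show ?thesis .
        qed
      qed
      then show ?thesis by (simp add: G_def)
    qed
    then show ?case by (simp add: \<delta>_def l_def mult.assoc)
  qed
qed

text \<open>The Cauchy inequality on discs of radius \<open>width T\<close> costs 2 / width T ^ 2,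
  which one more factor exp (width T * ln T) absorbs.\<close>

lemma zeta_deriv2_bound_near_line:
  assumes RH: "riemann_hypothesis"
  shows "\<forall>\<^sub>F T in at_top. \<forall>s. \<bar>Im s - T\<bar> \<le> 1/2 \<and> \<bar>Re s - 1/2\<bar> \<le> 79 * width T \<longrightarrow>
    cmod ((deriv ^^ 2) zeta s) \<le> exp (301 * width T * ln T)"
proof -
  have ev: "\<forall>\<^sub>F T in at_top. 2 / width T ^ 2 \<le> exp (width T * ln T) \<and> T \<ge> 4" unfolding width_def by (intro eventually_conj; real_asymp)
  show ?thesis
    using zeta_bound_near_line[OF RH] ev width_small[of "1/2", simplified]
  proof eventually_elim
    case (elim T)
    show ?case
    proof (intro allI impI)
      fix s assume s: "\<bar>Im s - T\<bar> \<le> 1/2 \<and> \<bar>Re s - 1/2\<bar> \<le> 79 * width T"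
      have in1: "\<bar>Im w - T\<bar> \<le> 1 \<and> \<bar>Re w - 1/2\<bar> \<le> 80 * width T" if "w \<in> ball s (width T)" for w
        using ball_Re_Im[OF that] s elim by linarith
      have n1: "1 \<notin> ball s (width T)" using in1[of 1] elim by auto
      have "cmod ((deriv ^^ 2) zeta s) \<le> fact 2 * exp (300 * width T * ln T) / width T ^ 2"
        using elim(1,3) in1 by (intro cmod_deriv_le holomorphic_zeta n1) auto
      also have "\<dots> = 2 / width T ^ 2 * exp (300 * width T * ln T)" by simp
      also have "\<dots> \<le> exp (width T * ln T) * exp (300 * width T * ln T)"
        using elim by (intro mult_right_mono) auto
      also have "\<dots> = exp (301 * width T * ln T)" by (simp flip: exp_add)
      finally show "cmod ((deriv ^^ 2) zeta s) \<le> exp (301 * width T * ln T)" .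
    qed
  qed
qed

lemma zeta_deriv2_bound_right:
  assumes RH: "riemann_hypothesis" and A: "A \<ge> 4"
  shows "\<forall>\<^sub>F T in at_top. \<forall>s. \<bar>Im s - T\<bar> \<le> A \<and> 1/2 + 2 * width T \<le> Re s \<longrightarrow>
    cmod ((deriv ^^ 2) zeta s) \<le> exp (2 * width T ^ 4 * ln T)"
proof -
  have ev: "\<forall>\<^sub>F T in at_top. 4 / width T ^ 2 \<le> exp (width T ^ 4 * ln T) \<and> T \<ge> 2 * A + 1" unfolding width_def by (intro eventually_conj; real_asymp)
  show ?thesis
    using zeta_upper_bound_right[OF RH A] ev width_small[of "1/2", simplified]
  proof eventually_elim
    case (elim T)
    show ?case
    proof (intro allI impI)
      fix s assume s: "\<bar>Im s - T\<bar> \<le> A \<and> 1/2 + 2 * width T \<le> Re s"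
      have in1: "\<bar>Im w - T\<bar> \<le> 2 * A \<and> 1/2 + width T \<le> Re w" if "w \<in> ball s (width T)" for w
        using ball_Re_Im[OF that] s elim A by linarith
      have n1: "1 \<notin> ball s (width T)" using in1[of 1] elim by auto
      have "cmod ((deriv ^^ 2) zeta s) \<le> fact 2 * (2 * exp (width T ^ 4 * ln T)) / width T ^ 2"
        using elim(1,3) in1 by (intro cmod_deriv_le holomorphic_zeta n1) auto
      also have "\<dots> = 4 / width T ^ 2 * exp (width T ^ 4 * ln T)" by simp
      also have "\<dots> \<le> exp (width T ^ 4 * ln T) * exp (width T ^ 4 * ln T)"
        using elim by (intro mult_right_mono) auto
      also have "\<dots> = exp (2 * width T ^ 4 * ln T)" by (simp flip: exp_add)
      finally show "cmod ((deriv ^^ 2) zeta s) \<le> exp (2 * width T ^ 4 * ln T)" .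
    qed
  qed
qed

section \<open>The change of the argument along the edges\<close>

lemma holomorphic_deriv2_zeta: "1 \<notin> S \<Longrightarrow> (deriv ^^ 2) zeta holomorphic_on S"
proof -
  assume "1 \<notin> S"
  have "deriv (deriv zeta) holomorphic_on - {1}"
    by (intro holomorphic_deriv[of _ "- {1}"] holomorphic_deriv_zeta) auto
  then show ?thesis using \<open>1 \<notin> S\<close> by (auto simp: numeral_2_eq_2 intro: holomorphic_on_subset)
qed

text \<open>The Cauchy inequality on a unit disc carries \<open>zeta_dirichlet_tail\<close> over to
  the second derivative, where the term 1 disappears and 2 powr (- s) acquires the factor (ln 2)^2.
  The 54 is 2 * 9 * 3.\<close>

lemma deriv2_zeta_right:
  "\<exists>A\<ge>4. \<forall>s. Re s \<ge> A \<longrightarrow>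
     cmod ((deriv ^^ 2) zeta s * exp (of_real (ln 2) * s) / of_real (ln 2 ^ 2) - 1) \<le> 1 / 2"
proof -
  define p where "p = (\<lambda>s. exp (- (of_real (ln 2) * s)) :: complex)"
  have p2: "2 powr (- s) = p s" for s by (simp add: p_def powr_def Ln_of_real[symmetric] mult.commute)
  have dp: "(p has_field_derivative - of_real (ln 2) * p s) (at s)" for s
    unfolding p_def by (auto intro!: derivative_eq_intros)
  have hp: "p holomorphic_on S" for S unfolding p_def by (intro holomorphic_intros)
  have d1p: "deriv p = (\<lambda>s. - of_real (ln 2) * p s)" using dp DERIV_imp_deriv by blast
  have "(deriv p has_field_derivative - of_real (ln 2) * (- of_real (ln 2) * p s)) (at s)" for s
    unfolding d1p by (intro DERIV_cmult dp)
  from DERIV_imp_deriv[OF this] have d2p: "(deriv ^^ 2) p s = of_real (ln 2 ^ 2) * p s" for s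
    by (simp add: numeral_2_eq_2)
  have E: "cmod ((deriv ^^ 2) zeta s - of_real (ln 2 ^ 2) * p s) \<le> 54 * 3 powr (- Re s)" if s: "Re s \<ge> 3" for s
  proof -
    have n1: "1 \<notin> ball s 1" using ball_Re_Im[of 1 s 1] s by auto
    have hz: "(\<lambda>z. zeta z - 1) holomorphic_on ball s 1" by (intro holomorphic_intros holomorphic_zeta n1)
    have eq: "(deriv ^^ 2) (\<lambda>z. zeta z - 1 - p z) s = (deriv ^^ 2) zeta s - (deriv ^^ 2) p s"
    proof -
      have "(deriv ^^ 2) (\<lambda>z. zeta z - 1 - p z) s = (deriv ^^ 2) (\<lambda>z. zeta z - 1) s - (deriv ^^ 2) p s"
        by (rule higher_deriv_diff[OF hz hp, of s]) auto
      also have "(deriv ^^ 2) (\<lambda>z. zeta z - 1) s = (deriv ^^ 2) zeta s - (deriv ^^ 2) (\<lambda>z. 1) s"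
        by (rule higher_deriv_diff[OF holomorphic_zeta[OF n1] holomorphic_on_const, of s]) auto
      finally show ?thesis by (simp add: numeral_2_eq_2)
    qed
    have "cmod ((deriv ^^ 2) (\<lambda>z. zeta z - 1 - p z) s) \<le> fact 2 * (9 * 3 powr (1 - Re s)) / 1 ^ 2"
    proof (rule cmod_deriv_le)
      fix w assume "w \<in> ball s 1"
      then have "Re w \<ge> 2" "Re w \<ge> Re s - 1" using ball_Re_Im[of w s 1] s by auto
      then show "cmod (zeta w - 1 - p w) \<le> 9 * 3 powr (1 - Re s)"
        using zeta_dirichlet_tail[of w] powr_mono[of "- Re w" "1 - Re s" "3::real"] unfolding p2 by linarith
    qed (auto intro!: holomorphic_intros hz hp)
    also have "3 powr (1 - Re s) = 3 * 3 powr (- Re s)" using powr_add[of 3 1 "- Re s"] by simp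
    finally show ?thesis unfolding eq d2p by simp
  qed
  have "\<forall>\<^sub>F x::real in at_top. 54 * 3 powr (- x) * exp (ln 2 * x) / ln 2 ^ 2 \<le> 1 / 2" by real_asymp
  then obtain A0 where A0: "\<And>x::real. x \<ge> A0 \<Longrightarrow> 54 * 3 powr (- x) * exp (ln 2 * x) / ln 2 ^ 2 \<le> 1 / 2"
    unfolding eventually_at_top_linorder by blast
  have "cmod ((deriv ^^ 2) zeta s * exp (of_real (ln 2) * s) / of_real (ln 2 ^ 2) - 1) \<le> 1 / 2"
    if s: "Re s \<ge> max A0 4" for s
  proof -
    have "p s * exp (of_real (ln 2) * s) = 1" by (simp add: p_def flip: exp_add)
    then have "(deriv ^^ 2) zeta s * exp (of_real (ln 2) * s) / of_real (ln 2 ^ 2) - 1 =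
       ((deriv ^^ 2) zeta s - of_real (ln 2 ^ 2) * p s) * exp (of_real (ln 2) * s) / of_real (ln 2 ^ 2)"
      by (simp add: field_simps)
    then have "cmod ((deriv ^^ 2) zeta s * exp (of_real (ln 2) * s) / of_real (ln 2 ^ 2) - 1) =
       cmod ((deriv ^^ 2) zeta s - of_real (ln 2 ^ 2) * p s) * exp (ln 2 * Re s) / ln 2 ^ 2"
      by (simp add: norm_mult norm_divide norm_power)
    also have "\<dots> \<le> 54 * 3 powr (- Re s) * exp (ln 2 * Re s) / ln 2 ^ 2"
      using s by (intro divide_right_mono mult_right_mono E) auto
    also have "\<dots> \<le> 1 / 2" using s by (intro A0) auto
    finally show ?thesis .
  qed
  then show ?thesis by (intro exI[of _ "max A0 4"]) auto
qed

text \<open>With l = ln (Im s) the functional equation gives zeta_ld s = - l + e, where cmod e <= l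
  / 8. The square then has real part at least (49 - 1) / 64 * l^2, and the derivative takes away at
  most l^2 / 4.\<close>

lemma Re_log_deriv_quotient_pos:
  assumes b: "b \<ge> 0"
  shows "\<exists>C>0. \<forall>s. - b \<le> Re s \<and> Re s \<le> 1/2 \<and> Im s \<ge> 3 \<and> zeta (1 - s) \<noteq> 0 \<and>
     cmod (zeta_ld (1 - s)) + C \<le> ln (Im s) / 8 \<and> cmod (deriv zeta_ld (1 - s)) + C \<le> ln (Im s) ^ 2 / 4 \<longrightarrow>
     Re (zeta_ld s ^ 2 + deriv zeta_ld s) > 0"
proof -
  obtain C where C: "C > 0" "\<And>s. - b \<le> Re s \<Longrightarrow> Re s \<le> 1/2 \<Longrightarrow> Im s \<ge> 3 \<Longrightarrow>
      cmod (chi_logderiv s + of_real (ln (Im s))) \<le> C \<and> cmod (deriv chi_logderiv s) \<le> C"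
    using chi_logderiv_bounds[OF b] by blast
  have "Re (zeta_ld s ^ 2 + deriv zeta_ld s) > 0"
    if s: "- b \<le> Re s" "Re s \<le> 1/2" "Im s \<ge> 3" "zeta (1 - s) \<noteq> 0"
      and le: "cmod (zeta_ld (1 - s)) + C \<le> ln (Im s) / 8" "cmod (deriv zeta_ld (1 - s)) + C \<le> ln (Im s) ^ 2 / 4" for s
  proof -
    define l where "l = ln (Im s)"
    have l: "l > 0" using s by (simp add: l_def)
    have sl: "s \<in> slit_plane" "sin (of_real pi * s / 2) \<noteq> 0"
      using slit_plane_iff[of s] sin_pi_half_nonzero[of s] s by auto
    define e where "e = zeta_ld s + of_real l"
    have "e = (chi_logderiv s + of_real l) - zeta_ld (1 - s)"
      unfolding e_def zeta_ld_functional_equation(2)[OF sl s(4)] by simp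
    then have "cmod e \<le> cmod (chi_logderiv s + of_real l) + cmod (zeta_ld (1 - s))"
      using norm_triangle_ineq4 by metis
    then have e: "cmod e \<le> l / 8" using C(2)[OF s(1-3)] le(1) by (simp add: l_def)
    have "cmod (deriv zeta_ld s) \<le> cmod (deriv chi_logderiv s) + cmod (deriv zeta_ld (1 - s))"
      unfolding deriv_zeta_ld_functional_equation(1)[OF sl s(4)] by (rule norm_triangle_ineq)
    then have d: "cmod (deriv zeta_ld s) \<le> l ^ 2 / 4" using C(2)[OF s(1-3)] le(2) by (simp add: l_def)
    have z: "zeta_ld s = e - of_real l" by (simp add: e_def)
    have "(7 / 8 * l) ^ 2 \<le> (Re e - l) ^ 2"
      using e abs_Re_le_cmod[of e] l by (subst abs_le_square_iff[symmetric]) auto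
    moreover have "(Im e) ^ 2 \<le> (l / 8) ^ 2"
      using e abs_Im_le_cmod[of e] l by (subst abs_le_square_iff[symmetric]) auto
    moreover have "Re (zeta_ld s ^ 2) = (Re e - l) ^ 2 - (Im e) ^ 2" unfolding z Re_power2 by simp
    moreover have "Re (deriv zeta_ld s) \<ge> - (l ^ 2 / 4)" using d abs_Re_le_cmod[of "deriv zeta_ld s"] by linarith
    moreover have "l ^ 2 > 0" using l by simp
    moreover have "(7 / 8 * l) ^ 2 = 49 / 64 * l ^ 2" "(l / 8) ^ 2 = l ^ 2 / 64"
      by (simp_all add: power_mult_distrib power_divide)
    ultimately show ?thesis unfolding plus_complex.sel by linarith
  qed
  then show ?thesis using C(1) by blast
qed

text \<open>The region in which, under the Riemann hypothesis, chi s, zeta (1 - s) and zeta s are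
  all zero-free, so that F factors through them.\<close>

definition left_strip :: "complex set" where
  "left_strip = {s. Re s < 1/2 \<and> Im s > 2}"

lemma zeta_left_strip:
  assumes RH: "riemann_hypothesis"
  shows "open left_strip" and "s \<in> left_strip \<Longrightarrow> zeta (1 - s) \<noteq> 0" and "s \<in> left_strip \<Longrightarrow> zeta s \<noteq> 0"
    and "s \<in> left_strip \<Longrightarrow> zeta s = chi s * zeta (1 - s)" and "s \<in> left_strip \<Longrightarrow> chi s \<noteq> 0"
    and "chi holomorphic_on left_strip" and "(\<lambda>s. zeta (1 - s)) holomorphic_on left_strip"
    and "(\<lambda>s. zeta_ld s ^ 2 + deriv zeta_ld s) holomorphic_on left_strip"
    and "s \<in> left_strip \<Longrightarrow> (deriv ^^ 2) zeta s = chi s * (zeta (1 - s) * (zeta_ld s ^ 2 + deriv zeta_ld s))"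
proof -
  have "open ({s. Re s < 1/2} \<inter> {s. Im s > 2})" by (intro open_Int open_halfspace_Re_lt open_halfspace_Im_gt)
  moreover have "{s. Re s < 1/2} \<inter> {s. Im s > 2} = left_strip" by (auto simp: left_strip_def)
  ultimately show o: "open left_strip" by metis
  have sl: "s \<in> slit_plane" "sin (of_real pi * s / 2) \<noteq> 0" if "s \<in> left_strip" for s
    using slit_plane_iff[of s] sin_pi_half_nonzero[of s] that by (auto simp: left_strip_def)
  show z1: "zeta (1 - s) \<noteq> 0" if "s \<in> left_strip" for s
    by (rule RH_zeta_nonzero[OF RH]) (use that in \<open>auto simp: left_strip_def\<close>)
  show z: "zeta s \<noteq> 0" if "s \<in> left_strip" for s
    using zeta_ld_functional_equation(1)[OF sl[OF that] z1[OF that]] .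
  show fe: "zeta s = chi s * zeta (1 - s)" if "s \<in> left_strip" for s
    using zeta_functional_equation sl(1)[OF that] .
  show "chi s \<noteq> 0" if "s \<in> left_strip" for s using chi_nonzero[OF sl[OF that]] .
  show "chi holomorphic_on left_strip"
    using chi_has_derivative[OF sl] o by (auto simp: holomorphic_on_open)
  have "zeta \<circ> (\<lambda>s. 1 - s) holomorphic_on left_strip"
    by (rule holomorphic_on_compose_gen[OF _ holomorphic_zeta[of "- {1}"]]) (auto simp: left_strip_def intro!: holomorphic_intros)
  then show "(\<lambda>s. zeta (1 - s)) holomorphic_on left_strip" by (simp add: o_def)
  have "zeta_ld holomorphic_on left_strip" using z by (intro holomorphic_zeta_ld) (auto simp: left_strip_def)
  then show "(\<lambda>s. zeta_ld s ^ 2 + deriv zeta_ld s) holomorphic_on left_strip"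
    using o by (intro holomorphic_intros holomorphic_deriv)
  show "(deriv ^^ 2) zeta s = chi s * (zeta (1 - s) * (zeta_ld s ^ 2 + deriv zeta_ld s))" if s: "s \<in> left_strip" for s
  proof -
    have "s \<noteq> 1" using s by (auto simp: left_strip_def)
    then have "(deriv ^^ 2) zeta s = zeta s * (zeta_ld s ^ 2 + deriv zeta_ld s)"
      using z[OF s] by (rule deriv2_zeta_eq)
    then show ?thesis unfolding fe[OF s] by simp
  qed
qed

text \<open>The multiplier g is 1 on the top edge and exp (- chi_main s) on the left edge, where it
  takes out the main term. The factor q^2 + q' stays in the right half-plane and adds 2 pi.\<close>

lemma arg_change_left_strip:
  assumes RH: "riemann_hypothesis" and sub: "closed_segment u v \<subseteq> left_strip"
    and V: "\<And>s. s \<in> closed_segment u v \<Longrightarrow> Re (zeta_ld s ^ 2 + deriv zeta_ld s) > 0"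
    and Z: "arg_change_le (\<lambda>s. zeta (1 - s)) u v K"
    and X: "arg_change_le (\<lambda>s. chi s * g s) u v K'" "g holomorphic_on left_strip" "\<And>s. s \<in> left_strip \<Longrightarrow> g s \<noteq> 0"
  shows "arg_change_le (\<lambda>s. (deriv ^^ 2) zeta s * g s) u v (K' + (K + 2 * pi))"
proof -
  note ls = zeta_left_strip[OF RH]
  define W where "W = (\<lambda>s. zeta_ld s ^ 2 + deriv zeta_ld s)"
  have W: "W holomorphic_on left_strip" unfolding W_def by (rule ls(8))
  have nzW: "W s \<noteq> 0" if "s \<in> closed_segment u v" for s
    using V[OF that] unfolding W_def by (metis less_irrefl zero_complex.sel(1))
  have "arg_change_le W u v (2 * pi)"
    by (rule arg_change_le_Ln[OF ls(1) W sub, of 1])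
       (use V in \<open>auto simp: W_def complex_nonpos_Reals_iff not_le\<close>)
  from arg_change_le_mult[OF Z this ls(1,7) W sub]
  have ZW: "arg_change_le (\<lambda>s. zeta (1 - s) * W s) u v (K + 2 * pi)"
    using nzW ls(2) sub by blast
  have "arg_change_le (\<lambda>s. chi s * g s * (zeta (1 - s) * W s)) u v (K' + (K + 2 * pi))"
    by (rule arg_change_le_mult[OF X(1) ZW ls(1) _ _ sub])
       (use nzW ls(2,5) sub X(3) in \<open>auto intro!: holomorphic_intros ls(6,7) W X(2)\<close>)
  then show ?thesis
    by (rule arg_change_le_cong[OF ls(1) sub, rotated]) (use ls(9) in \<open>simp add: W_def mult_ac\<close>)
qed

lemma arg_change_top_left:
  assumes RH: "riemann_hypothesis" and b: "b \<ge> 3"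
  shows "\<exists>C. \<forall>\<^sub>F T in at_top. \<forall>u v. Im u = T \<and> Im v = T \<and> - b \<le> Re u \<and> Re u \<le> Re v \<and> Re v \<le> 1/2 - 2 * width T \<longrightarrow>
     arg_change_le ((deriv ^^ 2) zeta) u v (C + 2 * width T ^ 4 * ln T)"
proof -
  obtain C1 where C1: "C1 > 0" "\<And>s. - b \<le> Re s \<Longrightarrow> Re s \<le> 1/2 \<Longrightarrow> Im s \<ge> 3 \<Longrightarrow> zeta (1 - s) \<noteq> 0 \<Longrightarrow>
     cmod (zeta_ld (1 - s)) + C1 \<le> ln (Im s) / 8 \<Longrightarrow> cmod (deriv zeta_ld (1 - s)) + C1 \<le> ln (Im s) ^ 2 / 4 \<Longrightarrow>
     Re (zeta_ld s ^ 2 + deriv zeta_ld s) > 0"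
    using Re_log_deriv_quotient_pos[of b] b by auto
  obtain C2 where C2: "C2 > 0" "\<And>u v. - b \<le> Re u \<Longrightarrow> Re u \<le> Re v \<Longrightarrow> Re v \<le> 1/2 \<Longrightarrow> Im u \<ge> 3 \<Longrightarrow> Im v = Im u \<Longrightarrow>
     arg_change_le chi u v C2"
    using chi_horizontal[of b] b by auto
  \<comment> \<open>For A = b + 1 the reflected disc is centred over 1 - A = - b, the left end of
    the top edge.\<close>
  have A: "b + 1 \<ge> 4" using b by simp
  have ev: "\<forall>\<^sub>F T in at_top. width T ^ 3 * ln T + C1 \<le> ln T / 8 \<and> 2 * width T ^ 2 * ln T + C1 \<le> ln T ^ 2 / 4 \<and> T \<ge> 3"
    unfolding width_def by (intro eventually_conj; real_asymp)
  have "\<forall>\<^sub>F T in at_top. \<forall>u v. Im u = T \<and> Im v = T \<and> - b \<le> Re u \<and> Re u \<le> Re v \<and> Re v \<le> 1/2 - 2 * width T \<longrightarrow>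
     arg_change_le ((deriv ^^ 2) zeta) u v ((C2 + 2 * pi) + 2 * width T ^ 4 * ln T)"
    using reflected_zeta_bounds[OF RH A] ev width_small[of 1, simplified]
  proof eventually_elim
    case (elim T)
    show ?case
    proof (intro allI impI)
      fix u v assume uv: "Im u = T \<and> Im v = T \<and> - b \<le> Re u \<and> Re u \<le> Re v \<and> Re v \<le> 1/2 - 2 * width T"
      have seg: "Im s = T \<and> - b \<le> Re s \<and> Re s \<le> 1/2 - 2 * width T" if "s \<in> closed_segment u v" for s
        using that closed_segment_same_Im[of u v] uv by (auto simp: closed_segment_eq_real_ivl)
      have sub: "closed_segment u v \<subseteq> left_strip"
      proof
        fix s assume "s \<in> closed_segment u v"
        then show "s \<in> left_strip" using seg[of s] elim by (simp add: left_strip_def)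
      qed
      have "arg_change_le (\<lambda>s. (deriv ^^ 2) zeta s * 1) u v (C2 + (2 * width T ^ 4 * ln T + 2 * pi))"
      proof (rule arg_change_left_strip[OF RH sub])
        fix s assume s: "s \<in> closed_segment u v"
        have "zeta (1 - s) \<noteq> 0" using sub s zeta_left_strip(2)[OF RH] by blast
        moreover have "cmod (zeta_ld (1 - s)) \<le> width T ^ 3 * ln T" "cmod (deriv zeta_ld (1 - s)) \<le> 2 * width T ^ 2 * ln T"
          using elim(1) seg[OF s] by auto
        ultimately show "Re (zeta_ld s ^ 2 + deriv zeta_ld s) > 0"
          using seg[OF s] elim(2,3) by (intro C1(2)) auto
      next
        show "arg_change_le (\<lambda>s. zeta (1 - s)) u v (2 * width T ^ 4 * ln T)"
          using elim(1) uv by auto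
        show "arg_change_le (\<lambda>s. chi s * 1) u v C2"
          using uv elim(2,3) by simp (intro C2(2); simp)
      qed auto
      then show "arg_change_le ((deriv ^^ 2) zeta) u v ((C2 + 2 * pi) + 2 * width T ^ 4 * ln T)"
        by (simp add: algebra_simps)
    qed
  qed
  then show ?thesis by blast
qed

text \<open>Both claims come from the disc around A + i T that ends 4 widths before the critical
  line. F is at least the constant m at the centre, and the relative margin \<epsilon> = 2 *
  \<delta> / R makes the usable disc end at 1/2 + 8 * \<delta> and B / \<epsilon> of order
  \<delta>^3 * l. The lower bound loses a further factor ln (A / \<delta>), which \<delta>^2
  outweighs. The point z is the centre needed in \<open>arg_change_top_middle\<close>.\<close>

lemma arg_change_top_right:
  assumes RH: "riemann_hypothesis" and A: "A \<ge> 4"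
    and F: "\<And>s. Re s \<ge> A \<Longrightarrow> cmod ((deriv ^^ 2) zeta s * exp (of_real (ln 2) * s) / of_real (ln 2 ^ 2) - 1) \<le> 1 / 2"
  shows "\<forall>\<^sub>F T in at_top. (\<forall>u v. Im u = T \<and> Im v = T \<and> 1/2 + 8 * width T \<le> Re u \<and> Re u \<le> Re v \<and> Re v \<le> A \<and>
       (\<forall>s\<in>closed_segment u v. (deriv ^^ 2) zeta s \<noteq> 0) \<longrightarrow>
       arg_change_le ((deriv ^^ 2) zeta) u v (60 * A * width T ^ 3 * ln T)) \<and>
     (\<exists>z\<in>cball (Complex (1/2 + 10 * width T) T) (2 * width T). cmod ((deriv ^^ 2) zeta z) \<ge> exp (- (width T * ln T)))"
proof -
  define F where "F = (deriv ^^ 2) zeta"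
  define m where "m = ln 2 ^ 2 / (2 * exp (ln 2 * A))"
  have m: "m > 0" by (simp add: m_def)
  have Fm: "cmod (F s) \<ge> m" if "Re s = A" for s
  proof -
    define w where "w = F s * exp (of_real (ln 2) * s) / of_real (ln 2 ^ 2)"
    have "cmod w \<ge> 1 / 2"
      using F[of s] that norm_triangle_ineq2[of 1 "1 - w"] by (simp add: F_def w_def norm_minus_commute)
    moreover have "cmod w = cmod (F s) * exp (ln 2 * A) / ln 2 ^ 2"
      using that by (simp add: w_def norm_mult norm_divide norm_power)
    ultimately show ?thesis unfolding m_def by (simp add: field_simps)
  qed
  have ev: "\<forall>\<^sub>F T in at_top. 1 / m \<le> exp (width T ^ 4 * ln T) \<and>
     ln m \<ge> - (width T * ln T / 2) \<and>
     3 / 2 * A * width T ^ 3 * ln T * (4 + ln (A / width T)) \<le> width T * ln T / 2 \<and> T \<ge> 2 * A"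
    unfolding width_def using A m by (intro eventually_conj; real_asymp)
  show ?thesis
    using zeta_deriv2_bound_right[OF RH A] ev width_small[of "1/24", simplified]
  proof eventually_elim
    case (elim T)
    define \<delta> where "\<delta> = width T"
    define l where "l = ln T"
    have \<delta>: "0 < \<delta>" "\<delta> < 1/24" using elim by (auto simp: \<delta>_def)
    have l: "l > 0" using elim A by (simp add: l_def)
    define c where "c = Complex A T"
    define R where "R = A - 1/2 - 4 * \<delta>"
    define B where "B = 3 * \<delta> ^ 4 * l"
    define \<epsilon> where "\<epsilon> = 2 * \<delta> / R"
    have R: "R > 3" "R \<le> A" using A \<delta> by (auto simp: R_def)
    have B: "B > 0" using \<delta> l by (simp add: B_def)
    have \<epsilon>: "0 < \<epsilon>" "\<epsilon> < 1/2" using R \<delta> by (auto simp: \<epsilon>_def divide_less_eq)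
    have \<epsilon>R: "(1 - 2 * \<epsilon>) * R = A - 1/2 - 8 * \<delta>" using R by (simp add: \<epsilon>_def R_def left_diff_distrib)
    have Fc: "cmod (F c) \<ge> m" by (rule Fm) (simp add: c_def)
    then have Fc0: "F c \<noteq> 0" using m by auto
    have inb: "Re z \<ge> 1/2 + 4 * \<delta>" "\<bar>Im z - T\<bar> \<le> A" if "z \<in> ball c R" for z
      using ball_Re_Im[OF that] R by (auto simp: c_def R_def)
    have hol: "F holomorphic_on ball c R" unfolding F_def
      using inb(2)[of 1] A elim by (intro holomorphic_deriv2_zeta) auto
    have le: "cmod (F z) \<le> exp B * cmod (F c)" if z: "z \<in> ball c R" for z
    proof -
      have "cmod (F z) \<le> exp (2 * \<delta> ^ 4 * l) * 1"
        using elim(1) inb[OF z] \<delta>(1) unfolding F_def \<delta>_def l_def by simp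
      also have "\<dots> \<le> exp (2 * \<delta> ^ 4 * l) * (exp (\<delta> ^ 4 * l) * cmod (F c))"
      proof (intro mult_left_mono)
        have "1 / m * m \<le> exp (\<delta> ^ 4 * l) * cmod (F c)"
          using elim(2) Fc m by (intro mult_mono) (auto simp: \<delta>_def l_def)
        then show "1 \<le> exp (\<delta> ^ 4 * l) * cmod (F c)" using m by simp
      qed auto
      also have "\<dots> = exp B * cmod (F c)"
        unfolding B_def mult.assoc[symmetric] exp_add[symmetric] by (simp add: algebra_simps)
      finally show ?thesis .
    qed
    have Be: "B / \<epsilon> = 3 / 2 * R * \<delta> ^ 3 * l" using \<delta> by (simp add: B_def \<epsilon>_def field_simps power3_eq_cube power4_eq_xxxx)
    have 1: "arg_change_le F u v (60 * A * \<delta> ^ 3 * l)"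
      if uv: "Im u = T" "Im v = T" "1/2 + 8 * \<delta> \<le> Re u" "Re u \<le> Re v" "Re v \<le> A"
        and nz: "\<And>s. s \<in> closed_segment u v \<Longrightarrow> F s \<noteq> 0" for u v
    proof -
      have cb: "s \<in> cball c ((1 - 2 * \<epsilon>) * R)" if s: "Im s = T" "1/2 + 8 * \<delta> \<le> Re s" "Re s \<le> A" for s
      proof -
        have "c - s = of_real (A - Re s)" using s by (simp add: c_def complex_eq_iff)
        then have "dist c s = \<bar>A - Re s\<bar>" by (simp only: dist_norm norm_of_real)
        then show ?thesis unfolding \<epsilon>R using s by simp
      qed
      have "arg_change_le F u v (40 * B / \<epsilon>)"
        using uv R nz by (intro disc_arg_change[OF hol le _ Fc0 \<epsilon> B] cb) auto
      moreover have "40 * B / \<epsilon> = 40 * (B / \<epsilon>)" by simp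
      then have "40 * B / \<epsilon> = 60 * R * \<delta> ^ 3 * l" unfolding Be by simp
      moreover have "60 * R * \<delta> ^ 3 * l \<le> 60 * A * \<delta> ^ 3 * l" using R \<delta> l by (intro mult_right_mono) auto
      ultimately show ?thesis using arg_change_le_mono by metis
    qed
    define p where "p = Complex (1/2 + 10 * \<delta>) T"
    have "c - p = of_real (A - 1/2 - 10 * \<delta>)" by (simp add: c_def p_def complex_eq_iff)
    then have "dist c p = \<bar>A - 1/2 - 10 * \<delta>\<bar>" by (simp only: dist_norm norm_of_real)
    then have dcp: "dist c p = A - 1/2 - 10 * \<delta>" using A \<delta> by simp
    have "cball p (2 * \<delta>) \<subseteq> cball c ((1 - 2 * \<epsilon>) * R)"
      unfolding \<epsilon>R
    proof
      fix x assume "x \<in> cball p (2 * \<delta>)"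
      then show "x \<in> cball c (A - 1/2 - 8 * \<delta>)" using dcp dist_triangle[of c x p] by simp
    qed
    then obtain z where z: "z \<in> cball p (2 * \<delta>)" "cmod (F z) \<ge> cmod (F c) * exp (- (B / \<epsilon> * (4 + ln (2 * R / (2 * \<delta>)))))"
      using disc_lower_bound_point[OF hol le _ Fc0 \<epsilon> B, of "2 * \<delta>" p] \<delta> R by auto
    have "exp (- (\<delta> * l)) \<le> cmod (F z)"
    proof -
      have "B / \<epsilon> * (4 + ln (2 * R / (2 * \<delta>))) \<le> 3 / 2 * A * \<delta> ^ 3 * l * (4 + ln (A / \<delta>))"
        unfolding Be using R \<delta> l by (intro mult_mono add_mono ln_mono divide_right_mono) (auto intro!: ln_ge_zero add_nonneg_nonneg simp: le_divide_eq)
      also have "\<dots> \<le> \<delta> * l / 2" using elim(2) by (simp add: \<delta>_def l_def)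
      finally have "exp (- (\<delta> * l / 2)) \<le> exp (- (B / \<epsilon> * (4 + ln (2 * R / (2 * \<delta>)))))" by simp
      moreover have "exp (- (\<delta> * l / 2)) \<le> cmod (F c)"
      proof -
        have "exp (- (\<delta> * l / 2)) \<le> exp (ln m)" using elim(2) by (simp add: \<delta>_def l_def)
        then show ?thesis using m Fc by simp
      qed
      ultimately have "exp (- (\<delta> * l / 2)) * exp (- (\<delta> * l / 2)) \<le> cmod (F c) * exp (- (B / \<epsilon> * (4 + ln (2 * R / (2 * \<delta>)))))"
        by (intro mult_mono) auto
      also have "\<dots> \<le> cmod (F z)" by (rule z(2))
      finally show ?thesis by (simp flip: exp_add)
    qed
    then show ?case using 1 z(1) unfolding F_def \<delta>_def l_def p_def by blast
  qed
qed

text \<open>F is at most exp (301 * \<delta> * l) near the line and at least exp (- \<delta> * l) at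
  the point supplied by \<open>arg_change_top_right\<close>, hence B = 302 * \<delta> * l. With
  \<epsilon> = 1/4 the usable radius is 30 * \<delta>, while the segment stays within 17 * \<delta>
  of the centre; and 40 * 302 * 4 < 50000.\<close>

lemma arg_change_top_middle:
  assumes RH: "riemann_hypothesis" and A: "A \<ge> 4"
    and F: "\<And>s. Re s \<ge> A \<Longrightarrow> cmod ((deriv ^^ 2) zeta s * exp (of_real (ln 2) * s) / of_real (ln 2 ^ 2) - 1) \<le> 1 / 2"
  shows "\<forall>\<^sub>F T in at_top. \<forall>u v. Im u = T \<and> Im v = T \<and> 1/2 - 3 * width T \<le> Re u \<and> Re u \<le> Re v \<and> Re v \<le> 1/2 + 8 * width T \<and>
       (\<forall>s\<in>closed_segment u v. (deriv ^^ 2) zeta s \<noteq> 0) \<longrightarrow>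
       arg_change_le ((deriv ^^ 2) zeta) u v (50000 * width T * ln T)"
proof -
  have ev: "\<forall>\<^sub>F T in at_top. \<exists>z\<in>cball (Complex (1/2 + 10 * width T) T) (2 * width T). cmod ((deriv ^^ 2) zeta z) \<ge> exp (- (width T * ln T))"
    by (rule eventually_mono, rule arg_change_top_right[OF RH A], erule F, blast)
  show ?thesis using ev zeta_deriv2_bound_near_line[OF RH] width_small[of "1/160", simplified] eventually_gt_at_top[of 4]
  proof eventually_elim
    case (elim T)
    define F where "F = (deriv ^^ 2) zeta"
    define \<delta> where "\<delta> = width T"
    define l where "l = ln T"
    have \<delta>: "0 < \<delta>" "\<delta> < 1/160" using elim by (auto simp: \<delta>_def)
    have l: "l > 0" using elim by (simp add: l_def)
    define p where "p = Complex (1/2 + 10 * \<delta>) T"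
    obtain z where z: "z \<in> cball p (2 * \<delta>)" "cmod (F z) \<ge> exp (- (\<delta> * l))"
      using elim(1) unfolding F_def \<delta>_def l_def p_def by blast
    have "\<bar>Re p - Re z\<bar> \<le> 2 * \<delta>" "\<bar>Im p - Im z\<bar> \<le> 2 * \<delta>"
      using z(1) abs_Re_le_cmod[of "p - z"] abs_Im_le_cmod[of "p - z"] by (auto simp: dist_norm)
    then have zz: "Re z \<ge> 1/2 + 8 * \<delta>" "Re z \<le> 1/2 + 12 * \<delta>" "Im z \<ge> T - 2 * \<delta>" "Im z \<le> T + 2 * \<delta>" by (auto simp: p_def)
    define R where "R = 60 * \<delta>"
    define B where "B = 302 * \<delta> * l"
    have B: "B > 0" using \<delta> l by (simp add: B_def)
    have Fz0: "F z \<noteq> 0" using z(2) by (metis exp_gt_zero norm_zero not_le)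
    have inb: "\<bar>Im w - T\<bar> \<le> 1/2" "\<bar>Re w - 1/2\<bar> \<le> 79 * \<delta>" if "w \<in> ball z R" for w
      using ball_Re_Im[OF that] zz \<delta> unfolding R_def by linarith+
    have hol: "F holomorphic_on ball z R" unfolding F_def
      using inb(1)[of 1] elim by (intro holomorphic_deriv2_zeta) auto
    have le: "cmod (F w) \<le> exp B * cmod (F z)" if w: "w \<in> ball z R" for w
    proof -
      have "cmod (F w) \<le> exp (301 * \<delta> * l)" using elim(2) inb[OF w] unfolding F_def \<delta>_def l_def by simp
      also have "\<dots> = exp B * exp (- (\<delta> * l))" unfolding B_def exp_add[symmetric] by (simp add: algebra_simps)
      also have "\<dots> \<le> exp B * cmod (F z)" using z(2) by (intro mult_left_mono) auto
      finally show ?thesis .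
    qed
    have "arg_change_le F u v (50000 * \<delta> * l)"
      if uv: "Im u = T" "Im v = T" "1/2 - 3 * \<delta> \<le> Re u" "Re u \<le> Re v" "Re v \<le> 1/2 + 8 * \<delta>"
        and nz: "\<And>s. s \<in> closed_segment u v \<Longrightarrow> F s \<noteq> 0" for u v
    proof -
      have cb: "s \<in> cball z ((1 - 2 * (1/4)) * R)" if s: "Im s = T" "1/2 - 3 * \<delta> \<le> Re s" "Re s \<le> 1/2 + 8 * \<delta>" for s
      proof -
        have "dist z s \<le> \<bar>Re z - Re s\<bar> + \<bar>Im z - Im s\<bar>" using cmod_le[of "z - s"] by (simp add: dist_norm)
        then show ?thesis using s zz \<delta> by (simp add: R_def)
      qed
      have "arg_change_le F u v (40 * B / (1/4))"
        using uv \<delta> nz by (intro disc_arg_change[OF hol le _ Fz0 _ _ B] cb) (auto simp: R_def)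
      moreover have "40 * B / (1/4) \<le> 50000 * \<delta> * l" using \<delta> l by (simp add: B_def)
      ultimately show ?thesis using arg_change_le_mono by blast
    qed
    then show ?case unfolding F_def \<delta>_def l_def by blast
  qed
qed

text \<open>Separates an explicit main term that grows with T: the logarithmic derivative of F is
  that of F * exp (- M) plus M', and M' integrates to the exact increment of M.\<close>

lemma arg_change_le_exp_factor:
  assumes arg: "arg_change_le (\<lambda>s. F s * exp (- M s)) a b K"
    and S: "open S" "closed_segment a b \<subseteq> S" "F holomorphic_on S"
    and M: "\<And>s. s \<in> S \<Longrightarrow> (M has_field_derivative M' s) (at s)"
    and nz: "\<And>s. s \<in> closed_segment a b \<Longrightarrow> F s \<noteq> 0"
  shows "\<exists>I. ((\<lambda>s. deriv F s / F s) has_contour_integral I) (linepath a b) \<and> \<bar>Im I - Im (M b - M a)\<bar> \<le> K"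
proof -
  define G where "G = (\<lambda>s. F s * exp (- M s))"
  have eq: "deriv G s / G s = deriv F s / F s - M' s" if s: "s \<in> closed_segment a b" for s
  proof -
    have "s \<in> S" using s S by auto
    then have "(F has_field_derivative deriv F s) (at s)" using holomorphic_derivI[OF S(3,1)] by simp
    moreover have "((\<lambda>s. exp (- M s)) has_field_derivative exp (- M s) * - M' s) (at s)"
      by (intro DERIV_chain2[OF DERIV_exp] DERIV_minus M \<open>s \<in> S\<close>)
    ultimately have "(G has_field_derivative deriv F s * exp (- M s) + exp (- M s) * - M' s * F s) (at s)"
      unfolding G_def by (rule DERIV_mult)
    then have "deriv G s = exp (- M s) * (deriv F s - M' s * F s)"
      by (simp add: DERIV_imp_deriv algebra_simps)
    then show ?thesis using nz[OF s] by (simp add: G_def field_simps)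
  qed
  obtain I where I: "((\<lambda>s. deriv G s / G s) has_contour_integral I) (linepath a b)" "\<bar>Im I\<bar> \<le> K"
    by (rule arg_change_le_integral[OF arg]) (simp add: G_def)
  have "(M' has_contour_integral M (pathfinish (linepath a b)) - M (pathstart (linepath a b))) (linepath a b)"
    by (rule contour_integral_primitive[of S])
       (use M S(2) in \<open>auto intro: has_field_derivative_at_within\<close>)
  then have "(M' has_contour_integral M b - M a) (linepath a b)" by simp
  from has_contour_integral_add[OF I(1) this]
  have "((\<lambda>s. deriv F s / F s) has_contour_integral (I + (M b - M a))) (linepath a b)"
    by (rule has_contour_integral_eq) (simp add: eq)
  then show ?thesis using I(2) by (intro exI[of _ "I + (M b - M a)"]) simp
qed

text \<open>On this edge 1 - s has real part at least 4, where zeta' / zeta and its derivative are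
  at most 7 and zeta is close to 1. The factors zeta (1 - s) and q^2 + q' turn by at most 2 pi each,
  and chi follows \<open>chi_main\<close> up to 10.\<close>

lemma left_edge:
  assumes RH: "riemann_hypothesis" and b: "b \<ge> 3"
  shows "\<exists>t1\<ge>3. \<forall>t0\<ge>t1. \<forall>T\<ge>t0. \<exists>I. ((\<lambda>s. deriv ((deriv ^^ 2) zeta) s / (deriv ^^ 2) zeta s) has_contour_integral I)
      (linepath (Complex (-b) t0) (Complex (-b) T)) \<and>
    \<bar>Im I - Im (chi_main (Complex (-b) T) - chi_main (Complex (-b) t0))\<bar> \<le> 10 + 4 * pi"
proof -
  note ls = zeta_left_strip[OF RH]
  obtain C where C: "C > 0" "\<And>s. - b \<le> Re s \<Longrightarrow> Re s \<le> 1/2 \<Longrightarrow> Im s \<ge> 3 \<Longrightarrow> zeta (1 - s) \<noteq> 0 \<Longrightarrow>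
     cmod (zeta_ld (1 - s)) + C \<le> ln (Im s) / 8 \<Longrightarrow> cmod (deriv zeta_ld (1 - s)) + C \<le> ln (Im s) ^ 2 / 4 \<Longrightarrow>
     Re (zeta_ld s ^ 2 + deriv zeta_ld s) > 0"
    using Re_log_deriv_quotient_pos[of b] b by auto
  have "\<forall>\<^sub>F t in at_top. 7 + C \<le> ln t / 8 \<and> 7 + C \<le> ln t ^ 2 / 4 \<and> t \<ge> 3" by (intro eventually_conj; real_asymp)
  then obtain t1 where t1: "\<And>t. t \<ge> t1 \<Longrightarrow> 7 + C \<le> ln t / 8 \<and> 7 + C \<le> ln t ^ 2 / 4 \<and> t \<ge> 3"
    unfolding eventually_at_top_linorder by blast
  have ld1: "cmod (zeta_ld w) \<le> 7 \<and> cmod (deriv zeta_ld w) \<le> 7" if w: "Re w \<ge> 4" for w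
  proof
    show "cmod (zeta_ld w) \<le> 7" using w by (intro zeta_ld_le) auto
    have in1: "Re z \<ge> 3" if "z \<in> ball w 1" for z using ball_Re_Im[OF that] w by auto
    have "cmod ((deriv ^^ 1) zeta_ld w) \<le> fact 1 * 7 / 1 ^ 1"
    proof (rule cmod_deriv_le)
      show "zeta_ld holomorphic_on ball w 1"
      proof (rule holomorphic_zeta_ld)
        show "1 \<notin> ball w 1" using in1[of 1] by auto
        show "zeta s \<noteq> 0" if "s \<in> ball w 1" for s using in1[OF that] by (intro zeta_nonzero_Re_ge_2) auto
      qed
    qed (use in1 zeta_ld_le in auto)
    then show "cmod (deriv zeta_ld w) \<le> 7" by simp
  qed
  have "\<exists>I. ((\<lambda>s. deriv ((deriv ^^ 2) zeta) s / (deriv ^^ 2) zeta s) has_contour_integral I)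
      (linepath (Complex (-b) t0) (Complex (-b) T)) \<and>
    \<bar>Im I - Im (chi_main (Complex (-b) T) - chi_main (Complex (-b) t0))\<bar> \<le> 10 + 4 * pi"
    if t0: "t0 \<ge> t1" "T \<ge> t0" for t0 T
  proof -
    define u v where "u = Complex (-b) t0" and "v = Complex (-b) T"
    have t3: "t0 \<ge> 3" using t1[of t0] t0 by auto
    have seg: "Re s = - b" "t0 \<le> Im s" if "s \<in> closed_segment u v" for s
      using that closed_segment_same_Re[of u v] t0 by (auto simp: u_def v_def closed_segment_eq_real_ivl)
    have sub: "closed_segment u v \<subseteq> left_strip"
    proof
      fix s assume "s \<in> closed_segment u v"
      then show "s \<in> left_strip" using seg[of s] t3 b by (auto simp: left_strip_def)
    qed
    have V: "Re (zeta_ld s ^ 2 + deriv zeta_ld s) > 0" if s: "s \<in> closed_segment u v" for s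
    proof -
      have "zeta (1 - s) \<noteq> 0" using sub s ls(2) by blast
      then show ?thesis
        using seg[OF s] t1[of "Im s"] t0 ld1[of "1 - s"] b by (intro C(2)) auto
    qed
    have main: "(chi_main has_field_derivative (of_real (ln (2 * pi)) - \<i> * of_real (pi / 2) - Ln (1 - s) + 1 / (2 * (1 - s)))) (at s)"
      if "s \<in> left_strip" for s
      using that by (intro chi_main_has_derivative) (auto simp: left_strip_def)
    have hM: "chi_main holomorphic_on left_strip"
      using main ls(1) by (auto simp: holomorphic_on_open)
    have "arg_change_le (\<lambda>s. (deriv ^^ 2) zeta s * exp (- chi_main s)) u v (10 + (2 * pi + 2 * pi))"
    proof (rule arg_change_left_strip[OF RH sub V])
      show "arg_change_le (\<lambda>s. zeta (1 - s)) u v (2 * pi)"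
      proof (rule arg_change_le_Ln[OF ls(1) ls(7) sub, of 1])
        fix z assume z: "z \<in> closed_segment u v"
        have "cmod (zeta (1 - z) - 1) \<le> 3 / 4" using seg[OF z] b by (intro zeta_minus_one_le) auto
        then have "Re (zeta (1 - z)) > 0" using abs_Re_le_cmod[of "zeta (1 - z) - 1"] by simp
        then show "1 * zeta (1 - z) \<notin> \<real>\<^sub>\<le>\<^sub>0" by (auto simp: complex_nonpos_Reals_iff)
      qed
      show "arg_change_le (\<lambda>s. chi s * exp (- chi_main s)) u v 10"
        unfolding u_def v_def using t3 t0 b by (intro chi_vertical) auto
    qed (auto intro!: holomorphic_intros hM)
    then have "\<exists>I. ((\<lambda>s. deriv ((deriv ^^ 2) zeta) s / (deriv ^^ 2) zeta s) has_contour_integral I)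
      (linepath u v) \<and> \<bar>Im I - Im (chi_main v - chi_main u)\<bar> \<le> 10 + (2 * pi + 2 * pi)"
    proof (rule arg_change_le_exp_factor[OF _ ls(1) sub])
      show "(deriv ^^ 2) zeta holomorphic_on left_strip"
        by (rule holomorphic_deriv2_zeta) (auto simp: left_strip_def)
      fix s assume s: "s \<in> closed_segment u v"
      have "zeta_ld s ^ 2 + deriv zeta_ld s \<noteq> 0" using V[OF s] by (metis less_irrefl zero_complex.sel(1))
      then show "(deriv ^^ 2) zeta s \<noteq> 0" using ls(9,5,2) sub s by auto
    qed (rule main)
    then show ?thesis by (simp add: u_def v_def)
  qed
  then show ?thesis using t1 by (intro exI[of _ "t1"]) auto
qed

lemma deriv2_zeta_right_nonzero:
  assumes F: "\<And>s. Re s \<ge> A \<Longrightarrow> cmod ((deriv ^^ 2) zeta s * exp (of_real (ln 2) * s) / of_real (ln 2 ^ 2) - 1) \<le> 1 / 2"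
    and s: "Re s \<ge> A"
  shows "(deriv ^^ 2) zeta s \<noteq> 0"
  using F[OF s] by auto

text \<open>Once the exponential with M s = - ln 2 * s is taken out, the normalized values stay
  within 1/2 of 1, hence in the right half-plane.\<close>

lemma right_edge:
  assumes F: "\<And>s. Re s \<ge> A \<Longrightarrow> cmod ((deriv ^^ 2) zeta s * exp (of_real (ln 2) * s) / of_real (ln 2 ^ 2) - 1) \<le> 1 / 2"
    and t: "0 < t0" "t0 \<le> T"
  shows "\<exists>I. ((\<lambda>s. deriv ((deriv ^^ 2) zeta) s / (deriv ^^ 2) zeta s) has_contour_integral I)
      (linepath (Complex A t0) (Complex A T)) \<and> \<bar>Im I + ln 2 * (T - t0)\<bar> \<le> 2 * pi"
proof -
  define S where "S = - {1::complex}"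
  define M where "M = (\<lambda>s::complex. - of_real (ln 2) * s)"
  define u v where "u = Complex A t0" and "v = Complex A T"
  have oS: "open S" unfolding S_def by (intro open_Compl closed_singleton)
  have hol: "(deriv ^^ 2) zeta holomorphic_on S" by (rule holomorphic_deriv2_zeta) (simp add: S_def)
  have seg: "Re s = A" "t0 \<le> Im s" if "s \<in> closed_segment u v" for s
    using that closed_segment_same_Re[of u v] t by (auto simp: u_def v_def closed_segment_eq_real_ivl)
  have sub: "closed_segment u v \<subseteq> S"
  proof
    fix s assume "s \<in> closed_segment u v"
    then show "s \<in> S" using seg[of s] t by (auto simp: S_def)
  qed
  have "arg_change_le (\<lambda>s. (deriv ^^ 2) zeta s * exp (- M s)) u v (2 * pi)"
  proof (rule arg_change_le_Ln[OF oS _ sub, where u = "1 / of_real (ln 2 ^ 2)"])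
    show "(\<lambda>s. (deriv ^^ 2) zeta s * exp (- M s)) holomorphic_on S"
      unfolding M_def by (intro holomorphic_intros hol)
    fix z assume "z \<in> closed_segment u v"
    then have "cmod ((deriv ^^ 2) zeta z * exp (of_real (ln 2) * z) / of_real (ln 2 ^ 2) - 1) \<le> 1 / 2"
      using seg[of z] by (intro F) auto
    moreover have "Re (w - 1) \<ge> - cmod (w - 1)" for w using abs_Re_le_cmod[of "w - 1"] by linarith
    ultimately have "Re ((deriv ^^ 2) zeta z * exp (of_real (ln 2) * z) / of_real (ln 2 ^ 2)) > 0"
      by (smt (verit) minus_complex.sel(1) one_complex.sel(1) field_sum_of_halves)
    then show "1 / of_real (ln 2 ^ 2) * ((deriv ^^ 2) zeta z * exp (- M z)) \<notin> \<real>\<^sub>\<le>\<^sub>0"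
      by (simp add: M_def complex_nonpos_Reals_iff)
  qed
  then have "\<exists>I. ((\<lambda>s. deriv ((deriv ^^ 2) zeta) s / (deriv ^^ 2) zeta s) has_contour_integral I)
      (linepath u v) \<and> \<bar>Im I - Im (M v - M u)\<bar> \<le> 2 * pi"
  proof (rule arg_change_le_exp_factor[OF _ oS sub hol])
    show "(M has_field_derivative - of_real (ln 2)) (at s)" for s
      unfolding M_def by (auto intro!: derivative_eq_intros)
    show "(deriv ^^ 2) zeta s \<noteq> 0" if "s \<in> closed_segment u v" for s
      using seg[OF that] by (intro deriv2_zeta_right_nonzero[OF F]) auto
  qed
  moreover have "Im (M v - M u) = - ln 2 * (T - t0)" by (simp add: M_def u_def v_def algebra_simps)
  ultimately show ?thesis by (simp add: u_def v_def)
qed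

lemma top_edge:
  assumes RH: "riemann_hypothesis" and A: "A \<ge> 4" and b: "b \<ge> 3"
    and F: "\<And>s. Re s \<ge> A \<Longrightarrow> cmod ((deriv ^^ 2) zeta s * exp (of_real (ln 2) * s) / of_real (ln 2 ^ 2) - 1) \<le> 1 / 2"
  shows "\<exists>C>0. \<forall>\<^sub>F T in at_top. (\<forall>s. Im s = T \<longrightarrow> (deriv ^^ 2) zeta s \<noteq> 0) \<longrightarrow>
     (\<exists>I. ((\<lambda>s. deriv ((deriv ^^ 2) zeta) s / (deriv ^^ 2) zeta s) has_contour_integral I)
      (linepath (Complex (-b) T) (Complex A T)) \<and> \<bar>Im I\<bar> \<le> C * (width T * ln T))"
proof -
  obtain C0 where C0: "\<forall>\<^sub>F T in at_top. \<forall>u v. Im u = T \<and> Im v = T \<and> - b \<le> Re u \<and> Re u \<le> Re v \<and> Re v \<le> 1/2 - 2 * width T \<longrightarrow>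
     arg_change_le ((deriv ^^ 2) zeta) u v (C0 + 2 * width T ^ 4 * ln T)"
    using arg_change_top_left[OF RH b] by blast
  define C where "C = 50003 + 60 * A"
  have m: "\<forall>\<^sub>F T in at_top. \<forall>u v. Im u = T \<and> Im v = T \<and> 1/2 - 3 * width T \<le> Re u \<and> Re u \<le> Re v \<and> Re v \<le> 1/2 + 8 * width T \<and>
       (\<forall>s\<in>closed_segment u v. (deriv ^^ 2) zeta s \<noteq> 0) \<longrightarrow>
       arg_change_le ((deriv ^^ 2) zeta) u v (50000 * width T * ln T)"
    by (rule arg_change_top_middle[OF RH A]) (erule F)
  have r: "\<forall>\<^sub>F T in at_top. \<forall>u v. Im u = T \<and> Im v = T \<and> 1/2 + 8 * width T \<le> Re u \<and> Re u \<le> Re v \<and> Re v \<le> A \<and>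
       (\<forall>s\<in>closed_segment u v. (deriv ^^ 2) zeta s \<noteq> 0) \<longrightarrow>
       arg_change_le ((deriv ^^ 2) zeta) u v (60 * A * width T ^ 3 * ln T)"
    by (rule eventually_mono, rule arg_change_top_right[OF RH A], erule F, blast)
  have ev: "\<forall>\<^sub>F T in at_top. C0 \<le> width T * ln T \<and> 2 * width T ^ 4 * ln T \<le> 2 * (width T * ln T) \<and> width T ^ 3 * ln T \<le> width T * ln T"
    unfolding width_def by (intro eventually_conj; real_asymp)
  have "\<forall>\<^sub>F T in at_top. (\<forall>s. Im s = T \<longrightarrow> (deriv ^^ 2) zeta s \<noteq> 0) \<longrightarrow>
     (\<exists>I. ((\<lambda>s. deriv ((deriv ^^ 2) zeta) s / (deriv ^^ 2) zeta s) has_contour_integral I)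
      (linepath (Complex (-b) T) (Complex A T)) \<and> \<bar>Im I\<bar> \<le> C * (width T * ln T))"
    using C0 m r ev width_small[of "1/160", simplified]
  proof eventually_elim
    case (elim T)
    show ?case
    proof
      assume nz: "\<forall>s. Im s = T \<longrightarrow> (deriv ^^ 2) zeta s \<noteq> 0"
      define f where "f = (\<lambda>s. deriv ((deriv ^^ 2) zeta) s / (deriv ^^ 2) zeta s)"
      define \<delta> where "\<delta> = width T"
      have \<delta>: "0 < \<delta>" "\<delta> < 1/160" using elim by (auto simp: \<delta>_def)
      \<comment> \<open>The cut points of the top edge: the factorization through chi is used up to
        p, the small disc from p to q, the large disc from q on.\<close>
      define p q where "p = 1/2 - 3 * \<delta>" and "q = 1/2 + 8 * \<delta>"
      have o: "- b \<le> p" "p \<le> q" "q \<le> A" using \<delta> A b by (auto simp: p_def q_def)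
      have nzs: "\<forall>s\<in>closed_segment (Complex x T) (Complex y T). (deriv ^^ 2) zeta s \<noteq> 0" for x y
        using nz closed_segment_same_Im[of "Complex x T" "Complex y T"] by auto
      have "arg_change_le ((deriv ^^ 2) zeta) (Complex (-b) T) (Complex p T) (C0 + 2 * width T ^ 4 * ln T)"
        using elim(1) o \<delta> by (auto simp: p_def \<delta>_def)
      then obtain I1 where I1: "(f has_contour_integral I1) (linepath (Complex (-b) T) (Complex p T))" "\<bar>Im I1\<bar> \<le> C0 + 2 * width T ^ 4 * ln T"
        unfolding f_def by (rule arg_change_le_integral)
      have "arg_change_le ((deriv ^^ 2) zeta) (Complex p T) (Complex q T) (50000 * width T * ln T)"
        using elim(2) o \<delta> nzs[of p q] by (auto simp: p_def q_def \<delta>_def)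
      then obtain I2 where I2: "(f has_contour_integral I2) (linepath (Complex p T) (Complex q T))" "\<bar>Im I2\<bar> \<le> 50000 * width T * ln T"
        unfolding f_def by (rule arg_change_le_integral)
      have "arg_change_le ((deriv ^^ 2) zeta) (Complex q T) (Complex A T) (60 * A * width T ^ 3 * ln T)"
        using elim(3) o \<delta> nzs[of q A] by (auto simp: q_def \<delta>_def)
      then obtain I3 where I3: "(f has_contour_integral I3) (linepath (Complex q T) (Complex A T))" "\<bar>Im I3\<bar> \<le> 60 * A * width T ^ 3 * ln T"
        unfolding f_def by (rule arg_change_le_integral)
      have split: "\<exists>k. 0 \<le> k \<and> k \<le> 1 \<and> Complex y T - Complex x T = k *\<^sub>R (Complex z T - Complex x T)"
        if "x \<le> y" "y \<le> z" for x y z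
      proof (cases "x = z")
        case False
        then show ?thesis using that by (intro exI[of _ "(y - x) / (z - x)"]) (auto simp: complex_eq_iff divide_le_eq)
      qed (use that in \<open>auto intro: exI[of _ 0]\<close>)
      obtain k where k: "0 \<le> k" "k \<le> 1" "Complex q T - Complex p T = k *\<^sub>R (Complex A T - Complex p T)"
        using split o by blast
      have I23: "(f has_contour_integral (I2 + I3)) (linepath (Complex p T) (Complex A T))"
        by (rule has_contour_integral_split[OF I2(1) I3(1) k])
      have "p \<le> A" using o by simp
      then obtain k where k: "0 \<le> k" "k \<le> 1" "Complex p T - Complex (-b) T = k *\<^sub>R (Complex A T - Complex (-b) T)"
        using split o by blast
      have I: "(f has_contour_integral (I1 + (I2 + I3))) (linepath (Complex (-b) T) (Complex A T))"
        by (rule has_contour_integral_split[OF I1(1) I23 k])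
      have "60 * A * width T ^ 3 * ln T \<le> 60 * A * (width T * ln T)"
        using elim(4) A mult_left_mono[of "width T ^ 3 * ln T" "width T * ln T" "60 * A"] by (simp add: mult.assoc)
      moreover have "\<bar>Im (I1 + (I2 + I3))\<bar> \<le> \<bar>Im I1\<bar> + \<bar>Im I2\<bar> + \<bar>Im I3\<bar>" by simp
      ultimately have "\<bar>Im (I1 + (I2 + I3))\<bar> \<le> width T * ln T + 2 * (width T * ln T) + 50000 * (width T * ln T) + 60 * A * (width T * ln T)"
        using I1(2) I2(2) I3(2) elim(4) by (simp add: mult.assoc)
      also have "\<dots> = C * (width T * ln T)" by (simp add: C_def algebra_simps)
      finally show "\<exists>I. ((\<lambda>s. deriv ((deriv ^^ 2) zeta) s / (deriv ^^ 2) zeta s) has_contour_integral I)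
        (linepath (Complex (-b) T) (Complex A T)) \<and> \<bar>Im I\<bar> \<le> C * (width T * ln T)"
        using I unfolding f_def by blast
    qed
  qed
  moreover have "C > 0" using A by (simp add: C_def)
  ultimately show ?thesis by blast
qed

section \<open>Counting zeros\<close>

text \<open>The difference of zeta and 1 / (s - 1) is bounded near 1, so by the Cauchy inequality its second
  derivative is smaller than 2 / |s - 1|^3.\<close>

lemma deriv2_zeta_nonzero_near_1: "\<exists>r>0. \<forall>s\<in>ball 1 r - {1}. (deriv ^^ 2) zeta s \<noteq> 0"
proof -
  define h where "h = (\<lambda>s::complex. zeta s - 1 / (s - 1))"
  define K where "K = (\<Sum>n. real (Suc n) powr (- (5/2)))"
  have sumK: "summable (\<lambda>n. real (Suc n) powr (- (5/2)))" by (rule summable_Suc_powr) simp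
  have K0: "K \<ge> 0" unfolding K_def by (intro suminf_nonneg sumK) simp
  define B where "B = 1 + 4 * K"
  have B: "B > 0" using K0 by (simp add: B_def)
  have hb: "cmod (h s) \<le> B" if s: "s \<in> ball 1 (1/2)" "s \<noteq> 1" for s
  proof -
    have re: "1/2 < Re s" using ball_Re_Im(1)[OF s(1)] by simp
    have n1: "cmod s \<le> 3/2"
      using s(1) norm_triangle_ineq2[of s 1] by (simp add: dist_norm norm_minus_commute)
    then have n2: "cmod (s + 1) \<le> 5/2" using norm_triangle_ineq[of s 1] by simp
    have "cmod (trapezoid_error n s) \<le> 15 / 4 * real (Suc n) powr (- (5/2))" for n
    proof -
      have "cmod (trapezoid_error n s) \<le> cmod s * cmod (s + 1) * real (Suc n) powr (- Re s - 2)"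
        using s re by (intro norm_trapezoid_error) auto
      also have "\<dots> \<le> 3/2 * (5/2) * real (Suc n) powr (- (5/2))"
        using n1 n2 re by (intro mult_mono powr_mono) auto
      finally show ?thesis by simp
    qed
    moreover have "(\<lambda>n. trapezoid_error n s) sums (zeta s - 1 / 2 - 1 / (s - 1))"
      using re s by (intro zeta_trapezoid) auto
    moreover have "(\<lambda>n. 15 / 4 * real (Suc n) powr (- (5/2))) sums (15 / 4 * K)"
      unfolding K_def by (intro sums_mult summable_sums sumK)
    ultimately have "cmod (zeta s - 1 / 2 - 1 / (s - 1)) \<le> 15 / 4 * K" using norm_sums_le by blast
    moreover have "h s = (zeta s - 1 / 2 - 1 / (s - 1)) + 1 / 2" by (simp add: h_def)
    ultimately have "cmod (h s) \<le> 15 / 4 * K + 1 / 2"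
      using norm_triangle_ineq[of "zeta s - 1 / 2 - 1 / (s - 1)" "1 / 2"] by simp
    then show ?thesis using K0 by (simp add: B_def)
  qed
  define r where "r = min (1/4) (1 / B)"
  have "(deriv ^^ 2) zeta s \<noteq> 0" if s: "s \<in> ball 1 r" "s \<noteq> 1" for s
  proof
    assume z0: "(deriv ^^ 2) zeta s = 0"
    define d where "d = cmod (s - 1)"
    have d: "0 < d" "d < 1/4" "d < 1 / B" using s by (auto simp: d_def r_def dist_norm norm_minus_commute)
    have ns1: "1 \<notin> ball s d" by (simp add: d_def dist_norm)
    have sub: "ball s d \<subseteq> ball 1 (1/2)"
    proof
      fix w assume "w \<in> ball s d"
      then show "w \<in> ball 1 (1/2)" using d dist_triangle[of 1 w s] by (simp add: d_def dist_norm norm_minus_commute)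
    qed
    have hz: "zeta holomorphic_on ball s d" by (rule holomorphic_zeta[OF ns1])
    have hi: "(\<lambda>s. 1 / (s - 1)) holomorphic_on ball s d" using ns1 by (intro holomorphic_intros) auto
    have "(deriv ^^ 2) h s = (deriv ^^ 2) zeta s - (deriv ^^ 2) (\<lambda>s. 1 / (s - 1)) s"
      unfolding h_def by (rule higher_deriv_diff[OF hz hi]) (use d in auto)
    moreover have "(deriv ^^ 2) (\<lambda>s. 1 / (s - 1)) s = 2 / (s - 1) ^ 3"
    proof -
      have d: "((\<lambda>w. inverse (w - 1)) has_field_derivative (- (inverse (w - 1) ^ 2))) (at w)" if "w \<noteq> 1" for w :: complex
        using that by (auto intro!: derivative_eq_intros simp: power2_eq_square)
      have 1: "deriv (\<lambda>s. 1 / (s - 1)) w = - (inverse (w - 1) ^ 2)" if "w \<noteq> 1" for w :: complex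
        using DERIV_imp_deriv[OF d[OF that]] by (simp add: inverse_eq_divide)
      have "((\<lambda>w. - (inverse (w - 1) ^ 2)) has_field_derivative (- (of_nat 2 * (- (inverse (s - 1) ^ 2) * inverse (s - 1) ^ (2 - Suc 0))))) (at s)"
        by (intro DERIV_minus DERIV_power d s(2))
      then have "((\<lambda>w. - (inverse (w - 1) ^ 2)) has_field_derivative 2 / (s - 1) ^ 3) (at s)"
        by (simp add: power3_eq_cube power2_eq_square divide_inverse mult_ac)
      then have "(deriv (\<lambda>s. 1 / (s - 1)) has_field_derivative 2 / (s - 1) ^ 3) (at s)"
        by (rule has_field_derivative_transform_within_open[of _ _ _ "- {1}"]) (use s(2) 1 in \<open>auto intro: open_Compl\<close>)
      then show ?thesis by (simp add: numeral_2_eq_2 DERIV_imp_deriv)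
    qed
    moreover have "cmod ((deriv ^^ 2) h s) \<le> fact 2 * B / d ^ 2"
    proof (rule cmod_deriv_le)
      show "h holomorphic_on ball s d" unfolding h_def by (intro holomorphic_on_diff hz hi)
      show "cmod (h w) \<le> B" if "w \<in> ball s d" for w
        using that sub ns1 by (intro hb) auto
    qed (use d in auto)
    ultimately have "2 / d ^ 3 \<le> 2 * B / d ^ 2"
      using z0 by (simp add: norm_divide norm_power d_def)
    then have "1 \<le> B * d" using d by (simp add: field_simps power2_eq_square power3_eq_cube)
    then show False using d B by (simp add: field_simps)
  qed
  moreover have "r > 0" using B by (simp add: r_def)
  ultimately show ?thesis by blast
qed

section \<open>The argument principle in a fixed strip\<close>

locale deriv2_zeta_strip =
  fixes b A :: real
  assumes b: "b \<ge> 3" and left: "\<And>s. Re s \<le> - b \<Longrightarrow> Im s > 0 \<Longrightarrow> (deriv ^^ 2) zeta s \<noteq> 0"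
    and A: "A \<ge> 4"
    and right: "\<And>s. Re s \<ge> A \<Longrightarrow> cmod ((deriv ^^ 2) zeta s * exp (of_real (ln 2) * s) / of_real (ln 2 ^ 2) - 1) \<le> 1 / 2"
begin

definition F :: "complex \<Rightarrow> complex" where "F = (deriv ^^ 2) zeta"

lemma holF: "1 \<notin> S \<Longrightarrow> F holomorphic_on S"
  unfolding F_def by (rule holomorphic_deriv2_zeta)

lemma zero_in_strip: "F s = 0 \<Longrightarrow> 0 < Im s \<Longrightarrow> - b < Re s \<and> Re s < A"
proof -
  assume s: "F s = 0" "0 < Im s"
  have "F s \<noteq> 0" if "Re s \<ge> A"
    unfolding F_def by (rule deriv2_zeta_right_nonzero[where A = A]) (use right that in auto)
  then show ?thesis using s left unfolding F_def by (meson not_le)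
qed

text \<open>With a constant F the normalized modulus on the real axis would have to stay between 1/2
  and 3/2, yet it grows by the factor 2^3 from A to A + 3.\<close>

lemma not_constant: "\<not> F constant_on - {1}"
proof
  assume "F constant_on - {1}"
  then obtain c where c: "\<And>s. s \<noteq> 1 \<Longrightarrow> F s = c" unfolding constant_on_def by blast
  have bd: "1 / 2 \<le> cmod c * exp (ln 2 * x) / ln 2 ^ 2 \<and> cmod c * exp (ln 2 * x) / ln 2 ^ 2 \<le> 3 / 2" if x: "x \<ge> A" for x
  proof -
    define w where "w = F (of_real x) * exp (of_real (ln 2) * of_real x) / of_real (ln 2 ^ 2)"
    have "of_real x \<noteq> (1::complex)" using x A by simp
    then have cw: "cmod w = cmod c * exp (ln 2 * x) / ln 2 ^ 2"
      unfolding w_def by (simp add: c norm_mult norm_divide norm_power)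
    moreover have "cmod (w - 1) \<le> 1 / 2" using right[of "of_real x"] x unfolding w_def F_def by simp
    ultimately show ?thesis
      unfolding cw[symmetric] using norm_triangle_ineq2[of w 1] norm_triangle_ineq2[of 1 w] norm_minus_commute[of w 1]
      unfolding norm_one by linarith
  qed
  have "exp (ln 2 * (A + 3)) = exp (ln 2 * A) * 2 powr 3" by (simp add: powr_def distrib_left exp_add mult.commute)
  then have "cmod c * exp (ln 2 * (A + 3)) / ln 2 ^ 2 = 8 * (cmod c * exp (ln 2 * A) / ln 2 ^ 2)" by simp
  then show False using bd[of A] bd[of "A + 3"] by linarith
qed

text \<open>The zeros lie in a bounded rectangle and could accumulate only at the pole 1 on its
  lower side; \<open>deriv2_zeta_nonzero_near_1\<close> cuts out a disc around it and leaves a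
  compact set.\<close>

lemma finite_zeros: "finite {s. F s = 0 \<and> 0 < Im s \<and> Im s \<le> T}"
proof -
  obtain r where r: "r > 0" "\<And>s. s \<in> ball 1 r \<Longrightarrow> s \<noteq> 1 \<Longrightarrow> F s \<noteq> 0"
    using deriv2_zeta_nonzero_near_1 unfolding F_def by blast
  define K where "K = cbox (Complex (-b) 0) (Complex A T) - ball 1 r"
  have "finite {z\<in>K. F z = 0}"
  proof (rule holomorphic_compact_finite_zeros[of F "- {1}"])
    show "F holomorphic_on - {1}" by (rule holF) simp
    show "connected (- {1::complex})" by (rule connected_punctured_universe) simp
    show "compact K" unfolding K_def by (intro compact_diff compact_cbox open_ball)
    show "K \<subseteq> - {1}" using r by (auto simp: K_def)
    show "open (- {1::complex})" by (intro open_Compl closed_singleton)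
  qed (rule not_constant)
  moreover have "{s. F s = 0 \<and> 0 < Im s \<and> Im s \<le> T} \<subseteq> {z\<in>K. F z = 0}"
  proof
    fix s assume s: "s \<in> {s. F s = 0 \<and> 0 < Im s \<and> Im s \<le> T}"
    then have "s \<noteq> 1" by auto
    then have "s \<notin> ball 1 r" using r(2) s by blast
    then show "s \<in> {z\<in>K. F z = 0}" using s zero_in_strip[of s] by (auto simp: K_def in_cbox_complex_iff)
  qed
  ultimately show ?thesis by (rule rev_finite_subset)
qed

text \<open>Ensures that the conversion \<open>nat\<close> in \<open>N2\<close> does not truncate
  any multiplicity.\<close>

lemma zorder_pos: "F s = 0 \<Longrightarrow> Im s > 0 \<Longrightarrow> zorder F s > 0"
proof -
  assume s: "F s = 0" "Im s > 0"
  have "\<exists>w\<in>- {1}. F w \<noteq> 0" using not_constant unfolding constant_on_def by metis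
  moreover have "connected (- {1::complex})" by (rule connected_punctured_universe) simp
  moreover have "open (- {1::complex})" by (intro open_Compl closed_singleton)
  moreover have "s \<in> - {1}" using s by auto
  moreover have "F holomorphic_on - {1}" by (rule holF) simp
  ultimately show ?thesis using zorder_exist_zero[of F "- {1}" s] s by simp
qed

lemma N2_eq: "N2 T = (\<Sum>s | F s = 0 \<and> 0 < Im s \<and> Im s \<le> T. nat (zorder F s))"
  unfolding N2_def F_def ..

lemma N2_mono: "S \<le> T \<Longrightarrow> N2 S \<le> N2 T"
  unfolding N2_eq by (intro sum_mono2 finite_zeros) auto

text \<open>Zeros strictly between the heights t0 and T have winding number 1, all others 0, and
  none lies on the boundary. The domain is the open strip up to height T + 1: it contains the
  rectangle and finitely many zeros, but not the pole on the real axis.\<close>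

lemma N2_argument_principle:
  assumes t: "0 < t0" "t0 < T" and nz: "\<And>s. Im s = t0 \<or> Im s = T \<Longrightarrow> F s \<noteq> 0"
  shows "contour_integral (rectpath (Complex (-b) t0) (Complex A T)) (\<lambda>s. deriv F s / F s)
    = 2 * of_real pi * \<i> * of_real (real (N2 T) - real (N2 t0))"
proof -
  define a where "a = Complex (-b) t0"
  define c where "c = Complex A T"
  define g where "g = rectpath a c"
  define S where "S = {s. 0 < Im s} \<inter> {s. Im s < T + 1}"
  define Z where "Z = {s. F s = 0 \<and> 0 < Im s \<and> Im s \<le> T}"
  define Z0 where "Z0 = {s. F s = 0 \<and> 0 < Im s \<and> Im s \<le> t0}"
  have ac: "Re a \<le> Re c" "Im a \<le> Im c" using A b t by (auto simp: a_def c_def)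
  have n1: "1 \<notin> S" by (simp add: S_def)
  have finS: "finite {w\<in>S. F w = 0}"
    by (rule finite_subset[OF _ finite_zeros[of "T + 1"]]) (auto simp: S_def)
  have img: "path_image g \<subseteq> S - {w\<in>S. F w = 0}"
  proof
    fix s assume "s \<in> path_image g"
    then have s: "(Re s = -b \<or> Re s = A) \<and> t0 \<le> Im s \<and> Im s \<le> T \<or> (Im s = t0 \<or> Im s = T)"
      unfolding g_def path_image_rectpath[OF ac] by (auto simp: a_def c_def)
    then have "0 < Im s" "Im s \<le> T" using t by auto
    moreover have "F s \<noteq> 0" using s nz[of s] zero_in_strip[of s] \<open>0 < Im s\<close> by auto
    ultimately show "s \<in> S - {w\<in>S. F w = 0}" by (auto simp: S_def)
  qed
  have wn0: "winding_number g z = 0" if "z \<notin> cbox a c" for z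
    unfolding g_def by (rule winding_number_rectpath_outside[OF ac that])
  have "contour_integral g (\<lambda>x. deriv F x * 1 / F x) = 2 * pi * \<i> * (\<Sum>p\<in>{w\<in>S. F w = 0 \<or> w \<in> {}}. winding_number g p * 1 * zorder F p)"
  proof (rule argument_principle)
    show "open S" unfolding S_def by (intro open_Int open_halfspace_Im_gt open_halfspace_Im_lt)
    show "connected S" unfolding S_def by (intro convex_connected convex_Int convex_halfspace_Im_gt convex_halfspace_Im_lt)
    show "F holomorphic_on S - {}" using holF[OF n1] by simp
    show "\<forall>z. z \<notin> S \<longrightarrow> winding_number g z = 0"
    proof (intro allI impI wn0)
      fix z assume "z \<notin> S"
      then show "z \<notin> cbox a c" using t by (auto simp: S_def in_cbox_complex_iff a_def c_def)
    qed
  qed (use finS img in \<open>auto simp: g_def valid_path_rectpath\<close>)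
  also have "(\<Sum>p\<in>{w\<in>S. F w = 0 \<or> w \<in> {}}. winding_number g p * 1 * zorder F p) = (\<Sum>p\<in>Z - Z0. of_int (zorder F p))"
  proof -
    have "(\<Sum>p\<in>Z - Z0. of_int (zorder F p) :: complex) = (\<Sum>p\<in>Z - Z0. winding_number g p * 1 * zorder F p)"
    proof (rule sum.cong)
      fix p assume p: "p \<in> Z - Z0"
      then have "F p = 0" "t0 < Im p" "Im p \<le> T" "0 < Im p" using t by (auto simp: Z_def Z0_def)
      then have "p \<in> box a c" using zero_in_strip[of p] nz[of p] by (cases "Im p = T") (auto simp: in_box_complex_iff a_def c_def)
      then have "winding_number g p = 1" unfolding g_def by (rule winding_number_rectpath)
      then show "of_int (zorder F p) = winding_number g p * 1 * zorder F p" by simp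
    qed simp
    also have "\<dots> = (\<Sum>p\<in>{w\<in>S. F w = 0 \<or> w \<in> {}}. winding_number g p * 1 * zorder F p)"
    proof (rule sum.mono_neutral_left)
      show "\<forall>i\<in>{w\<in>S. F w = 0 \<or> w \<in> {}} - (Z - Z0). winding_number g i * 1 * zorder F i = 0"
      proof
        fix i assume i: "i \<in> {w\<in>S. F w = 0 \<or> w \<in> {}} - (Z - Z0)"
        then have "Im i > 0" "F i = 0" "Im i \<le> t0 \<or> Im i > T" by (auto simp: Z_def Z0_def S_def)
        then have "i \<notin> cbox a c" using nz[of i] by (auto simp: in_cbox_complex_iff a_def c_def)
        then show "winding_number g i * 1 * zorder F i = 0" by (simp add: wn0)
      qed
    qed (use finS in \<open>auto simp: Z_def S_def\<close>)
    finally show ?thesis by simp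
  qed
  also have "(\<Sum>p\<in>Z - Z0. of_int (zorder F p) :: complex) = of_real (real (N2 T) - real (N2 t0))"
  proof -
    have pos: "of_nat (nat (zorder F p)) = (of_int (zorder F p) :: complex)" if "p \<in> Z" for p
      using zorder_pos[of p] that by (simp add: Z_def)
    have Zsub: "Z0 \<subseteq> Z" using t by (auto simp: Z_def Z0_def)
    have fin: "finite Z" unfolding Z_def by (rule finite_zeros)
    have "(\<Sum>p\<in>Z - Z0. of_int (zorder F p) :: complex) = (\<Sum>p\<in>Z. of_int (zorder F p)) - (\<Sum>p\<in>Z0. of_int (zorder F p))"
      by (rule sum_diff[OF fin Zsub])
    also have "(\<Sum>p\<in>Z. of_int (zorder F p) :: complex) = of_nat (N2 T)"
      unfolding N2_eq of_nat_sum Z_def[symmetric] by (rule sum.cong) (simp_all add: pos)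
    also have "(\<Sum>p\<in>Z0. of_int (zorder F p) :: complex) = of_nat (N2 t0)"
      unfolding N2_eq of_nat_sum Z0_def[symmetric] by (rule sum.cong) (use pos Zsub in auto)
    finally show ?thesis by simp
  qed
  finally show ?thesis unfolding g_def a_def c_def by simp
qed

lemma exists_zero_free_height:
  assumes "x < y" "0 < x"
  shows "\<exists>t. x < t \<and> t < y \<and> (\<forall>s. Im s = t \<longrightarrow> F s \<noteq> 0)"
proof (rule ccontr)
  assume "\<not> ?thesis"
  then have "\<exists>s. Im s = t \<and> F s = 0" if "x < t" "t < y" for t using that by blast
  then have "{x<..<y} \<subseteq> Im ` {s. F s = 0 \<and> 0 < Im s \<and> Im s \<le> y}"
    using assms by (fastforce simp: image_iff)
  then have "finite {x<..<y}" using finite_zeros finite_surj by blast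
  then show False using assms infinite_Ioo by blast
qed

end

definition N2_main :: "real \<Rightarrow> real" where
  "N2_main T = T / (2 * pi) * ln (T / (4 * pi)) - T / (2 * pi)"

context deriv2_zeta_strip
begin

lemma N2_asymptotic_zero_free:
  assumes RH: "riemann_hypothesis"
  shows "\<exists>K>0. \<forall>\<^sub>F T in at_top. (\<forall>s. Im s = T \<longrightarrow> F s \<noteq> 0) \<longrightarrow>
    \<bar>real (N2 T) - N2_main T\<bar> \<le> K * (width T * ln T)"
proof -
  define f where "f = (\<lambda>s. deriv F s / F s)"
  obtain t1 where t1: "t1 \<ge> 3" "\<And>t0 T. t0 \<ge> t1 \<Longrightarrow> T \<ge> t0 \<Longrightarrow> \<exists>I. (f has_contour_integral I)
      (linepath (Complex (-b) t0) (Complex (-b) T)) \<and>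
    \<bar>Im I - Im (chi_main (Complex (-b) T) - chi_main (Complex (-b) t0))\<bar> \<le> 10 + 4 * pi"
    using left_edge[OF RH b] unfolding f_def F_def by blast
  obtain t0 where t0: "t1 < t0" "\<And>s. Im s = t0 \<Longrightarrow> F s \<noteq> 0"
    using exists_zero_free_height[of t1 "t1 + 1"] t1(1) by auto
  have t3: "t0 > 3" using t0 t1 by simp
  obtain C where C: "C > 0" "\<forall>\<^sub>F T in at_top. (\<forall>s. Im s = T \<longrightarrow> F s \<noteq> 0) \<longrightarrow>
     (\<exists>I. (f has_contour_integral I) (linepath (Complex (-b) T) (Complex A T)) \<and> \<bar>Im I\<bar> \<le> C * (width T * ln T))"
    using top_edge[OF RH A b right] unfolding f_def F_def by blast
  obtain C2 where C2: "\<And>T. T \<ge> 3 \<Longrightarrow> \<bar>Im (chi_main (Complex (-b) T)) + (T * ln (T / (2 * pi)) - T)\<bar> \<le> C2"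
    using chi_main_Im[of b] b by auto
  define Ib where "Ib = contour_integral (linepath (Complex (-b) t0) (Complex A t0)) f"
  have Ib: "(f has_contour_integral Ib) (linepath (Complex (-b) t0) (Complex A t0))"
  proof -
    have seg: "Im s = t0" if "s \<in> closed_segment (Complex (-b) t0) (Complex A t0)" for s
      using that closed_segment_same_Im[of "Complex (-b) t0" "Complex A t0"] by auto
    have "F holomorphic_on - {1}" by (rule holF) simp
    moreover from this have "deriv F holomorphic_on - {1}"
      by (rule holomorphic_deriv) (intro open_Compl closed_singleton)
    moreover have "closed_segment (Complex (-b) t0) (Complex A t0) \<subseteq> - {1}"
      using seg t3 by fastforce
    ultimately have "continuous_on (closed_segment (Complex (-b) t0) (Complex A t0)) f"
      unfolding f_def using seg t0(2)
      by (intro continuous_on_divide) (auto intro: continuous_on_subset holomorphic_on_imp_continuous_on)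
    then show ?thesis unfolding Ib_def
      by (intro has_contour_integral_integral contour_integrable_continuous_linepath)
  qed
  \<comment> \<open>Collects everything that does not depend on T: the bottom edge, the end points
    at height t0 and the bounded errors of the vertical edges. It is eventually below width T * ln
    T.\<close>
  define D where "D = 2 * pi * real (N2 t0) + \<bar>Im Ib\<bar> + 2 * pi + ln 2 * t0 + 10 + 4 * pi + C2 + \<bar>Im (chi_main (Complex (-b) t0))\<bar>"
  have ev: "\<forall>\<^sub>F T in at_top. D \<le> width T * ln T \<and> 0 \<le> width T * ln T" unfolding width_def by (intro eventually_conj; real_asymp)
  have "\<forall>\<^sub>F T in at_top. (\<forall>s. Im s = T \<longrightarrow> F s \<noteq> 0) \<longrightarrow>
    \<bar>real (N2 T) - N2_main T\<bar> \<le> (C + 1) * (width T * ln T)"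
    using C(2) ev eventually_gt_at_top[of t0]
  proof eventually_elim
    case (elim T)
    show ?case
    proof
      assume nz: "\<forall>s. Im s = T \<longrightarrow> F s \<noteq> 0"
      define w where "w = width T * ln T"
      obtain It where It: "(f has_contour_integral It) (linepath (Complex (-b) T) (Complex A T))" "\<bar>Im It\<bar> \<le> C * w"
        using elim(1) nz unfolding w_def by blast
      obtain Il where Il: "(f has_contour_integral Il) (linepath (Complex (-b) t0) (Complex (-b) T))"
        "\<bar>Im Il - Im (chi_main (Complex (-b) T) - chi_main (Complex (-b) t0))\<bar> \<le> 10 + 4 * pi"
        using t1(2)[of t0 T] t0 elim by auto
      have "\<exists>I. (f has_contour_integral I) (linepath (Complex A t0) (Complex A T)) \<and> \<bar>Im I + ln 2 * (T - t0)\<bar> \<le> 2 * pi"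
        unfolding f_def F_def by (rule right_edge[OF right]) (use t3 elim in auto)
      then obtain Ir where Ir: "(f has_contour_integral Ir) (linepath (Complex A t0) (Complex A T))" "\<bar>Im Ir + ln 2 * (T - t0)\<bar> \<le> 2 * pi"
        by blast
      have "(f has_contour_integral (Ib + (Ir + (- It + - Il)))) (rectpath (Complex (-b) t0) (Complex A T))"
        unfolding rectpath_def Let_def complex.sel
        by (intro has_contour_integral_join Ib Ir has_contour_integral_reverse_linepath It(1) Il(1))
           (auto intro!: valid_path_join)
      then have "Ib + (Ir + (- It + - Il)) = 2 * of_real pi * \<i> * of_real (real (N2 T) - real (N2 t0))"
        using N2_argument_principle[of t0 T] t0(2) t3 elim(3) nz contour_integral_unique unfolding f_def by fastforce
      then have "Im (Ib + (Ir + (- It + - Il))) = Im (2 * of_real pi * \<i> * of_real (real (N2 T) - real (N2 t0)))" by simp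
      then have eq: "Im Ib + Im Ir - Im It - Im Il = 2 * pi * real (N2 T) - 2 * pi * real (N2 t0)"
        by (simp add: algebra_simps)
      have T: "T > 3" using t3 elim by simp
      \<comment> \<open>The contribution - T * ln 2 of the right edge turns the 2 * pi in the
        logarithm of the left edge into 4 * pi.\<close>
      have "ln (T / (4 * pi)) = ln (T / (2 * pi)) - ln 2"
        using T ln_div[of "T / (2 * pi)" 2] by simp
      moreover have "2 * pi * N2_main T = T * ln (T / (4 * pi)) - T"
        by (simp add: N2_main_def right_diff_distrib)
      ultimately have "2 * pi * N2_main T = T * ln (T / (2 * pi)) - T * ln 2 - T"
        by (simp add: right_diff_distrib)
      moreover have "ln 2 * (T - t0) = T * ln 2 - ln 2 * t0" by (simp add: algebra_simps)
      moreover have "ln 2 * t0 \<ge> 0" "2 * pi * real (N2 t0) \<ge> 0" using t3 by simp_all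
      ultimately have "\<bar>2 * pi * real (N2 T) - 2 * pi * N2_main T\<bar> \<le> D + C * w"
        using eq It(2) Il(2) Ir(2) C2[OF less_imp_le[OF T]] abs_ge_self[of "Im Ib"] abs_ge_minus_self[of "Im Ib"]
          abs_ge_self[of "Im (chi_main (Complex (-b) t0))"] abs_ge_minus_self[of "Im (chi_main (Complex (-b) t0))"]
        unfolding D_def minus_complex.sel abs_le_iff by linarith
      also have "\<dots> \<le> (C + 1) * w" using elim(2) by (simp add: w_def algebra_simps)
      finally have "2 * pi * \<bar>real (N2 T) - N2_main T\<bar> \<le> (C + 1) * w"
        by (simp add: abs_mult flip: right_diff_distrib)
      moreover have "1 * \<bar>real (N2 T) - N2_main T\<bar> \<le> 2 * pi * \<bar>real (N2 T) - N2_main T\<bar>"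
        using pi_gt3 by (intro mult_right_mono) auto
      ultimately show "\<bar>real (N2 T) - N2_main T\<bar> \<le> (C + 1) * (width T * ln T)" by (simp add: w_def)
    qed
  qed
  then show ?thesis using C(1) by (intro exI[of _ "C + 1"]) auto
qed

text \<open>N2 is continuous from the right, so a height that carries zeros is a limit of zero-free heights
  with the same count.\<close>

lemma N2_asymptotic:
  assumes RH: "riemann_hypothesis"
  shows "\<exists>K>0. \<forall>\<^sub>F T in at_top. \<bar>real (N2 T) - N2_main T\<bar> \<le> K * (width T * ln T)"
proof -
  obtain K T0 where K: "K > 0" "\<And>T. T \<ge> T0 \<Longrightarrow> (\<And>s. Im s = T \<Longrightarrow> F s \<noteq> 0) \<Longrightarrow>
    \<bar>real (N2 T) - N2_main T\<bar> \<le> K * (width T * ln T)"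
    using N2_asymptotic_zero_free[OF RH] unfolding eventually_at_top_linorder by blast
  have "\<forall>\<^sub>F T in at_top. T \<ge> T0 \<and> T > 0 \<and> ln T > 0 \<and> ln (ln T) > 0" by (intro eventually_conj; real_asymp)
  then have "\<forall>\<^sub>F T in at_top. \<bar>real (N2 T) - N2_main T\<bar> \<le> K * (width T * ln T)"
  proof eventually_elim
    case (elim T)
    define Z where "Z = Im ` {s. F s = 0 \<and> 0 < Im s \<and> Im s \<le> T + 1} \<inter> {T<..}"
    define e where "e = Min (insert (T + 1) Z)"
    have fin: "finite Z" unfolding Z_def using finite_zeros by blast
    have e: "T < e" "e \<le> T + 1" "\<And>z. z \<in> Z \<Longrightarrow> e \<le> z"
      using fin unfolding e_def by (auto simp: Z_def)
    have nz: "F s \<noteq> 0" if "T < Im s" "Im s < e" for s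
    proof
      assume "F s = 0"
      then have "Im s \<in> Z" unfolding Z_def using that elim e by auto
      then show False using e(3)[of "Im s"] that by simp
    qed
    have N: "N2 T' = N2 T" if "T < T'" "T' < e" for T'
    proof -
      have "{s. F s = 0 \<and> 0 < Im s \<and> Im s \<le> T'} = {s. F s = 0 \<and> 0 < Im s \<and> Im s \<le> T}"
      proof (intro Collect_cong iffI; elim conjE; intro conjI)
        fix s assume "F s = 0" "Im s \<le> T'"
        then show "Im s \<le> T" using nz[of s] that by (cases "Im s \<le> T") auto
      qed (use that in auto)
      then show ?thesis unfolding N2_eq by simp
    qed
    have "eventually (\<lambda>T'. T' \<in> {T<..<e}) (at_right T)" using e(1) by (rule eventually_at_right_real)
    then have "eventually (\<lambda>T'. \<bar>real (N2 T) - N2_main T'\<bar> \<le> K * (width T' * ln T')) (at_right T)"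
    proof eventually_elim
      case (elim T')
      then show ?case using K(2)[of T'] N[of T'] nz \<open>T \<ge> T0 \<and> _\<close> by auto
    qed
    moreover have "((\<lambda>T'. \<bar>real (N2 T) - N2_main T'\<bar>) \<longlongrightarrow> \<bar>real (N2 T) - N2_main T\<bar>) (at_right T)"
      unfolding N2_main_def using elim by (intro tendsto_intros) auto
    moreover have "((\<lambda>T'. K * (width T' * ln T')) \<longlongrightarrow> K * (width T * ln T)) (at_right T)"
      unfolding width_def using elim by (intro tendsto_intros) auto
    ultimately show ?case by (intro tendsto_le[of "at_right T"]) auto
  qed
  then show ?thesis using K(1) by blast
qed

end

text \<open>At T = exp 1 the divisor is 0 and the quotient is 0 by convention, so this point is
  excluded. Below a threshold T1 the two sides are compared with constants: monotonicity of
  \<open>N2\<close> bounds the left side by N2 T1 + B, and the quotient on the right is at least m >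
  0.\<close>

theorem theorem3:
  assumes "riemann_hypothesis"
  shows "\<exists>C>0. \<forall>T::real. T \<ge> 2 \<and> T \<noteq> exp 1 \<longrightarrow>
           \<bar>real (N2 T) - (T / (2 * pi) * ln (T / (4 * pi)) - T / (2 * pi))\<bar>
             \<le> C * \<bar>ln T / sqrt (ln (ln T))\<bar>"
proof -
  obtain b where b: "\<And>s. Re s \<le> - b \<Longrightarrow> Im s > 0 \<Longrightarrow> (deriv ^^ 2) zeta s \<noteq> 0"
    using zeta_deriv2_nonzero_left by blast
  obtain A where A: "A \<ge> 4" "\<And>s. Re s \<ge> A \<Longrightarrow>
     cmod ((deriv ^^ 2) zeta s * exp (of_real (ln 2) * s) / of_real (ln 2 ^ 2) - 1) \<le> 1 / 2"
    using deriv2_zeta_right by blast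
  interpret deriv2_zeta_strip "max b 3" A
    by unfold_locales (use b A in auto)
  obtain K T0 where K: "K > 0" "\<And>T. T \<ge> T0 \<Longrightarrow> \<bar>real (N2 T) - N2_main T\<bar> \<le> K * (width T * ln T)"
    using N2_asymptotic[OF assms] unfolding eventually_at_top_linorder by blast
  have ln2: "ln 2 \<ge> (1/2 :: real)" using ln_le_minus_one[of "1/2 :: real"] by (simp add: ln_div)
  define T1 where "T1 = max T0 4"
  have lle: "\<bar>ln (ln T)\<bar> \<le> T1" if "2 \<le> T" "T \<le> T1" for T
  proof -
    have "ln T \<ge> ln 2" using that by (intro ln_mono) auto
    then have l: "ln T \<ge> 1/2" using ln2 by simp
    have "ln T \<le> T" using that ln_bound[of T] by simp
    then have "ln (ln T) \<le> T1" using that l ln_bound[of "ln T"] by linarith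
    moreover have "ln (ln T) \<ge> ln (1/2)" using l by (intro ln_mono) auto
    then have "ln (ln T) \<ge> - ln 2" by (simp add: ln_div)
    ultimately show ?thesis using ln_2_less_1 by (simp add: T1_def abs_le_iff)
  qed
  obtain B where B: "B > 0" "\<And>T. 2 \<le> T \<Longrightarrow> T \<le> T1 \<Longrightarrow> \<bar>N2_main T\<bar> \<le> B"
  proof -
    have "continuous_on {2..T1} N2_main" unfolding N2_main_def[abs_def] by (intro continuous_intros) auto
    then have "bounded (N2_main ` {2..T1})" by (intro compact_imp_bounded compact_continuous_image) auto
    then obtain B where "B > 0" "\<And>T. T \<in> {2..T1} \<Longrightarrow> norm (N2_main T) \<le> B" by (auto simp: bounded_pos)
    then show thesis using that[of B] by auto
  qed
  \<comment> \<open>A lower bound for the quotient on the bounded range, from ln T >= 1/2 and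
    \<open>lle\<close>.\<close>
  define m where "m = 1 / (2 * sqrt T1)"
  have m: "m > 0" by (simp add: m_def T1_def)
  define C where "C = K + (real (N2 T1) + B) / m"
  have C: "C \<ge> K" "C > 0" using K(1) B m by (auto simp: C_def add_pos_nonneg)
  have "\<bar>real (N2 T) - N2_main T\<bar> \<le> C * \<bar>ln T / sqrt (ln (ln T))\<bar>" if T: "T \<ge> 2" "T \<noteq> exp 1" for T
  proof (cases "T \<ge> T1")
    case True
    then have "\<bar>real (N2 T) - N2_main T\<bar> \<le> K * (width T * ln T)" using K(2) by (auto simp: T1_def)
    also have "width T * ln T = ln T / sqrt (ln (ln T))" by (simp add: width_def)
    also have "K * \<dots> \<le> K * \<bar>ln T / sqrt (ln (ln T))\<bar>" using K(1) by (intro mult_left_mono abs_ge_self) auto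
    also have "K * \<bar>ln T / sqrt (ln (ln T))\<bar> \<le> C * \<bar>ln T / sqrt (ln (ln T))\<bar>" using C by (intro mult_right_mono) auto
    finally show ?thesis using K(1) by simp
  next
    case False
    have l: "ln T \<ge> 1/2"
    proof -
      have "ln T \<ge> ln 2" using T by (intro ln_mono) auto
      then show ?thesis using ln2 by simp
    qed
    \<comment> \<open>The logarithm of ln T is negative for T < e, and sqrt is extended to an odd function.\<close>
    have "ln T \<noteq> 1" using T by (metis exp_ln less_le_trans zero_less_numeral)
    then have l0: "ln (ln T) \<noteq> 0" using l by simp
    have "sqrt \<bar>ln (ln T)\<bar> \<le> sqrt T1" using lle[of T] T False by (intro real_sqrt_le_mono) auto
    then have "m \<le> (1/2) / sqrt \<bar>ln (ln T)\<bar>" unfolding m_def using l0 T1_def by (simp add: field_simps)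
    also have "\<dots> \<le> ln T / sqrt \<bar>ln (ln T)\<bar>" using l by (intro divide_right_mono) auto
    also have "\<dots> = \<bar>ln T / sqrt (ln (ln T))\<bar>"
      using l by (cases "ln (ln T) \<ge> 0") (simp_all add: real_sqrt_minus)
    finally have mm: "m \<le> \<bar>ln T / sqrt (ln (ln T))\<bar>" .
    have "\<bar>real (N2 T) - N2_main T\<bar> \<le> real (N2 T1) + B"
      using N2_mono[of T T1] B(2)[of T] False T by simp
    also have "\<dots> = (real (N2 T1) + B) / m * m" using m by simp
    also have "\<dots> \<le> C * m" using K(1) m by (intro mult_right_mono) (auto simp: C_def)
    also have "\<dots> \<le> C * \<bar>ln T / sqrt (ln (ln T))\<bar>" using mm C by (intro mult_left_mono) auto
    finally show ?thesis .
  qed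
  then show ?thesis using C(2) unfolding N2_main_def by blast
qed

end
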